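(* Let $\lambda>-1/2$, $1\le p<\infty$, $\delta\in\mathbb{R}$. Then the maximal operator $P_*^{\lambda}$, considered on the measure space $(\mathbb{R}_+,x^{\delta}dx)$, has the following mapping properties: (a) $P_*^{\lambda}$ is of strong type $(p,p)$ if and only if $p>1$ and $-1<\delta<(2\lambda+1)p-1$; (b) $P_*^{\lambda}$ is of weak type $(p,p)$ if and only if $-1<\delta<(2\lambda+1)p-1$ or $\delta=2\lambda$; (c) $P_*^{\lambda}$ is of restricted weak type $(p,p)$ if and only if $-1<\delta\le(2\lambda+1)p-1$. Moreover, $P_*^{\lambda}$ is of strong type $(\infty,\infty)$.
   Context: $\mathbb{R}_+=(0,\infty)$ and $d\mu_\lambda(x)=x^{2\lambda}dx$ on $\mathbb{R}_+$. For $\lambda>-1/2$ let $\varphi_z^\lambda(x)=(zx)^{-\lambda+1/2}J_{\lambda-1/2}(zx)$, $x,z>0$, where $J_\nu$ is the Bessel function of the first kind of order $\nu$ (these are eigenfunctions of the Bessel operator $\Delta_\lambda=-\frac{d^2}{dx^2}-\frac{2\lambda}{x}\frac{d}{dx}$, with eigenvalue $z^2$). The Poisson kernel is $$P_t^\lambda(x,y)=\int_0^\infty e^{-zt}\varphi_z^\lambda(x)\varphi_z^\lambda(y)\,d\mu_\lambda(z),\qquad t,x,y>0,$$ the Poisson integral is $P_t^\lambda f(x)=\int_0^\infty P_t^\lambda(x,y)f(y)\,d\mu_\lambda(y)$, and the maximal operator is $P_*^\lambda f(x)=\sup_{t>0}|P_t^\lambda f(x)|$, $x>0$. Let $T$ be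 an operator defined on $L^2(\mathbb{R}_+,d\mu_\lambda)$ and let $1\le p<\infty$. On the measure space $(\mathbb{R}_+,x^\delta dx)$: $T$ is of strong type $(p,p)$ if it extends from $L^2(\mathbb{R}_+,d\mu_\lambda)\cap L^p(\mathbb{R}_+,x^\delta dx)$ to a bounded operator from $L^p(\mathbb{R}_+,x^\delta dx)$ to itself (i.e. $\|Tf\|_{L^p(x^\delta dx)}\le C\|f\|_{L^p(x^\delta dx)}$); of weak type $(p,p)$ if it extends in the same way to a bounded operator from $L^p(\mathbb{R}_+,x^\delta dx)$ to weak $L^{p,\infty}(\mathbb{R}_+,x^\delta dx)$ (i.e. $\int_{\{|Tf|>\gamma\}}x^\delta dx\le C\gamma^{-p}\|f\|^p_{L^p(x^\delta dx)}$ for all $\gamma>0$); of restricted weak type $(p,p)$ if the weak type inequality holds for $f=\chi_E$, with $C$ independent of $\gamma$ and of the measurable set $E$ of finite measure. Strong type $(\infty,\infty)$ means $\|Tf\|_{\infty}\le C\|f\|_\infty$ for all $f\in L^\infty(\mathbb{R}_+)$. *)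

theory Defs
  imports "HOL-Analysis.Analysis" "HOL-Probability.Essential_Supremum"
begin

definition power_measure :: "real \<Rightarrow> real measure" where
  "power_measure d = density (lebesgue_on {0<..}) (\<lambda>x. ennreal (x powr d))"

(* The Bessel function of the first kind, for positive argument and arbitrary real order.
   The reciprocal Gamma function vanishes at the poles of Gamma, as required. *)
definition bessel_J :: "real \<Rightarrow> real \<Rightarrow> real" where
  "bessel_J \<nu> x =
     (\<Sum>k. (-1) ^ k * rGamma (real k + \<nu> + 1) / fact k * (x / 2) powr (2 * real k + \<nu>))"

definition bessel_eigenfun :: "real \<Rightarrow> real \<Rightarrow> real \<Rightarrow> real" where
  "bessel_eigenfun l z x = (z * x) powr (- l + 1/2) * bessel_J (l - 1/2) (z * x)"

definition poisson_kernel :: "real \<Rightarrow> real \<Rightarrow> real \<Rightarrow> real \<Rightarrow> real" where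
  "poisson_kernel l t x y =
     (\<integral>z. exp (- z * t) * bessel_eigenfun l z x * bessel_eigenfun l z y \<partial>power_measure (2 * l))"

definition poisson_integral :: "real \<Rightarrow> real \<Rightarrow> (real \<Rightarrow> complex) \<Rightarrow> real \<Rightarrow> complex" where
  "poisson_integral l t f x =
     (\<integral>y. complex_of_real (poisson_kernel l t x y) * f y \<partial>power_measure (2 * l))"

definition poisson_maximal :: "real \<Rightarrow> (real \<Rightarrow> complex) \<Rightarrow> real \<Rightarrow> ennreal" where
  "poisson_maximal l f x = (SUP t\<in>{0<..}. ennreal (norm (poisson_integral l t f x)))"

(* Intended for exponents p > 0. *)
definition ennreal_powr :: "ennreal \<Rightarrow> real \<Rightarrow> ennreal" where
  "ennreal_powr a p = (if a = top then top else ennreal (enn2real a powr p))"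

definition Lp_norm :: "'a measure \<Rightarrow> real \<Rightarrow> ('a \<Rightarrow> ennreal) \<Rightarrow> ennreal" where
  "Lp_norm M p g = ennreal_powr (\<integral>\<^sup>+x. ennreal_powr (g x) p \<partial>M) (1 / p)"

abbreviation enorm :: "('a \<Rightarrow> complex) \<Rightarrow> 'a \<Rightarrow> ennreal" where
  "enorm f \<equiv> \<lambda>x. ennreal (norm (f x))"

definition Lp :: "'a measure \<Rightarrow> real \<Rightarrow> ('a \<Rightarrow> complex) set" where
  "Lp M p = {f \<in> borel_measurable M. Lp_norm M p (enorm f) < top}"

definition Linfty :: "'a measure \<Rightarrow> ('a \<Rightarrow> complex) set" where
  "Linfty M = {f \<in> borel_measurable M. esssup M (enorm f) < top}"

(* Operators may be nonlinear, with values given by their moduli in [0, \<infinity>]; maximal operators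
   are of this kind.  S extends T from L2(N) \<inter> Lp(M) to Lp(M).  Sublinearity makes a bounded
   extension unique, just as linearity does for linear operators; without it the extension
   could be chosen arbitrarily outside L2(N). *)
definition sublinear_extension ::
    "(('a \<Rightarrow> complex) \<Rightarrow> 'a \<Rightarrow> ennreal) \<Rightarrow> 'a measure \<Rightarrow> 'a measure \<Rightarrow> real
      \<Rightarrow> (('a \<Rightarrow> complex) \<Rightarrow> 'a \<Rightarrow> ennreal) \<Rightarrow> bool" where
  "sublinear_extension T N M p S \<longleftrightarrow>
     (\<forall>f \<in> Lp N 2 \<inter> Lp M p. AE x in M. S f x = T f x) \<and>
     (\<forall>f \<in> Lp M p. \<forall>g \<in> Lp M p. AE x in M. S (\<lambda>y. f y + g y) x \<le> S f x + S g x) \<and>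
     (\<forall>f \<in> Lp M p. \<forall>c. AE x in M. S (\<lambda>y. c * f y) x = ennreal (norm c) * S f x)"

definition strong_type ::
    "(('a \<Rightarrow> complex) \<Rightarrow> 'a \<Rightarrow> ennreal) \<Rightarrow> 'a measure \<Rightarrow> 'a measure \<Rightarrow> real \<Rightarrow> bool" where
  "strong_type T N M p \<longleftrightarrow>
     (\<exists>S. sublinear_extension T N M p S \<and>
       (\<exists>C::real. \<forall>f \<in> Lp M p. S f \<in> borel_measurable M \<and>
          Lp_norm M p (S f) \<le> ennreal C * Lp_norm M p (enorm f)))"

definition weak_type_bound ::
    "'a measure \<Rightarrow> real \<Rightarrow> real \<Rightarrow> ('a \<Rightarrow> ennreal) \<Rightarrow> ('a \<Rightarrow> complex) \<Rightarrow> bool" where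
  "weak_type_bound M p C g f \<longleftrightarrow>
     g \<in> borel_measurable M \<and>
     (\<forall>\<gamma>>0. emeasure M {x \<in> space M. g x > ennreal \<gamma>}
        \<le> ennreal (C * \<gamma> powr (- p)) * ennreal_powr (Lp_norm M p (enorm f)) p)"

definition weak_type ::
    "(('a \<Rightarrow> complex) \<Rightarrow> 'a \<Rightarrow> ennreal) \<Rightarrow> 'a measure \<Rightarrow> 'a measure \<Rightarrow> real \<Rightarrow> bool" where
  "weak_type T N M p \<longleftrightarrow>
     (\<exists>S. sublinear_extension T N M p S \<and>
       (\<exists>C::real. \<forall>f \<in> Lp M p. weak_type_bound M p C (S f) f))"

definition restricted_weak_type ::
    "(('a \<Rightarrow> complex) \<Rightarrow> 'a \<Rightarrow> ennreal) \<Rightarrow> 'a measure \<Rightarrow> real \<Rightarrow> bool" where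
  "restricted_weak_type T M p \<longleftrightarrow>
     (\<exists>C::real. \<forall>E \<in> sets M. emeasure M E < top \<longrightarrow>
        weak_type_bound M p C (T (indicator E)) (indicator E))"

definition strong_type_infty ::
    "(('a \<Rightarrow> complex) \<Rightarrow> 'a \<Rightarrow> ennreal) \<Rightarrow> 'a measure \<Rightarrow> bool" where
  "strong_type_infty T M \<longleftrightarrow>
     (\<exists>C::real. \<forall>f \<in> Linfty M. T f \<in> borel_measurable M \<and>
        esssup M (T f) \<le> ennreal C * esssup M (enorm f))"

end

theory Submission
  imports Defs "HOL-Probability.Probability"
begin

text \<open>
  Everything rests on a two-sided bound of the kernel: up to constants, $P_t(x,y)$ is $t A^{-l} /
  (t^2 + (x-y)^2)$ with $A = t^2 + x^2 + y^2$ (poisson_kernel_bounds). It comes from an exact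
  series. Subordination writes $e^{-zt}$ as a superposition of Gaussians $e^{-sz^2}$ with positive
  density in $s$, Weber's integral evaluates the Gaussian average of two Bessel functions as an
  exponential times a modified Bessel function, and integrating the power series of the latter term
  by term in $s$ gives $P_t(x,y) = 2 \pi^{-1/2} t A^{-(l+1)} \sum_n c_n q^{2n}$ with $q = 2xy/A$
  (poisson_kernel_sums). The coefficients $c_n$ are positive and tend to a positive limit, so the
  sum is comparable with a geometric series, and $1 - q = (t^2 + (x-y)^2)/A$.

  For the upper estimates the half-line is cut at $x/2$ and $2x$. For $y \le x/2$ the bound of the
  kernel is the kernel of the Hardy operator $x^{-(2l+1)} \int_0^x F(y) y^{2l} dy$, for $y \ge 2x$
  that of the dual operator $\int_x^\infty F(y) dy/y$. For $y$ comparable with $x$ the weights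
  $y^{2l}$ and $y^\delta$ are almost constant, so a dyadic decomposition around $x$ leads to the
  uncentred maximal function with respect to $y^\delta dy$. Hence the Poisson maximal function is
  bounded pointwise by a sum of three operators (poisson_model_le_majorant). The interval maximal
  function is of weak type $(1,1)$ for every $\delta$, because intervals of the line have subcovers
  of overlap two, and of strong type for $p > 1$ by interpolation. The dual Hardy operator is
  bounded for $\delta > -1$ and the other one for $\delta < (2l+1)p - 1$, both by a Schur test. At
  $\delta = (2l+1)p - 1$ the Hardy operator is still of weak type when $p = 1$, and of restricted
  weak type for every $p$, because among all sets of given measure an interval at the origin has, up
  to a constant, the largest integral of $y^{2l}$ (mass_le_power_measure). For bounded functions the
  kernel is integrated instead: its total mass is bounded uniformly in $t$ and $x$
  (poisson_model_mass).

  The lower bound of the kernel gives the converse. The maximal function of the indicator of $[1,2]$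
  is bounded below near $0$, which forces $\delta > -1$, and decays no faster than $x^{-(2l+1)}$,
  which forces $\delta \le (2l+1)p - 1$ already for indicators. The truncations of $y^{-(2l+1)}$ to
  $[a,1]$ with $a \to 0$ exclude weak type at the endpoint for $p > 1$, and the indicators of
  $[1,1+e]$ with $e \to 0$ exclude strong type for $p = 1$ by a logarithmic divergence. Finally,
  when $p > 1$ the value $\delta = 2l$ lies inside the open range, and when $p = 1$ it is the
  endpoint.
\<close>

section \<open>Bessel-Clifford functions\<close>

text \<open>
  The Bessel-Clifford function: $J_\nu(u) = (u/2)^\nu$ times its value at $a = \nu + 1$, $s =
  (u/2)^2$. It is entire in $s$, so that no power singularity has to be carried through the
  calculations, and negative $s$ gives the modified Bessel functions.
\<close>

definition clifford :: "real \<Rightarrow> real \<Rightarrow> real" where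
  "clifford a s = (\<Sum>k. rGamma (real k + a) / fact k * (- s) ^ k)"

lemma rGamma_real_pos: "0 < (z::real) \<Longrightarrow> 0 < rGamma z"
  using Gamma_real_pos[of z] by (simp add: rGamma_inverse_Gamma)

text \<open>
  The reciprocal Gamma function decreases along integer steps from the second step on, since the
  factor $k + a$ is then at least 1.
\<close>

lemma rGamma_shift_bounded:
  fixes a :: real
  assumes "0 < a"
  shows "rGamma (real k + a) \<le> rGamma a + rGamma (a + 1)"
proof (induction k)
  case 0
  show ?case using rGamma_real_pos[of "a+1"] assms by simp
next
  case (Suc k)
  show ?case
  proof (cases "k = 0")
    case True
    then show ?thesis using rGamma_real_pos[of a] assms by (simp add: add.commute)
  next
    case False
    have "1 * rGamma (real k + a + 1) \<le> (real k + a) * rGamma (real k + a + 1)"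
      using False assms rGamma_real_pos[of "real k + a + 1"]
      by (intro mult_right_mono) auto
    then have "rGamma (real (Suc k) + a) \<le> (real k + a) * rGamma (real k + a + 1)"
      by (simp add: add_ac)
    also have "\<dots> = rGamma (real k + a)" by (rule rGamma_plus1)
    finally show ?thesis using Suc.IH by simp
  qed
qed

lemma summable_clifford_norm:
  assumes "0 < a"
  shows "summable (\<lambda>k. norm (rGamma (real k + a) / fact k * (s::real) ^ k))"
proof (rule summable_comparison_test')
  show "summable (\<lambda>k. (rGamma a + rGamma (a + 1)) * (inverse (fact k) * \<bar>s\<bar> ^ k))"
    using summable_exp[of "\<bar>s\<bar>"] by (intro summable_mult) auto
next
  fix k :: nat
  have "rGamma (real k + a) * (inverse (fact k) * \<bar>s\<bar> ^ k)
     \<le> (rGamma a + rGamma (a + 1)) * (inverse (fact k) * \<bar>s\<bar> ^ k)"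
    using rGamma_shift_bounded[OF assms, of k] by (intro mult_right_mono) auto
  moreover have "0 < rGamma (real k + a)" using assms by (intro rGamma_real_pos) simp
  ultimately show "norm (norm (rGamma (real k + a) / fact k * s ^ k))
     \<le> (rGamma a + rGamma (a + 1)) * (inverse (fact k) * \<bar>s\<bar> ^ k)"
    by (simp add: abs_mult power_abs divide_inverse mult_ac)
qed

lemma summable_clifford: "0 < a \<Longrightarrow> summable (\<lambda>k. rGamma (real k + a) / fact k * (s::real) ^ k)"
  using summable_norm_cancel[OF summable_clifford_norm] .

lemma clifford_sums: "0 < a \<Longrightarrow> (\<lambda>k. rGamma (real k + a) / fact k * (- s) ^ k) sums clifford a s"
  unfolding clifford_def using summable_sums[OF summable_clifford] .

lemma clifford_has_derivative:
  assumes "0 < a"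
  shows "(clifford a has_real_derivative - clifford (a + 1) s) (at s)"
proof -
  let ?c = "\<lambda>k. rGamma (real k + a) / fact k"
  have d: "diffs ?c = (\<lambda>k. rGamma (real k + (a + 1)) / fact k)"
  proof
    fix k
    have e: "real (Suc k) + a = real k + (a + 1)" by simp
    show "diffs ?c k = rGamma (real k + (a + 1)) / fact k"
      unfolding diffs_def e by (simp del: of_nat_Suc)
  qed
  have "((\<lambda>x. \<Sum>k. ?c k * x ^ k) has_real_derivative (\<Sum>k. diffs ?c k * (- s) ^ k)) (at (- s))"
    by (rule termdiffs_strong_converges_everywhere) (rule summable_clifford[OF assms])
  then have "((\<lambda>x. \<Sum>k. ?c k * x ^ k) has_real_derivative clifford (a + 1) s) (at (- s))"
    unfolding d clifford_def .
  then have "((\<lambda>x. \<Sum>k. ?c k * (- x) ^ k) has_real_derivative clifford (a + 1) s * (- 1)) (at s)"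
    by (rule DERIV_chain2[where f = "\<lambda>x. \<Sum>k. ?c k * x ^ k"]) (auto intro!: derivative_eq_intros)
  then show ?thesis unfolding clifford_def[abs_def] by simp
qed

text \<open>
  The recurrence of $1/\Gamma$, summed; together with the derivative this is the Bessel equation.
\<close>

lemma clifford_contiguous:
  assumes "0 < a"
  shows "clifford a s = a * clifford (a + 1) s - s * clifford (a + 2) s"
proof -
  let ?f = "\<lambda>k. real k * rGamma (real k + (a + 1)) / fact k * (- s) ^ k"
  have 2: "(\<lambda>k. - s * (rGamma (real k + (a + 2)) / fact k * (- s) ^ k)) sums (- s * clifford (a + 2) s)"
    using assms by (intro sums_mult clifford_sums) simp
  have "(\<lambda>k. - s * (rGamma (real k + (a + 2)) / fact k * (- s) ^ k)) = (\<lambda>k. ?f (Suc k))"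
  proof
    fix k
    have e: "real (Suc k) + (a + 1) = real k + (a + 2)" by simp
    show "- s * (rGamma (real k + (a + 2)) / fact k * (- s) ^ k) = ?f (Suc k)"
      unfolding e by (simp del: of_nat_Suc)
  qed
  with 2 have "(\<lambda>k. ?f (Suc k)) sums (- s * clifford (a + 2) s)" by simp
  then have 3: "?f sums (- s * clifford (a + 2) s)"
    by (subst (asm) sums_Suc_iff) simp
  have "(\<lambda>k. a * (rGamma (real k + (a + 1)) / fact k * (- s) ^ k) + ?f k) sums
     (a * clifford (a + 1) s + - s * clifford (a + 2) s)"
    using assms by (intro sums_add sums_mult clifford_sums 3) simp
  also have "(\<lambda>k. a * (rGamma (real k + (a + 1)) / fact k * (- s) ^ k) + ?f k)
      = (\<lambda>k. rGamma (real k + a) / fact k * (- s) ^ k)"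
  proof
    fix k
    have "rGamma (real k + a) = (real k + a) * rGamma (real k + (a + 1))"
      using rGamma_plus1[of "real k + a"] by (simp add: add.assoc)
    then show "a * (rGamma (real k + (a + 1)) / fact k * (- s) ^ k) + ?f k
      = rGamma (real k + a) / fact k * (- s) ^ k"
      by (simp add: field_simps)
  qed
  finally show ?thesis using clifford_sums[OF assms, of s] by (auto dest: sums_unique2)
qed

lemma continuous_on_clifford [continuous_intros]:
  assumes "0 < a" "continuous_on S f"
  shows "continuous_on S (\<lambda>x. clifford a (f x))"
proof -
  have "continuous_on UNIV (clifford a)"
    using clifford_has_derivative[OF assms(1)] by (auto intro!: continuous_at_imp_continuous_on DERIV_isCont)
  then show ?thesis using assms(2) by (auto intro: continuous_on_compose2)
qed

text \<open>
  A crude bound, enough for absolute convergence against an exponential. The energy $E(s) = f_a(s)^2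
  + s f_{a+1}(s)^2$ has derivative $(1 - 2a) f_{a+1}(s)^2 \le E(s)/s$ because of $a > 0$, so
  $E(s)/s$ does not increase.
\<close>

lemma clifford_growth:
  assumes "0 < a"
  obtains C where "0 < C" "\<And>s. 0 \<le> s \<Longrightarrow> \<bar>clifford a s\<bar> \<le> C * (1 + s)"
proof -
  define E where "E s = (clifford a s)\<^sup>2 + s * (clifford (a + 1) s)\<^sup>2" for s
  have dE: "((\<lambda>s. E s / s) has_real_derivative
       ((1 - 2 * a) * (clifford (a + 1) s)\<^sup>2 * s - E s) / s\<^sup>2) (at s)" if "0 < s" for s
  proof -
    have c: "clifford a s = a * clifford (a + 1) s - s * clifford (a + 1 + 1) s"
      using clifford_contiguous[OF assms, of s] by (simp add: add.assoc)
    have "(E has_real_derivative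
       2 * clifford a s * (- clifford (a + 1) s) +
       ((clifford (a + 1) s)\<^sup>2 + s * (2 * clifford (a + 1) s * (- clifford (a + 1 + 1) s)))) (at s)"
      unfolding E_def[abs_def] using assms
      by (auto intro!: derivative_eq_intros clifford_has_derivative simp: power2_eq_square)
    also have "2 * clifford a s * (- clifford (a + 1) s) +
       ((clifford (a + 1) s)\<^sup>2 + s * (2 * clifford (a + 1) s * (- clifford (a + 1 + 1) s)))
       = (1 - 2 * a) * (clifford (a + 1) s)\<^sup>2"
      unfolding c by (simp add: algebra_simps power2_eq_square)
    finally have "(E has_real_derivative (1 - 2 * a) * (clifford (a + 1) s)\<^sup>2) (at s)" .
    then show ?thesis using that
      by (auto intro!: derivative_eq_intros simp: power2_eq_square)
  qed
  have dec: "E s / s \<le> E 1 / 1" if "1 \<le> s" for s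
  proof (rule DERIV_nonpos_imp_nonincreasing[OF that])
    fix x :: real assume x: "1 \<le> x" "x \<le> s"
    have "(1 - 2 * a) * (clifford (a + 1) x)\<^sup>2 * x \<le> 1 * (clifford (a + 1) x)\<^sup>2 * x"
      using x assms by (intro mult_right_mono) auto
    also have "\<dots> \<le> E x" by (simp add: E_def mult_ac)
    finally have "((1 - 2 * a) * (clifford (a + 1) x)\<^sup>2 * x - E x) / x\<^sup>2 \<le> 0"
      by (simp add: divide_nonpos_nonneg)
    then show "\<exists>y. ((\<lambda>s. E s / s) has_real_derivative y) (at x) \<and> y \<le> 0"
      using dE[of x] x by force
  qed
  have E1: "0 \<le> E 1" by (simp add: E_def)
  have big: "\<bar>clifford a s\<bar> \<le> (1 + E 1) * (1 + s)" if "1 \<le> s" for s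
  proof -
    have "(clifford a s)\<^sup>2 \<le> E s" using that by (simp add: E_def)
    also have "\<dots> \<le> s * E 1" using dec[OF that] that by (simp add: field_simps)
    also have "\<dots> \<le> (1 + s) * (1 + E 1)" using that E1 by (intro mult_mono) auto
    also have "\<dots> \<le> ((1 + s) * (1 + E 1))\<^sup>2" using that E1
      by (intro self_le_power) (auto intro: order_trans[OF _ mult_mono[of 1 _ 1]])
    finally show ?thesis using that E1 by (auto simp: mult.commute abs_le_square_iff[symmetric])
  qed
  \<comment> \<open>Near 0 the quotient by s is of no use, and compactness takes over.\<close>
  have "compact (clifford a ` {0..1})"
    using assms by (intro compact_continuous_image continuous_intros) auto
  then obtain B where B: "\<And>s. 0 \<le> s \<Longrightarrow> s \<le> 1 \<Longrightarrow> \<bar>clifford a s\<bar> \<le> B"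
    by (force dest!: compact_imp_bounded simp: bounded_iff)
  show ?thesis
  proof (rule that[of "1 + E 1 + \<bar>B\<bar>"])
    show "0 < 1 + E 1 + \<bar>B\<bar>" using E1 by simp
    fix s :: real assume s: "0 \<le> s"
    show "\<bar>clifford a s\<bar> \<le> (1 + E 1 + \<bar>B\<bar>) * (1 + s)"
    proof (cases "s \<le> 1")
      case True
      have "\<bar>clifford a s\<bar> \<le> (1 + E 1 + \<bar>B\<bar>) * 1" using B[OF s True] E1 by simp
      also have "\<dots> \<le> (1 + E 1 + \<bar>B\<bar>) * (1 + s)" using s E1 by (intro mult_left_mono) auto
      finally show ?thesis .
    next
      case False
      have "\<bar>clifford a s\<bar> \<le> (1 + E 1) * (1 + s)" using big False by simp
      also have "\<dots> \<le> (1 + E 1 + \<bar>B\<bar>) * (1 + s)" using s E1 by (intro mult_right_mono) auto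
      finally show ?thesis .
    qed
  qed
qed

lemma bessel_eigenfun_clifford:
  assumes "0 < z" "0 < x" "l > -1/2"
  shows "bessel_eigenfun l z x = 2 powr (1/2 - l) * clifford (l + 1/2) ((x / 2)\<^sup>2 * z\<^sup>2)"
proof -
  define u where "u = z * x / 2"
  have u: "0 < u" "z * x = 2 * u" using assms by (auto simp: u_def)
  have a: "0 < l + 1/2" using assms by simp
  have "(\<lambda>k. u powr (l - 1/2) * (rGamma (real k + (l + 1/2)) / fact k * (- u\<^sup>2) ^ k)) sums (u powr (l - 1/2) * clifford (l + 1/2) (u\<^sup>2))"
    by (intro sums_mult clifford_sums a)
  also have "(\<lambda>k. u powr (l - 1/2) * (rGamma (real k + (l + 1/2)) / fact k * (- u\<^sup>2) ^ k)) =
    (\<lambda>k. (-1) ^ k * rGamma (real k + (l - 1/2) + 1) / fact k * u powr (2 * real k + (l - 1/2)))"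
  proof
    fix k
    have "u powr (2 * real k + (l - 1/2)) = u ^ (2 * k) * u powr (l - 1/2)"
      using u by (simp add: powr_add powr_realpow[symmetric])
    moreover have "real k + (l - 1/2) + 1 = real k + (l + 1/2)" by simp
    ultimately show "u powr (l - 1/2) * (rGamma (real k + (l + 1/2)) / fact k * (- u\<^sup>2) ^ k) =
    (-1) ^ k * rGamma (real k + (l - 1/2) + 1) / fact k * u powr (2 * real k + (l - 1/2))"
      by (simp only: power_mult power_minus[of "u\<^sup>2"]) (simp add: mult_ac)
  qed
  finally have "bessel_J (l - 1/2) (z * x) = u powr (l - 1/2) * clifford (l + 1/2) (u\<^sup>2)"
    unfolding bessel_J_def u(2) by (simp add: sums_iff)
  then have "bessel_eigenfun l z x = (2 * u) powr (1/2 - l) * (u powr (l - 1/2) * clifford (l + 1/2) (u\<^sup>2))"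
    unfolding bessel_eigenfun_def u(2) by simp
  also have "(2 * u) powr (1/2 - l) = 2 powr (1/2 - l) * u powr (1/2 - l)"
    using u by (simp add: powr_mult)
  also have "2 powr (1/2 - l) * u powr (1/2 - l) * (u powr (l - 1/2) * clifford (l + 1/2) (u\<^sup>2))
     = 2 powr (1/2 - l) * (u powr (1/2 - l) * u powr (l - 1/2)) * clifford (l + 1/2) (u\<^sup>2)" by simp
  also have "u powr (1/2 - l) * u powr (l - 1/2) = 1"
    using u by (subst powr_add[symmetric]) simp
  finally show ?thesis by (simp add: u_def power_mult_distrib power_divide mult_ac)
qed

section \<open>Weber's second exponential integral\<close>

abbreviation LP :: "real measure" where
  "LP \<equiv> lebesgue_on {0<..}"

text \<open>
  Euler's integral after the substitution $w = k z^r$. The three cases needed are $r = 2$ (Gaussian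
  moments), $r = 1$ (exponential moments) and $r = -1$ (moments in the subordination variable).
\<close>

lemma power_gamma_moment:
  assumes "r \<noteq> 0" "0 < c / r" "0 < k"
  shows "has_bochner_integral LP (\<lambda>z. z powr (c - 1) * exp (- k * z powr r))
           (Gamma (c / r) * k powr (- c / r) / \<bar>r\<bar>)"
proof -
  define f where "f w = w powr (c / r - 1) / exp w" for w :: real
  define g where "g z = k * z powr r" for z :: real
  define g' where "g' z = k * (r * z powr (r - 1))" for z :: real
  have der: "(g has_field_derivative g' x) (at x within {0<..})" if "x \<in> {0<..}" for x
    unfolding g_def[abs_def] g'_def using that
    by (intro DERIV_cmult has_field_derivative_at_within[OF has_real_derivative_powr]) auto
  \<comment> \<open>The substitution is monotone in either direction, so the change of variables needs only injectivity.\<close>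
  have inj: "inj_on g {0<..}"
  proof (rule inj_onI)
    fix x y :: real assume "x \<in> {0<..}" "y \<in> {0<..}" "g x = g y"
    then have "(x powr r) powr (1 / r) = (y powr r) powr (1 / r)" using assms by (simp add: g_def)
    with \<open>x \<in> {0<..}\<close> \<open>y \<in> {0<..}\<close> assms(1) show "x = y" by (simp add: powr_powr)
  qed
  have img: "g ` {0<..} = {0<..}"
  proof (intro equalityI subsetI)
    fix w :: real assume w: "w \<in> {0<..}"
    then have "w = g ((w / k) powr (1 / r))" using assms by (simp add: g_def powr_powr)
    moreover have "(w / k) powr (1 / r) \<in> {0<..}" using w assms by simp
    ultimately show "w \<in> g ` {0<..}" by blast
  qed (use assms in \<open>auto simp: g_def\<close>)
  have hi: "(f has_integral Gamma (c / r)) {0<..}"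
  proof -
    have "(f has_integral Gamma (c / r)) {0..}"
      unfolding f_def by (rule Gamma_integral_real[OF assms(2)])
    then have "((\<lambda>t. if t \<in> {0<..} then f t else 0) has_integral Gamma (c / r)) {0..}"
      by (rule has_integral_spike [of "{0}", rotated 2]) auto
    then show ?thesis by (subst (asm) has_integral_restrict) auto
  qed
  then have ai: "f absolutely_integrable_on {0<..}"
    by (intro nonnegative_absolutely_integrable_1) (auto simp: f_def)
  from has_absolute_integral_change_of_variables_1'[OF _ der inj, of f "Gamma (c / r)"] img ai hi
  have *: "(\<lambda>x. \<bar>g' x\<bar> * f (g x)) absolutely_integrable_on {0<..}"
      "integral {0<..} (\<lambda>x. \<bar>g' x\<bar> * f (g x)) = Gamma (c / r)" by auto
  then have "has_bochner_integral LP (\<lambda>x. \<bar>g' x\<bar> * f (g x)) (Gamma (c / r))"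
    unfolding has_bochner_integral_iff
    by (simp add: integrable_restrict_space integral_restrict_space set_integrable_def
        set_lebesgue_integral_eq_integral(2)[symmetric] set_lebesgue_integral_def)
  then have "has_bochner_integral LP (\<lambda>x. k powr (- c / r) / \<bar>r\<bar> * (\<bar>g' x\<bar> * f (g x)))
     (k powr (- c / r) / \<bar>r\<bar> * Gamma (c / r))"
    by (rule has_bochner_integral_mult_right)
  also have "?this \<longleftrightarrow> has_bochner_integral LP (\<lambda>z. z powr (c - 1) * exp (- k * z powr r))
           (Gamma (c / r) * k powr (- c / r) / \<bar>r\<bar>)"
  proof (rule has_bochner_integral_cong)
    fix z assume "z \<in> space LP"
    then have z: "0 < z" by simp
    have "k powr (- c / r) / \<bar>r\<bar> * (\<bar>g' z\<bar> * f (g z))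
      = (k powr (- c / r) * (k * k powr (c / r - 1))) * (z powr (r - 1) * (z powr r) powr (c / r - 1)) * exp (- k * z powr r)"
      using z assms by (simp add: g_def g'_def f_def abs_mult powr_mult exp_minus field_simps)
    also have "k powr (- c / r) * (k * k powr (c / r - 1)) = 1"
    proof -
      have "k * k powr (c / r - 1) = k powr (c / r)"
        using assms powr_add[of k 1 "c / r - 1"] by simp
      then show ?thesis using assms by (simp add: powr_minus field_simps)
    qed
    also have "z powr (r - 1) * (z powr r) powr (c / r - 1) = z powr (c - 1)"
      using assms by (simp add: powr_powr powr_add[symmetric] algebra_simps)
    finally show "k powr (- c / r) / \<bar>r\<bar> * (\<bar>g' z\<bar> * f (g z)) = z powr (c - 1) * exp (- k * z powr r)"
      by simp
  qed (simp_all add: mult_ac)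
  finally show ?thesis .
qed

text \<open>
  Vandermonde's convolution for the upper index $k + (j + a - 1)$, with all binomial coefficients
  written through Gamma. It separates $j$ from $k$: on the right $j$ enters only through $1/(j-m)!$,
  so a power series in $j$ sums to an exponential.
\<close>

lemma Gamma_Vandermonde:
  fixes a :: real
  assumes "0 < a"
  shows "Gamma (real j + real k + a) * rGamma (real j + a) / fact j =
    Gamma (real k + a) * (\<Sum>m\<le>k. if m \<le> j then (k choose m) * rGamma (real m + a) / fact (j - m) else 0)"
proof -
  have G: "0 < Gamma (real n + a)" for n using assms by (intro Gamma_real_pos) simp
  have nz: "real n + a \<notin> \<int>\<^sub>\<le>\<^sub>0" for n using assms by (auto elim!: nonpos_Ints_cases)
  have "(\<Sum>m\<le>j. (real k gchoose m) * ((real j + a - 1) gchoose (j - m))) = (real k + (real j + a - 1)) gchoose j"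
    using gbinomial_Vandermonde[of "real k" "real j + a - 1" j] by (simp add: atLeast0AtMost)
  also have "\<dots> = pochhammer (real k + a) j / fact j"
    by (simp add: gbinomial_pochhammer' algebra_simps)
  also have "\<dots> = Gamma (real j + real k + a) / Gamma (real k + a) / fact j"
    using nz[of k] by (simp add: pochhammer_Gamma add_ac)
  finally have 1: "Gamma (real j + real k + a) / fact j =
     Gamma (real k + a) * (\<Sum>m\<le>j. (real k gchoose m) * ((real j + a - 1) gchoose (j - m)))"
    using G[of k] by (simp add: field_simps)
  have 2: "(real k gchoose m) * ((real j + a - 1) gchoose (j - m)) =
     Gamma (real j + a) * ((k choose m) * rGamma (real m + a) / fact (j - m))" if "m \<le> j" for m
  proof -
    have "((real j + a - 1) gchoose (j - m)) = pochhammer (real m + a) (j - m) / fact (j - m)"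
      using that by (simp add: gbinomial_pochhammer' of_nat_diff algebra_simps)
    also have "pochhammer (real m + a) (j - m) = Gamma (real j + a) * rGamma (real m + a)"
      using nz[of m] that by (simp add: pochhammer_Gamma of_nat_diff add_ac rGamma_inverse_Gamma divide_inverse)
    finally show ?thesis by (simp add: binomial_gbinomial)
  qed
  have "(\<Sum>m\<le>j. (real k gchoose m) * ((real j + a - 1) gchoose (j - m))) =
      Gamma (real j + a) * (\<Sum>m\<le>j. (k choose m) * rGamma (real m + a) / fact (j - m))"
    unfolding sum_distrib_left by (intro sum.cong) (auto simp: 2)
  \<comment> \<open>The binomial coefficient cuts the sum at k, the condition m <= j at j.\<close>
  also have "(\<Sum>m\<le>j. (k choose m) * rGamma (real m + a) / fact (j - m)) =
      (\<Sum>m\<le>k. if m \<le> j then (k choose m) * rGamma (real m + a) / fact (j - m) else 0)"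
    by (rule sum.mono_neutral_cong) (auto simp: binomial_eq_0)
  finally show ?thesis using 1 G[of j]
    by (simp add: rGamma_inverse_Gamma field_simps)
qed

text \<open>
  Up to the factor $\Gamma(k+a)/\Gamma(a)$ this is the confluent hypergeometric function $M(k+a, a,
  x)$, in the form that Kummer's transformation gives it: an exponential times a polynomial.
\<close>

definition kummer :: "real \<Rightarrow> nat \<Rightarrow> real \<Rightarrow> real" where
  "kummer a k x = Gamma (real k + a) * (exp x * (\<Sum>m\<le>k. (k choose m) * rGamma (real m + a) * x ^ m))"

lemma kummer_sums:
  assumes "0 < a"
  shows "(\<lambda>j. rGamma (real j + a) / fact j * x ^ j * Gamma (real j + real k + a)) sums kummer a k x"
proof -
  have s: "(\<lambda>j. if m \<le> j then (k choose m) * rGamma (real m + a) / fact (j - m) * x ^ j else 0)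
     sums ((k choose m) * rGamma (real m + a) * x ^ m * exp x)" for m
  proof -
    have "(\<lambda>j. ((k choose m) * rGamma (real m + a) * x ^ m) * (x ^ j /\<^sub>R fact j)) sums
       ((k choose m) * rGamma (real m + a) * x ^ m * exp x)"
      by (intro sums_mult exp_converges)
    then have "(\<lambda>j. if m \<le> j + m then (k choose m) * rGamma (real m + a) / fact (j + m - m) * x ^ (j + m) else 0)
       sums ((k choose m) * rGamma (real m + a) * x ^ m * exp x)"
      by (simp add: power_add field_simps)
    then show ?thesis by (subst (asm) sums_zero_iff_shift) auto
  qed
  have "(\<lambda>j. Gamma (real k + a) * (\<Sum>m\<le>k. if m \<le> j then (k choose m) * rGamma (real m + a) / fact (j - m) * x ^ j else 0))
     sums (Gamma (real k + a) * (\<Sum>m\<le>k. (k choose m) * rGamma (real m + a) * x ^ m * exp x))"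
    by (intro sums_mult sums_sum s)
  also have "(\<lambda>j. Gamma (real k + a) * (\<Sum>m\<le>k. if m \<le> j then (k choose m) * rGamma (real m + a) / fact (j - m) * x ^ j else 0))
     = (\<lambda>j. rGamma (real j + a) / fact j * x ^ j * Gamma (real j + real k + a))"
  proof
    fix j
    have "rGamma (real j + a) / fact j * x ^ j * Gamma (real j + real k + a)
       = x ^ j * (Gamma (real j + real k + a) * rGamma (real j + a) / fact j)" by simp
    also have "\<dots> = Gamma (real k + a) * (\<Sum>m\<le>k. if m \<le> j then (k choose m) * rGamma (real m + a) / fact (j - m) * x ^ j else 0)"
      unfolding Gamma_Vandermonde[OF assms] sum_distrib_left sum_distrib_right
      by (intro sum.cong) (auto simp: field_simps)
    finally show "Gamma (real k + a) * (\<Sum>m\<le>k. if m \<le> j then (k choose m) * rGamma (real m + a) / fact (j - m) * x ^ j else 0)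
      = rGamma (real j + a) / fact j * x ^ j * Gamma (real j + real k + a)" ..
  qed
  also have "Gamma (real k + a) * (\<Sum>m\<le>k. (k choose m) * rGamma (real m + a) * x ^ m * exp x) = kummer a k x"
    unfolding kummer_def sum_distrib_left by (simp add: mult_ac)
  finally show ?thesis .
qed

text \<open>
  The factor $\Gamma(k+a)$ cancels, and what remains is $e^x$ times the Cauchy product of the
  Bessel-Clifford series at $-xy$ with the exponential series of $y$.
\<close>

lemma kummer_double_sums:
  assumes "0 < a"
  shows "(\<lambda>k. rGamma (real k + a) / fact k * y ^ k * kummer a k x) sums (exp (x + y) * clifford a (- (x * y)))"
proof -
  have nz: "Gamma (real n + a) \<noteq> 0" for n using Gamma_real_pos[of "real n + a"] assms by fastforce
  have "(\<lambda>k. \<Sum>m\<le>k. (rGamma (real m + a) / fact m * (x * y) ^ m) * (y ^ (k - m) /\<^sub>R fact (k - m)))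
     sums ((\<Sum>m. rGamma (real m + a) / fact m * (x * y) ^ m) * (\<Sum>n. y ^ n /\<^sub>R fact n))"
    using summable_clifford_norm[OF assms, of "x * y"] summable_norm_exp[of y]
    by (intro Cauchy_product_sums)
  also have "(\<Sum>m. rGamma (real m + a) / fact m * (x * y) ^ m) = clifford a (- (x * y))"
    by (simp add: clifford_def)
  also have "(\<Sum>n. y ^ n /\<^sub>R fact n) = exp y" by (simp add: exp_def)
  finally have "(\<lambda>k. exp x * (\<Sum>m\<le>k. (rGamma (real m + a) / fact m * (x * y) ^ m) * (y ^ (k - m) /\<^sub>R fact (k - m))))
     sums (exp x * (clifford a (- (x * y)) * exp y))" by (rule sums_mult)
  also have "(\<lambda>k. exp x * (\<Sum>m\<le>k. (rGamma (real m + a) / fact m * (x * y) ^ m) * (y ^ (k - m) /\<^sub>R fact (k - m))))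
    = (\<lambda>k. rGamma (real k + a) / fact k * y ^ k * kummer a k x)"
  proof
    fix k
    have "rGamma (real k + a) / fact k * y ^ k * kummer a k x =
       exp x * (\<Sum>m\<le>k. y ^ k / fact k * ((k choose m) * rGamma (real m + a) * x ^ m))"
      unfolding kummer_def sum_distrib_left[symmetric] using nz[of k]
      by (simp add: rGamma_inverse_Gamma field_simps)
    also have "(\<Sum>m\<le>k. y ^ k / fact k * ((k choose m) * rGamma (real m + a) * x ^ m)) =
      (\<Sum>m\<le>k. (rGamma (real m + a) / fact m * (x * y) ^ m) * (y ^ (k - m) /\<^sub>R fact (k - m)))"
    proof (rule sum.cong[OF refl])
      fix m assume "m \<in> {..k}"
      then have m: "m \<le> k" by simp
      then have "y ^ k = y ^ m * y ^ (k - m)" by (simp add: power_add[symmetric])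
      then show "y ^ k / fact k * ((k choose m) * rGamma (real m + a) * x ^ m) =
         (rGamma (real m + a) / fact m * (x * y) ^ m) * (y ^ (k - m) /\<^sub>R fact (k - m))"
        using m by (simp add: binomial_fact power_mult_distrib field_simps)
    qed
    finally show "exp x * (\<Sum>m\<le>k. (rGamma (real m + a) / fact m * (x * y) ^ m) * (y ^ (k - m) /\<^sub>R fact (k - m)))
      = rGamma (real k + a) / fact k * y ^ k * kummer a k x" ..
  qed
  finally show ?thesis by (simp add: exp_add mult_ac)
qed

text \<open>
  The Bessel factor is expanded and integrated against Gaussian moments. The second part bounds the
  absolute value by the same expression with the sign of $b$ reversed; it is the majorant that
  permits to expand the other factor of Weber's integral as well.
\<close>

lemma weber_moment:
  fixes l s b :: real and k :: nat
  defines "a \<equiv> l + 1/2"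
  assumes "0 < a" "0 < s" "0 \<le> b"
  shows "has_bochner_integral LP (\<lambda>z. z powr (2 * l) * exp (- s * z\<^sup>2) * clifford a (b * z\<^sup>2) * (z\<^sup>2) ^ k)
      (s powr (- a) / s ^ k / 2 * kummer a k (- b / s))" (is ?A)
    and "(\<integral>z. norm (z powr (2 * l) * exp (- s * z\<^sup>2) * clifford a (b * z\<^sup>2) * (z\<^sup>2) ^ k) \<partial>LP)
      \<le> s powr (- a) / s ^ k / 2 * kummer a k (b / s)" (is ?B)
proof -
  define w where "w z = z powr (2 * l) * exp (- s * z\<^sup>2)" for z :: real
  have w0: "0 \<le> w z" for z by (simp add: w_def)
  have mom: "has_bochner_integral LP (\<lambda>z. w z * (z\<^sup>2) ^ n) (s powr (- a) / s ^ n / 2 * Gamma (real n + a))" for n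
  proof -
    have "has_bochner_integral LP (\<lambda>z. z powr ((2 * real n + 2 * l + 1) - 1) * exp (- s * z powr 2))
       (Gamma ((2 * real n + 2 * l + 1) / 2) * s powr (- (2 * real n + 2 * l + 1) / 2) / \<bar>2\<bar>)"
      using assms by (intro power_gamma_moment) auto
    also have "?this \<longleftrightarrow> ?thesis"
    proof (rule has_bochner_integral_cong)
      fix z assume "z \<in> space LP"
      then have z: "0 < z" by simp
      have "(z\<^sup>2) ^ n = z powr (2 * real n)"
        using z powr_realpow[of z "2 * n"] by (simp add: power_mult)
      then show "z powr ((2 * real n + 2 * l + 1) - 1) * exp (- s * z powr 2) = w z * (z\<^sup>2) ^ n"
        using z by (simp add: w_def powr_add)
    next
      have "s powr (- (2 * real n + 2 * l + 1) / 2) = s powr (- a - real n)"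
        by (rule arg_cong2[where f="(powr)"]) (auto simp: a_def field_simps)
      also have "\<dots> = s powr (- a) / s ^ n"
        using \<open>0 < s\<close> by (simp add: powr_diff powr_realpow)
      finally have e2: "s powr (- (2 * real n + 2 * l + 1) / 2) = s powr (- a) / s ^ n" .
      have e1: "(2 * real n + 2 * l + 1) / 2 = real n + a" by (simp add: a_def field_simps)
      show "Gamma ((2 * real n + 2 * l + 1) / 2) * s powr (- (2 * real n + 2 * l + 1) / 2) / \<bar>2\<bar>
         = s powr (- a) / s ^ n / 2 * Gamma (real n + a)" unfolding e1 e2 by simp
    qed simp
    finally show ?thesis .
  qed
  define q where "q j = rGamma (real j + a) / fact j" for j
  have q0: "0 \<le> q j" for j unfolding q_def using rGamma_real_pos[of "real j + a"] assms by simp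
  define f where "f j z = q j * (- b) ^ j * (w z * (z\<^sup>2) ^ (j + k))" for j z
  have alg: "c * B * (S / (p * r) / 2 * G) = S / r / 2 * (c * (B / p) * G)" for c B S p r G :: real
    by (simp add: field_simps)
  have fi: "has_bochner_integral LP (f j) (s powr (- a) / s ^ k / 2 * (q j * (- b / s) ^ j * Gamma (real j + real k + a)))" for j
  proof -
    have "has_bochner_integral LP (f j) (q j * (- b) ^ j * (s powr (- a) / s ^ (j + k) / 2 * Gamma (real (j + k) + a)))"
      unfolding f_def by (intro has_bochner_integral_mult_right mom)
    also have "q j * (- b) ^ j * (s powr (- a) / s ^ (j + k) / 2 * Gamma (real (j + k) + a)) =
       s powr (- a) / s ^ k / 2 * (q j * (- b / s) ^ j * Gamma (real j + real k + a))"
      unfolding power_add power_divide of_nat_add by (rule alg)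
    finally show ?thesis .
  qed
  have fn: "has_bochner_integral LP (\<lambda>z. norm (f j z)) (s powr (- a) / s ^ k / 2 * (q j * (b / s) ^ j * Gamma (real j + real k + a)))" for j
  proof -
    have "has_bochner_integral LP (\<lambda>z. q j * b ^ j * (w z * (z\<^sup>2) ^ (j + k))) (q j * b ^ j * (s powr (- a) / s ^ (j + k) / 2 * Gamma (real (j + k) + a)))"
      by (intro has_bochner_integral_mult_right mom)
    also have "q j * b ^ j * (s powr (- a) / s ^ (j + k) / 2 * Gamma (real (j + k) + a)) =
       s powr (- a) / s ^ k / 2 * (q j * (b / s) ^ j * Gamma (real j + real k + a))"
      unfolding power_add power_divide of_nat_add by (rule alg)
    also have "(\<lambda>z. q j * b ^ j * (w z * (z\<^sup>2) ^ (j + k))) = (\<lambda>z. norm (f j z))"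
      using q0 w0 \<open>0 \<le> b\<close> by (auto simp: f_def abs_mult power_abs fun_eq_iff)
    finally show ?thesis .
  qed
  have fs: "(\<lambda>j. f j z) sums (w z * clifford a (b * z\<^sup>2) * (z\<^sup>2) ^ k)" for z
  proof -
    have "(\<lambda>j. w z * (z\<^sup>2) ^ k * (rGamma (real j + a) / fact j * (- (b * z\<^sup>2)) ^ j)) sums (w z * (z\<^sup>2) ^ k * clifford a (b * z\<^sup>2))"
      using assms by (intro sums_mult clifford_sums) auto
    also have "(\<lambda>j. w z * (z\<^sup>2) ^ k * (rGamma (real j + a) / fact j * (- (b * z\<^sup>2)) ^ j)) = (\<lambda>j. f j z)"
    proof
      fix j
      have "(- (b * z\<^sup>2)) ^ j = (- b) ^ j * (z\<^sup>2) ^ j" by (simp add: power_mult_distrib[symmetric])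
      then show "w z * (z\<^sup>2) ^ k * (rGamma (real j + a) / fact j * (- (b * z\<^sup>2)) ^ j) = f j z"
        by (simp add: f_def q_def power_add mult_ac)
    qed
    finally show ?thesis by (simp add: mult_ac)
  qed
  have fns: "summable (\<lambda>j. norm (f j z))" for z
  proof -
    have "summable (\<lambda>j. w z * (z\<^sup>2) ^ k * norm (rGamma (real j + a) / fact j * (- (b * z\<^sup>2)) ^ j))"
      using assms by (intro summable_mult summable_clifford_norm) auto
    then show ?thesis using w0[of z] q0
      by (simp add: f_def q_def abs_mult power_abs power_add power_mult_distrib mult_ac)
  qed
  have ks: "(\<lambda>j. \<integral>z. norm (f j z) \<partial>LP) sums (s powr (- a) / s ^ k / 2 * kummer a k (b / s))"
    unfolding has_bochner_integral_integral_eq[OF fn] q_def using assms by (intro sums_mult kummer_sums) auto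
  have ks': "(\<lambda>j. \<integral>z. f j z \<partial>LP) sums (s powr (- a) / s ^ k / 2 * kummer a k (- b / s))"
    unfolding has_bochner_integral_integral_eq[OF fi] q_def using assms by (intro sums_mult kummer_sums) auto
  have int: "integrable LP (f j)" for j using fi by (simp add: has_bochner_integral_iff)
  note sw = integrable_suminf[OF int _ sums_summable[OF ks]] sums_integral[OF int _ sums_summable[OF ks]]
  have "integrable LP (\<lambda>z. \<Sum>j. f j z)" using sw fns by auto
  moreover have "(\<lambda>j. \<integral>z. f j z \<partial>LP) sums (\<integral>z. (\<Sum>j. f j z) \<partial>LP)" using sw fns by auto
  moreover have eq: "(\<Sum>j. f j z) = w z * clifford a (b * z\<^sup>2) * (z\<^sup>2) ^ k" for z
    using fs[of z] by (simp add: sums_iff)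
  ultimately show A: ?A using ks' unfolding has_bochner_integral_iff w_def
    by (auto dest: sums_unique2)
  have intn: "integrable LP (\<lambda>z. norm (f j z))" for j using fn by (simp add: has_bochner_integral_iff)
  have ks2: "summable (\<lambda>j. \<integral>z. norm (norm (f j z)) \<partial>LP)" using ks by (simp add: sums_iff)
  have *: "integrable LP (\<lambda>z. \<Sum>j. norm (f j z))" "(\<lambda>j. \<integral>z. norm (f j z) \<partial>LP) sums (\<integral>z. (\<Sum>j. norm (f j z)) \<partial>LP)"
    using integrable_suminf[OF intn _ ks2] sums_integral[OF intn _ ks2] fns by auto
  have "(\<integral>z. norm (w z * clifford a (b * z\<^sup>2) * (z\<^sup>2) ^ k) \<partial>LP) \<le> (\<integral>z. (\<Sum>j. norm (f j z)) \<partial>LP)"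
  proof (rule integral_mono)
    show "integrable LP (\<lambda>z. norm (w z * clifford a (b * z\<^sup>2) * (z\<^sup>2) ^ k))"
      using A by (simp add: has_bochner_integral_iff w_def)
    show "norm (w z * clifford a (b * z\<^sup>2) * (z\<^sup>2) ^ k) \<le> (\<Sum>j. norm (f j z))" for z
      unfolding eq[symmetric] by (rule summable_norm[OF fns])
  qed (rule *)
  also have "\<dots> = s powr (- a) / s ^ k / 2 * kummer a k (b / s)"
    using sums_unique2[OF *(2) ks] .
  finally show ?B unfolding w_def .
qed

text \<open>
  Weber's second exponential integral. Both power series are integrated term by term, which is
  legitimate because the double series of absolute values is the same one at arguments of the
  opposite sign, and that one converges by kummer_double_sums.
\<close>

lemma weber_integral:
  fixes l s b :: real
  defines "a \<equiv> l + 1/2"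
  assumes "0 < a" "0 < s" "0 \<le> b" "0 \<le> c"
  shows "has_bochner_integral LP (\<lambda>z. z powr (2 * l) * exp (- s * z\<^sup>2) * clifford a (b * z\<^sup>2) * clifford a (c * z\<^sup>2))
      (s powr (- a) / 2 * (exp (- (b + c) / s) * clifford a (- (b * c / s\<^sup>2))))"
proof -
  define w where "w z = z powr (2 * l) * exp (- s * z\<^sup>2) * clifford a (b * z\<^sup>2)" for z :: real
  define q where "q j = rGamma (real j + a) / fact j" for j
  have q0: "0 \<le> q j" for j unfolding q_def using rGamma_real_pos[of "real j + a"] assms by simp
  define f where "f k z = q k * (- c) ^ k * (w z * (z\<^sup>2) ^ k)" for k z
  note inner = weber_moment[of l s b, folded a_def, OF assms(2-4)]
  have fi: "has_bochner_integral LP (f k) (s powr (- a) / 2 * (q k * (- c / s) ^ k * kummer a k (- b / s)))" for k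
  proof -
    have "has_bochner_integral LP (f k) (q k * (- c) ^ k * (s powr (- a) / s ^ k / 2 * kummer a k (- b / s)))"
      unfolding f_def w_def by (intro has_bochner_integral_mult_right inner)
    also have "q k * (- c) ^ k * (s powr (- a) / s ^ k / 2 * kummer a k (- b / s)) =
       s powr (- a) / 2 * (q k * (- c / s) ^ k * kummer a k (- b / s))"
      by (simp only: power_divide) (simp add: field_simps)
    finally show ?thesis .
  qed
  have int: "integrable LP (f k)" for k using fi by (simp add: has_bochner_integral_iff)
  have fs: "(\<lambda>k. f k z) sums (w z * clifford a (c * z\<^sup>2))" and fns: "summable (\<lambda>k. norm (f k z))" for z
  proof -
    have e: "(\<lambda>k. w z * (q k * (- (c * z\<^sup>2)) ^ k)) = (\<lambda>k. f k z)"
    proof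
      fix k
      have "(- (c * z\<^sup>2)) ^ k = (- c) ^ k * (z\<^sup>2) ^ k" by (simp add: power_mult_distrib[symmetric])
      then show "w z * (q k * (- (c * z\<^sup>2)) ^ k) = f k z"
        by (simp add: f_def mult_ac)
    qed
    show "(\<lambda>k. f k z) sums (w z * clifford a (c * z\<^sup>2))"
      unfolding e[symmetric] q_def using assms by (intro sums_mult clifford_sums) auto
    have "summable (\<lambda>k. norm (w z) * norm (q k * (- (c * z\<^sup>2)) ^ k))"
      unfolding q_def using assms by (intro summable_mult summable_clifford_norm) auto
    then show "summable (\<lambda>k. norm (f k z))"
      unfolding norm_mult[symmetric] fun_cong[OF e, symmetric] .
  qed
  have ns: "summable (\<lambda>k. \<integral>z. norm (f k z) \<partial>LP)"
  proof (rule summable_comparison_test')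
    show "summable (\<lambda>k. s powr (- a) / 2 * (q k * (c / s) ^ k * kummer a k (b / s)))"
      unfolding q_def using assms by (intro summable_mult sums_summable[OF kummer_double_sums]) auto
    fix k
    have "(\<lambda>z. norm (f k z)) = (\<lambda>z. q k * c ^ k * norm (w z * (z\<^sup>2) ^ k))"
      using q0 assms by (auto simp: f_def abs_mult power_abs fun_eq_iff)
    then have "(\<integral>z. norm (f k z) \<partial>LP) = q k * c ^ k * (\<integral>z. norm (w z * (z\<^sup>2) ^ k) \<partial>LP)"
      by (simp only: integral_mult_right_zero)
    also have "\<dots> \<le> q k * c ^ k * (s powr (- a) / s ^ k / 2 * kummer a k (b / s))"
      using inner(2)[of k] q0[of k] assms unfolding w_def by (intro mult_left_mono) auto
    also have "\<dots> = s powr (- a) / 2 * (q k * (c / s) ^ k * kummer a k (b / s))"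
      by (simp add: power_divide field_simps)
    finally show "norm (\<integral>z. norm (f k z) \<partial>LP) \<le> s powr (- a) / 2 * (q k * (c / s) ^ k * kummer a k (b / s))"
      by simp
  qed
  have "(\<lambda>k. \<integral>z. f k z \<partial>LP) sums (s powr (- a) / 2 * (exp (- b / s + - c / s) * clifford a (- (- b / s * (- c / s)))))"
    unfolding has_bochner_integral_integral_eq[OF fi] q_def using assms
    by (intro sums_mult kummer_double_sums) auto
  moreover have e: "- b / s + - c / s = - (b + c) / s"
    unfolding add_divide_distrib[symmetric] by simp
  moreover have e2: "- b / s * (- c / s) = b * c / s\<^sup>2"
    by (simp add: power2_eq_square)
  ultimately have ks: "(\<lambda>k. \<integral>z. f k z \<partial>LP) sums (s powr (- a) / 2 * (exp (- (b + c) / s) * clifford a (- (b * c / s\<^sup>2))))"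
    by (simp only: e e2)
  have eq: "(\<Sum>k. f k z) = w z * clifford a (c * z\<^sup>2)" for z
    using fs[of z] by (simp add: sums_iff)
  have "integrable LP (\<lambda>z. \<Sum>k. f k z)" "(\<lambda>k. \<integral>z. f k z \<partial>LP) sums (\<integral>z. (\<Sum>k. f k z) \<partial>LP)"
    using integrable_suminf[OF int _ ns] sums_integral[OF int _ ns] fns by auto
  then show ?thesis using ks unfolding eq has_bochner_integral_iff w_def
    by (auto dest: sums_unique2)
qed

section \<open>The subordination formula\<close>

text \<open>
  An error function on the whole line with both of its limits; the antiderivative in the
  subordination formula is built from it.
\<close>

lemma gauss_antiderivative:
  obtains G :: "real \<Rightarrow> real" where
    "\<And>x. (G has_real_derivative exp (- x\<^sup>2)) (at x)"
    "(G \<longlongrightarrow> sqrt pi / 2) at_top" "(G \<longlongrightarrow> - (sqrt pi / 2)) at_bot"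
proof -
  obtain F :: "real \<Rightarrow> real" where F: "\<And>x. (F has_real_derivative exp (- x\<^sup>2)) (at x)"
    using einterval_antiderivative[of "-\<infinity>" \<infinity> "\<lambda>x::real. exp (- x\<^sup>2)"]
    by (auto simp: has_real_derivative_iff_has_vector_derivative)
  define G where "G x = F x - F 0" for x
  have dG: "(G has_real_derivative exp (- x\<^sup>2)) (at x)" for x
    unfolding G_def[abs_def] by (auto intro!: derivative_eq_intros F)
  have "((\<lambda>y. \<integral>x. indicator {.. y} (x::real) *\<^sub>R (indicator {0..} x *\<^sub>R exp (- x\<^sup>2)) \<partial>lborel) \<longlongrightarrow>
      (\<integral>x. indicator {0..} x *\<^sub>R exp (- x\<^sup>2) \<partial>lborel)) at_top"
    using gaussian_moment_0 by (intro tendsto_integral_at_top) (auto simp: has_bochner_integral_iff)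
  also have "(\<integral>x. indicator {0..} x *\<^sub>R exp (- x\<^sup>2) \<partial>lborel) = sqrt pi / 2"
    using gaussian_moment_0 by (simp add: has_bochner_integral_iff)
  finally have top: "(G \<longlongrightarrow> sqrt pi / 2) at_top"
  proof (rule Lim_transform_eventually)
    show "\<forall>\<^sub>F y in at_top. (\<integral> x. indicator {.. y} (x::real) *\<^sub>R (indicator {0..} x *\<^sub>R exp (- x\<^sup>2)) \<partial>lborel) = G y"
      using eventually_ge_at_top[of "0::real"]
    proof eventually_elim
      case (elim y)
      have "(\<integral>x. exp (- x\<^sup>2) * indicator {0..y} x \<partial>lborel) = G y - G 0"
        using elim by (intro integral_FTC_Icc_nonneg) (auto intro: dG)
      moreover have "(\<lambda>x. indicator {.. y} x *\<^sub>R (indicator {0..} x *\<^sub>R exp (- x\<^sup>2))) = (\<lambda>x. exp (- x\<^sup>2) * indicator {0..y} x)"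
        by (auto simp: indicator_def fun_eq_iff)
      ultimately show ?case by (simp add: G_def)
    qed
  qed
  have odd: "G (- x) = - G x" for x
  proof -
    have "((\<lambda>x. G x + G (- x)) has_real_derivative 0) (at y)" for y
      by (auto intro!: derivative_eq_intros dG DERIV_chain2[OF dG])
    then have "G x + G (- x) = G 0 + G (- 0)"
      using DERIV_isconst_all[of "\<lambda>x. G x + G (- x)" x 0] by blast
    then show ?thesis by (simp add: G_def)
  qed
  have "((\<lambda>x. - G x) \<longlongrightarrow> - (sqrt pi / 2)) at_top" by (intro tendsto_minus top)
  then have "(G \<longlongrightarrow> - (sqrt pi / 2)) at_bot"
    by (simp add: filterlim_at_bot_mirror odd)
  with dG top show ?thesis by (rule that)
qed

lemma filterlim_tendsto_add_at_bot:
  fixes f g :: "'a \<Rightarrow> real"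
  assumes "(f \<longlongrightarrow> c) F" "filterlim g at_bot F"
  shows "filterlim (\<lambda>x. f x + g x) at_bot F"
  using filterlim_tendsto_add_at_top[OF tendsto_minus[OF assms(1)], of "\<lambda>x. - g x"] assms(2)
  by (simp add: filterlim_uminus_at_bot)

text \<open>
  The integrand has an explicit antiderivative. With $G' (u) = e^{-u^2}$ and $u_\pm = \pm z \sqrt s
  - t / (2 \sqrt s)$ one has $u_\pm^2 = s z^2 \mp z t + t^2 / (4 s)$, so $e^{-tz} G(u_+) + e^{tz}
  G(u_-)$ differentiates to the Gaussian factor times $u_+' + u_-' = t s^{-3/2} / 2$.
\<close>

lemma subordination_formula:
  fixes t z :: real
  assumes "0 < t" "0 < z"
  shows "has_bochner_integral (lebesgue_on {0<..})
     (\<lambda>s. t / (2 * sqrt pi) * s powr (- (3/2)) * exp (- t\<^sup>2 / (4 * s)) * exp (- s * z\<^sup>2)) (exp (- z * t))"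
proof -
  obtain G where dG: "\<And>x. (G has_real_derivative exp (- x\<^sup>2)) (at x)"
    and top: "(G \<longlongrightarrow> sqrt pi / 2) at_top" and bot: "(G \<longlongrightarrow> - (sqrt pi / 2)) at_bot"
    using gauss_antiderivative by blast
  define f where "f s = t / (2 * sqrt pi) * s powr (- (3/2)) * exp (- t\<^sup>2 / (4 * s)) * exp (- s * z\<^sup>2)" for s
  define F where "F s = (exp (- t * z) * G (z * sqrt s - t / 2 * inverse (sqrt s))
      + exp (t * z) * G (- z * sqrt s - t / 2 * inverse (sqrt s))) / sqrt pi" for s
  have dF: "(F has_real_derivative f s) (at s)" if s: "0 < s" for s
  proof -
    define r where "r = sqrt s"
    have r: "0 < r" "s = r\<^sup>2" using s by (auto simp: r_def)
    have p: "s powr (- (3/2)) = 1 / r ^ 3"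
    proof -
      have "s powr (- (3/2)) = 1 / (r powr 2) powr (3/2)"
        using r by (simp add: powr_minus_divide powr_numeral)
      also have "(r powr 2) powr (3/2) = r powr (real 3)" using r by (simp only: powr_powr) simp
      also have "\<dots> = r ^ 3" using r by (subst powr_realpow) auto
      finally show ?thesis .
    qed
    \<comment> \<open>The two squares differ only in the sign of the mixed term, which the prefactors cancel.\<close>
    have e1: "exp (- t * z) * exp (- (z * r - t / 2 * inverse r)\<^sup>2) = exp (- t\<^sup>2 / (4 * s)) * exp (- s * z\<^sup>2)"
      unfolding exp_add[symmetric] using r by (intro arg_cong[where f=exp]) (simp add: power2_eq_square field_simps)
    have e2: "exp (t * z) * exp (- (- z * r - t / 2 * inverse r)\<^sup>2) = exp (- t\<^sup>2 / (4 * s)) * exp (- s * z\<^sup>2)"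
      unfolding exp_add[symmetric] using r by (intro arg_cong[where f=exp]) (simp add: power2_eq_square field_simps)
    have ds: "(sqrt has_real_derivative inverse (2 * r)) (at s)"
      using s unfolding r_def by (auto intro!: derivative_eq_intros simp: field_simps)
    have du: "((\<lambda>s. c * sqrt s - t / 2 * inverse (sqrt s)) has_real_derivative
       (c * inverse (2 * r) + t / 2 * (inverse r * inverse (2 * r) * inverse r))) (at s)" for c
    proof -
      have "((\<lambda>s. inverse (sqrt s)) has_real_derivative - (inverse r * inverse (2 * r) * inverse r)) (at s)"
        using DERIV_inverse'[OF ds] r(1) unfolding r_def by simp
      from DERIV_diff[OF DERIV_cmult[OF ds, of c] DERIV_cmult[OF this, of "t / 2"]]
      show ?thesis by simp
    qed
    have "(F has_real_derivative
       (exp (- t * z) * (exp (- (z * r - t / 2 * inverse r)\<^sup>2) * (z * inverse (2 * r) + t / 2 * (inverse r * inverse (2 * r) * inverse r)))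
      + exp (t * z) * (exp (- (- z * r - t / 2 * inverse r)\<^sup>2) * (- z * inverse (2 * r) + t / 2 * (inverse r * inverse (2 * r) * inverse r)))) / sqrt pi) (at s)"
      unfolding F_def[abs_def]
      by (intro DERIV_cdivide DERIV_add DERIV_cmult DERIV_chain2[OF dG[of "z * r - t / 2 * inverse r", unfolded r_def] du[of z], folded r_def]
          DERIV_chain2[OF dG[of "- z * r - t / 2 * inverse r", unfolded r_def] du[of "- z"], folded r_def])
    also have "(exp (- t * z) * (exp (- (z * r - t / 2 * inverse r)\<^sup>2) * (z * inverse (2 * r) + t / 2 * (inverse r * inverse (2 * r) * inverse r)))
      + exp (t * z) * (exp (- (- z * r - t / 2 * inverse r)\<^sup>2) * (- z * inverse (2 * r) + t / 2 * (inverse r * inverse (2 * r) * inverse r)))) / sqrt pi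
      = (exp (- t\<^sup>2 / (4 * s)) * exp (- s * z\<^sup>2) * (z * inverse (2 * r) + t / 2 * (inverse r * inverse (2 * r) * inverse r))
       + exp (- t\<^sup>2 / (4 * s)) * exp (- s * z\<^sup>2) * (- z * inverse (2 * r) + t / 2 * (inverse r * inverse (2 * r) * inverse r))) / sqrt pi"
      unfolding e1[symmetric] e2[symmetric] mult.assoc by (simp only: e1 e2 mult.assoc[symmetric])
    also have "\<dots> = t * inverse r ^ 3 / (2 * sqrt pi) * (exp (- t\<^sup>2 / (4 * s)) * exp (- s * z\<^sup>2))"
      by (simp add: algebra_simps power3_eq_cube add_divide_distrib)
    also have "\<dots> = f s" unfolding f_def p by (simp add: field_simps power_inverse)
    finally show ?thesis .
  qed
  have s0: "(sqrt \<longlongrightarrow> 0) (at_right 0)"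
    using tendsto_real_sqrt[of "\<lambda>x. x" 0 "at_right 0"] tendsto_ident_at[of 0 "{0<..}"] by simp
  have "filterlim sqrt (at_right 0) (at_right 0)"
    unfolding filterlim_at using s0 by (auto simp: eventually_at_filter)
  then have i0: "filterlim (\<lambda>s. inverse (sqrt s)) at_top (at_right 0)"
    by (rule filterlim_compose[OF filterlim_inverse_at_top_right])
  have b0: "filterlim (\<lambda>s. - (t/2) * inverse (sqrt s)) at_bot (at_right 0)"
    by (rule filterlim_tendsto_neg_mult_at_bot[OF tendsto_const _ i0]) (use assms in auto)
  have A1: "filterlim (\<lambda>s. c * sqrt s - t / 2 * inverse (sqrt s)) at_bot (at_right 0)" for c
  proof -
    have "((\<lambda>s. c * sqrt s) \<longlongrightarrow> c * 0) (at_right 0)" by (intro tendsto_mult tendsto_const s0)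
    from filterlim_tendsto_add_at_bot[OF this b0] show ?thesis by simp
  qed
  have A: "(F \<longlongrightarrow> (exp (- t * z) * (- (sqrt pi / 2)) + exp (t * z) * (- (sqrt pi / 2))) / sqrt pi) (at_right 0)"
    unfolding F_def[abs_def] by (intro tendsto_intros filterlim_compose[OF bot] A1) auto
  have si: "((\<lambda>s. inverse (sqrt s)) \<longlongrightarrow> 0) at_top"
    by (rule tendsto_inverse_0_at_top[OF sqrt_at_top])
  have si': "((\<lambda>s. - (t/2) * inverse (sqrt s)) \<longlongrightarrow> - (t/2) * 0) at_top" by (intro tendsto_mult tendsto_const si)
  have "filterlim (\<lambda>s. z * sqrt s) at_top at_top"
    by (rule filterlim_tendsto_pos_mult_at_top[OF tendsto_const _ sqrt_at_top]) (use assms in auto)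
  from filterlim_tendsto_add_at_top[OF si' this]
  have B1: "filterlim (\<lambda>s. z * sqrt s - t / 2 * inverse (sqrt s)) at_top at_top" by simp
  have "filterlim (\<lambda>s. - z * sqrt s) at_bot at_top"
    by (rule filterlim_tendsto_neg_mult_at_bot[OF tendsto_const _ sqrt_at_top]) (use assms in auto)
  from filterlim_tendsto_add_at_bot[OF si' this]
  have B2: "filterlim (\<lambda>s. - z * sqrt s - t / 2 * inverse (sqrt s)) at_bot at_top"
    by (simp add: algebra_simps)
  have B: "(F \<longlongrightarrow> (exp (- t * z) * (sqrt pi / 2) + exp (t * z) * (- (sqrt pi / 2))) / sqrt pi) at_top"
    unfolding F_def[abs_def]
    by (intro tendsto_intros filterlim_compose[OF bot B2] filterlim_compose[OF top B1]) auto
  have cont: "isCont f x" if "0 < x" for x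
    using that unfolding f_def[abs_def] by (intro continuous_intros) auto
  have f0: "0 \<le> f x" if "0 < x" for x using that assms by (simp add: f_def)
  have *: "set_integrable lborel (einterval 0 \<infinity>) f"
     "(LBINT x=0..\<infinity>. f x) = (exp (- t * z) * (sqrt pi / 2) + exp (t * z) * (- (sqrt pi / 2))) / sqrt pi
        - (exp (- t * z) * (- (sqrt pi / 2)) + exp (t * z) * (- (sqrt pi / 2))) / sqrt pi"
    using A B dF cont f0
    by (intro interval_integral_FTC_nonneg[of 0 \<infinity> F f];
        simp add: zero_ereal_def ereal_tendsto_simps; fail)+
  have "(LBINT x=0..\<infinity>. f x) = exp (- z * t)"
    unfolding * by (simp add: field_simps)
  moreover have "einterval 0 \<infinity> = {0<..}" by (auto simp: einterval_def zero_ereal_def)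
  moreover have "f \<in> borel_measurable borel" unfolding f_def[abs_def] by measurable
  ultimately show ?thesis using *(1)
    unfolding f_def[symmetric] has_bochner_integral_iff
    by (simp add: integrable_restrict_space integral_restrict_space set_integrable_def
        integrable_completion integral_completion interval_lebesgue_integral_def set_lebesgue_integral_def zero_ereal_def)
qed

section \<open>The Poisson kernel as a power series\<close>

text \<open>
  The Taylor coefficients of the kernel in the variable $(2xy/(t^2+x^2+y^2))^2$; up to a constant
  those of the hypergeometric function of a Legendre function of the second kind.
\<close>

definition legendre_coeff :: "real \<Rightarrow> nat \<Rightarrow> real" where
  "legendre_coeff l n = Gamma (2 * real n + l + 1) * rGamma (real n + (l + 1/2)) / (fact n * 4 ^ n)"

definition sqsum :: "real \<Rightarrow> real \<Rightarrow> real \<Rightarrow> real" where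
  "sqsum t x y = t\<^sup>2 + x\<^sup>2 + y\<^sup>2"

lemma sqsum_pos: "0 < t \<Longrightarrow> 0 < sqsum t x y"
  by (simp add: sqsum_def add_pos_nonneg)

lemma sqsum_minus: "sqsum t x y - 2 * x * y = t\<^sup>2 + (x - y)\<^sup>2"
  by (simp add: sqsum_def power2_eq_square algebra_simps)

lemma sigma_finite_lebesgue: "sigma_finite_measure (lebesgue :: real measure)"
proof
  obtain A :: "real set set" where "countable A" "A \<subseteq> sets lborel" "\<Union>A = space lborel" "\<forall>a\<in>A. emeasure lborel a \<noteq> \<infinity>"
    using sigma_finite_measure.sigma_finite_countable[OF sigma_finite_lborel] by blast
  then show "\<exists>A::real set set. countable A \<and> A \<subseteq> sets lebesgue \<and> \<Union>A = space lebesgue \<and> (\<forall>a\<in>A. emeasure lebesgue a \<noteq> \<infinity>)"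
    by (intro exI[of _ A]) (auto simp: emeasure_completion)
qed

interpretation LP: sigma_finite_measure LP
  by (intro sigma_finite_measure_restrict_space sigma_finite_lebesgue) auto

interpretation LP2: pair_sigma_finite LP LP ..

text \<open>
  Linear growth of both Bessel factors leaves three exponential moments.
\<close>

lemma integrable_exp_clifford_clifford:
  fixes l t b c :: real
  assumes l: "l > -1/2" and "0 < t" "0 \<le> b" "0 \<le> c"
  shows "integrable LP (\<lambda>z. z powr (2 * l) * exp (- z * t) * clifford (l + 1/2) (b * z\<^sup>2) * clifford (l + 1/2) (c * z\<^sup>2))"
proof -
  have a: "0 < l + 1/2" using l by simp
  obtain C where C: "0 < C" "\<And>s. 0 \<le> s \<Longrightarrow> \<bar>clifford (l + 1/2) s\<bar> \<le> C * (1 + s)"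
    using clifford_growth[OF a] by blast
  have m: "integrable LP (\<lambda>z. z powr (2 * l) * exp (- z * t) * z ^ n)" for n :: nat
  proof -
    have "has_bochner_integral LP (\<lambda>z. z powr ((2 * l + real n + 1) - 1) * exp (- t * z powr 1))
       (Gamma ((2 * l + real n + 1) / 1) * t powr (- (2 * l + real n + 1) / 1) / \<bar>1\<bar>)"
      using assms by (intro power_gamma_moment) auto
    then have "integrable LP (\<lambda>z. z powr ((2 * l + real n + 1) - 1) * exp (- t * z powr 1))"
      by (simp add: has_bochner_integral_iff)
    also have "?this \<longleftrightarrow> ?thesis"
      by (intro Bochner_Integration.integrable_cong) (auto simp: powr_add powr_realpow mult_ac)
    finally show ?thesis .
  qed
  have "integrable LP (\<lambda>z. C\<^sup>2 * (z powr (2 * l) * exp (- z * t) * z ^ 0 + (b + c) * (z powr (2 * l) * exp (- z * t) * z ^ 2)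
        + b * c * (z powr (2 * l) * exp (- z * t) * z ^ 4)))"
    by (intro integrable_mult_right Bochner_Integration.integrable_add m)
  then show ?thesis
  proof (rule Bochner_Integration.integrable_bound)
    have [measurable]: "clifford (l + 1/2) \<in> borel_measurable borel"
      using a by (intro borel_measurable_continuous_onI continuous_intros continuous_on_clifford[where f="\<lambda>x. x"])
    show "(\<lambda>z. z powr (2 * l) * exp (- z * t) * clifford (l + 1/2) (b * z\<^sup>2) * clifford (l + 1/2) (c * z\<^sup>2)) \<in> borel_measurable LP"
      by (intro measurable_restrict_space1 measurable_completion) (simp, measurable)
    have "norm (z powr (2 * l) * exp (- z * t) * clifford (l + 1/2) (b * z\<^sup>2) * clifford (l + 1/2) (c * z\<^sup>2))
      \<le> norm (C\<^sup>2 * (z powr (2 * l) * exp (- z * t) * z ^ 0 + (b + c) * (z powr (2 * l) * exp (- z * t) * z ^ 2)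
        + b * c * (z powr (2 * l) * exp (- z * t) * z ^ 4)))" for z
    proof -
      have "\<bar>clifford (l + 1/2) (b * z\<^sup>2)\<bar> * \<bar>clifford (l + 1/2) (c * z\<^sup>2)\<bar> \<le> (C * (1 + b * z\<^sup>2)) * (C * (1 + c * z\<^sup>2))"
        using C assms by (intro mult_mono C) auto
      then have "z powr (2 * l) * exp (- z * t) * (\<bar>clifford (l + 1/2) (b * z\<^sup>2)\<bar> * \<bar>clifford (l + 1/2) (c * z\<^sup>2)\<bar>)
         \<le> z powr (2 * l) * exp (- z * t) * ((C * (1 + b * z\<^sup>2)) * (C * (1 + c * z\<^sup>2)))"
        by (intro mult_left_mono) auto
      then show ?thesis
        by (auto simp: abs_mult power2_eq_square power4_eq_xxxx algebra_simps intro: order_trans[OF _ abs_ge_self])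
    qed
    then show "AE z in LP. norm (z powr (2 * l) * exp (- z * t) * clifford (l + 1/2) (b * z\<^sup>2) * clifford (l + 1/2) (c * z\<^sup>2))
      \<le> norm (C\<^sup>2 * (z powr (2 * l) * exp (- z * t) * z ^ 0 + (b + c) * (z powr (2 * l) * exp (- z * t) * z ^ 2)
        + b * c * (z powr (2 * l) * exp (- z * t) * z ^ 4)))" by simp
  qed
qed

lemma borel_LP: "f \<in> borel_measurable borel \<Longrightarrow> f \<in> borel_measurable LP"
  by (intro measurable_restrict_space1 measurable_completion) simp

lemma poisson_kernel_eq_clifford:
  assumes l: "l > -1/2" and "0 < x" "0 < y"
  shows "poisson_kernel l t x y = 2 powr (1 - 2 * l) *
     (\<integral>z. z powr (2 * l) * exp (- z * t) * clifford (l + 1/2) ((x / 2)\<^sup>2 * z\<^sup>2) * clifford (l + 1/2) ((y / 2)\<^sup>2 * z\<^sup>2) \<partial>LP)"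
proof -
  have a: "0 < l + 1/2" using l by simp
  have [measurable]: "clifford (l + 1/2) \<in> borel_measurable borel"
    using a by (intro borel_measurable_continuous_onI continuous_on_clifford[where f="\<lambda>x. x"] continuous_intros)
  let ?g = "\<lambda>x z. 2 powr (1/2 - l) * clifford (l + 1/2) ((x / 2)\<^sup>2 * z\<^sup>2)"
  have "poisson_kernel l t x y = (\<integral>z. exp (- z * t) * ?g x z * ?g y z \<partial>power_measure (2 * l))"
    unfolding poisson_kernel_def
    by (rule Bochner_Integration.integral_cong) (use assms in \<open>auto simp: power_measure_def bessel_eigenfun_clifford\<close>)
  also have "\<dots> = (\<integral>z. z powr (2 * l) *\<^sub>R (exp (- z * t) * ?g x z * ?g y z) \<partial>LP)"
    unfolding power_measure_def by (intro integral_density borel_LP) (auto, measurable)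
  also have "\<dots> = (\<integral>z. (2 powr (1/2 - l) * 2 powr (1/2 - l)) * (z powr (2 * l) * exp (- z * t) * clifford (l + 1/2) ((x / 2)\<^sup>2 * z\<^sup>2) * clifford (l + 1/2) ((y / 2)\<^sup>2 * z\<^sup>2)) \<partial>LP)"
    by (intro Bochner_Integration.integral_cong) (auto simp: mult_ac)
  also have "2 powr (1/2 - l) * 2 powr (1/2 - l) = 2 powr (1 - 2 * l)"
    unfolding powr_add[symmetric] by simp
  finally show ?thesis by simp
qed

text \<open>
  Subordination under the integral sign. Absolute convergence of the double integral is free: the
  subordination density is positive, so the inner integral of the absolute value is the absolute
  value of an integrable function.
\<close>

lemma poisson_subordination:
  assumes l: "l > -1/2" and t: "0 < t" and "0 \<le> b" "0 \<le> c"
  defines "a \<equiv> l + 1/2"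
  shows "has_bochner_integral LP (\<lambda>s. t / (2 * sqrt pi) * s powr (- (3/2)) * exp (- t\<^sup>2 / (4 * s)) *
      (s powr (- a) / 2 * (exp (- (b + c) / s) * clifford a (- (b * c / s\<^sup>2)))))
      (\<integral>z. z powr (2 * l) * exp (- z * t) * clifford a (b * z\<^sup>2) * clifford a (c * z\<^sup>2) \<partial>LP)"
proof -
  have a: "0 < a" using l by (simp add: a_def)
  have [measurable]: "clifford a \<in> borel_measurable borel"
    using a by (intro borel_measurable_continuous_onI continuous_on_clifford[where f="\<lambda>x. x"] continuous_intros)
  define h where "h z = z powr (2 * l) * clifford a (b * z\<^sup>2) * clifford a (c * z\<^sup>2)" for z
  define \<sigma> where "\<sigma> s = t / (2 * sqrt pi) * s powr (- (3/2)) * exp (- t\<^sup>2 / (4 * s))" for s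
  have \<sigma>0: "0 \<le> \<sigma> s" for s using t by (simp add: \<sigma>_def)
  define H where "H z s = h z * (\<sigma> s * exp (- s * z\<^sup>2))" for z s
  have meas: "(\<lambda>(z, s). H z s) \<in> borel_measurable (borel \<Otimes>\<^sub>M borel)"
    unfolding H_def h_def \<sigma>_def by measurable
  have id: "(\<lambda>x. x) \<in> measurable LP borel"
    by (intro borel_LP) simp
  have "(\<lambda>x. (fst x, snd x)) \<in> measurable (LP \<Otimes>\<^sub>M LP) (borel \<Otimes>\<^sub>M borel)"
    by (intro measurable_Pair measurable_compose[OF measurable_fst id] measurable_compose[OF measurable_snd id])
  from measurable_compose[OF this meas]
  have meas': "(\<lambda>(z, s). H z s) \<in> borel_measurable (LP \<Otimes>\<^sub>M LP)" by (simp add: case_prod_beta)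
  have sub: "has_bochner_integral LP (\<lambda>s. \<sigma> s * exp (- s * z\<^sup>2)) (exp (- z * t))" if "0 < z" for z
    using subordination_formula[OF t that] unfolding \<sigma>_def .
  have hi: "integrable LP (\<lambda>z. h z * exp (- z * t))"
    using integrable_exp_clifford_clifford[OF l t assms(3,4)] by (simp add: h_def a_def mult_ac)
  have inner: "(\<integral>s. H z s \<partial>LP) = h z * exp (- z * t)" "integrable LP (H z)"
     "(\<integral>s. norm (H z s) \<partial>LP) = norm (h z * exp (- z * t))" if "0 < z" for z
  proof -
    have s: "has_bochner_integral LP (H z) (h z * exp (- z * t))"
      unfolding H_def by (intro has_bochner_integral_mult_right sub that)
    then show "(\<integral>s. H z s \<partial>LP) = h z * exp (- z * t)" "integrable LP (H z)"
      by (auto simp: has_bochner_integral_iff)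
    have "has_bochner_integral LP (\<lambda>s. norm (h z) * (\<sigma> s * exp (- s * z\<^sup>2))) (norm (h z) * exp (- z * t))"
      by (intro has_bochner_integral_mult_right sub that)
    also have "(\<lambda>s. norm (h z) * (\<sigma> s * exp (- s * z\<^sup>2))) = (\<lambda>s. norm (H z s))"
      using \<sigma>0 by (auto simp: H_def abs_mult fun_eq_iff)
    finally show "(\<integral>s. norm (H z s) \<partial>LP) = norm (h z * exp (- z * t))"
      by (simp add: has_bochner_integral_iff abs_mult)
  qed
  have fub: "integrable (LP \<Otimes>\<^sub>M LP) (\<lambda>(z, s). H z s)"
  proof (rule LP2.Fubini_integrable[OF meas'])
    have "integrable LP (\<lambda>z. norm (h z * exp (- z * t)))" using hi by (rule integrable_norm)
    also have "?this \<longleftrightarrow> integrable LP (\<lambda>z. \<integral>s. norm (H z s) \<partial>LP)"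
    proof (rule Bochner_Integration.integrable_cong)
      fix z assume "z \<in> space LP"
      then have "0 < z" by simp
      from inner(3)[OF this] show "norm (h z * exp (- z * t)) = (\<integral>s. norm (H z s) \<partial>LP)" ..
    qed simp
    finally show "integrable LP (\<lambda>x. \<integral>y. norm (case (x, y) of (z, s) \<Rightarrow> H z s) \<partial>LP)" by simp
    show "AE x in LP. integrable LP (\<lambda>y. case (x, y) of (z, s) \<Rightarrow> H z s)"
      by (rule AE_I2) (use inner in auto)
  qed
  have "(\<integral>s. (\<integral>z. H z s \<partial>LP) \<partial>LP) = (\<integral>z. (\<integral>s. H z s \<partial>LP) \<partial>LP)"
    by (rule LP2.Fubini_integral[OF fub])
  also have "\<dots> = (\<integral>z. h z * exp (- z * t) \<partial>LP)"
    by (intro Bochner_Integration.integral_cong) (auto simp: inner)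
  finally have 1: "(\<integral>s. (\<integral>z. H z s \<partial>LP) \<partial>LP) = (\<integral>z. h z * exp (- z * t) \<partial>LP)" .
  have 2: "integrable LP (\<lambda>s. \<integral>z. H z s \<partial>LP)"
    using LP2.integrable_snd[OF fub] by simp
  have 3: "(\<integral>z. H z s \<partial>LP) = \<sigma> s * (s powr (- a) / 2 * (exp (- (b + c) / s) * clifford a (- (b * c / s\<^sup>2))))" if "0 < s" for s
  proof -
    have "has_bochner_integral LP (\<lambda>z. \<sigma> s * (z powr (2 * l) * exp (- s * z\<^sup>2) * clifford a (b * z\<^sup>2) * clifford a (c * z\<^sup>2)))
       (\<sigma> s * (s powr (- a) / 2 * (exp (- (b + c) / s) * clifford a (- (b * c / s\<^sup>2)))))"
      using weber_integral[of l s b c] a that assms unfolding a_def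
      by (intro has_bochner_integral_mult_right) auto
    then show ?thesis by (simp add: has_bochner_integral_iff H_def h_def mult_ac)
  qed
  have "has_bochner_integral LP (\<lambda>s. \<integral>z. H z s \<partial>LP) (\<integral>z. h z * exp (- z * t) \<partial>LP)"
    using 1 2 by (simp add: has_bochner_integral_iff)
  also have "?this \<longleftrightarrow> has_bochner_integral LP (\<lambda>s. \<sigma> s * (s powr (- a) / 2 * (exp (- (b + c) / s) * clifford a (- (b * c / s\<^sup>2)))))
       (\<integral>z. h z * exp (- z * t) \<partial>LP)"
    by (intro has_bochner_integral_cong) (auto simp: 3)
  finally show ?thesis unfolding \<sigma>_def h_def by (simp add: mult_ac)
qed

text \<open>
  After subordination and Weber's integral the Bessel factor stands at a negative argument, so its
  series has positive terms, and each term is a moment in $1/s$. Monotone convergence then gives the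
  exchange of sum and integral together with the summability of the result.
\<close>

lemma poisson_kernel_sums:
  assumes l: "l > -1/2" and t: "0 < t" and "0 < x" "0 < y"
  shows "(\<lambda>n. 2 / sqrt pi * t * sqsum t x y powr (- (l + 1)) * (legendre_coeff l n * ((2 * x * y / sqsum t x y)\<^sup>2) ^ n))
     sums poisson_kernel l t x y"
proof -
  define a where "a = l + 1/2"
  have a: "0 < a" using l by (simp add: a_def)
  define b where "b = (x / 2)\<^sup>2"
  define c where "c = (y / 2)\<^sup>2"
  define A where "A = sqsum t x y"
  have A: "0 < A" using sqsum_pos[OF t] by (simp add: A_def)
  have bc: "0 \<le> b" "0 \<le> c" by (auto simp: b_def c_def)
  define J where "J = (\<integral>z. z powr (2 * l) * exp (- z * t) * clifford a (b * z\<^sup>2) * clifford a (c * z\<^sup>2) \<partial>LP)"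
  define q where "q n = rGamma (real n + a) / fact n" for n
  have q0: "0 \<le> q n" for n unfolding q_def using rGamma_real_pos[of "real n + a"] a by simp
  define g where "g s = t / (2 * sqrt pi) * s powr (- (3/2)) * exp (- t\<^sup>2 / (4 * s)) *
      (s powr (- a) / 2 * (exp (- (b + c) / s) * clifford a (- (b * c / s\<^sup>2))))" for s
  define G where "G n s = t / (4 * sqrt pi) * (q n * (b * c) ^ n) * (s powr (- (2 * real n + l + 1) - 1) * exp (- (A / 4) * s powr (- 1)))" for n s
  define I where "I n = t / (4 * sqrt pi) * (q n * (b * c) ^ n) * (Gamma (2 * real n + l + 1) * (A / 4) powr (- (2 * real n + l + 1)))" for n
  have g: "has_bochner_integral LP g J"
    unfolding g_def J_def a_def by (rule poisson_subordination[OF l t bc])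
  have G0: "0 \<le> G n s" for n s using q0 t bc by (simp add: G_def)
  have GI: "has_bochner_integral LP (G n) (I n)" for n
  proof -
    have "has_bochner_integral LP (\<lambda>s. s powr (- (2 * real n + l + 1) - 1) * exp (- (A / 4) * s powr (- 1)))
      (Gamma (- (2 * real n + l + 1) / - 1) * (A / 4) powr (- (- (2 * real n + l + 1)) / - 1) / \<bar>- 1\<bar>)"
      using l A by (intro power_gamma_moment) auto
    moreover have "- m / - 1 = m" "- (- m) / - 1 = - m" for m :: real by auto
    ultimately have "has_bochner_integral LP (\<lambda>s. s powr (- (2 * real n + l + 1) - 1) * exp (- (A / 4) * s powr (- 1)))
      (Gamma (2 * real n + l + 1) * (A / 4) powr (- (2 * real n + l + 1)))"
      by (simp only: abs_minus_cancel abs_one div_by_1)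
    then show ?thesis unfolding G_def I_def by (intro has_bochner_integral_mult_right)
  qed
  have sums: "(\<lambda>n. G n s) sums g s" if s: "0 < s" for s
  proof -
    have "(\<lambda>n. t / (2 * sqrt pi) * s powr (- (3/2)) * exp (- t\<^sup>2 / (4 * s)) * (s powr (- a) / 2 * (exp (- (b + c) / s) *
       (rGamma (real n + a) / fact n * (- (- (b * c / s\<^sup>2))) ^ n)))) sums g s"
      unfolding g_def by (intro sums_mult clifford_sums a)
    also have "(\<lambda>n. t / (2 * sqrt pi) * s powr (- (3/2)) * exp (- t\<^sup>2 / (4 * s)) * (s powr (- a) / 2 * (exp (- (b + c) / s) *
       (rGamma (real n + a) / fact n * (- (- (b * c / s\<^sup>2))) ^ n)))) = (\<lambda>n. G n s)"
    proof
      fix n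
      have e: "exp (- t\<^sup>2 / (4 * s)) * exp (- (b + c) / s) = exp (- (A / 4) * s powr (- 1))"
        unfolding exp_add[symmetric] using s
        by (intro arg_cong[where f=exp]) (simp add: A_def b_def c_def sqsum_def powr_minus field_simps power2_eq_square)
      have p: "s powr (- (3/2)) * s powr (- a) * (1 / s\<^sup>2) ^ n = s powr (- (2 * real n + l + 1) - 1)"
      proof -
        have "(1 / s\<^sup>2) ^ n = 1 / s ^ (2 * n)" by (simp add: power_one_over power_mult)
        also have "\<dots> = s powr (- (2 * real n))"
          using s powr_realpow[of s "2 * n"] by (simp add: powr_minus_divide)
        finally have "s powr (- (3/2)) * s powr (- a) * (1 / s\<^sup>2) ^ n = s powr (- (3/2) + - a + - (2 * real n))"
          by (simp only: powr_add)
        also have "- (3/2) + - a + - (2 * real n) = - (2 * real n + l + 1) - 1" by (simp add: a_def)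
        finally show ?thesis .
      qed
      have "(b * c / s\<^sup>2) ^ n = (b * c) ^ n * (1 / s\<^sup>2) ^ n"
        unfolding power_mult_distrib[symmetric] by simp
      then have "t / (2 * sqrt pi) * s powr (- (3/2)) * exp (- t\<^sup>2 / (4 * s)) * (s powr (- a) / 2 * (exp (- (b + c) / s) *
       (rGamma (real n + a) / fact n * (- (- (b * c / s\<^sup>2))) ^ n)))
        = t / (4 * sqrt pi) * (q n * (b * c) ^ n) * ((s powr (- (3/2)) * s powr (- a) * (1 / s\<^sup>2) ^ n) *
           (exp (- t\<^sup>2 / (4 * s)) * exp (- (b + c) / s)))"
        by (simp add: q_def mult_ac)
      then show "t / (2 * sqrt pi) * s powr (- (3/2)) * exp (- t\<^sup>2 / (4 * s)) * (s powr (- a) / 2 * (exp (- (b + c) / s) *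
       (rGamma (real n + a) / fact n * (- (- (b * c / s\<^sup>2))) ^ n))) = G n s"
        unfolding G_def e p .
    qed
    finally show ?thesis .
  qed
  have g0: "0 \<le> g s" if "0 < s" for s
    using sums_le[OF _ sums_zero sums[OF that]] G0 by simp
  have I0: "0 \<le> I n" for n
  proof -
    have "0 \<le> (\<integral>s. G n s \<partial>LP)" by (intro Bochner_Integration.integral_nonneg G0)
    then show ?thesis using has_bochner_integral_integral_eq[OF GI[of n]] by simp
  qed
  have "ennreal J = (\<integral>\<^sup>+s. g s \<partial>LP)"
    using g g0 by (intro nn_integral_eq_integral[symmetric, THEN trans[rotated]])
       (auto simp: has_bochner_integral_iff)
  also have "\<dots> = (\<integral>\<^sup>+s. (\<Sum>n. ennreal (G n s)) \<partial>LP)"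
    using sums G0 by (intro nn_integral_cong) (auto simp: sums_iff suminf_ennreal2)
  also have "\<dots> = (\<Sum>n. \<integral>\<^sup>+s. G n s \<partial>LP)"
    using borel_measurable_has_bochner_integral[OF GI] by (intro nn_integral_suminf) simp
  also have "\<dots> = (\<Sum>n. ennreal (I n))"
  proof (rule suminf_cong)
    fix n
    have "integrable LP (G n)" "(\<integral>s. G n s \<partial>LP) = I n"
      using GI[of n] by (auto simp: has_bochner_integral_iff)
    then show "(\<integral>\<^sup>+s. G n s \<partial>LP) = ennreal (I n)" using G0 by (simp add: nn_integral_eq_integral)
  qed
  finally have eq: "ennreal J = (\<Sum>n. ennreal (I n))" .
  then have "(\<Sum>n. ennreal (I n)) \<noteq> top" by (metis ennreal_neq_top)
  then have Is: "summable I" using I0 by (auto intro: summable_suminf_not_top)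
  with eq I0 have "ennreal J = ennreal (suminf I)" by (simp add: suminf_ennreal2)
  moreover have "0 \<le> J"
    using g g0 by (auto simp: has_bochner_integral_iff intro!: Bochner_Integration.integral_nonneg)
  ultimately have "J = suminf I" using Is I0 by (simp add: suminf_nonneg)
  with Is have Isums: "I sums J" by (simp add: sums_iff)
  have "(\<lambda>n. 2 powr (1 - 2 * l) * I n) sums (2 powr (1 - 2 * l) * J)"
    by (rule sums_mult[OF Isums])
  also have "2 powr (1 - 2 * l) * J = poisson_kernel l t x y"
    using poisson_kernel_eq_clifford[OF l assms(3,4)] by (simp add: J_def a_def b_def c_def)
  also have "(\<lambda>n. 2 powr (1 - 2 * l) * I n) = (\<lambda>n. 2 / sqrt pi * t * A powr (- (l + 1)) * (legendre_coeff l n * ((2 * x * y / A)\<^sup>2) ^ n))"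
  proof
    fix n
    have p1: "(A / 4) powr (- (2 * real n + l + 1)) = A powr (- (l + 1)) / A ^ (2 * n) * (4 powr (l + 1) * 4 ^ (2 * n))"
    proof -
      have "(A / 4) powr (- (2 * real n + l + 1)) = A powr (- (l + 1) - real (2 * n)) / 4 powr (- (l + 1) - real (2 * n))"
        using A by (simp add: powr_divide algebra_simps)
      also have "\<dots> = A powr (- (l + 1)) / A ^ (2 * n) * (4 powr (l + 1) * 4 ^ (2 * n))"
        using A unfolding powr_diff powr_realpow[OF A]
        by (simp only: powr_realpow[of 4] powr_minus) (simp add: field_simps)
      finally show ?thesis .
    qed
    have p2: "2 powr (1 - 2 * l) * 4 powr (l + 1) = 8"
    proof -
      have "(4::real) powr (l + 1) = (2 powr 2) powr (l + 1)" by simp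
      also have "\<dots> = 2 powr (2 * l + 2)" by (simp only: powr_powr) (simp add: algebra_simps)
      finally have "2 powr (1 - 2 * l) * 4 powr (l + 1) = 2 powr ((1 - 2 * l) + (2 * l + 2))"
        by (simp only: powr_add)
      also have "\<dots> = 2 powr (real 3)" by (rule arg_cong) simp
      also have "\<dots> = 8" by (subst powr_realpow) auto
      finally show ?thesis .
    qed
    have p3: "(b * c) ^ n / A ^ (2 * n) * 4 ^ (2 * n) = ((2 * x * y / A)\<^sup>2) ^ n / 4 ^ n"
    proof -
      have "(b * c) ^ n / A ^ (2 * n) * 4 ^ (2 * n) = (b * c / A\<^sup>2 * 16) ^ n"
        by (simp add: power_mult power_divide power_mult_distrib)
      also have "b * c / A\<^sup>2 * 16 = (2 * x * y / A)\<^sup>2 / 4"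
        by (simp add: b_def c_def power_divide power_mult_distrib)
      finally show ?thesis by (simp add: power_divide)
    qed
    have "2 powr (1 - 2 * l) * I n = t / (4 * sqrt pi) * (2 powr (1 - 2 * l) * 4 powr (l + 1)) * A powr (- (l + 1)) *
       (q n * Gamma (2 * real n + l + 1)) * ((b * c) ^ n / A ^ (2 * n) * 4 ^ (2 * n))"
      unfolding I_def p1 by (simp add: mult_ac)
    also have "\<dots> = 2 / sqrt pi * t * A powr (- (l + 1)) * (legendre_coeff l n * ((2 * x * y / A)\<^sup>2) ^ n)"
      unfolding p2 p3 legendre_coeff_def q_def a_def by (simp add: mult_ac)
    finally show "2 powr (1 - 2 * l) * I n = 2 / sqrt pi * t * A powr (- (l + 1)) * (legendre_coeff l n * ((2 * x * y / A)\<^sup>2) ^ n)" .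
  qed
  finally show ?thesis unfolding A_def .
qed

section \<open>Two-sided bounds of the Poisson kernel\<close>

lemma legendre_coeff_pos: "l > -1/2 \<Longrightarrow> 0 < legendre_coeff l n"
  unfolding legendre_coeff_def by (intro divide_pos_pos mult_pos_pos Gamma_real_pos rGamma_real_pos) auto

text \<open>
  The duplication formula turns the coefficient into a quotient of four Pochhammer symbols. They are
  the numerators of Euler's products for $1/\Gamma$; the normalising factors $n! n^z$ cancel since
  $u + (u + 1/2) = a + 1$.
\<close>

lemma legendre_coeff_Suc_rGamma_series:
  assumes l: "l > -1/2" and "0 < n"
  defines "u \<equiv> (l + 1) / 2" and "a \<equiv> l + 1/2"
  shows "legendre_coeff l (Suc n) = Gamma (l + 1) * rGamma a *
     (rGamma_series u n * rGamma_series (u + 1/2) n / (rGamma_series a n * rGamma_series 1 n))"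
proof -
  have a: "0 < a" using l by (simp add: a_def)
  have nza: "a \<notin> \<int>\<^sub>\<le>\<^sub>0" "l + 1 \<notin> \<int>\<^sub>\<le>\<^sub>0" using a l by (auto elim!: nonpos_Ints_cases)
  have "Gamma (2 * real (Suc n) + l + 1) = pochhammer (l + 1) (2 * Suc n) * Gamma (l + 1)"
  proof -
    have nz: "Gamma (l + 1) \<noteq> 0" using Gamma_real_pos[of "l + 1"] l by linarith
    have "2 * real (Suc n) + l + 1 = l + 1 + real (2 * Suc n)" by simp
    then show ?thesis unfolding pochhammer_Gamma[OF nza(2)]
      by (simp only: times_divide_eq_left nonzero_mult_div_cancel_right[OF nz])
  qed
  also have "pochhammer (l + 1) (2 * Suc n) = 2 ^ (2 * Suc n) * pochhammer u (Suc n) * pochhammer (u + 1/2) (Suc n)"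
  proof -
    have "2 * u = l + 1" by (simp add: u_def)
    from pochhammer_double[of u "Suc n", unfolded this] show ?thesis
      by (simp only: of_nat_power of_nat_numeral)
  qed
  also have "(2::real) ^ (2 * Suc n) = 4 ^ Suc n" by (simp add: power_mult)
  finally have 1: "Gamma (2 * real (Suc n) + l + 1) = 4 ^ Suc n * pochhammer u (Suc n) * pochhammer (u + 1/2) (Suc n) * Gamma (l + 1)" .
  have pa: "0 < pochhammer a (Suc n)" using a by (rule pochhammer_pos)
  have 2: "rGamma (real (Suc n) + a) = rGamma a / pochhammer a (Suc n)"
    using pochhammer_rGamma[of a "Suc n"] pa by (simp add: add_ac field_simps)
  have 3: "fact (Suc n) = pochhammer (1::real) (Suc n)" by (rule pochhammer_fact)
  define N where "N = ln (real n)"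
  \<comment> \<open>The powers n^z in the four products cancel because the exponents have equal sums.\<close>
  have e: "exp (u * N) * exp ((u + 1/2) * N) = exp (a * N) * exp (1 * N)"
    unfolding exp_add[symmetric] by (simp add: u_def a_def algebra_simps add_divide_distrib)
  have e0: "exp (u * N) \<noteq> 0" "exp ((u + 1/2) * N) \<noteq> 0" "exp (a * N) \<noteq> 0" "exp (1 * N) \<noteq> 0" by auto
  have ge: "P1 * P2 / (Pa * Q) = (P1 / (f * E1)) * (P2 / (f * E2)) / ((Pa / (f * E3)) * (Q / (f * E4)))"
    if "E1 * E2 = E3 * E4" "E1 \<noteq> 0" "E2 \<noteq> 0" "E3 \<noteq> 0" "E4 \<noteq> 0" "f \<noteq> 0" for P1 P2 Pa Q f E1 E2 E3 E4 :: real
  proof -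
    have m1: "(P1 / (f * E1)) * (P2 / (f * E2)) = P1 * P2 / (f * f * (E3 * E4))"
      unfolding that(1)[symmetric] by (simp add: mult_ac)
    have m2: "(Pa / (f * E3)) * (Q / (f * E4)) = Pa * Q / (f * f * (E3 * E4))"
      by (simp add: mult_ac)
    have "f * f * (E3 * E4) \<noteq> 0" using that by simp
    then show ?thesis unfolding m1 m2 by simp
  qed
  have "legendre_coeff l (Suc n) = Gamma (l + 1) * rGamma a *
     (pochhammer u (Suc n) * pochhammer (u + 1/2) (Suc n) / (pochhammer a (Suc n) * pochhammer 1 (Suc n)))"
    unfolding legendre_coeff_def a_def[symmetric] 1 2 3 by simp
  also have "pochhammer u (Suc n) * pochhammer (u + 1/2) (Suc n) / (pochhammer a (Suc n) * pochhammer 1 (Suc n))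
      = rGamma_series u n * rGamma_series (u + 1/2) n / (rGamma_series a n * rGamma_series 1 n)"
    unfolding rGamma_series_def real_scaleR_def scaleR_conv_of_real
    using ge[OF e e0, of "fact n"] by (simp add: N_def)
  finally show ?thesis .
qed

text \<open>
  A positive sequence with a positive limit is bounded above and away from 0.
\<close>

lemma legendre_coeff_bounds:
  assumes l: "l > -1/2"
  obtains c C where "0 < c" "0 < C" "\<And>n. c \<le> legendre_coeff l n" "\<And>n. legendre_coeff l n \<le> C"
proof -
  define u where "u = (l + 1) / 2"
  define a where "a = l + 1/2"
  have pos: "0 < a" "0 < u" "0 < l + 1" using l by (auto simp: u_def a_def)
  define L where "L = Gamma (l + 1) * rGamma a * (rGamma u * rGamma (u + 1/2) / (rGamma a * rGamma 1))"
  have L: "0 < L" unfolding L_def using pos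
    by (intro mult_pos_pos divide_pos_pos Gamma_real_pos rGamma_real_pos) auto
  have "(\<lambda>n. Gamma (l + 1) * rGamma a *
     (rGamma_series u n * rGamma_series (u + 1/2) n / (rGamma_series a n * rGamma_series 1 n))) \<longlonglongrightarrow> L"
    unfolding L_def using rGamma_real_pos[OF pos(1)]
    by (intro tendsto_intros) auto
  then have "(\<lambda>n. legendre_coeff l (Suc n)) \<longlonglongrightarrow> L"
  proof (rule Lim_transform_eventually)
    show "\<forall>\<^sub>F n in sequentially. Gamma (l + 1) * rGamma a *
     (rGamma_series u n * rGamma_series (u + 1/2) n / (rGamma_series a n * rGamma_series 1 n)) = legendre_coeff l (Suc n)"
      using eventually_gt_at_top[of "0::nat"]
      by eventually_elim (simp add: legendre_coeff_Suc_rGamma_series[OF l] u_def a_def)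
  qed
  then have lim: "legendre_coeff l \<longlonglongrightarrow> L" by (simp add: filterlim_sequentially_Suc)
  from Bseq_conv_Bfun convergentI[OF lim] have "Bseq (legendre_coeff l)" by (auto intro: convergent_imp_Bseq)
  then obtain C where C: "0 < C" "\<And>n. norm (legendre_coeff l n) \<le> C" by (auto elim: BseqE)
  have "(\<lambda>n. inverse (legendre_coeff l n)) \<longlonglongrightarrow> inverse L" using L by (intro tendsto_inverse lim) simp
  then have "Bseq (\<lambda>n. inverse (legendre_coeff l n))" by (auto intro: convergent_imp_Bseq convergentI)
  then obtain D where D: "0 < D" "\<And>n. norm (inverse (legendre_coeff l n)) \<le> D" by (auto elim: BseqE)
  show ?thesis
  proof (rule that[of "inverse D" C])
    fix n
    show "inverse D \<le> legendre_coeff l n"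
      using le_imp_inverse_le[of "inverse (legendre_coeff l n)" D] D(2)[of n] legendre_coeff_pos[OF l, of n]
      by simp
    show "legendre_coeff l n \<le> C" using C(2)[of n] by simp
  qed (use C D in auto)
qed

text \<open>
  Comparable with the Poisson kernel, by the lemma poisson_kernel_bounds.
\<close>

definition poisson_model :: "real \<Rightarrow> real \<Rightarrow> real \<Rightarrow> real \<Rightarrow> real" where
  "poisson_model l t x y = t * sqsum t x y powr (- l) / (t\<^sup>2 + (x - y)\<^sup>2)"

lemma aperture_bounds:
  assumes "0 < t" "0 < x" "0 < y"
  shows "0 < 2 * x * y / sqsum t x y" "2 * x * y / sqsum t x y < 1"
    "1 - 2 * x * y / sqsum t x y = (t\<^sup>2 + (x - y)\<^sup>2) / sqsum t x y"
proof -
  have A: "0 < sqsum t x y" using assms by (intro sqsum_pos)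
  show "0 < 2 * x * y / sqsum t x y" using assms A by simp
  show e: "1 - 2 * x * y / sqsum t x y = (t\<^sup>2 + (x - y)\<^sup>2) / sqsum t x y"
    unfolding sqsum_minus[symmetric] using A by (simp add: diff_divide_distrib)
  have "0 < (t\<^sup>2 + (x - y)\<^sup>2) / sqsum t x y" using assms A by (simp add: add_pos_nonneg)
  with e show "2 * x * y / sqsum t x y < 1" by simp
qed

text \<open>
  The coefficients lie between two positive constants, so the series is comparable with $1/(1 -
  q^2)$, and $1 - q \le 1 - q^2 \le 2 (1 - q)$.
\<close>

lemma poisson_kernel_bounds:
  assumes l: "l > -1/2"
  obtains c C where "0 < c" "0 < C"
    "\<And>t x y. 0 < t \<Longrightarrow> 0 < x \<Longrightarrow> 0 < y \<Longrightarrow> c * poisson_model l t x y \<le> poisson_kernel l t x y"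
    "\<And>t x y. 0 < t \<Longrightarrow> 0 < x \<Longrightarrow> 0 < y \<Longrightarrow> poisson_kernel l t x y \<le> C * poisson_model l t x y"
proof -
  obtain c C where cC: "0 < c" "0 < C" "\<And>n. c \<le> legendre_coeff l n" "\<And>n. legendre_coeff l n \<le> C"
    using legendre_coeff_bounds[OF l] by blast
  have main: "2 / sqrt pi * c * (1/2) * poisson_model l t x y \<le> poisson_kernel l t x y \<and>
      poisson_kernel l t x y \<le> 2 / sqrt pi * C * poisson_model l t x y"
    if txy: "0 < t" "0 < x" "0 < y" for t x y
  proof -
    define A where "A = sqsum t x y"
    define q where "q = 2 * x * y / A"
    define T where "T = 2 / sqrt pi * t * A powr (- (l + 1))"
    have A: "0 < A" unfolding A_def using txy by (intro sqsum_pos)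
    have q: "0 < q" "q < 1" "1 - q = (t\<^sup>2 + (x - y)\<^sup>2) / A"
      using aperture_bounds[OF txy] by (auto simp: q_def A_def)
    have q2: "norm (q\<^sup>2) < 1" using q by (simp add: power_less_one_iff abs_square_less_1)
    have T: "0 < T" unfolding T_def using txy A by simp
    have s: "(\<lambda>n. T * (legendre_coeff l n * (q\<^sup>2) ^ n)) sums poisson_kernel l t x y"
      using poisson_kernel_sums[OF l txy] unfolding T_def q_def A_def .
    have g: "(\<lambda>n. T * (d * (q\<^sup>2) ^ n)) sums (T * (d * (1 / (1 - q\<^sup>2))))" for d
      by (intro sums_mult geometric_sums q2)
    have lo: "T * (c * (1 / (1 - q\<^sup>2))) \<le> poisson_kernel l t x y"
      by (rule sums_le[OF _ g s]) (use T cC in \<open>auto intro!: mult_left_mono mult_right_mono\<close>)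
    have up: "poisson_kernel l t x y \<le> T * (C * (1 / (1 - q\<^sup>2)))"
      by (rule sums_le[OF _ s g]) (use T cC in \<open>auto intro!: mult_left_mono mult_right_mono\<close>)
    have qq: "1 - q\<^sup>2 = (1 - q) * (1 + q)" by (simp add: power2_eq_square algebra_simps)
    define D where "D = t\<^sup>2 + (x - y)\<^sup>2"
    have D: "0 < D" unfolding D_def using txy by (simp add: add_pos_nonneg)
    have K: "T / (1 - q) = 2 / sqrt pi * poisson_model l t x y"
    proof -
      have "A powr (- (l + 1)) * A = A powr (- l)"
        using A powr_add[of A "- (l + 1)" 1] by simp
      moreover have "T / (1 - q) = 2 / sqrt pi * (t * (A powr (- (l + 1)) * A) / D)"
        unfolding T_def q(3) D_def[symmetric] by simp
      ultimately show ?thesis unfolding poisson_model_def A_def[symmetric] D_def[symmetric] by simp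
    qed
    have d1: "1 / (1 - q\<^sup>2) \<le> 1 / (1 - q)" using q(1,2) unfolding qq by (intro divide_left_mono) (auto intro!: mult_pos_pos)
    have d2: "1 / 2 * (1 / (1 - q)) \<le> 1 / (1 - q\<^sup>2)"
    proof -
      have "1 / 2 * (1 / (1 - q)) \<le> 1 / (1 + q) * (1 / (1 - q))"
        using q(1,2) by (intro mult_right_mono) (auto simp: field_simps)
      then show ?thesis unfolding qq by (simp add: mult.commute)
    qed
    have "2 / sqrt pi * c * (1/2) * poisson_model l t x y = T * (c * (1/2 * (1 / (1 - q))))"
    proof -
      have "T * (c * (1/2 * (1 / (1 - q)))) = (T / (1 - q)) * c * (1/2)" by simp
      then show ?thesis unfolding K by simp
    qed
    also have "\<dots> \<le> T * (c * (1 / (1 - q\<^sup>2)))" using T cC d2 by (intro mult_left_mono) auto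
    also note lo
    finally have 1: "2 / sqrt pi * c * (1/2) * poisson_model l t x y \<le> poisson_kernel l t x y" .
    note up
    also have "T * (C * (1 / (1 - q\<^sup>2))) \<le> T * (C * (1 / (1 - q)))" using T cC d1 by (intro mult_left_mono) auto
    also have "\<dots> = 2 / sqrt pi * C * poisson_model l t x y"
    proof -
      have "T * (C * (1 / (1 - q))) = (T / (1 - q)) * C" by simp
      then show ?thesis unfolding K by simp
    qed
    finally show ?thesis using 1 by blast
  qed
  show ?thesis
    by (rule that[of "2 / sqrt pi * c * (1/2)" "2 / sqrt pi * C"]) (use main cC in auto)
qed

text \<open>
  The sum is a power series inside its disc of convergence. Continuity supplies the measurability of
  the kernel and, later, the semicontinuity of the maximal function.
\<close>

lemma continuous_on_poisson_kernel:
  assumes l: "l > -1/2"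
  shows "continuous_on {(t, x, y). 0 < t \<and> 0 < x \<and> 0 < y} (\<lambda>(t, x, y). poisson_kernel l t x y)"
proof -
  let ?S = "{(t, x, y). 0 < t \<and> 0 < x \<and> 0 < (y::real)} :: (real \<times> real \<times> real) set"
  obtain C where C: "0 < C" "\<And>n. legendre_coeff l n \<le> C" using legendre_coeff_bounds[OF l] by blast
  have sm: "summable (\<lambda>n. legendre_coeff l n * s ^ n)" if "\<bar>s\<bar> < 1" for s
  proof (rule summable_comparison_test')
    show "summable (\<lambda>n. C * \<bar>s\<bar> ^ n)" using that by (intro summable_mult summable_geometric) auto
    show "norm (legendre_coeff l n * s ^ n) \<le> C * \<bar>s\<bar> ^ n" for n
      using C(2)[of n] legendre_coeff_pos[OF l, of n] by (auto simp: abs_mult power_abs intro!: mult_right_mono)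
  qed
  have F: "isCont (\<lambda>s. \<Sum>n. legendre_coeff l n * s ^ n) s" if s1: "\<bar>s\<bar> < 1" for s
  proof -
    obtain r where "\<bar>s\<bar> < r" "r < 1" using dense[of "\<bar>s\<bar>" 1] s1 by blast
    then show ?thesis by (intro isCont_powser[of _ r] sm) auto
  qed
  then have F': "continuous_on {-1<..<1} (\<lambda>s. \<Sum>n. legendre_coeff l n * s ^ n)"
    by (intro continuous_at_imp_continuous_on) auto
  have A: "continuous_on ?S (\<lambda>p. sqsum (fst p) (fst (snd p)) (snd (snd p)))"
    unfolding sqsum_def by (intro continuous_intros)
  have "continuous_on ?S (\<lambda>p. 2 / sqrt pi * fst p * sqsum (fst p) (fst (snd p)) (snd (snd p)) powr (- (l + 1)) *
     (\<Sum>n. legendre_coeff l n * ((2 * fst (snd p) * snd (snd p) / sqsum (fst p) (fst (snd p)) (snd (snd p)))\<^sup>2) ^ n))"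
  proof (intro continuous_on_mult continuous_on_powr A continuous_on_compose2[OF F'])
    show "\<forall>x\<in>?S. sqsum (fst x) (fst (snd x)) (snd (snd x)) \<noteq> 0"
      using sqsum_pos by (fastforce simp: less_le)
    show "continuous_on ?S (\<lambda>p. (2 * fst (snd p) * snd (snd p) / sqsum (fst p) (fst (snd p)) (snd (snd p)))\<^sup>2)"
      by (intro continuous_intros A) (use sqsum_pos in \<open>fastforce simp: less_le\<close>)
    show "(\<lambda>p. (2 * fst (snd p) * snd (snd p) / sqsum (fst p) (fst (snd p)) (snd (snd p)))\<^sup>2) ` ?S \<subseteq> {-1<..<1}"
    proof clarsimp
      fix t x y :: real assume "0 < t" "0 < x" "0 < y"
      from aperture_bounds[OF this] have "0 < 2 * x * y / sqsum t x y" "2 * x * y / sqsum t x y < 1" by auto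
      then have "(2 * x * y / sqsum t x y)\<^sup>2 < 1" by (simp add: abs_square_less_1)
      moreover have "0 \<le> (2 * x * y / sqsum t x y)\<^sup>2" by simp
      ultimately show "- 1 < (2 * x * y / sqsum t x y)\<^sup>2 \<and> (2 * x * y / sqsum t x y)\<^sup>2 < 1" by linarith
    qed
  qed (auto intro!: continuous_intros)
  then show ?thesis
  proof (rule continuous_on_eq)
    fix p assume p: "p \<in> ?S"
    then obtain t x y where [simp]: "p = (t, x, y)" and txy: "0 < t" "0 < x" "0 < y" by auto
    define A where "A = sqsum t x y"
    define q where "q = 2 * x * y / A"
    have q: "0 < q" "q < 1" using aperture_bounds[OF txy] by (auto simp: q_def A_def)
    have "\<bar>q\<^sup>2\<bar> < 1" using q by (simp add: abs_square_less_1)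
    from suminf_mult[OF sm[OF this], of "2 / sqrt pi * t * A powr (- (l + 1))"]
    show "2 / sqrt pi * fst p * sqsum (fst p) (fst (snd p)) (snd (snd p)) powr (- (l + 1)) *
     (\<Sum>n. legendre_coeff l n * ((2 * fst (snd p) * snd (snd p) / sqsum (fst p) (fst (snd p)) (snd (snd p)))\<^sup>2) ^ n)
     = (case p of (t, x, y) \<Rightarrow> poisson_kernel l t x y)"
      using poisson_kernel_sums[OF l txy] by (simp add: sums_iff q_def A_def)
  qed
qed

section \<open>Power weights and the Schur test\<close>

lemma ennreal_powr_ennreal [simp]: "0 \<le> r \<Longrightarrow> ennreal_powr (ennreal r) p = ennreal (r powr p)"
  by (simp add: ennreal_powr_def)

lemma ennreal_powr_top [simp]: "ennreal_powr top p = top"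
  by (simp add: ennreal_powr_def)

lemma ennreal_powr_0 [simp]: "ennreal_powr 0 p = 0"
  by (simp add: ennreal_powr_def)

lemma ennreal_powr_mono: "a \<le> b \<Longrightarrow> 0 \<le> p \<Longrightarrow> ennreal_powr a p \<le> ennreal_powr b p"
  by (cases a; cases b) (auto intro!: ennreal_leI powr_mono2 simp: top_unique)

lemma ennreal_powr_mult: "ennreal_powr (a * b) p = ennreal_powr a p * ennreal_powr b p"
  by (cases a; cases b)
     (auto simp: ennreal_mult[symmetric] powr_mult ennreal_top_mult ennreal_mult_top ennreal_mult_eq_top_iff)

lemma ennreal_powr_inverse: "0 < p \<Longrightarrow> ennreal_powr (ennreal_powr a (1 / p)) p = a"
  by (cases a) (auto simp: powr_powr)

lemma ennreal_powr_one [simp]: "ennreal_powr a 1 = a"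
  by (cases a) auto

lemma ennreal_powr_measurable [measurable (raw)]:
  assumes [measurable]: "g \<in> borel_measurable M"
  shows "(\<lambda>x. ennreal_powr (g x) p) \<in> borel_measurable M"
  unfolding ennreal_powr_def by measurable

lemma ennreal_powr_add3:
  assumes "0 \<le> p"
  shows "ennreal_powr (a + b + c) p \<le> ennreal (3 powr p) * (ennreal_powr a p + ennreal_powr b p + ennreal_powr c p)"
proof -
  define m where "m = max a (max b c)"
  have "a + b + c \<le> m + m + m" by (intro add_mono) (auto simp: m_def le_max_iff_disj)
  also have "\<dots> = ennreal 3 * m"
  proof -
    have "ennreal 3 = 1 + 1 + 1" by simp
    then show ?thesis by (simp only: distrib_right mult_1_left)
  qed
  finally have "ennreal_powr (a + b + c) p \<le> ennreal_powr (ennreal 3 * m) p"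
    using assms by (rule ennreal_powr_mono)
  also have "\<dots> = ennreal (3 powr p) * ennreal_powr m p"
    unfolding ennreal_powr_mult by (subst ennreal_powr_ennreal) auto
  also have "ennreal_powr m p \<le> ennreal_powr a p + ennreal_powr b p + ennreal_powr c p"
    unfolding m_def max_def by (auto intro: add_increasing add_increasing2)
  finally show ?thesis by (simp add: mult_left_mono)
qed

lemma sets_power_measure [simp, measurable_cong]: "sets (power_measure d) = sets LP"
  by (simp add: power_measure_def)

lemma space_power_measure [simp]: "space (power_measure d) = {0<..}"
  by (simp add: power_measure_def)

lemma borel_measurable_power_measure [simp]: "borel_measurable (power_measure d) = borel_measurable LP"
  by (intro measurable_cong_sets) auto

lemma nn_integral_power_measure:
  "f \<in> borel_measurable LP \<Longrightarrow> (\<integral>\<^sup>+x. f x \<partial>power_measure d) = (\<integral>\<^sup>+x. ennreal (x powr d) * f x \<partial>LP)"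
  unfolding power_measure_def by (rule nn_integral_density) (rule borel_LP, measurable)

lemma AE_power_measure: "(AE x in power_measure d. P x) \<longleftrightarrow> (AE x in LP. P x)"
proof -
  have "(AE x in power_measure d. P x) \<longleftrightarrow> (AE x in LP. 0 < ennreal (x powr d) \<longrightarrow> P x)"
    unfolding power_measure_def by (intro AE_density borel_LP) auto
  also have "\<dots> \<longleftrightarrow> (AE x in LP. P x)" by (intro AE_cong) auto
  finally show ?thesis .
qed

abbreviation weighted_integral :: "real \<Rightarrow> real \<Rightarrow> (real \<Rightarrow> ennreal) \<Rightarrow> ennreal" where
  "weighted_integral d p F \<equiv> \<integral>\<^sup>+x. ennreal (x powr d) * ennreal_powr (F x) p \<partial>LP"

lemma nn_integral_LP:
  "(\<integral>\<^sup>+x. f x \<partial>LP) = (\<integral>\<^sup>+x. f x * indicator {0<..} x \<partial>lborel)"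
  by (simp add: nn_integral_restrict_space nn_integral_completion)

lemma measurable_LP_id: "(\<lambda>x. x) \<in> measurable LP borel"
  by (intro borel_LP) simp

lemma measurable_LP_pair:
  assumes "f \<in> borel_measurable (borel \<Otimes>\<^sub>M borel)"
  shows "f \<in> borel_measurable (LP \<Otimes>\<^sub>M LP)"
proof -
  have "(\<lambda>x. (fst x, snd x)) \<in> measurable (LP \<Otimes>\<^sub>M LP) (borel \<Otimes>\<^sub>M borel)"
    by (intro measurable_Pair measurable_compose[OF measurable_fst measurable_LP_id] measurable_compose[OF measurable_snd measurable_LP_id])
  from measurable_compose[OF this assms] show ?thesis by simp
qed

lemma emeasure_power_measure:
  assumes "A \<in> sets LP"
  shows "emeasure (power_measure d) A = (\<integral>\<^sup>+x. ennreal (x powr d) * indicator A x \<partial>LP)"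
  unfolding power_measure_def using assms by (intro emeasure_density borel_LP) auto

lemma borel_set_LP: "A \<in> sets borel \<Longrightarrow> A \<subseteq> {0<..} \<Longrightarrow> A \<in> sets LP"
  by (subst sets_restrict_space_iff) (auto intro: sets_completionI_sets)

lemma nn_integral_powr_lessThan:
  fixes c r :: real
  assumes "0 < c" "0 \<le> r"
  shows "(\<integral>\<^sup>+x. ennreal (x powr (c - 1)) * indicator {..<r} x \<partial>LP) = ennreal (r powr c / c)"
proof (cases "r = 0")
  case True
  have "(\<integral>\<^sup>+x. ennreal (x powr (c - 1)) * indicator {..<r} x \<partial>LP) = (\<integral>\<^sup>+x. 0 \<partial>LP)"
    by (intro nn_integral_cong) (auto simp: True indicator_def)
  then show ?thesis by (simp add: True)
next
  case False
  then have r: "0 < r" using assms by simp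
  have lim0: "((\<lambda>x. x powr c / c) \<longlongrightarrow> 0) (at_right 0)"
  proof -
    have "((\<lambda>x. x powr c / c) \<longlongrightarrow> 0 / c) (at_right 0)"
      using assms by (intro tendsto_divide tendsto_const tendsto_zero_powrI[where b=c])
         (auto intro: tendsto_ident_at simp: eventually_at_filter)
    then show ?thesis by simp
  qed
  have limr: "((\<lambda>x. x powr c / c) \<longlongrightarrow> r powr c / c) (at_left r)"
    using r assms by (intro tendsto_intros) auto
  have *: "set_integrable lborel (einterval 0 r) (\<lambda>x. x powr (c - 1))"
     "(LBINT x=0..r. x powr (c - 1)) = r powr c / c - 0"
    using lim0 limr r assms
    by (intro interval_integral_FTC_nonneg[of 0 r "\<lambda>x. x powr c / c"];
        auto simp: zero_ereal_def ereal_tendsto_simps intro!: derivative_eq_intros continuous_intros; fail)+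
  have e: "einterval 0 r = {0<..<r}" using r by (auto simp: einterval_def zero_ereal_def)
  have "(\<integral>\<^sup>+x. ennreal (x powr (c - 1)) * indicator {..<r} x \<partial>LP)
     = (\<integral>\<^sup>+x. ennreal (indicator {0<..<r} x *\<^sub>R x powr (c - 1)) \<partial>lborel)"
    unfolding nn_integral_LP by (intro nn_integral_cong) (auto simp: indicator_def)
  also have "\<dots> = ennreal (\<integral>x. indicator {0<..<r} x *\<^sub>R x powr (c - 1) \<partial>lborel)"
    using *(1) unfolding e set_integrable_def by (intro nn_integral_eq_integral) auto
  also have "(\<integral>x. indicator {0<..<r} x *\<^sub>R x powr (c - 1) \<partial>lborel) = r powr c / c"
    using *(2) r e by (simp add: interval_lebesgue_integral_def set_lebesgue_integral_def zero_ereal_def)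
  finally show ?thesis .
qed

lemma nn_integral_powr_greaterThan:
  fixes c r :: real
  assumes "0 < c" "0 < r"
  shows "(\<integral>\<^sup>+x. ennreal (x powr (- c - 1)) * indicator {r<..} x \<partial>LP) = ennreal (r powr (- c) / c)"
proof -
  have lim: "((\<lambda>x. - (x powr (- c) / c)) \<longlongrightarrow> 0) at_top"
  proof -
    have "((\<lambda>x. - (x powr (- c) / c)) \<longlongrightarrow> - (0 / c)) at_top"
      using assms by (intro tendsto_minus tendsto_divide tendsto_const tendsto_neg_powr filterlim_ident) auto
    then show ?thesis by simp
  qed
  have limr: "((\<lambda>x. - (x powr (- c) / c)) \<longlongrightarrow> - (r powr (- c) / c)) (at_right r)"
    using assms by (intro tendsto_intros) auto
  have *: "set_integrable lborel (einterval r \<infinity>) (\<lambda>x. x powr (- c - 1))"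
     "(LBINT x=r..\<infinity>. x powr (- c - 1)) = 0 - (- (r powr (- c) / c))"
    using lim limr assms
    by (intro interval_integral_FTC_nonneg[of r \<infinity> "\<lambda>x. - (x powr (- c) / c)"];
        auto simp: ereal_tendsto_simps intro!: derivative_eq_intros continuous_intros; fail)+
  have e: "einterval r \<infinity> = {r<..}" by (auto simp: einterval_def)
  have "(\<integral>\<^sup>+x. ennreal (x powr (- c - 1)) * indicator {r<..} x \<partial>LP)
     = (\<integral>\<^sup>+x. ennreal (indicator {r<..} x *\<^sub>R x powr (- c - 1)) \<partial>lborel)"
    unfolding nn_integral_LP using assms by (intro nn_integral_cong) (auto simp: indicator_def)
  also have "\<dots> = ennreal (\<integral>x. indicator {r<..} x *\<^sub>R x powr (- c - 1) \<partial>lborel)"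
    using *(1) unfolding e set_integrable_def by (intro nn_integral_eq_integral) auto
  also have "(\<integral>x. indicator {r<..} x *\<^sub>R x powr (- c - 1) \<partial>lborel) = r powr (- c) / c"
    using *(2) e by (simp add: interval_lebesgue_integral_def set_lebesgue_integral_def)
  finally show ?thesis .
qed

text \<open>
  The graph of $u^p$ lies above its tangent at $a$; this is Young's inequality for $u/a$ and 1.
\<close>

lemma powr_tangent_line:
  fixes a u p :: real
  assumes "1 \<le> p" "0 < a" "0 \<le> u"
  shows "p * a powr (p - 1) * u \<le> u powr p + (p - 1) * a powr p"
proof (cases "u = 0")
  case False
  define v where "v = u / a"
  have v: "0 < v" "u = a * v" using assms False by (auto simp: v_def)
  have "v * 1 \<le> 1 / p * v powr p + (1 - 1 / p) * 1"
  proof -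
    have "(v powr p) powr (1 / p) * 1 powr (1 - 1 / p) \<le> 1 / p * v powr p + (1 - 1 / p) * 1"
      using assms v by (intro Youngs_inequality_0) auto
    then show ?thesis using assms v by (simp add: powr_powr)
  qed
  then have "p * (v * 1) \<le> p * (1 / p * v powr p + (1 - 1 / p) * 1)" using assms by (intro mult_left_mono) auto
  moreover have "p * (1 / p * v powr p + (1 - 1 / p) * 1) = v powr p + (p - 1)"
    using assms by (simp add: distrib_left right_diff_distrib)
  ultimately have "p * v \<le> v powr p + (p - 1)" by simp
  then have "a powr p * (p * v) \<le> a powr p * (v powr p + (p - 1))" by (intro mult_left_mono) auto
  moreover have "a powr p * (p * v) = p * a powr (p - 1) * u"
    using assms by (simp add: v powr_diff)
  moreover have "a powr p * (v powr p + (p - 1)) = u powr p + (p - 1) * a powr p"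
    using assms v by (simp add: powr_mult algebra_simps)
  ultimately show ?thesis by simp
qed (use assms in simp)

text \<open>
  Jensen's inequality for the finite measure with density $m$: integrate the tangent line of $u^p$
  at the mean value of $h$.
\<close>

lemma nn_integral_Jensen_powr:
  fixes h m :: "'a \<Rightarrow> ennreal" and p B :: real
  assumes [measurable]: "h \<in> borel_measurable M" "m \<in> borel_measurable M"
    and p: "1 \<le> p" and B: "0 < B" and mB: "(\<integral>\<^sup>+x. m x \<partial>M) = ennreal B"
  shows "ennreal_powr (\<integral>\<^sup>+x. h x * m x \<partial>M) p \<le> ennreal (B powr (p - 1)) * (\<integral>\<^sup>+x. ennreal_powr (h x) p * m x \<partial>M)"
proof (cases "\<integral>\<^sup>+x. h x * m x \<partial>M")
  \<comment> \<open>An infinite mean is possible only if the right-hand side is infinite, because of u <= 1 + u^p.\<close>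
  case top
  have "h x \<le> 1 + ennreal_powr (h x) p" for x
  proof (cases "h x")
    case (real r)
    have "r \<le> 1 + r powr p"
    proof (cases "r \<le> 1")
      case False
      then have "r powr 1 \<le> r powr p" using p by (intro powr_mono) auto
      then show ?thesis using False by simp
    qed (simp add: add_increasing2)
    then have "ennreal r \<le> ennreal (1 + r powr p)" by (rule ennreal_leI)
    then show ?thesis using real by simp
  qed simp
  then have "(\<integral>\<^sup>+x. h x * m x \<partial>M) \<le> (\<integral>\<^sup>+x. m x + ennreal_powr (h x) p * m x \<partial>M)"
    by (intro nn_integral_mono order_trans[OF mult_right_mono[of "h _" "1 + ennreal_powr (h _) p"]])
       (auto simp: distrib_right)
  also have "\<dots> = ennreal B + (\<integral>\<^sup>+x. ennreal_powr (h x) p * m x \<partial>M)"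
    by (subst nn_integral_add) (auto simp: mB)
  finally have "(\<integral>\<^sup>+x. ennreal_powr (h x) p * m x \<partial>M) = top"
    using top by (simp add: top_unique ennreal_add_eq_top)
  then show ?thesis using B by (simp add: ennreal_mult_top)
next
  case (real I)
  show ?thesis
  proof (cases "I = 0")
    case False
    then have I: "0 < I" using real by simp
    define a where "a = I / B"
    have a: "0 < a" "I = a * B" using I B by (auto simp: a_def)
    have pt: "ennreal (p * a powr (p - 1)) * (h x * m x) \<le> ennreal_powr (h x) p * m x + ennreal ((p - 1) * a powr p) * m x" for x
    proof -
      have "ennreal (p * a powr (p - 1)) * h x \<le> ennreal_powr (h x) p + ennreal ((p - 1) * a powr p)"
      proof (cases "h x")
        case (real r)
        then show ?thesis using powr_tangent_line[OF p a(1), of r] p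
          by (simp add: ennreal_mult[symmetric] ennreal_plus[symmetric] del: ennreal_plus)
      qed simp
      from mult_right_mono[OF this, of "m x"] show ?thesis by (simp add: distrib_right mult.assoc)
    qed
    have "ennreal (p * a powr (p - 1)) * ennreal I = (\<integral>\<^sup>+x. ennreal (p * a powr (p - 1)) * (h x * m x) \<partial>M)"
      by (subst nn_integral_cmult) (auto simp: real)
    also have "\<dots> \<le> (\<integral>\<^sup>+x. ennreal_powr (h x) p * m x + ennreal ((p - 1) * a powr p) * m x \<partial>M)"
      by (intro nn_integral_mono pt)
    also have "\<dots> = (\<integral>\<^sup>+x. ennreal_powr (h x) p * m x \<partial>M) + ennreal ((p - 1) * a powr p) * ennreal B"
      by (subst nn_integral_add) (auto simp: nn_integral_cmult mB)
    finally have le: "ennreal (p * a powr (p - 1)) * ennreal I \<le> (\<integral>\<^sup>+x. ennreal_powr (h x) p * m x \<partial>M) + ennreal ((p - 1) * a powr p) * ennreal B" .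
    show ?thesis
    proof (cases "\<integral>\<^sup>+x. ennreal_powr (h x) p * m x \<partial>M")
      case top then show ?thesis using B by (simp add: ennreal_mult_top)
    next
      case (real J)
      have "p * a powr (p - 1) * I \<le> J + (p - 1) * a powr p * B"
        using le real p B I by (simp add: ennreal_mult[symmetric] ennreal_plus[symmetric] del: ennreal_plus)
      moreover have "a powr (p - 1) * I = a powr p * B"
        using a by (simp add: powr_diff)
      ultimately have "p * (a powr p * B) \<le> J + (p - 1) * (a powr p * B)"
        by (simp only: mult.assoc)
      then have "a powr p * B \<le> J" by (simp add: left_diff_distrib)
      then have "B powr (p - 1) * (a powr p * B) \<le> B powr (p - 1) * J" by (intro mult_left_mono) auto
      moreover have "B powr (p - 1) * (a powr p * B) = I powr p"
        using a B by (simp add: powr_mult powr_diff)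
      ultimately show ?thesis using real \<open>(\<integral>\<^sup>+x. h x * m x \<partial>M) = ennreal I\<close> I
        by (simp add: ennreal_mult[symmetric])
    qed
  qed (use real in simp)
qed

text \<open>
  The kernel is split as $h m$, where $m$ has the same mass $B$ in every row. Jensen's inequality
  for $m(x, \cdot)$ brings the power $p$ under the integral, and Fubini's theorem leaves the column
  integrals of $w h^p m$, which are controlled by assumption. The freedom in the choice of the
  splitting replaces the auxiliary test function.
\<close>

lemma Schur_test:
  fixes h m :: "real \<Rightarrow> real \<Rightarrow> real" and w :: "real \<Rightarrow> real" and F :: "real \<Rightarrow> ennreal"
  assumes [measurable]: "F \<in> borel_measurable LP"
    and hm: "(\<lambda>(x, y). h x y) \<in> borel_measurable (borel \<Otimes>\<^sub>M borel)" "(\<lambda>(x, y). m x y) \<in> borel_measurable (borel \<Otimes>\<^sub>M borel)"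
    and w: "w \<in> borel_measurable borel"
    and h0: "\<And>x y. 0 \<le> h x y"
    and p: "1 \<le> p" and B: "0 < B"
    and mB: "\<And>x. 0 < x \<Longrightarrow> (\<integral>\<^sup>+y. ennreal (m x y) \<partial>LP) = ennreal B"
    and wB: "\<And>y. 0 < y \<Longrightarrow> (\<integral>\<^sup>+x. ennreal (w x) * (ennreal (h x y powr p) * ennreal (m x y)) \<partial>LP) \<le> ennreal D * ennreal (w y)"
  shows "(\<integral>\<^sup>+x. ennreal (w x) * ennreal_powr (\<integral>\<^sup>+y. F y * ennreal (h x y) * ennreal (m x y) \<partial>LP) p \<partial>LP)
     \<le> ennreal (B powr (p - 1)) * ennreal D * (\<integral>\<^sup>+y. ennreal (w y) * ennreal_powr (F y) p \<partial>LP)"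
proof -
  have [measurable]: "w \<in> borel_measurable LP" using w by (rule borel_LP)
  have [measurable]: "(\<lambda>(x, y). h x y) \<in> borel_measurable (LP \<Otimes>\<^sub>M LP)" "(\<lambda>(x, y). m x y) \<in> borel_measurable (LP \<Otimes>\<^sub>M LP)"
    by (intro measurable_LP_pair hm)+
  have hx: "(\<lambda>y. h x y) \<in> borel_measurable LP" "(\<lambda>y. m x y) \<in> borel_measurable LP" for x
    using measurable_compose[OF measurable_Pair1' hm(1), of x] measurable_compose[OF measurable_Pair1' hm(2), of x]
    by (auto intro: borel_LP)
  have hy: "(\<lambda>x. h x y) \<in> borel_measurable LP" "(\<lambda>x. m x y) \<in> borel_measurable LP" for y
    using measurable_compose[OF measurable_Pair2' hm(1), of y] measurable_compose[OF measurable_Pair2' hm(2), of y]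
    by (auto intro: borel_LP)
  note [measurable] = hx hy
  let ?k = "\<lambda>x y. ennreal (w x) * (ennreal_powr (F y) p * (ennreal (h x y powr p) * ennreal (m x y)))"
  have J: "ennreal_powr (\<integral>\<^sup>+y. F y * ennreal (h x y) * ennreal (m x y) \<partial>LP) p \<le>
     ennreal (B powr (p - 1)) * (\<integral>\<^sup>+y. ennreal_powr (F y) p * (ennreal (h x y powr p) * ennreal (m x y)) \<partial>LP)" if "0 < x" for x
  proof -
    have "ennreal_powr (\<integral>\<^sup>+y. F y * ennreal (h x y) * ennreal (m x y) \<partial>LP) p \<le>
     ennreal (B powr (p - 1)) * (\<integral>\<^sup>+y. ennreal_powr (F y * ennreal (h x y)) p * ennreal (m x y) \<partial>LP)"
      by (intro nn_integral_Jensen_powr p B mB that) measurable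
    then show ?thesis using h0 by (simp add: ennreal_powr_mult mult.assoc)
  qed
  have "(\<integral>\<^sup>+x. ennreal (w x) * ennreal_powr (\<integral>\<^sup>+y. F y * ennreal (h x y) * ennreal (m x y) \<partial>LP) p \<partial>LP)
     \<le> (\<integral>\<^sup>+x. ennreal (B powr (p - 1)) * (\<integral>\<^sup>+y. ?k x y \<partial>LP) \<partial>LP)"
  proof (rule nn_integral_mono)
    fix x assume "x \<in> space LP"
    then have x: "0 < x" by simp
    have "(\<integral>\<^sup>+y. ?k x y \<partial>LP) = ennreal (w x) * (\<integral>\<^sup>+y. ennreal_powr (F y) p * (ennreal (h x y powr p) * ennreal (m x y)) \<partial>LP)"
      by (rule nn_integral_cmult) measurable
    then show "ennreal (w x) * ennreal_powr (\<integral>\<^sup>+y. F y * ennreal (h x y) * ennreal (m x y) \<partial>LP) p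
       \<le> ennreal (B powr (p - 1)) * (\<integral>\<^sup>+y. ?k x y \<partial>LP)"
      using mult_left_mono[OF J[OF x], of "ennreal (w x)"] by (simp add: mult_ac)
  qed
  also have "\<dots> = ennreal (B powr (p - 1)) * (\<integral>\<^sup>+x. (\<integral>\<^sup>+y. ?k x y \<partial>LP) \<partial>LP)"
    by (rule nn_integral_cmult) measurable
  also have "(\<integral>\<^sup>+x. (\<integral>\<^sup>+y. ?k x y \<partial>LP) \<partial>LP) = (\<integral>\<^sup>+y. (\<integral>\<^sup>+x. ?k x y \<partial>LP) \<partial>LP)"
    by (rule LP2.Fubini'[symmetric]) measurable
  also have "\<dots> \<le> (\<integral>\<^sup>+y. ennreal D * (ennreal (w y) * ennreal_powr (F y) p) \<partial>LP)"
  proof (rule nn_integral_mono)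
    fix y assume "y \<in> space LP"
    then have y: "0 < y" by simp
    have "(\<integral>\<^sup>+x. ?k x y \<partial>LP) = (\<integral>\<^sup>+x. ennreal_powr (F y) p * (ennreal (w x) * (ennreal (h x y powr p) * ennreal (m x y))) \<partial>LP)"
      by (simp add: mult_ac)
    also have "\<dots> = ennreal_powr (F y) p * (\<integral>\<^sup>+x. ennreal (w x) * (ennreal (h x y powr p) * ennreal (m x y)) \<partial>LP)"
      by (rule nn_integral_cmult) measurable
    also have "\<dots> \<le> ennreal_powr (F y) p * (ennreal D * ennreal (w y))"
      by (intro mult_left_mono wB y) simp
    finally show "(\<integral>\<^sup>+x. ?k x y \<partial>LP) \<le> ennreal D * (ennreal (w y) * ennreal_powr (F y) p)"
      by (simp add: mult_ac)
  qed
  also have "\<dots> = ennreal D * (\<integral>\<^sup>+y. ennreal (w y) * ennreal_powr (F y) p \<partial>LP)"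
    by (rule nn_integral_cmult) measurable
  finally show ?thesis by (simp add: mult.assoc mult_left_mono)
qed

section \<open>Hardy operators\<close>

text \<open>
  With $k = 2l + 1$ it majorises the part $y \le x/2$ of the Poisson integral.
\<close>

definition hardy_below :: "real \<Rightarrow> (real \<Rightarrow> ennreal) \<Rightarrow> real \<Rightarrow> ennreal" where
  "hardy_below k F x = (\<integral>\<^sup>+y. F y * ennreal (x powr (- k) * y powr (k - 1)) * indicator {..<x} y \<partial>LP)"

text \<open>
  The dual operator, which majorises the part $y \ge 2x$ of the Poisson integral for every order.
\<close>

definition hardy_above :: "(real \<Rightarrow> ennreal) \<Rightarrow> real \<Rightarrow> ennreal" where
  "hardy_above F x = (\<integral>\<^sup>+y. F y * ennreal (y powr (- 1)) * indicator {x<..} y \<partial>LP)"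

lemma hardy_below_strong:
  assumes p: "1 \<le> p" and d: "d < k * p - 1"
  shows "\<exists>C>0. \<forall>F\<in>borel_measurable LP. weighted_integral d p (hardy_below k F)
     \<le> ennreal C * weighted_integral d p F"
proof -
  \<comment> \<open>With this e the first factor below to the power p is (y/x)^(d+1), so the column integral is that of x^(-1-e) over x > y.\<close>
  define e where "e = (k * p - d - 1) / p"
  have e: "0 < e" "e * p = k * p - d - 1" using p d by (auto simp: e_def)
  let ?h = "\<lambda>x y. (y / x) powr (k - e)"
  let ?m = "\<lambda>x y. x powr (- e) * y powr (e - 1) * indicator {..<x} y"
  show ?thesis
  proof (intro exI[of _ "(1 / e) powr (p - 1) * (1 / e)"] conjI ballI)
    have e0: "0 \<le> (1 / e) powr (p - 1)" "0 \<le> 1 / e" using e by auto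
    show "0 < (1 / e) powr (p - 1) * (1 / e)" using e by simp
    fix F :: "real \<Rightarrow> ennreal" assume F: "F \<in> borel_measurable LP"
    have meas: "{z :: real \<times> real. snd z < fst z} \<in> sets (borel \<Otimes>\<^sub>M borel)"
      unfolding borel_prod by (intro borel_open open_Collect_less continuous_intros)
    have "(\<integral>\<^sup>+x. ennreal (x powr d) * ennreal_powr (\<integral>\<^sup>+y. F y * ennreal (?h x y) * ennreal (?m x y) \<partial>LP) p \<partial>LP)
       \<le> ennreal ((1 / e) powr (p - 1)) * ennreal (1 / e) * (\<integral>\<^sup>+y. ennreal (y powr d) * ennreal_powr (F y) p \<partial>LP)"
    proof (rule Schur_test[OF F])
      show "(\<lambda>(x, y). ?h x y) \<in> borel_measurable (borel \<Otimes>\<^sub>M borel)" by measurable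
      have "(\<lambda>(x, y). x powr (- e) * y powr (e - 1) * indicator {z. snd z < fst z} (x, y)) \<in> borel_measurable (borel \<Otimes>\<^sub>M borel)"
        using meas by measurable
      also have "(\<lambda>(x, y). x powr (- e) * y powr (e - 1) * indicator {z. snd z < fst z} (x, y)) = (\<lambda>(x, y). ?m x y)"
        by (auto simp: fun_eq_iff indicator_def)
      finally show "(\<lambda>(x, y). ?m x y) \<in> borel_measurable (borel \<Otimes>\<^sub>M borel)" .
      show "(\<integral>\<^sup>+y. ennreal (?m x y) \<partial>LP) = ennreal (1 / e)" if x: "0 < x" for x
      proof -
        have "(\<integral>\<^sup>+y. ennreal (?m x y) \<partial>LP) = (\<integral>\<^sup>+y. ennreal (x powr (- e)) * (ennreal (y powr (e - 1)) * indicator {..<x} y) \<partial>LP)"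
          by (intro nn_integral_cong) (auto simp: indicator_def ennreal_mult)
        also have "\<dots> = ennreal (x powr (- e)) * (\<integral>\<^sup>+y. ennreal (y powr (e - 1)) * indicator {..<x} y \<partial>LP)"
          by (rule nn_integral_cmult) (intro borel_LP, measurable)
        also have "\<dots> = ennreal (x powr (- e)) * ennreal (x powr e / e)"
          using e x by (subst nn_integral_powr_lessThan) auto
        also have "\<dots> = ennreal (1 / e)"
          using e x by (simp add: ennreal_mult[symmetric] powr_minus field_simps)
        finally show ?thesis .
      qed
      show "(\<integral>\<^sup>+x. ennreal (x powr d) * (ennreal (?h x y powr p) * ennreal (?m x y)) \<partial>LP) \<le> ennreal (1 / e) * ennreal (y powr d)"
        if y: "0 < y" for y
      proof -
        have ex: "d - (k - e) * p - e = - e - 1" using e(2) by (simp add: algebra_simps)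
        have "(\<integral>\<^sup>+x. ennreal (x powr d) * (ennreal (?h x y powr p) * ennreal (?m x y)) \<partial>LP)
          = (\<integral>\<^sup>+x. ennreal (y powr ((k - e) * p + e - 1)) * (ennreal (x powr (- e - 1)) * indicator {y<..} x) \<partial>LP)"
        proof (rule nn_integral_cong)
          fix x assume "x \<in> space LP"
          then have x: "0 < x" by simp
          have "x powr d * (?h x y powr p * (x powr (- e) * y powr (e - 1)))
             = (y powr ((k - e) * p) * y powr (e - 1)) * (x powr d * x powr (- ((k - e) * p)) * x powr (- e))"
            using x y by (simp add: powr_powr powr_divide powr_minus divide_simps)
          also have "\<dots> = y powr ((k - e) * p + (e - 1)) * x powr (d + - ((k - e) * p) + - e)"
            unfolding powr_add ..
          also have "d + - ((k - e) * p) + - e = - e - 1" using ex by simp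
          also have "(k - e) * p + (e - 1) = (k - e) * p + e - 1" by simp
          finally have "x powr d * (?h x y powr p * (x powr (- e) * y powr (e - 1))) = y powr ((k - e) * p + e - 1) * x powr (- e - 1)" .
          then show "ennreal (x powr d) * (ennreal (?h x y powr p) * ennreal (?m x y))
            = ennreal (y powr ((k - e) * p + e - 1)) * (ennreal (x powr (- e - 1)) * indicator {y<..} x)"
            by (auto simp: indicator_def ennreal_mult[symmetric])
        qed
        also have "\<dots> = ennreal (y powr ((k - e) * p + e - 1)) * (\<integral>\<^sup>+x. ennreal (x powr (- e - 1)) * indicator {y<..} x \<partial>LP)"
          by (rule nn_integral_cmult) (intro borel_LP, measurable)
        also have "\<dots> = ennreal (y powr ((k - e) * p + e - 1)) * ennreal (y powr (- e) / e)"
          using e y by (subst nn_integral_powr_greaterThan) auto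
        also have "\<dots> = ennreal (1 / e * y powr ((k - e) * p + e - 1 + - e))"
          using e unfolding powr_add by (simp add: ennreal_mult[symmetric])
        also have "(k - e) * p + e - 1 + - e = d" using e(2) by (simp add: algebra_simps)
        also have "ennreal (1 / e * y powr d) = ennreal (1 / e) * ennreal (y powr d)" using e by (intro ennreal_mult) auto
        finally show ?thesis by (rule eq_refl)
      qed
    qed (use p e in auto)
    also have "(\<integral>\<^sup>+x. ennreal (x powr d) * ennreal_powr (\<integral>\<^sup>+y. F y * ennreal (?h x y) * ennreal (?m x y) \<partial>LP) p \<partial>LP)
       = weighted_integral d p (hardy_below k F)"
    proof (rule nn_integral_cong)
      fix x assume "x \<in> space LP"
      then have x: "0 < x" by simp
      have "(\<integral>\<^sup>+y. F y * ennreal (?h x y) * ennreal (?m x y) \<partial>LP) = hardy_below k F x"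
        unfolding hardy_below_def
      proof (rule nn_integral_cong)
        fix y assume "y \<in> space LP"
        then have y: "0 < y" by simp
        have "?h x y = y powr (k - e) * x powr (- (k - e))"
          unfolding powr_minus using x y by (subst powr_divide) (auto simp: divide_inverse)
        then have "?h x y * (x powr (- e) * y powr (e - 1)) = (x powr (- (k - e)) * x powr (- e)) * (y powr (k - e) * y powr (e - 1))"
          by (simp only: mult_ac)
        also have "\<dots> = x powr (- k) * y powr (k - 1)" unfolding powr_add[symmetric] by simp
        finally show "F y * ennreal (?h x y) * ennreal (?m x y) = F y * ennreal (x powr (- k) * y powr (k - 1)) * indicator {..<x} y"
          by (auto simp: indicator_def mult.assoc ennreal_mult[symmetric])
      qed
      then show "ennreal (x powr d) * ennreal_powr (\<integral>\<^sup>+y. F y * ennreal (?h x y) * ennreal (?m x y) \<partial>LP) p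
        = ennreal (x powr d) * ennreal_powr (hardy_below k F x) p" by simp
    qed
    finally show "weighted_integral d p (hardy_below k F)
       \<le> ennreal ((1 / e) powr (p - 1) * (1 / e)) * weighted_integral d p F"
      by (simp only: ennreal_mult[OF e0])
  qed
qed

lemma hardy_above_strong:
  assumes p: "1 \<le> p" and d: "-1 < d"
  shows "\<exists>C>0. \<forall>F\<in>borel_measurable LP. weighted_integral d p (hardy_above F)
     \<le> ennreal C * weighted_integral d p F"
proof -
  \<comment> \<open>With this e the first factor below to the power p is (y/x)^(d+1), so the column integral is that of x^(e-1) over x < y.\<close>
  define e where "e = (d + 1) / p"
  have e: "0 < e" "e * p = d + 1" using p d by (auto simp: e_def)
  let ?h = "\<lambda>x y. (y / x) powr e"
  let ?m = "\<lambda>x y. x powr e * y powr (- e - 1) * indicator {x<..} y"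
  show ?thesis
  proof (intro exI[of _ "(1 / e) powr (p - 1) * (1 / e)"] conjI ballI)
    have e0: "0 \<le> (1 / e) powr (p - 1)" "0 \<le> 1 / e" using e by auto
    show "0 < (1 / e) powr (p - 1) * (1 / e)" using e by simp
    fix F :: "real \<Rightarrow> ennreal" assume F: "F \<in> borel_measurable LP"
    have meas: "{z :: real \<times> real. fst z < snd z} \<in> sets (borel \<Otimes>\<^sub>M borel)"
      unfolding borel_prod by (intro borel_open open_Collect_less continuous_intros)
    have "(\<integral>\<^sup>+x. ennreal (x powr d) * ennreal_powr (\<integral>\<^sup>+y. F y * ennreal (?h x y) * ennreal (?m x y) \<partial>LP) p \<partial>LP)
       \<le> ennreal ((1 / e) powr (p - 1)) * ennreal (1 / e) * (\<integral>\<^sup>+y. ennreal (y powr d) * ennreal_powr (F y) p \<partial>LP)"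
    proof (rule Schur_test[OF F])
      show "(\<lambda>(x, y). ?h x y) \<in> borel_measurable (borel \<Otimes>\<^sub>M borel)" by measurable
      have "(\<lambda>(x, y). x powr e * y powr (- e - 1) * indicator {z. fst z < snd z} (x, y)) \<in> borel_measurable (borel \<Otimes>\<^sub>M borel)"
        using meas by measurable
      also have "(\<lambda>(x, y). x powr e * y powr (- e - 1) * indicator {z. fst z < snd z} (x, y)) = (\<lambda>(x, y). ?m x y)"
        by (auto simp: fun_eq_iff indicator_def)
      finally show "(\<lambda>(x, y). ?m x y) \<in> borel_measurable (borel \<Otimes>\<^sub>M borel)" .
      show "(\<integral>\<^sup>+y. ennreal (?m x y) \<partial>LP) = ennreal (1 / e)" if x: "0 < x" for x
      proof -
        have "(\<integral>\<^sup>+y. ennreal (?m x y) \<partial>LP) = (\<integral>\<^sup>+y. ennreal (x powr e) * (ennreal (y powr (- e - 1)) * indicator {x<..} y) \<partial>LP)"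
          by (intro nn_integral_cong) (auto simp: indicator_def ennreal_mult)
        also have "\<dots> = ennreal (x powr e) * (\<integral>\<^sup>+y. ennreal (y powr (- e - 1)) * indicator {x<..} y \<partial>LP)"
          by (rule nn_integral_cmult) (intro borel_LP, measurable)
        also have "\<dots> = ennreal (x powr e) * ennreal (x powr (- e) / e)"
          using e x by (subst nn_integral_powr_greaterThan) auto
        also have "\<dots> = ennreal (1 / e)"
          using e x by (simp add: ennreal_mult[symmetric] powr_minus field_simps)
        finally show ?thesis .
      qed
      show "(\<integral>\<^sup>+x. ennreal (x powr d) * (ennreal (?h x y powr p) * ennreal (?m x y)) \<partial>LP) \<le> ennreal (1 / e) * ennreal (y powr d)"
        if y: "0 < y" for y
      proof -
        have "(\<integral>\<^sup>+x. ennreal (x powr d) * (ennreal (?h x y powr p) * ennreal (?m x y)) \<partial>LP)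
          = (\<integral>\<^sup>+x. ennreal (y powr (e * p - e - 1)) * (ennreal (x powr (e - 1)) * indicator {..<y} x) \<partial>LP)"
        proof (rule nn_integral_cong)
          fix x assume "x \<in> space LP"
          then have x: "0 < x" by simp
          have "x powr d * (?h x y powr p * (x powr e * y powr (- e - 1)))
               = (y powr (e * p) * y powr (- e - 1)) * (x powr d * x powr (- (e * p)) * x powr e)"
            using x y by (simp add: powr_powr powr_divide powr_minus divide_simps)
          also have "\<dots> = y powr (e * p - e - 1) * x powr (e - 1)"
            unfolding powr_add[symmetric] using e(2) by (simp add: algebra_simps)
          finally show "ennreal (x powr d) * (ennreal (?h x y powr p) * ennreal (?m x y))
            = ennreal (y powr (e * p - e - 1)) * (ennreal (x powr (e - 1)) * indicator {..<y} x)"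
            by (auto simp: indicator_def ennreal_mult[symmetric])
        qed
        also have "\<dots> = ennreal (y powr (e * p - e - 1)) * (\<integral>\<^sup>+x. ennreal (x powr (e - 1)) * indicator {..<y} x \<partial>LP)"
          by (rule nn_integral_cmult) (intro borel_LP, measurable)
        also have "\<dots> = ennreal (y powr (e * p - e - 1)) * ennreal (y powr e / e)"
          using e y by (subst nn_integral_powr_lessThan) auto
        also have "\<dots> = ennreal (1 / e * y powr (e * p - e - 1 + e))"
          using e unfolding powr_add by (simp add: ennreal_mult[symmetric])
        also have "e * p - e - 1 + e = d" using e(2) by simp
        also have "ennreal (1 / e * y powr d) = ennreal (1 / e) * ennreal (y powr d)" using e by (intro ennreal_mult) auto
        finally show ?thesis by (rule eq_refl)
      qed
    qed (use p e in auto)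
    also have "(\<integral>\<^sup>+x. ennreal (x powr d) * ennreal_powr (\<integral>\<^sup>+y. F y * ennreal (?h x y) * ennreal (?m x y) \<partial>LP) p \<partial>LP)
       = weighted_integral d p (hardy_above F)"
    proof (rule nn_integral_cong)
      fix x assume "x \<in> space LP"
      then have x: "0 < x" by simp
      have "(\<integral>\<^sup>+y. F y * ennreal (?h x y) * ennreal (?m x y) \<partial>LP) = hardy_above F x"
        unfolding hardy_above_def
      proof (rule nn_integral_cong)
        fix y assume "y \<in> space LP"
        then have y: "0 < y" by simp
        have "?h x y * (x powr e * y powr (- e - 1)) = y powr e * y powr (- e - 1)"
          using x y by (simp add: powr_divide)
        also have "\<dots> = y powr (- 1)" unfolding powr_add[symmetric] by simp
        finally show "F y * ennreal (?h x y) * ennreal (?m x y) = F y * ennreal (y powr (- 1)) * indicator {x<..} y"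
          by (auto simp: indicator_def mult.assoc ennreal_mult[symmetric])
      qed
      then show "ennreal (x powr d) * ennreal_powr (\<integral>\<^sup>+y. F y * ennreal (?h x y) * ennreal (?m x y) \<partial>LP) p
        = ennreal (x powr d) * ennreal_powr (hardy_above F x) p" by simp
    qed
    finally show "weighted_integral d p (hardy_above F)
       \<le> ennreal ((1 / e) powr (p - 1) * (1 / e)) * weighted_integral d p F"
      by (simp only: ennreal_mult[OF e0])
  qed
qed

text \<open>
  The operator is at most $x^{-k}$ times the total mass, so its level sets are contained in
  intervals at the origin. Both endpoint estimates reduce to a bound of that mass.
\<close>

lemma hardy_below_weak_of_mass:
  fixes F :: "real \<Rightarrow> ennreal" and k p W \<gamma> :: real
  assumes k: "0 < k" and p: "1 \<le> p" and \<gamma>: "0 < \<gamma>" and W: "0 \<le> W"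
    and mass: "(\<integral>\<^sup>+y. F y * ennreal (y powr (k - 1)) \<partial>LP) \<le> ennreal W"
    and F: "F \<in> borel_measurable LP"
    and A: "A \<in> sets LP" "A \<subseteq> {x. 0 < x \<and> hardy_below k F x > ennreal \<gamma>}"
  shows "emeasure (power_measure (k * p - 1)) A \<le> ennreal (\<gamma> powr (- p) * W powr p / (k * p))"
proof -
  define R where "R = (W / \<gamma>) powr (1 / k)"
  have sub: "A \<subseteq> {0<..<R}"
  proof
    fix x assume "x \<in> A"
    then have x: "0 < x" "ennreal \<gamma> < hardy_below k F x" using A by auto
    have "hardy_below k F x \<le> (\<integral>\<^sup>+y. ennreal (x powr (- k)) * (F y * ennreal (y powr (k - 1))) \<partial>LP)"
      unfolding hardy_below_def
      by (intro nn_integral_mono) (auto simp: indicator_def ennreal_mult mult_ac)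
    also have "\<dots> = ennreal (x powr (- k)) * (\<integral>\<^sup>+y. F y * ennreal (y powr (k - 1)) \<partial>LP)"
      using F by (intro nn_integral_cmult borel_measurable_times_ennreal) (auto intro!: borel_LP)
    also have "\<dots> \<le> ennreal (x powr (- k)) * ennreal W" by (intro mult_left_mono mass) simp
    finally have "ennreal \<gamma> < ennreal (x powr (- k) * W)" using x W by (simp add: ennreal_mult)
    then have "\<gamma> < x powr (- k) * W" using \<gamma> by (simp add: ennreal_less_iff)
    then have "x powr k < W / \<gamma>" using \<gamma> x by (simp add: powr_minus field_simps)
    then have "(x powr k) powr (1 / k) < (W / \<gamma>) powr (1 / k)" using k by (intro powr_less_mono2) auto
    then show "x \<in> {0<..<R}" using x k by (simp add: R_def powr_powr)
  qed
  have "emeasure (power_measure (k * p - 1)) A \<le> emeasure (power_measure (k * p - 1)) {0<..<R}"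
    using sub by (intro emeasure_mono) (auto intro!: borel_set_LP)
  also have "\<dots> = (\<integral>\<^sup>+x. ennreal (x powr (k * p - 1)) * indicator {0<..<R} x \<partial>LP)"
    by (intro emeasure_power_measure borel_set_LP) auto
  also have "\<dots> = (\<integral>\<^sup>+x. ennreal (x powr (k * p - 1)) * indicator {..<R} x \<partial>LP)"
    by (intro nn_integral_cong) (auto simp: indicator_def)
  also have "\<dots> = ennreal (R powr (k * p) / (k * p))"
    using k p by (intro nn_integral_powr_lessThan) (auto simp: R_def)
  also have "R powr (k * p) = (W / \<gamma>) powr p" using k by (simp add: R_def powr_powr)
  also have "\<dots> = \<gamma> powr (- p) * W powr p" using W \<gamma> by (simp add: powr_divide powr_minus field_simps)
  finally show ?thesis .
qed

text \<open>
  The relation between two power measures of a set, from which the restricted weak type at the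
  endpoint follows. The density quotient $y^{k-1} / y^{kp-1}$ decreases, so an interval at the
  origin is extremal; up to constants it is enough to cut $E$ at one radius.
\<close>

lemma mass_le_power_measure:
  fixes k p :: real
  assumes k: "0 < k" and p: "1 \<le> p" and E: "E \<in> sets LP"
    and fin: "emeasure (power_measure (k * p - 1)) E = ennreal M" "0 \<le> M"
  shows "(\<integral>\<^sup>+y. indicator E y * ennreal (y powr (k - 1)) \<partial>LP) \<le> ennreal ((2 powr p / k powr (p - 1) * M) powr (1 / p))"
proof -
  have key: "v powr p \<le> 2 powr p / k powr (p - 1) * M"
    if v: "0 < v" "ennreal v \<le> (\<integral>\<^sup>+y. indicator E y * ennreal (y powr (k - 1)) \<partial>LP)" for v
  proof -
    \<comment> \<open>The interval (0, r) has mass v/2, so at least half of the mass lies beyond r, where the quotient of the densities is bounded.\<close>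
    define r where "r = (k * v / 2) powr (1 / k)"
    have r: "0 < r" using k v by (simp add: r_def)
    have rk: "r powr k = k * v / 2" using k v by (simp add: r_def powr_powr)
    have [measurable]: "(\<lambda>y::real. y powr c) \<in> borel_measurable LP" for c by (intro borel_LP) measurable
    have [measurable]: "(\<lambda>y. indicator {..<r} y :: ennreal) \<in> borel_measurable LP" by (intro borel_LP) measurable
    note [measurable] = E
    have "(\<integral>\<^sup>+y. indicator E y * ennreal (y powr (k - 1)) \<partial>LP)
      \<le> (\<integral>\<^sup>+y. ennreal (y powr (k - 1)) * indicator {..<r} y + ennreal (r powr (- (k * (p - 1)))) * (ennreal (y powr (k * p - 1)) * indicator E y) \<partial>LP)"
    proof (rule nn_integral_mono)
      fix y assume "y \<in> space LP"
      then have y: "0 < y" by simp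
      show "indicator E y * ennreal (y powr (k - 1)) \<le>
         ennreal (y powr (k - 1)) * indicator {..<r} y + ennreal (r powr (- (k * (p - 1)))) * (ennreal (y powr (k * p - 1)) * indicator E y)"
      proof (cases "y < r")
        case True
        then show ?thesis by (auto simp: indicator_def)
      next
        case False
        then have "r powr (k * (p - 1)) \<le> y powr (k * (p - 1))" using k p r by (intro powr_mono2) auto
        then have "y powr (k - 1) * r powr (k * (p - 1)) \<le> y powr (k - 1) * y powr (k * (p - 1))" by (intro mult_left_mono) auto
        also have "\<dots> = y powr (k * p - 1)" unfolding powr_add[symmetric] by (simp add: algebra_simps)
        finally have le: "y powr (k - 1) * r powr (k * (p - 1)) \<le> y powr (k * p - 1)" .
        have "0 < r powr (k * (p - 1))" using r by simp
        with le have "y powr (k - 1) \<le> y powr (k * p - 1) / r powr (k * (p - 1))"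
          by (simp only: pos_le_divide_eq)
        also have "\<dots> = r powr (- (k * (p - 1))) * y powr (k * p - 1)"
          by (simp only: powr_minus divide_inverse mult.commute)
        finally have "y powr (k - 1) \<le> r powr (- (k * (p - 1))) * y powr (k * p - 1)" .
        then have "ennreal (y powr (k - 1)) \<le> ennreal (r powr (- (k * (p - 1)))) * ennreal (y powr (k * p - 1))"
          by (simp add: ennreal_mult[symmetric] ennreal_leI)
        then show ?thesis using False by (auto simp: indicator_def)
      qed
    qed
    also have "\<dots> = (\<integral>\<^sup>+y. ennreal (y powr (k - 1)) * indicator {..<r} y \<partial>LP) + (\<integral>\<^sup>+y. ennreal (r powr (- (k * (p - 1)))) * (ennreal (y powr (k * p - 1)) * indicator E y) \<partial>LP)"
      by (rule nn_integral_add) measurable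
    also have "(\<integral>\<^sup>+y. ennreal (y powr (k - 1)) * indicator {..<r} y \<partial>LP) = ennreal (v / 2)"
    proof -
      have "r powr k / k = v / 2" using k rk by simp
      then show ?thesis using k r by (subst nn_integral_powr_lessThan) auto
    qed
    also have "(\<integral>\<^sup>+y. ennreal (r powr (- (k * (p - 1)))) * (ennreal (y powr (k * p - 1)) * indicator E y) \<partial>LP)
       = ennreal (r powr (- (k * (p - 1)))) * (\<integral>\<^sup>+y. ennreal (y powr (k * p - 1)) * indicator E y \<partial>LP)"
      by (rule nn_integral_cmult) measurable
    also have "(\<integral>\<^sup>+y. ennreal (y powr (k * p - 1)) * indicator E y \<partial>LP) = ennreal M"
      using fin emeasure_power_measure[OF E] by simp
    finally have "(\<integral>\<^sup>+y. indicator E y * ennreal (y powr (k - 1)) \<partial>LP) \<le> ennreal (v / 2 + r powr (- (k * (p - 1))) * M)"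
      using v(1) fin(2) by (simp add: ennreal_mult[symmetric] ennreal_plus[symmetric] del: ennreal_plus)
    with v(2) have "ennreal v \<le> ennreal (v / 2 + r powr (- (k * (p - 1))) * M)" by (rule order_trans)
    then have "v \<le> v / 2 + r powr (- (k * (p - 1))) * M" using v(1) fin(2) by (subst (asm) ennreal_le_iff) auto
    then have "v / 2 \<le> r powr (- (k * (p - 1))) * M" by simp
    moreover have "r powr (- (k * (p - 1))) = (k * v / 2) powr (- (p - 1))"
      unfolding rk[symmetric] by (simp only: powr_powr mult_minus_right)
    ultimately have "v / 2 \<le> (k * v / 2) powr (- (p - 1)) * M" by simp
    then have "v / 2 \<le> inverse ((k * v / 2) powr (p - 1)) * M" by (simp only: powr_minus)
    then have "(k * v / 2) powr (p - 1) * (v / 2) \<le> (k * v / 2) powr (p - 1) * (inverse ((k * v / 2) powr (p - 1)) * M)"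
      by (intro mult_left_mono) auto
    also have "\<dots> = M"
    proof -
      have nz: "(k * v / 2) powr (p - 1) \<noteq> 0" using k v by simp
      show ?thesis by (simp only: mult.assoc[symmetric] right_inverse[OF nz] mult_1_left)
    qed
    finally have "(k * v / 2) powr (p - 1) * (v / 2) \<le> M" .
    also have "(k * v / 2) powr (p - 1) * (v / 2) = k powr (p - 1) * ((v / 2) powr (p - 1) * (v / 2))"
      using k v by (simp add: powr_mult[of k "v / 2", simplified])
    also have "(v / 2) powr (p - 1) * (v / 2) = (v / 2) powr p"
      using v by (simp add: powr_diff)
    also have "\<dots> = v powr p / 2 powr p" using v by (simp add: powr_divide)
    finally show ?thesis using k by (simp add: field_simps)
  qed
  have key2: "v \<le> (2 powr p / k powr (p - 1) * M) powr (1 / p)"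
    if v: "0 < v" "ennreal v \<le> (\<integral>\<^sup>+y. indicator E y * ennreal (y powr (k - 1)) \<partial>LP)" for v
  proof -
    have "(v powr p) powr (1 / p) \<le> (2 powr p / k powr (p - 1) * M) powr (1 / p)"
      using key[OF v] p by (intro powr_mono2) auto
    then show ?thesis using v p by (simp add: powr_powr)
  qed
  let ?W = "(2 powr p / k powr (p - 1) * M) powr (1 / p)"
  show ?thesis
  proof (rule ccontr)
    \<comment> \<open>The mass is not known to be finite, so the bound is shown for all finite v below it.\<close>
    assume "\<not> ?thesis"
    then have "ennreal ?W < (\<integral>\<^sup>+y. indicator E y * ennreal (y powr (k - 1)) \<partial>LP)" by simp
    then obtain c where c: "ennreal ?W < c" "c < (\<integral>\<^sup>+y. indicator E y * ennreal (y powr (k - 1)) \<partial>LP)"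
      using dense by blast
    then obtain v where v: "c = ennreal v" "0 \<le> v" by (cases c) auto
    have wv: "?W < v" using c(1) unfolding v(1) by (subst (asm) ennreal_less_iff) auto
    have "0 \<le> ?W" by simp
    with wv have "0 < v" by linarith
    from key2[OF this] c(2) v(1) have "v \<le> ?W" by (simp add: less_imp_le)
    with wv show False by linarith
  qed
qed

section \<open>The maximal function over intervals: weak type\<close>

text \<open>
  Of three intervals with a common point, one that extends farthest to the left and one that extends
  farthest to the right cover the remaining one.
\<close>

lemma interval_overlap3:
  fixes x :: real
  assumes "x \<in> {a1<..<b1}" "x \<in> {a2<..<b2}" "x \<in> {a3<..<b3}"
  shows "{a1<..<b1} \<subseteq> {a2<..<b2} \<union> {a3<..<b3} \<or> {a2<..<b2} \<subseteq> {a1<..<b1} \<union> {a3<..<b3} \<or>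
         {a3<..<b3} \<subseteq> {a1<..<b1} \<union> {a2<..<b2}"
proof -
  have sub: "{a<..<b} \<subseteq> {c<..<d} \<union> {e<..<f}"
    if "c \<le> a \<or> e \<le> a" "b \<le> d \<or> b \<le> f" "x \<in> {c<..<d}" "x \<in> {e<..<f}" for a b c d e f :: real
    using that by auto
  have "(a2 \<le> a1 \<or> a3 \<le> a1) \<and> (b1 \<le> b2 \<or> b1 \<le> b3) \<or>
        (a1 \<le> a2 \<or> a3 \<le> a2) \<and> (b2 \<le> b1 \<or> b2 \<le> b3) \<or>
        (a1 \<le> a3 \<or> a2 \<le> a3) \<and> (b3 \<le> b1 \<or> b3 \<le> b2)"
    by linarith
  then show ?thesis using sub[of a2 a1 a3 b1 b2 b3] sub[of a1 a2 a3 b2 b1 b3] sub[of a1 a3 a2 b3 b1 b2] assms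
    by blast
qed

text \<open>
  As long as a point belongs to three intervals, one of them is superfluous. Overlap two takes the
  place of the doubling property in Vitali's covering lemma, so the weak type estimate below covers
  all exponents $d$ at once, also $d \le -1$, when every neighbourhood of 0 has infinite measure.
\<close>

lemma interval_subcover_overlap2:
  fixes J :: "real set set"
  assumes "finite J" "\<And>I. I \<in> J \<Longrightarrow> \<exists>a b. I = {a<..<b}"
  shows "\<exists>J'\<subseteq>J. \<Union>J' = \<Union>J \<and> (\<forall>x. card {I\<in>J'. x \<in> I} \<le> 2)"
  using assms
proof (induction J rule: finite_psubset_induct)
  case (psubset J)
  show ?case
  proof (cases "\<forall>x. card {I\<in>J. x \<in> I} \<le> 2")
    case False
    then obtain x where "\<not> card {I\<in>J. x \<in> I} \<le> 2" by blast
    then have "3 \<le> card {I\<in>J. x \<in> I}" by simp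
    then obtain T where T: "T \<subseteq> {I\<in>J. x \<in> I}" "card T = 3"
      by (meson obtain_subset_with_card_n)
    then obtain I1 I2 I3 where I: "T = {I1, I2, I3}" "I1 \<noteq> I2" "I2 \<noteq> I3" "I1 \<noteq> I3"
      by (auto simp: card_3_iff)
    then have mem: "I1 \<in> J" "I2 \<in> J" "I3 \<in> J" "x \<in> I1" "x \<in> I2" "x \<in> I3" using T by auto
    obtain a1 b1 a2 b2 a3 b3 where "I1 = {a1<..<b1}" "I2 = {a2<..<b2}" "I3 = {a3<..<b3}"
      using psubset.prems mem by metis
    with interval_overlap3[of x a1 b1 a2 b2 a3 b3] mem
    have "I1 \<subseteq> I2 \<union> I3 \<or> I2 \<subseteq> I1 \<union> I3 \<or> I3 \<subseteq> I1 \<union> I2" by simp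
    then obtain K where K: "K \<in> J" "\<Union>(J - {K}) = \<Union>J"
    proof (elim disjE)
      assume "I1 \<subseteq> I2 \<union> I3" with mem I that[of I1] show ?thesis by blast
    next
      assume "I2 \<subseteq> I1 \<union> I3" with mem I that[of I2] show ?thesis by blast
    next
      assume "I3 \<subseteq> I1 \<union> I2" with mem I that[of I3] show ?thesis by blast
    qed
    then have "J - {K} \<subset> J" by blast
    from psubset.IH[OF this] psubset.prems obtain J' where "J' \<subseteq> J - {K}" "\<Union>J' = \<Union>(J - {K})" "\<forall>x. card {I\<in>J'. x \<in> I} \<le> 2"
      by blast
    then show ?thesis using K by (intro exI[of _ J']) auto
  qed auto
qed

text \<open>
  The intervals with average of $F$ above $c$; multiplied out, the inequality behaves well for
  subtraction and for infinite integrals. Their union is a level set of the maximal function.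
\<close>

definition large_average_intervals :: "real \<Rightarrow> (real \<Rightarrow> ennreal) \<Rightarrow> ennreal \<Rightarrow> real set set" where
  "large_average_intervals d F c = {{a<..<b} | a b. 0 < a \<and> a < b \<and>
     c * emeasure (power_measure d) {a<..<b} < (\<integral>\<^sup>+y. F y * indicator {a<..<b} y \<partial>power_measure d)}"

text \<open>
  The uncentred maximal function for the measure $x^d dx$. The intervals stay away from 0, so their
  measure is positive and finite for every real $d$.
\<close>

definition maxfun :: "real \<Rightarrow> (real \<Rightarrow> ennreal) \<Rightarrow> real \<Rightarrow> ennreal" where
  "maxfun d F x = (SUP I\<in>{{a<..<b} | a b. 0 < a \<and> a < x \<and> x < b}.
     (\<integral>\<^sup>+y. F y * indicator I y \<partial>power_measure d) / emeasure (power_measure d) I)"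

lemma nn_integral_LP_Ioo:
  assumes "0 < a" "a < b"
  shows "(\<integral>\<^sup>+x. indicator {a<..<b} x \<partial>LP) = ennreal (b - a)"
proof -
  have "(\<integral>\<^sup>+x. indicator {a<..<b} x \<partial>LP) = (\<integral>\<^sup>+x. indicator {a<..<b} x \<partial>lborel)"
    unfolding nn_integral_LP using assms by (intro nn_integral_cong) (auto simp: indicator_def)
  then show ?thesis using assms by simp
qed

lemma powr_between:
  fixes a b x d :: real
  assumes "0 < a" "a \<le> x" "x \<le> b"
  shows "min (a powr d) (b powr d) \<le> x powr d" "x powr d \<le> max (a powr d) (b powr d)"
proof -
  show "min (a powr d) (b powr d) \<le> x powr d"
  proof (cases "0 \<le> d")
    case True
    then have "a powr d \<le> x powr d" using assms by (intro powr_mono2) auto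
    then show ?thesis by simp
  next
    case False
    then have "b powr d \<le> x powr d" using assms by (intro powr_mono2') auto
    then show ?thesis by simp
  qed
  show "x powr d \<le> max (a powr d) (b powr d)"
  proof (cases "0 \<le> d")
    case True
    then have "x powr d \<le> b powr d" using assms by (intro powr_mono2) auto
    then show ?thesis by simp
  next
    case False
    then have "x powr d \<le> a powr d" using assms by (intro powr_mono2') auto
    then show ?thesis by simp
  qed
qed

lemma power_measure_interval:
  assumes "0 < a" "a < b"
  shows "0 < emeasure (power_measure d) {a<..<b}"
    and "emeasure (power_measure d) {a<..<b} \<le> ennreal (max (a powr d) (b powr d) * (b - a))"
    and "ennreal (min (a powr d) (b powr d) * (b - a)) \<le> emeasure (power_measure d) {a<..<b}"
    and "emeasure (power_measure d) {a<..<b} < top"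
proof -
  have s: "{a<..<b} \<in> sets LP" using assms by (intro borel_set_LP) auto
  have [measurable]: "(\<lambda>y. indicator {a<..<b} y :: ennreal) \<in> borel_measurable LP" by (intro borel_LP) measurable
  have e: "emeasure (power_measure d) {a<..<b} = (\<integral>\<^sup>+x. ennreal (x powr d) * indicator {a<..<b} x \<partial>LP)"
    by (rule emeasure_power_measure[OF s])
  have "emeasure (power_measure d) {a<..<b} \<le> (\<integral>\<^sup>+x. ennreal (max (a powr d) (b powr d)) * indicator {a<..<b} x \<partial>LP)"
    unfolding e using assms powr_between(2)[of a _ b d]
    by (intro nn_integral_mono) (auto simp: indicator_def intro!: ennreal_leI)
  also have "\<dots> = ennreal (max (a powr d) (b powr d)) * ennreal (b - a)"
    using assms by (subst nn_integral_cmult) (auto simp: nn_integral_LP_Ioo)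
  also have "\<dots> = ennreal (max (a powr d) (b powr d) * (b - a))"
    using assms by (intro ennreal_mult[symmetric]) (auto simp: le_max_iff_disj)
  finally show up: "emeasure (power_measure d) {a<..<b} \<le> ennreal (max (a powr d) (b powr d) * (b - a))" .
  then show "emeasure (power_measure d) {a<..<b} < top" by (rule le_less_trans) simp
  have "ennreal (min (a powr d) (b powr d) * (b - a)) = ennreal (min (a powr d) (b powr d)) * ennreal (b - a)"
    using assms by (intro ennreal_mult) auto
  also have "\<dots> = (\<integral>\<^sup>+x. ennreal (min (a powr d) (b powr d)) * indicator {a<..<b} x \<partial>LP)"
    using assms by (subst nn_integral_cmult) (auto simp: nn_integral_LP_Ioo)
  also have "\<dots> \<le> emeasure (power_measure d) {a<..<b}"
    unfolding e using assms powr_between(1)[of a _ b d]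
    by (intro nn_integral_mono) (auto simp: indicator_def intro!: ennreal_leI)
  finally show lo: "ennreal (min (a powr d) (b powr d) * (b - a)) \<le> emeasure (power_measure d) {a<..<b}" .
  have "0 < ennreal (min (a powr d) (b powr d) * (b - a))" using assms by (auto simp: min_def)
  also note lo
  finally show "0 < emeasure (power_measure d) {a<..<b}" .
qed

lemma maxfun_level:
  assumes "0 < x"
  shows "c < maxfun d F x \<longleftrightarrow> x \<in> \<Union>(large_average_intervals d F c)"
proof -
  have "c < maxfun d F x \<longleftrightarrow> (\<exists>a b. 0 < a \<and> a < x \<and> x < b \<and>
      c < (\<integral>\<^sup>+y. F y * indicator {a<..<b} y \<partial>power_measure d) / emeasure (power_measure d) {a<..<b})"
    unfolding maxfun_def less_SUP_iff by blast
  also have "\<dots> \<longleftrightarrow> (\<exists>a b. 0 < a \<and> a < x \<and> x < b \<and>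
      c * emeasure (power_measure d) {a<..<b} < (\<integral>\<^sup>+y. F y * indicator {a<..<b} y \<partial>power_measure d))"
  proof -
    have "c < u / m \<longleftrightarrow> c * m < u" if "0 < m" "m < top" for u m :: ennreal
    proof -
      have m: "m \<noteq> 0" "m \<noteq> top" using that by auto
      have mm: "m / m = 1" using that by (intro ennreal_divide_self) auto
      have "u \<le> c * m" if "u / m \<le> c"
        using mult_right_mono[OF that, of m] m by (simp add: ennreal_divide_times mm)
      moreover have "u / m \<le> c" if "u \<le> c * m"
        using divide_right_mono_ennreal[OF that, of m] m by (simp add: mult_divide_eq_ennreal)
      ultimately have "u / m \<le> c \<longleftrightarrow> u \<le> c * m" by blast
      then show ?thesis by (simp add: not_le[symmetric])
    qed
    note div = this
    have "c < (\<integral>\<^sup>+y. F y * indicator {a<..<b} y \<partial>power_measure d) / emeasure (power_measure d) {a<..<b} \<longleftrightarrow>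
      c * emeasure (power_measure d) {a<..<b} < (\<integral>\<^sup>+y. F y * indicator {a<..<b} y \<partial>power_measure d)"
      if "0 < a" "a < x" "x < b" for a b
      using that power_measure_interval(1,4)[of a b d] by (intro div) auto
    then show ?thesis by blast
  qed
  also have "\<dots> \<longleftrightarrow> x \<in> \<Union>(large_average_intervals d F c)"
  proof -
    have gen: "(\<exists>a b. 0 < a \<and> a < x \<and> x < b \<and> Q a b) \<longleftrightarrow> x \<in> \<Union>{{a<..<b} | a b. 0 < a \<and> a < b \<and> Q a b}"
      for Q :: "real \<Rightarrow> real \<Rightarrow> bool"
    proof
      assume "\<exists>a b. 0 < a \<and> a < x \<and> x < b \<and> Q a b"
      then obtain a b where ab: "0 < a" "a < x" "x < b" "Q a b" by blast
      then have "a < b" by linarith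
      with ab have "{a<..<b} \<in> {{a<..<b} | a b. 0 < a \<and> a < b \<and> Q a b}" by blast
      moreover have "x \<in> {a<..<b}" using ab by simp
      ultimately show "x \<in> \<Union>{{a<..<b} | a b. 0 < a \<and> a < b \<and> Q a b}" by (rule UnionI)
    next
      assume "x \<in> \<Union>{{a<..<b} | a b. 0 < a \<and> a < b \<and> Q a b}"
      then obtain a b where "x \<in> {a<..<b}" "0 < a" "Q a b" by blast
      then show "\<exists>a b. 0 < a \<and> a < x \<and> x < b \<and> Q a b" by (intro exI[of _ a] exI[of _ b]) auto
    qed
    show ?thesis unfolding large_average_intervals_def by (rule gen)
  qed
  finally show ?thesis .
qed

lemma large_average_intervals_open:
  "I \<in> large_average_intervals d F c \<Longrightarrow> open I" "\<Union>(large_average_intervals d F c) \<subseteq> {0<..}" "open (\<Union>(large_average_intervals d F c))"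
  by (auto simp: large_average_intervals_def)

lemma maxfun_measurable [measurable]: "maxfun d F \<in> borel_measurable LP"
proof (rule borel_measurableI_greater)
  fix c
  have "{x \<in> space LP. c < maxfun d F x} = \<Union>(large_average_intervals d F c)"
    using maxfun_level[of _ c d F] large_average_intervals_open(2)[of d F c] by auto
  also have "\<dots> \<in> sets LP" using large_average_intervals_open(2,3)[of d F c] by (intro borel_set_LP) auto
  finally show "{x \<in> space LP. c < maxfun d F x} \<in> sets LP" .
qed

text \<open>
  The level set is a union of intervals on which $F$ has a large average. A finite subfamily may be
  assumed to have overlap at most two, whence the factor 2; countable subfamilies (Lindelof) and
  continuity from below give the whole level set.
\<close>

lemma maxfun_weak:
  assumes [measurable]: "F \<in> borel_measurable LP"
  shows "c * emeasure (power_measure d) {x. 0 < x \<and> c < maxfun d F x} \<le> 2 * (\<integral>\<^sup>+x. F x \<partial>power_measure d)"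
proof -
  let ?N = "power_measure d"
  have setI: "I \<in> sets ?N" if I: "I \<in> large_average_intervals d F c" for I
  proof -
    obtain a b where "I = {a<..<b}" "0 < a" using I unfolding large_average_intervals_def by blast
    then show ?thesis unfolding sets_power_measure by (intro borel_set_LP) auto
  qed
  have fin: "c * emeasure ?N (\<Union>J) \<le> 2 * (\<integral>\<^sup>+x. F x \<partial>?N)" if J: "finite J" "J \<subseteq> large_average_intervals d F c" for J
  proof -
    have "\<exists>a b. I = {a<..<b}" if "I \<in> J" for I
      using subsetD[OF J(2) that] unfolding large_average_intervals_def by blast
    from interval_subcover_overlap2[OF J(1) this] obtain J' where
      J': "J' \<subseteq> J" "\<Union>J' = \<Union>J" "\<And>x. card {I\<in>J'. x \<in> I} \<le> 2" by blast
    have fJ': "finite J'" using J J' finite_subset by blast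
    have [measurable]: "I \<in> sets ?N" if "I \<in> J'" for I using that J J' setI by blast
    have "c * emeasure ?N (\<Union>J) = c * emeasure ?N (\<Union>I\<in>J'. I)" using J' by simp
    also have "\<dots> \<le> c * (\<Sum>I\<in>J'. emeasure ?N I)"
      using fJ' setI J J' by (intro mult_left_mono emeasure_subadditive_finite) auto
    also have "\<dots> = (\<Sum>I\<in>J'. c * emeasure ?N I)" by (rule sum_distrib_left)
    also have "\<dots> \<le> (\<Sum>I\<in>J'. \<integral>\<^sup>+y. F y * indicator I y \<partial>?N)"
      using J J' by (intro sum_mono) (auto simp: large_average_intervals_def intro: less_imp_le)
    also have "\<dots> = (\<integral>\<^sup>+y. (\<Sum>I\<in>J'. F y * indicator I y) \<partial>?N)"
      using setI J J' by (intro nn_integral_sum[symmetric] borel_measurable_times_ennreal borel_measurable_indicator) auto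
    also have "\<dots> \<le> (\<integral>\<^sup>+y. 2 * F y \<partial>?N)"
    proof (rule nn_integral_mono)
      fix y
      have "(\<Sum>I\<in>J'. F y * indicator I y) = F y * (\<Sum>I\<in>J'. indicator I y)" by (rule sum_distrib_left[symmetric])
      also have "(\<Sum>I\<in>J'. indicator I y :: ennreal) = (\<Sum>I\<in>{I\<in>J'. y \<in> I}. 1)"
        using fJ' by (intro sum.mono_neutral_cong_right) (auto simp: indicator_def)
      also have "\<dots> = of_nat (card {I\<in>J'. y \<in> I})" by simp
      also have "F y * \<dots> \<le> F y * of_nat 2" using J'(3)[of y] by (intro mult_left_mono of_nat_mono) auto
      finally show "(\<Sum>I\<in>J'. F y * indicator I y) \<le> 2 * F y" by (simp add: mult.commute)
    qed
    also have "\<dots> = 2 * (\<integral>\<^sup>+x. F x \<partial>?N)" by (rule nn_integral_cmult) simp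
    finally show ?thesis .
  qed
  have "\<And>S. S \<in> large_average_intervals d F c \<Longrightarrow> open S" by (rule large_average_intervals_open)
  then obtain K where K: "K \<subseteq> large_average_intervals d F c" "countable K" "\<Union>K = \<Union>(large_average_intervals d F c)"
    by (rule Lindelof) blast
  have lev: "{x. 0 < x \<and> c < maxfun d F x} = \<Union>(large_average_intervals d F c)"
    using maxfun_level[of _ c d F] large_average_intervals_open(2)[of d F c] by auto
  show ?thesis
  proof (cases "K = {}")
    case True
    then have U: "\<Union>(large_average_intervals d F c) = {}" using K(3) unfolding \<open>K = {}\<close> by simp
    show ?thesis unfolding lev U by simp
  next
    case False
    define A where "A n = (\<Union>i\<le>n. from_nat_into K i)" for n :: nat
    have A: "A n = \<Union>(from_nat_into K ` {..n})" for n by (simp add: A_def)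
    have sub: "from_nat_into K ` {..n} \<subseteq> large_average_intervals d F c" for n
      using from_nat_into[OF False] K by blast
    have rng: "range (from_nat_into K) = K" using False K by (simp add: range_from_nat_into)
    have U: "(\<Union>n. A n) = \<Union>K"
    proof -
      have "(\<Union>n. A n) = (\<Union>i. from_nat_into K i)" by (auto simp: A_def)
      also have "\<dots> = \<Union>K" using rng by auto
      finally show ?thesis .
    qed
    have "c * emeasure ?N (\<Union>n. A n) = c * (SUP n. emeasure ?N (A n))"
    proof (subst SUP_emeasure_incseq)
      show "range A \<subseteq> sets ?N" using sub setI unfolding A_def
        by (auto intro!: sets.countable_UN sets.finite_UN)
      show "incseq A" unfolding incseq_def A_def by (intro allI impI UN_mono) auto
    qed simp
    also have "\<dots> = (SUP n. c * emeasure ?N (A n))" by (simp add: SUP_mult_left_ennreal)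
    also have "\<dots> \<le> 2 * (\<integral>\<^sup>+x. F x \<partial>?N)"
      unfolding A by (intro SUP_least fin sub) auto
    finally show ?thesis unfolding lev U K(3) .
  qed
qed

section \<open>The maximal function over intervals: strong type\<close>

lemma layer_cake:
  assumes p: "0 < p"
  shows "(\<integral>\<^sup>+s. ennreal (p * s powr (p - 1)) * indicator {s. ennreal s < g} s \<partial>LP) = ennreal_powr g p"
proof -
  have fin: "(\<integral>\<^sup>+s. ennreal (p * s powr (p - 1)) * indicator {..<r} s \<partial>LP) = ennreal (r powr p)" if "0 \<le> r" for r
  proof -
    have "(\<integral>\<^sup>+s. ennreal (p * s powr (p - 1)) * indicator {..<r} s \<partial>LP)
      = (\<integral>\<^sup>+s. ennreal p * (ennreal (s powr (p - 1)) * indicator {..<r} s) \<partial>LP)"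
      using p by (simp add: ennreal_mult mult.assoc)
    also have "\<dots> = ennreal p * (\<integral>\<^sup>+s. ennreal (s powr (p - 1)) * indicator {..<r} s \<partial>LP)"
      by (rule nn_integral_cmult) (rule borel_LP, measurable)
    also have "\<dots> = ennreal (r powr p)"
      using p that by (subst nn_integral_powr_lessThan) (auto simp: ennreal_mult[symmetric])
    finally show ?thesis .
  qed
  show ?thesis
  proof (cases g)
    case (real r)
    have "(\<integral>\<^sup>+s. ennreal (p * s powr (p - 1)) * indicator {s. ennreal s < g} s \<partial>LP)
       = (\<integral>\<^sup>+s. ennreal (p * s powr (p - 1)) * indicator {..<r} s \<partial>LP)"
      using real by (intro nn_integral_cong) (auto simp: indicator_def ennreal_less_iff)
    then show ?thesis using fin real by simp
  next
    case top
    let ?I = "\<integral>\<^sup>+s. ennreal (p * s powr (p - 1)) * indicator {s. ennreal s < g} s \<partial>LP"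
    have le: "ennreal (r powr p) \<le> ?I" if "0 \<le> r" for r
      unfolding fin[OF that, symmetric] using top by (intro nn_integral_mono) (auto simp: indicator_def)
    have "?I = \<top>"
    proof (cases ?I)
      case (real s)
      have "ennreal (((s + 1) powr (1 / p)) powr p) \<le> ?I" by (rule le) simp
      then show ?thesis using real p by (simp add: powr_powr ennreal_le_iff)
    qed
    then show ?thesis using top by simp
  qed
qed

lemma mult_ennreal_powr_minus_one: "F * ennreal_powr F (p - 1) = ennreal_powr F p"
proof (cases F)
  case (real r)
  have "r * r powr (p - 1) = r powr p" using real by (cases "r = 0") (auto simp: powr_diff)
  then show ?thesis using real by (simp add: ennreal_mult[symmetric])
qed simp

text \<open>
  The part of $F$ below $g/2$ contributes at most $g/2$ to any average, so only the part above $g/2$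
  has to produce the other half.
\<close>

lemma maxfun_weak_truncated:
  assumes [measurable]: "F \<in> borel_measurable LP" and g: "0 < g"
  shows "emeasure (power_measure d) {x. 0 < x \<and> ennreal g < maxfun d F x}
     \<le> ennreal (4 / g) * (\<integral>\<^sup>+x. F x * indicator {z. ennreal (g / 2) < z} (F x) \<partial>power_measure d)"
proof -
  let ?N = "power_measure d"
  define F1 where "F1 x = F x * indicator {z. ennreal (g / 2) < z} (F x)" for x
  have [measurable]: "F1 \<in> borel_measurable LP" unfolding F1_def by measurable
  have Fle: "F x \<le> F1 x + ennreal (g / 2)" for x
    by (auto simp: F1_def indicator_def)
  have sub: "large_average_intervals d F (ennreal g) \<subseteq> large_average_intervals d F1 (ennreal (g / 2))"
  proof
    fix I assume "I \<in> large_average_intervals d F (ennreal g)"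
    then obtain a b where I: "I = {a<..<b}" "0 < a" "a < b"
      and lt: "ennreal g * emeasure ?N I < (\<integral>\<^sup>+y. F y * indicator I y \<partial>?N)"
      by (auto simp: large_average_intervals_def)
    have sI [measurable]: "I \<in> sets LP" using I by (auto intro!: borel_set_LP)
    have "(\<integral>\<^sup>+y. F y * indicator I y \<partial>?N) \<le> (\<integral>\<^sup>+y. F1 y * indicator I y + ennreal (g / 2) * indicator I y \<partial>?N)"
      using Fle by (intro nn_integral_mono) (auto simp: indicator_def)
    also have "\<dots> = (\<integral>\<^sup>+y. F1 y * indicator I y \<partial>?N) + ennreal (g / 2) * emeasure ?N I"
      by (subst nn_integral_add) (auto simp: nn_integral_cmult)
    finally have lt2: "ennreal g * emeasure ?N I < (\<integral>\<^sup>+y. F1 y * indicator I y \<partial>?N) + ennreal (g / 2) * emeasure ?N I"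
      using lt by (rule less_le_trans[rotated])
    \<comment> \<open>The measure of the interval is finite, so the contribution of the small part may be subtracted.\<close>
    obtain n where n: "emeasure ?N I = ennreal n" "0 \<le> n"
      using power_measure_interval(4)[OF I(2,3), of d] I(1) by (cases "emeasure ?N I") auto
    have "ennreal (g / 2) * emeasure ?N I < (\<integral>\<^sup>+y. F1 y * indicator I y \<partial>?N)"
    proof (cases "\<integral>\<^sup>+y. F1 y * indicator I y \<partial>?N")
      case (real r)
      have e1: "ennreal c * ennreal n = ennreal (c * n)" if "0 \<le> c" for c
        using n that by (intro ennreal_mult[symmetric]) auto
      have e2: "ennreal r + ennreal (g / 2 * n) = ennreal (r + g / 2 * n)"
        using n g real by (intro ennreal_plus[symmetric]) auto
      have "ennreal g * ennreal n < ennreal r + ennreal (g / 2) * ennreal n"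
        using lt2 unfolding n(1) real(2) .
      then have "ennreal (g * n) < ennreal (r + g / 2 * n)"
        using e1[of g] e1[of "g / 2"] e2 g by simp
      then have "g * n < r + g / 2 * n" using n g by (simp add: ennreal_less_iff)
      then have "g / 2 * n < r" by simp
      then have "ennreal (g / 2 * n) < ennreal r" using n g by (subst ennreal_less_iff) auto
      then show ?thesis unfolding n(1) real(2) using e1[of "g / 2"] g by simp
    next
      case top
      then show ?thesis unfolding n(1) top by (simp add: ennreal_mult_less_top)
    qed
    then show "I \<in> large_average_intervals d F1 (ennreal (g / 2))" using I by (auto simp: large_average_intervals_def)
  qed
  have "{x. 0 < x \<and> ennreal g < maxfun d F x} \<subseteq> {x. 0 < x \<and> ennreal (g / 2) < maxfun d F1 x}"
  proof
    fix x assume "x \<in> {x. 0 < x \<and> ennreal g < maxfun d F x}"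
    then have x: "0 < x" "ennreal g < maxfun d F x" by auto
    then have "x \<in> \<Union>(large_average_intervals d F (ennreal g))" by (simp only: maxfun_level)
    then have "x \<in> \<Union>(large_average_intervals d F1 (ennreal (g / 2)))" using Union_mono[OF sub] by (rule rev_subsetD)
    then show "x \<in> {x. 0 < x \<and> ennreal (g / 2) < maxfun d F1 x}" using x by (simp only: maxfun_level mem_Collect_eq simp_thms)
  qed
  then have "emeasure ?N {x. 0 < x \<and> ennreal g < maxfun d F x} \<le> emeasure ?N {x. 0 < x \<and> ennreal (g / 2) < maxfun d F1 x}"
  proof (rule emeasure_mono)
    have "{x \<in> space LP. ennreal (g / 2) < maxfun d F1 x} \<in> sets LP" by measurable
    then show "{x. 0 < x \<and> ennreal (g / 2) < maxfun d F1 x} \<in> sets ?N" by simp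
  qed
  also have "\<dots> = ennreal (2 / g) * (ennreal (g / 2) * emeasure ?N {x. 0 < x \<and> ennreal (g / 2) < maxfun d F1 x})"
    using g by (simp add: mult.assoc[symmetric] ennreal_mult[symmetric])
  also have "\<dots> \<le> ennreal (2 / g) * (2 * (\<integral>\<^sup>+x. F1 x \<partial>?N))"
    by (intro mult_left_mono maxfun_weak) auto
  also have "\<dots> = ennreal (4 / g) * (\<integral>\<^sup>+x. F1 x \<partial>?N)"
  proof -
    have "ennreal (2 / g) * 2 = ennreal (2 / g) * ennreal 2" by simp
    also have "\<dots> = ennreal (4 / g)" using g by (subst ennreal_mult[symmetric]) auto
    finally show ?thesis by (simp add: mult.assoc[symmetric])
  qed
  finally show ?thesis unfolding F1_def .
qed

text \<open>
  Marcinkiewicz interpolation between weak type $(1,1)$ and the trivial bound at infinity: insert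
  the truncated weak estimate in the layer cake formula and integrate first in the level. The inner
  integral of $s^{p-2}$ over $s < 2F$ converges because of $p > 1$.
\<close>

lemma maxfun_strong_bound:
  fixes p d :: real
  assumes p: "1 < p"
  shows "\<exists>C>0. \<forall>F\<in>borel_measurable LP. weighted_integral d p (maxfun d F)
     \<le> ennreal C * weighted_integral d p F"
proof (intro exI[of _ "4 * p / (p - 1) * 2 powr (p - 1)"] conjI ballI)
  show "0 < 4 * p / (p - 1) * 2 powr (p - 1)" using p by simp
  fix F :: "real \<Rightarrow> ennreal" assume F [measurable]: "F \<in> borel_measurable LP"
  let ?G = "maxfun d F"
  have pw [measurable]: "(\<lambda>y::real. y powr c) \<in> borel_measurable LP" for c by (intro borel_LP) measurable
  have idm [measurable]: "(\<lambda>y::real. y) \<in> borel_measurable LP" by (rule measurable_LP_id)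
  \<comment> \<open>Measurability of the region below a graph, for both applications of the theorem of Fubini.\<close>
  have sm: "{z \<in> space (LP \<Otimes>\<^sub>M LP). ennreal (snd z) < H (fst z)} \<in> sets (LP \<Otimes>\<^sub>M LP)"
    if [measurable]: "H \<in> borel_measurable LP" for H
  proof -
    have "(\<lambda>z. ennreal (snd z)) \<in> borel_measurable (LP \<Otimes>\<^sub>M LP)"
      by (intro measurable_compose[OF measurable_snd] measurable_compose[OF idm measurable_ennreal])
    moreover have "(\<lambda>z. H (fst z)) \<in> borel_measurable (LP \<Otimes>\<^sub>M LP)"
      by (intro measurable_compose[OF measurable_fst that])
    ultimately show ?thesis by (rule borel_measurable_less)
  qed
  have im: "(\<lambda>(x, s). indicator {s. ennreal s < H x} s :: ennreal) \<in> borel_measurable (LP \<Otimes>\<^sub>M LP)"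
    if H: "H \<in> borel_measurable LP" for H
  proof -
    have "(indicator {z \<in> space (LP \<Otimes>\<^sub>M LP). ennreal (snd z) < H (fst z)} :: _ \<Rightarrow> ennreal) \<in> borel_measurable (LP \<Otimes>\<^sub>M LP)"
      by (intro borel_measurable_indicator sm[OF H])
    also have "?this \<longleftrightarrow> ?thesis"
      by (intro measurable_cong) (auto simp: indicator_def space_pair_measure)
    finally show ?thesis .
  qed
  have wm: "(\<lambda>x. ennreal (x powr d)) \<in> borel_measurable LP" by measurable
  have sG: "{x \<in> space LP. ennreal s < ?G x} \<in> sets LP" for s by measurable
  let ?K = "\<lambda>x s. ennreal (x powr d) * (ennreal (p * s powr (p - 1)) * indicator {s. ennreal s < ?G x} s)"
  let ?H = "\<lambda>x s. ennreal (x powr d) * (F x * (ennreal (4 * p * s powr (p - 2)) * indicator {s. ennreal s < 2 * F x} s))"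
  have Km: "(\<lambda>(x, s). ?K x s) \<in> borel_measurable (LP \<Otimes>\<^sub>M LP)"
    using im[OF maxfun_measurable[of d F]] by measurable
  have F2: "(\<lambda>x. 2 * F x) \<in> borel_measurable LP" by measurable
  have Hm: "(\<lambda>(x, s). ?H x s) \<in> borel_measurable (LP \<Otimes>\<^sub>M LP)"
    using im[OF F2] by measurable
  have "weighted_integral d p ?G = (\<integral>\<^sup>+x. (\<integral>\<^sup>+s. ?K x s \<partial>LP) \<partial>LP)"
  proof (rule nn_integral_cong)
    fix x assume "x \<in> space LP"
    have "(\<lambda>s. ennreal (p * s powr (p - 1)) * indicator {s. ennreal s < ?G x} s) \<in> borel_measurable LP"
      by (rule borel_LP) measurable
    from nn_integral_cmult[OF this, of "ennreal (x powr d)"]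
    show "ennreal (x powr d) * ennreal_powr (?G x) p = (\<integral>\<^sup>+s. ?K x s \<partial>LP)"
      using p by (simp add: layer_cake)
  qed
  also have "\<dots> = (\<integral>\<^sup>+s. (\<integral>\<^sup>+x. ?K x s \<partial>LP) \<partial>LP)"
    by (rule LP2.Fubini'[OF Km, symmetric])
  also have "\<dots> \<le> (\<integral>\<^sup>+s. (\<integral>\<^sup>+x. ?H x s \<partial>LP) \<partial>LP)"
  proof (rule nn_integral_mono)
    fix s assume "s \<in> space LP"
    then have s: "0 < s" by simp
    have "(\<integral>\<^sup>+x. ?K x s \<partial>LP) = (\<integral>\<^sup>+x. ennreal (p * s powr (p - 1)) * (ennreal (x powr d) * indicator {x \<in> space LP. ennreal s < ?G x} x) \<partial>LP)"
      by (intro nn_integral_cong) (auto simp: indicator_def mult_ac)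
    also have "\<dots> = ennreal (p * s powr (p - 1)) * (\<integral>\<^sup>+x. ennreal (x powr d) * indicator {x \<in> space LP. ennreal s < ?G x} x \<partial>LP)"
      using sG by (intro nn_integral_cmult borel_measurable_times_ennreal borel_measurable_indicator) auto
    also have "\<dots> = ennreal (p * s powr (p - 1)) * emeasure (power_measure d) {x. 0 < x \<and> ennreal s < ?G x}"
      using sG[of s] by (subst emeasure_power_measure) auto
    also have "\<dots> \<le> ennreal (p * s powr (p - 1)) * (ennreal (4 / s) * (\<integral>\<^sup>+x. F x * indicator {z. ennreal (s / 2) < z} (F x) \<partial>power_measure d))"
      by (intro mult_left_mono maxfun_weak_truncated F s) auto
    also have "\<dots> = ennreal (4 * p * s powr (p - 2)) * (\<integral>\<^sup>+x. F x * indicator {z. ennreal (s / 2) < z} (F x) \<partial>power_measure d)"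
    proof -
      have "p * s powr (p - 1) * (4 / s) = 4 * p * s powr (p - 2)"
        using s by (simp add: powr_diff power2_eq_square field_simps)
      then show ?thesis using s p by (simp add: mult.assoc[symmetric] ennreal_mult[symmetric])
    qed
    also have "(\<integral>\<^sup>+x. F x * indicator {z. ennreal (s / 2) < z} (F x) \<partial>power_measure d)
       = (\<integral>\<^sup>+x. ennreal (x powr d) * (F x * indicator {z. ennreal (s / 2) < z} (F x)) \<partial>LP)"
      by (rule nn_integral_power_measure) measurable
    also have "ennreal (4 * p * s powr (p - 2)) * \<dots> = (\<integral>\<^sup>+x. ennreal (4 * p * s powr (p - 2)) * (ennreal (x powr d) * (F x * indicator {z. ennreal (s / 2) < z} (F x))) \<partial>LP)"
      by (rule nn_integral_cmult[symmetric]) measurable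
    also have "\<dots> = (\<integral>\<^sup>+x. ?H x s \<partial>LP)"
    proof (rule nn_integral_cong)
      fix x
      have "ennreal (s / 2) < F x \<longleftrightarrow> ennreal s < 2 * F x"
      proof (cases "F x")
        case (real r)
        have "2 * ennreal r = ennreal (2 * r)" using real by (simp add: ennreal_mult)
        then show ?thesis using real s by (auto simp: ennreal_less_iff)
      qed (auto simp: ennreal_mult_top)
      then show "ennreal (4 * p * s powr (p - 2)) * (ennreal (x powr d) * (F x * indicator {z. ennreal (s / 2) < z} (F x))) = ?H x s"
        by (auto simp: indicator_def mult_ac)
    qed
    finally show "(\<integral>\<^sup>+x. ?K x s \<partial>LP) \<le> (\<integral>\<^sup>+x. ?H x s \<partial>LP)" .
  qed
  also have "\<dots> = (\<integral>\<^sup>+x. (\<integral>\<^sup>+s. ?H x s \<partial>LP) \<partial>LP)"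
    by (rule LP2.Fubini'[OF Hm])
  also have "\<dots> = (\<integral>\<^sup>+x. ennreal (4 * p / (p - 1) * 2 powr (p - 1)) * (ennreal (x powr d) * ennreal_powr (F x) p) \<partial>LP)"
  proof (rule nn_integral_cong)
    fix x
    have m: "(\<lambda>s. ennreal ((p - 1) * s powr (p - 1 - 1)) * indicator {s. ennreal s < 2 * F x} s) \<in> borel_measurable LP"
      by (rule borel_LP) measurable
    have "(\<integral>\<^sup>+s. ?H x s \<partial>LP) = (\<integral>\<^sup>+s. ennreal (x powr d) * F x * ennreal (4 * p / (p - 1)) * (ennreal ((p - 1) * s powr (p - 1 - 1)) * indicator {s. ennreal s < 2 * F x} s) \<partial>LP)"
    proof (rule nn_integral_cong)
      fix s :: real
      have "4 * p * s powr (p - 2) = 4 * p / (p - 1) * ((p - 1) * s powr (p - 1 - 1))" using p by simp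
      then have "ennreal (4 * p * s powr (p - 2)) = ennreal (4 * p / (p - 1)) * ennreal ((p - 1) * s powr (p - 1 - 1))"
        using p by (simp add: ennreal_mult[symmetric])
      then show "?H x s = ennreal (x powr d) * F x * ennreal (4 * p / (p - 1)) * (ennreal ((p - 1) * s powr (p - 1 - 1)) * indicator {s. ennreal s < 2 * F x} s)"
        by (simp only: mult_ac)
    qed
    also have "\<dots> = ennreal (x powr d) * F x * ennreal (4 * p / (p - 1)) * ennreal_powr (2 * F x) (p - 1)"
      using p by (subst nn_integral_cmult[OF m], subst layer_cake) auto
    also have "ennreal_powr (2 * F x) (p - 1) = ennreal (2 powr (p - 1)) * ennreal_powr (F x) (p - 1)"
      using ennreal_powr_ennreal[of 2 "p - 1"] by (simp add: ennreal_powr_mult)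
    also have "ennreal (x powr d) * F x * ennreal (4 * p / (p - 1)) * (ennreal (2 powr (p - 1)) * ennreal_powr (F x) (p - 1))
       = (ennreal (4 * p / (p - 1)) * ennreal (2 powr (p - 1))) * (ennreal (x powr d) * (F x * ennreal_powr (F x) (p - 1)))"
      by (simp only: mult_ac)
    also have "\<dots> = ennreal (4 * p / (p - 1) * 2 powr (p - 1)) * (ennreal (x powr d) * ennreal_powr (F x) p)"
      using p by (subst ennreal_mult[symmetric]) (auto simp: mult_ennreal_powr_minus_one)
    finally show "(\<integral>\<^sup>+s. ?H x s \<partial>LP) = ennreal (4 * p / (p - 1) * 2 powr (p - 1)) * (ennreal (x powr d) * ennreal_powr (F x) p)" .
  qed
  also have "\<dots> = ennreal (4 * p / (p - 1) * 2 powr (p - 1)) * weighted_integral d p F"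
    by (rule nn_integral_cmult) measurable
  finally show "weighted_integral d p ?G
     \<le> ennreal (4 * p / (p - 1) * 2 powr (p - 1)) * weighted_integral d p F" .
qed

section \<open>Pointwise bounds near and far from the diagonal\<close>

text \<open>
  Away from the diagonal the denominator may be replaced by $A = t^2 + x^2 + y^2$; the second bound
  uses $t \le A^{1/2}$ and is uniform in $t$.
\<close>

lemma poisson_model_far:
  assumes t: "0 < t" and A: "sqsum t x y \<le> 5 * (t\<^sup>2 + (x - y)\<^sup>2)"
  shows "poisson_model l t x y \<le> 5 * t * sqsum t x y powr (- (l + 1))"
    and "poisson_model l t x y \<le> 5 * sqsum t x y powr (- (l + 1/2))"
proof -
  define S where "S = sqsum t x y"
  define D where "D = t\<^sup>2 + (x - y)\<^sup>2"
  have S: "0 < S" using sqsum_pos[OF t] by (simp add: S_def)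
  have D: "0 < D" using t by (simp add: D_def add_pos_nonneg)
  have "poisson_model l t x y = t * S powr (- l) * (1 / D)"
    by (simp add: poisson_model_def S_def D_def)
  also have "\<dots> \<le> t * S powr (- l) * (5 / S)"
    using t A S D by (intro mult_left_mono) (auto simp: S_def[symmetric] D_def[symmetric] field_simps)
  also have "\<dots> = 5 * t * (S powr (- l) / S powr 1)" using S by simp
  also have "S powr (- l) / S powr 1 = S powr (- (l + 1))" unfolding powr_diff[symmetric] by simp
  finally show 1: "poisson_model l t x y \<le> 5 * t * sqsum t x y powr (- (l + 1))" by (simp add: S_def)
  have "t = (t\<^sup>2) powr (1/2)" using t by (simp add: powr_half_sqrt)
  also have "\<dots> \<le> S powr (1/2)" by (intro powr_mono2) (auto simp: S_def sqsum_def)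
  finally have "5 * t * S powr (- (l + 1)) \<le> 5 * (S powr (1/2) * S powr (- (l + 1)))" by (simp add: mult_right_mono)
  also have "S powr (1/2) * S powr (- (l + 1)) = S powr (- (l + 1/2))"
  proof -
    have "1/2 + - (l + 1) = - (l + 1/2)" by simp
    then show ?thesis unfolding powr_add[symmetric] by (simp only:)
  qed
  finally show "poisson_model l t x y \<le> 5 * sqsum t x y powr (- (l + 1/2))"
    using 1 by (simp add: S_def)
qed

lemma far_from_diagonal:
  assumes "0 < x" "0 < y" "y \<le> x / 2 \<or> 2 * x \<le> y"
  shows "sqsum t x y \<le> 5 * (t\<^sup>2 + (x - y)\<^sup>2)"
proof -
  have aux: "T + X + Y \<le> 5 * (T + q)" if "X / 4 \<le> q" "Y \<le> X / 4" "0 \<le> T" for T X Y q :: real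
    using that by argo
  have aux': "T + X + Y \<le> 5 * (T + q)" if "Y / 4 \<le> q" "X \<le> Y / 4" "0 \<le> T" for T X Y q :: real
    using that by argo
  show ?thesis
    using assms(3)
  proof
  assume y: "y \<le> x / 2"
  have "(x / 2)\<^sup>2 \<le> (x - y)\<^sup>2" using assms y by (intro power_mono) auto
  moreover have "y\<^sup>2 \<le> (x / 2)\<^sup>2" using assms y by (intro power_mono) auto
  ultimately have "x\<^sup>2 / 4 \<le> (x - y)\<^sup>2" "y\<^sup>2 \<le> x\<^sup>2 / 4" by (simp_all add: power_divide)
  then show ?thesis unfolding sqsum_def by (intro aux) auto
next
  assume y: "2 * x \<le> y"
  have "(y / 2)\<^sup>2 \<le> (y - x)\<^sup>2" using assms y by (intro power_mono) auto
  moreover have "(y - x)\<^sup>2 = (x - y)\<^sup>2" by (rule power2_commute)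
  moreover have "x\<^sup>2 \<le> (y / 2)\<^sup>2" using assms y by (intro power_mono) auto
  ultimately have "y\<^sup>2 / 4 \<le> (x - y)\<^sup>2" "x\<^sup>2 \<le> y\<^sup>2 / 4" by (simp_all add: power_divide)
  then show ?thesis unfolding sqsum_def by (intro aux') auto
qed
qed

lemma sqsum_powr_le:
  assumes "0 < x" "0 < y" "0 < t" "0 \<le> c" "z = x \<or> z = y \<or> z = t"
  shows "sqsum t x y powr (- c) \<le> z powr (- (2 * c))"
proof -
  have "0 < z" using assms by auto
  have "z\<^sup>2 \<le> sqsum t x y" using assms(5) by (auto simp: sqsum_def)
  then have "sqsum t x y powr (- c) \<le> (z\<^sup>2) powr (- c)" using assms \<open>0 < z\<close> by (intro powr_mono2') auto
  also have "z\<^sup>2 = z powr 2" using \<open>0 < z\<close> by (simp add: powr_numeral)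
  also have "(z powr 2) powr (- c) = z powr (- (2 * c))" by (simp only: powr_powr mult_minus_right)
  finally show ?thesis .
qed

lemma poisson_model_below:
  assumes l: "l > -1/2" and "0 < t" "0 < x" "0 < y" "y \<le> x / 2"
  shows "poisson_model l t x y * y powr (2 * l) \<le> 5 * (x powr (- (2 * l + 1)) * y powr (2 * l))"
proof -
  have "poisson_model l t x y \<le> 5 * sqsum t x y powr (- (l + 1/2))"
    using assms by (intro poisson_model_far far_from_diagonal) auto
  also have "sqsum t x y powr (- (l + 1/2)) \<le> x powr (- (2 * (l + 1/2)))"
    using assms by (intro sqsum_powr_le) auto
  also have "- (2 * (l + 1/2)) = - (2 * l + 1)" by simp
  finally have "poisson_model l t x y \<le> 5 * x powr (- (2 * l + 1))" by simp
  from mult_right_mono[OF this, of "y powr (2 * l)"] show ?thesis by (simp add: mult.assoc)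
qed

text \<open>
  The first bound, uniform in $t$, is the kernel of the dual Hardy operator, but $1/y$ is not
  integrable at infinity; the other two, for small and large $y/t$, serve the uniform bound of the
  total mass.
\<close>

lemma poisson_model_above:
  assumes l: "l > -1/2" and "0 < t" "0 < x" "0 < y" "2 * x \<le> y"
  shows "poisson_model l t x y * y powr (2 * l) \<le> 5 * y powr (- 1)"
    and "poisson_model l t x y * y powr (2 * l) \<le> 5 * (t powr (- (2 * l + 1)) * y powr (2 * l))"
    and "poisson_model l t x y * y powr (2 * l) \<le> 5 * (t * y powr (- 2))"
proof -
  have 0: "sqsum t x y \<le> 5 * (t\<^sup>2 + (x - y)\<^sup>2)" using assms by (intro far_from_diagonal) auto
  have 1: "poisson_model l t x y \<le> 5 * z powr (- (2 * l + 1))" if "z = y \<or> z = t" for z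
  proof -
    have "poisson_model l t x y \<le> 5 * sqsum t x y powr (- (l + 1/2))"
      using assms 0 by (intro poisson_model_far) auto
    also have "sqsum t x y powr (- (l + 1/2)) \<le> z powr (- (2 * (l + 1/2)))"
      using assms that by (intro sqsum_powr_le) auto
    also have "- (2 * (l + 1/2)) = - (2 * l + 1)" by simp
    finally show ?thesis by simp
  qed
  have "poisson_model l t x y * y powr (2 * l) \<le> 5 * y powr (- (2 * l + 1)) * y powr (2 * l)"
    by (intro mult_right_mono 1) auto
  also have "\<dots> = 5 * y powr (- (2 * l + 1) + 2 * l)" by (simp only: powr_add mult.assoc)
  also have "- (2 * l + 1) + 2 * l = - 1" by simp
  finally show "poisson_model l t x y * y powr (2 * l) \<le> 5 * y powr (- 1)" .
  show "poisson_model l t x y * y powr (2 * l) \<le> 5 * (t powr (- (2 * l + 1)) * y powr (2 * l))"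
    using mult_right_mono[OF 1[of t], of "y powr (2 * l)"] by (simp add: mult.assoc)
  have "poisson_model l t x y \<le> 5 * t * sqsum t x y powr (- (l + 1))"
    using assms 0 by (intro poisson_model_far) auto
  also have "\<dots> \<le> 5 * t * y powr (- (2 * (l + 1)))"
    using assms by (intro mult_left_mono sqsum_powr_le) auto
  finally have "poisson_model l t x y * y powr (2 * l) \<le> 5 * t * y powr (- (2 * (l + 1))) * y powr (2 * l)"
    by (intro mult_right_mono) auto
  also have "\<dots> = 5 * t * y powr (- (2 * (l + 1)) + 2 * l)" by (simp only: powr_add mult.assoc)
  also have "- (2 * (l + 1)) + 2 * l = - 2" by simp
  finally show "poisson_model l t x y * y powr (2 * l) \<le> 5 * (t * y powr (- 2))" by (simp add: mult.assoc)
qed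

text \<open>
  The classical Poisson kernel of the half-plane appears, plus an average over $(x/2, 2x)$ that
  accounts for $t$ larger than $x$.
\<close>

lemma poisson_model_near:
  assumes l: "l > -1/2" and "0 < t" "0 < x" "0 < y" "x / 2 < y" "y < 2 * x"
  shows "poisson_model l t x y * y powr (2 * l) \<le> 5 * (t / (t\<^sup>2 + (x - y)\<^sup>2) + 1 / x)"
proof -
  define A where "A = sqsum t x y / y\<^sup>2"
  define D where "D = t\<^sup>2 + (x - y)\<^sup>2"
  have D: "0 < D" using assms by (simp add: D_def add_pos_nonneg)
  have A1: "1 \<le> A" using assms by (simp add: A_def sqsum_def)
  have "y powr (2 * l) = (y\<^sup>2) powr l" using assms by (simp add: powr_powr flip: powr_numeral)
  then have m: "poisson_model l t x y * y powr (2 * l) = A powr (- l) * (t / D)"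
    using assms sqsum_pos[of t x y]
    by (simp add: poisson_model_def A_def D_def powr_divide powr_minus field_simps)
  \<comment> \<open>Here l > -1/2 enters, as A is at least 1.\<close>
  have "A powr (- l) \<le> A powr (1/2)" using A1 l by (intro powr_mono) auto
  also have "\<dots> = sqrt A" using A1 by (simp add: powr_half_sqrt)
  also have "\<dots> = sqrt (sqsum t x y) / y" using assms by (simp add: A_def real_sqrt_divide)
  also have "\<dots> \<le> (t + 3 * y) / y"
  proof (rule divide_right_mono)
    have "sqrt (sqsum t x y) \<le> t + x + y"
      using assms by (intro real_le_lsqrt) (auto simp: sqsum_def power2_eq_square algebra_simps)
    then show "sqrt (sqsum t x y) \<le> t + 3 * y" using assms by simp
  qed (use assms in simp)
  also have "\<dots> = t / y + 3" using assms by (simp add: add_divide_distrib)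
  also have "\<dots> \<le> t / (x / 2) + 3" using assms by (intro add_right_mono divide_left_mono) auto
  finally have "A powr (- l) \<le> 2 * t / x + 3" using assms by (simp add: mult.commute)
  then have "A powr (- l) * (t / D) \<le> (2 * t / x + 3) * (t / D)" using assms D by (intro mult_right_mono) auto
  also have "\<dots> = 2 / x * (t\<^sup>2 / D) + 3 * (t / D)" by (simp add: distrib_right add_divide_distrib power2_eq_square)
  also have "2 / x * (t\<^sup>2 / D) \<le> 2 / x * 1" using assms D by (intro mult_left_mono) (auto simp: D_def)
  also have "2 / x * 1 + 3 * (t / D) \<le> 5 * (t / D + 1 / x)" using assms D by (simp add: distrib_left field_simps)
  finally show ?thesis unfolding m D_def by simp
qed

text \<open>
  The smallest dyadic dilate of $(-t, t)$ containing $u$ gives a term that already suffices.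
\<close>

lemma poisson_dyadic_bound:
  fixes t u :: real
  assumes t: "0 < t"
  shows "ennreal (t / (t\<^sup>2 + u\<^sup>2)) \<le> (\<Sum>j. ennreal (4 / (4 ^ j * t)) * indicator {u. \<bar>u\<bar> < 2 ^ j * t} u)"
proof -
  define P where "P j \<longleftrightarrow> \<bar>u\<bar> < 2 ^ j * t" for j :: nat
  have "\<exists>j. P j"
  proof -
    obtain j where "\<bar>u\<bar> / t < 2 ^ j" using real_arch_pow[of 2 "\<bar>u\<bar> / t"] by auto
    then show ?thesis using t by (intro exI[of _ j]) (simp add: P_def field_simps)
  qed
  define j where "j = (LEAST j. P j)"
  have Pj: "P j" unfolding j_def using \<open>\<exists>j. P j\<close> by (rule LeastI_ex)
  have "t / (t\<^sup>2 + u\<^sup>2) \<le> 4 / (4 ^ j * t)"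
  proof (cases j)
    case 0
    have "t / (t\<^sup>2 + u\<^sup>2) \<le> t / t\<^sup>2" using t by (intro divide_left_mono) (auto simp: add_pos_nonneg)
    also have "\<dots> = 1 / t" using t by (simp add: power2_eq_square)
    also have "\<dots> \<le> 4 / t" using t by (intro divide_right_mono) auto
    finally show ?thesis using 0 by simp
  next
    case (Suc i)
    then have "\<not> P i" using not_less_Least[of i P] by (simp add: j_def)
    then have "2 ^ i * t \<le> \<bar>u\<bar>" by (simp add: P_def)
    then have "(2 ^ i * t)\<^sup>2 \<le> \<bar>u\<bar>\<^sup>2" using t by (intro power_mono) auto
    moreover have "(2 ^ i)\<^sup>2 = (4::real) ^ i" by (simp add: power2_eq_square power_mult_distrib[symmetric])
    ultimately have "4 ^ i * t\<^sup>2 \<le> t\<^sup>2 + u\<^sup>2"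
      by (simp add: power_mult_distrib add_increasing)
    then have "t / (t\<^sup>2 + u\<^sup>2) \<le> t / (4 ^ i * t\<^sup>2)" using t by (intro divide_left_mono) (auto simp: add_pos_nonneg)
    also have "\<dots> = 4 / (4 ^ j * t)" using t Suc by (simp add: power2_eq_square)
    finally show ?thesis .
  qed
  then have "ennreal (t / (t\<^sup>2 + u\<^sup>2)) \<le> ennreal (4 / (4 ^ j * t)) * indicator {u. \<bar>u\<bar> < 2 ^ j * t} u"
    using Pj by (simp add: P_def ennreal_leI)
  also have "\<dots> \<le> (\<Sum>j. ennreal (4 / (4 ^ j * t)) * indicator {u. \<bar>u\<bar> < 2 ^ j * t} u)"
    using sum_le_suminf[OF summableI, of "{j}" "\<lambda>j. ennreal (4 / (4 ^ j * t)) * indicator {u. \<bar>u\<bar> < 2 ^ j * t} u"]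
    by (simp only: finite.intros sum.insert empty_iff sum.empty add_0_right ball_simps simp_thms zero_le if_True)
  finally show ?thesis .
qed

text \<open>
  On $(x/2, 2x)$ the weight $y^d$ is constant up to the factor $4^{|d|}$, so averages with respect
  to Lebesgue measure and to $y^d dy$ are comparable there.
\<close>

lemma local_average_le_maxfun:
  assumes F [measurable]: "F \<in> borel_measurable LP" and x: "0 < x" and r: "0 < r"
  shows "(\<integral>\<^sup>+y. F y * indicator ({x - r<..<x + r} \<inter> {x / 2<..<2 * x}) y \<partial>LP) \<le> ennreal (2 * 4 powr \<bar>d\<bar> * r) * maxfun d F x"
proof -
  define a where "a = max (x - r) (x / 2)"
  define b where "b = min (x + r) (2 * x)"
  \<comment> \<open>The smallest value of y^d on (x/2, 2x) is at least 1/M.\<close>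
  define M where "M = 2 powr \<bar>d\<bar> * x powr (- d)"
  let ?N = "power_measure d" and ?I = "{a<..<b}"
  have ab: "x / 2 \<le> a" "a < x" "x < b" "b \<le> 2 * x" "b - a \<le> 2 * r" using x r by (auto simp: a_def b_def)
  have a0: "0 < a" using ab x by linarith
  have I: "{x - r<..<x + r} \<inter> {x / 2<..<2 * x} = ?I" by (auto simp: a_def b_def)
  have sI [measurable]: "?I \<in> sets LP" using a0 by (intro borel_set_LP) auto
  have half: "(x / 2) powr d \<le> 2 powr \<bar>d\<bar> * x powr d" "(2 * x) powr d \<le> 2 powr \<bar>d\<bar> * x powr d"
    "2 powr (- \<bar>d\<bar>) * x powr d \<le> (x / 2) powr d" "2 powr (- \<bar>d\<bar>) * x powr d \<le> (2 * x) powr d"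
  proof -
    have h: "(x / 2) powr d = 2 powr (- d) * x powr d" "(2 * x) powr d = 2 powr d * x powr d"
      using x by (auto simp: powr_divide powr_mult powr_minus field_simps)
    show "(x / 2) powr d \<le> 2 powr \<bar>d\<bar> * x powr d" "(2 * x) powr d \<le> 2 powr \<bar>d\<bar> * x powr d"
      "2 powr (- \<bar>d\<bar>) * x powr d \<le> (x / 2) powr d" "2 powr (- \<bar>d\<bar>) * x powr d \<le> (2 * x) powr d"
      unfolding h by (auto intro!: mult_right_mono powr_mono)
  qed
  have pt: "2 powr (- \<bar>d\<bar>) * x powr d \<le> y powr d" "y powr d \<le> 2 powr \<bar>d\<bar> * x powr d"
    if "x / 2 \<le> y" "y \<le> 2 * x" for y
    using powr_between[of "x / 2" y "2 * x" d] that half x by (auto simp: min_def max_def split: if_splits)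
  have "(\<integral>\<^sup>+y. F y * indicator ?I y \<partial>LP) \<le> (\<integral>\<^sup>+y. ennreal M * (ennreal (y powr d) * (F y * indicator ?I y)) \<partial>LP)"
  proof (rule nn_integral_mono)
    fix y
    have "1 \<le> M * y powr d" if "y \<in> ?I"
    proof -
      have "1 = M * (2 powr (- \<bar>d\<bar>) * x powr d)" using x by (simp add: M_def powr_minus field_simps)
      also have "\<dots> \<le> M * y powr d" using that ab by (intro mult_left_mono pt) (auto simp: M_def)
      finally show ?thesis .
    qed
    then have "1 \<le> ennreal M * ennreal (y powr d)" if "y \<in> ?I"
      using that by (simp add: ennreal_mult[symmetric] M_def)
    from mult_right_mono[OF this, of "F y"]
    show "F y * indicator ?I y \<le> ennreal M * (ennreal (y powr d) * (F y * indicator ?I y))"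
      by (auto simp: indicator_def mult_ac)
  qed
  also have "\<dots> = ennreal M * (\<integral>\<^sup>+y. ennreal (y powr d) * (F y * indicator ?I y) \<partial>LP)"
  proof -
    have [measurable]: "(\<lambda>y::real. y powr d) \<in> borel_measurable LP" by (intro borel_LP) measurable
    show ?thesis by (rule nn_integral_cmult) measurable
  qed
  also have "(\<integral>\<^sup>+y. ennreal (y powr d) * (F y * indicator ?I y) \<partial>LP) = (\<integral>\<^sup>+y. F y * indicator ?I y \<partial>?N)"
    by (rule nn_integral_power_measure[symmetric]) measurable
  also have "\<dots> \<le> maxfun d F x * emeasure ?N ?I"
  proof -
    have "a < b" using ab by simp
    note pm = power_measure_interval(1,4)[OF a0 this, of d]
    have "(\<integral>\<^sup>+y. F y * indicator ?I y \<partial>?N) / emeasure ?N ?I \<le> maxfun d F x"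
      unfolding maxfun_def by (intro SUP_upper CollectI exI conjI refl) (use ab a0 in auto)
    from mult_right_mono[OF this, of "emeasure ?N ?I"]
    have "(\<integral>\<^sup>+y. F y * indicator ?I y \<partial>?N) * (emeasure ?N ?I / emeasure ?N ?I) \<le> maxfun d F x * emeasure ?N ?I"
      by (simp add: ennreal_divide_times)
    moreover have "emeasure ?N ?I / emeasure ?N ?I = 1" using pm by (intro ennreal_divide_self) auto
    ultimately show ?thesis by simp
  qed
  also have "emeasure ?N ?I \<le> ennreal (2 powr \<bar>d\<bar> * x powr d * (2 * r))"
  proof -
    have "emeasure ?N ?I \<le> ennreal (max (a powr d) (b powr d) * (b - a))"
      using a0 ab by (intro power_measure_interval) auto
    also have "\<dots> \<le> ennreal (2 powr \<bar>d\<bar> * x powr d * (2 * r))"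
      using pt[of a] pt[of b] ab r by (intro ennreal_leI mult_mono) auto
    finally show ?thesis .
  qed
  finally have "(\<integral>\<^sup>+y. F y * indicator ?I y \<partial>LP) \<le> ennreal M * (maxfun d F x * ennreal (2 powr \<bar>d\<bar> * x powr d * (2 * r)))"
    by (simp add: mult_left_mono)
  also have "\<dots> = ennreal M * ennreal (2 powr \<bar>d\<bar> * x powr d * (2 * r)) * maxfun d F x" by (simp only: mult_ac)
  also have "ennreal M * ennreal (2 powr \<bar>d\<bar> * x powr d * (2 * r)) = ennreal (M * (2 powr \<bar>d\<bar> * x powr d * (2 * r)))"
    using r by (intro ennreal_mult[symmetric]) (auto simp: M_def)
  also have "M * (2 powr \<bar>d\<bar> * x powr d * (2 * r)) = 2 * 4 powr \<bar>d\<bar> * r"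
  proof -
    have "4 powr \<bar>d\<bar> = 2 powr \<bar>d\<bar> * 2 powr \<bar>d\<bar>" by (simp add: powr_mult[symmetric])
    moreover have "x powr (- d) * x powr d = 1" using x by (simp add: powr_minus)
    ultimately have "2 * 4 powr \<bar>d\<bar> * r = (2 powr \<bar>d\<bar> * 2 powr \<bar>d\<bar>) * (x powr (- d) * x powr d) * (2 * r)" by simp
    then show ?thesis by (simp only: M_def mult_ac)
  qed
  finally show ?thesis unfolding I .
qed

text \<open>
  The dyadic pieces have radius $2^j t$ and height $4/(4^j t)$, so they sum to a geometric series of
  averages. The estimate holds with any exponent $d$ in the maximal function.
\<close>

lemma local_poisson_le_maxfun:
  assumes F [measurable]: "F \<in> borel_measurable LP" and x: "0 < x" and t: "0 < t"
  shows "(\<integral>\<^sup>+y. F y * (ennreal (t / (t\<^sup>2 + (x - y)\<^sup>2) + 1 / x) * indicator {x / 2<..<2 * x} y) \<partial>LP) \<le> ennreal (18 * 4 powr \<bar>d\<bar>) * maxfun d F x"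
proof -
  let ?J = "\<lambda>r. {x - r<..<x + r} \<inter> {x / 2<..<2 * x}"
  have mI: "(\<lambda>y. F y * indicator (?J r) y) \<in> borel_measurable LP" for r
  proof -
    have [measurable]: "(\<lambda>y. indicator (?J r) y :: ennreal) \<in> borel_measurable LP" by (intro borel_LP) measurable
    show ?thesis by measurable
  qed
  have "(\<integral>\<^sup>+y. F y * (ennreal (t / (t\<^sup>2 + (x - y)\<^sup>2) + 1 / x) * indicator {x / 2<..<2 * x} y) \<partial>LP)
    \<le> (\<integral>\<^sup>+y. (\<Sum>j. ennreal (4 / (4 ^ j * t)) * (F y * indicator (?J (2 ^ j * t)) y)) + ennreal (1 / x) * (F y * indicator (?J x) y) \<partial>LP)"
  proof (rule nn_integral_mono)
    fix y :: real
    show "F y * (ennreal (t / (t\<^sup>2 + (x - y)\<^sup>2) + 1 / x) * indicator {x / 2<..<2 * x} y)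
      \<le> (\<Sum>j. ennreal (4 / (4 ^ j * t)) * (F y * indicator (?J (2 ^ j * t)) y)) + ennreal (1 / x) * (F y * indicator (?J x) y)"
    proof (cases "y \<in> {x / 2<..<2 * x}")
      case True
      have Jx: "y \<in> ?J x" using True x by auto
      have ind: "indicator {u. \<bar>u\<bar> < 2 ^ j * t} (x - y) = (indicator (?J (2 ^ j * t)) y :: ennreal)" for j
        using True by (auto simp: indicator_def abs_less_iff)
      have "ennreal (t / (t\<^sup>2 + (x - y)\<^sup>2) + 1 / x) = ennreal (t / (t\<^sup>2 + (x - y)\<^sup>2)) + ennreal (1 / x)"
        using x t by (intro ennreal_plus) auto
      also have "\<dots> \<le> (\<Sum>j. ennreal (4 / (4 ^ j * t)) * indicator (?J (2 ^ j * t)) y) + ennreal (1 / x)"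
        using poisson_dyadic_bound[OF t, of "x - y"] unfolding ind by (intro add_right_mono)
      finally have "F y * ennreal (t / (t\<^sup>2 + (x - y)\<^sup>2) + 1 / x) \<le> F y * ((\<Sum>j. ennreal (4 / (4 ^ j * t)) * indicator (?J (2 ^ j * t)) y) + ennreal (1 / x))"
        by (intro mult_left_mono) auto
      also have "\<dots> = (\<Sum>j. F y * (ennreal (4 / (4 ^ j * t)) * indicator (?J (2 ^ j * t)) y)) + F y * ennreal (1 / x)"
        by (simp add: distrib_left ennreal_suminf_cmult)
      finally show ?thesis using True Jx by (simp add: mult_ac)
    qed simp
  qed
  also have "\<dots> = (\<integral>\<^sup>+y. (\<Sum>j. ennreal (4 / (4 ^ j * t)) * (F y * indicator (?J (2 ^ j * t)) y)) \<partial>LP) + (\<integral>\<^sup>+y. ennreal (1 / x) * (F y * indicator (?J x) y) \<partial>LP)"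
    by (rule nn_integral_add) (intro borel_measurable_suminf_order borel_measurable_times_ennreal borel_measurable_const mI)+
  also have "(\<integral>\<^sup>+y. (\<Sum>j. ennreal (4 / (4 ^ j * t)) * (F y * indicator (?J (2 ^ j * t)) y)) \<partial>LP)
     = (\<Sum>j. \<integral>\<^sup>+y. ennreal (4 / (4 ^ j * t)) * (F y * indicator (?J (2 ^ j * t)) y) \<partial>LP)"
    by (rule nn_integral_suminf) (intro borel_measurable_times_ennreal borel_measurable_const mI)
  also have "\<dots> = (\<Sum>j. ennreal (4 / (4 ^ j * t)) * (\<integral>\<^sup>+y. F y * indicator (?J (2 ^ j * t)) y \<partial>LP))"
    by (intro suminf_cong nn_integral_cmult mI)
  also have "\<dots> \<le> (\<Sum>j. ennreal (8 * 4 powr \<bar>d\<bar> * (1 / 2) ^ j) * maxfun d F x)"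
  proof (intro suminf_le summableI)
    fix j :: nat
    have "ennreal (4 / (4 ^ j * t)) * (\<integral>\<^sup>+y. F y * indicator (?J (2 ^ j * t)) y \<partial>LP) \<le>
       ennreal (4 / (4 ^ j * t)) * (ennreal (2 * 4 powr \<bar>d\<bar> * (2 ^ j * t)) * maxfun d F x)"
      using t x by (intro mult_left_mono local_average_le_maxfun F) auto
    also have "\<dots> = ennreal (4 / (4 ^ j * t) * (2 * 4 powr \<bar>d\<bar> * (2 ^ j * t))) * maxfun d F x"
      using t by (subst ennreal_mult) (auto simp: mult.assoc)
    also have "4 / (4 ^ j * t) * (2 * 4 powr \<bar>d\<bar> * (2 ^ j * t)) = 8 * 4 powr \<bar>d\<bar> * (1 / 2) ^ j"
    proof -
      have "(4::real) ^ j = 2 ^ j * 2 ^ j" by (simp add: power_mult_distrib[symmetric])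
      then show ?thesis using t by (simp add: power_divide field_simps)
    qed
    finally show "ennreal (4 / (4 ^ j * t)) * (\<integral>\<^sup>+y. F y * indicator (?J (2 ^ j * t)) y \<partial>LP) \<le> ennreal (8 * 4 powr \<bar>d\<bar> * (1 / 2) ^ j) * maxfun d F x" .
  qed
  also have "\<dots> = (\<Sum>j. ennreal (8 * 4 powr \<bar>d\<bar> * (1 / 2) ^ j)) * maxfun d F x"
    by (simp add: ennreal_suminf_multc)
  also have "(\<Sum>j. ennreal (8 * 4 powr \<bar>d\<bar> * (1 / 2) ^ j)) = ennreal (16 * 4 powr \<bar>d\<bar>)"
  proof -
    have s: "(\<lambda>j. 8 * 4 powr \<bar>d\<bar> * (1 / 2) ^ j) sums (8 * 4 powr \<bar>d\<bar> * (1 / (1 - 1 / 2)))"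
      by (intro sums_mult geometric_sums) simp
    then show ?thesis by (subst suminf_ennreal2) (auto simp: sums_iff)
  qed
  also have "(\<integral>\<^sup>+y. ennreal (1 / x) * (F y * indicator (?J x) y) \<partial>LP) = ennreal (1 / x) * (\<integral>\<^sup>+y. F y * indicator (?J x) y \<partial>LP)"
    by (intro nn_integral_cmult mI)
  also have "\<dots> \<le> ennreal (1 / x) * (ennreal (2 * 4 powr \<bar>d\<bar> * x) * maxfun d F x)"
    using x by (intro mult_left_mono local_average_le_maxfun F) auto
  also have "\<dots> = ennreal (2 * 4 powr \<bar>d\<bar>) * maxfun d F x"
    using x by (simp add: mult.assoc[symmetric] ennreal_mult[symmetric])
  also have "ennreal (16 * 4 powr \<bar>d\<bar>) * maxfun d F x + ennreal (2 * 4 powr \<bar>d\<bar>) * maxfun d F x = ennreal (18 * 4 powr \<bar>d\<bar>) * maxfun d F x"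
    by (simp add: distrib_right[symmetric] ennreal_plus[symmetric] del: ennreal_plus)
  finally show ?thesis by (simp add: add_mono)
qed

section \<open>Domination by the interval maximal function and Hardy operators\<close>

text \<open>
  The Poisson maximal function is bounded pointwise by a multiple of this, with the exponent $d$ of
  the maximal function at one's disposal.
\<close>

definition majorant :: "real \<Rightarrow> real \<Rightarrow> (real \<Rightarrow> ennreal) \<Rightarrow> real \<Rightarrow> ennreal" where
  "majorant l d F x = maxfun d F x + hardy_below (2 * l + 1) F x + hardy_above F x"

text \<open>
  The weak type inequality for one pair of functions. All $F$ or only indicators may then be
  quantified over, which makes the same lemmas serve weak and restricted weak type.
\<close>

definition weak_bound :: "real \<Rightarrow> real \<Rightarrow> real \<Rightarrow> (real \<Rightarrow> ennreal) \<Rightarrow> (real \<Rightarrow> ennreal) \<Rightarrow> bool" where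
  "weak_bound d p C G F \<longleftrightarrow> (\<forall>\<gamma>>0. emeasure (power_measure d) {x. 0 < x \<and> ennreal \<gamma> < G x}
     \<le> ennreal (C * \<gamma> powr (- p)) * weighted_integral d p F)"

lemma powr_measurable_LP [measurable]: "(\<lambda>y::real. y powr c) \<in> borel_measurable LP"
  by (intro borel_LP) measurable

lemma less_pair_measurable:
  "{z :: real \<times> real. snd z < fst z} \<in> sets (borel \<Otimes>\<^sub>M borel)"
  "{z :: real \<times> real. fst z < snd z} \<in> sets (borel \<Otimes>\<^sub>M borel)"
  unfolding borel_prod by (intro borel_open open_Collect_less continuous_intros)+

lemma hardy_below_measurable [measurable]:
  assumes [measurable]: "F \<in> borel_measurable LP"
  shows "hardy_below k F \<in> borel_measurable LP"
proof -
  have "(\<lambda>z::real \<times> real. ennreal (fst z powr (- k) * snd z powr (k - 1)) * indicator {z. snd z < fst z} z) \<in> borel_measurable (borel \<Otimes>\<^sub>M borel)"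
    using less_pair_measurable(1) by measurable
  from measurable_LP_pair[OF this]
  have m: "(\<lambda>z::real \<times> real. ennreal (fst z powr (- k) * snd z powr (k - 1)) * indicator {z. snd z < fst z} z) \<in> borel_measurable (LP \<Otimes>\<^sub>M LP)" .
  have "(\<lambda>z. F (snd z) * (ennreal (fst z powr (- k) * snd z powr (k - 1)) * indicator {z. snd z < fst z} z)) \<in> borel_measurable (LP \<Otimes>\<^sub>M LP)"
    by (intro borel_measurable_times_ennreal m measurable_compose[OF measurable_snd assms])
  then have "(\<lambda>x. \<integral>\<^sup>+y. F (snd (x, y)) * (ennreal (fst (x, y) powr (- k) * snd (x, y) powr (k - 1)) * indicator {z. snd z < fst z} (x, y)) \<partial>LP) \<in> borel_measurable LP"
    by (rule LP.borel_measurable_nn_integral_fst)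
  also have "(\<lambda>x. \<integral>\<^sup>+y. F (snd (x, y)) * (ennreal (fst (x, y) powr (- k) * snd (x, y) powr (k - 1)) * indicator {z. snd z < fst z} (x, y)) \<partial>LP) = hardy_below k F"
    by (auto simp: hardy_below_def fun_eq_iff indicator_def intro!: nn_integral_cong)
  finally show ?thesis .
qed

lemma hardy_above_measurable [measurable]:
  assumes [measurable]: "F \<in> borel_measurable LP"
  shows "hardy_above F \<in> borel_measurable LP"
proof -
  have "(\<lambda>z::real \<times> real. ennreal (snd z powr (- 1)) * indicator {z. fst z < snd z} z) \<in> borel_measurable (borel \<Otimes>\<^sub>M borel)"
    using less_pair_measurable(2) by measurable
  from measurable_LP_pair[OF this]
  have m: "(\<lambda>z::real \<times> real. ennreal (snd z powr (- 1)) * indicator {z. fst z < snd z} z) \<in> borel_measurable (LP \<Otimes>\<^sub>M LP)" .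
  have "(\<lambda>z. F (snd z) * (ennreal (snd z powr (- 1)) * indicator {z. fst z < snd z} z)) \<in> borel_measurable (LP \<Otimes>\<^sub>M LP)"
    by (intro borel_measurable_times_ennreal m measurable_compose[OF measurable_snd assms])
  then have "(\<lambda>x. \<integral>\<^sup>+y. F (snd (x, y)) * (ennreal (snd (x, y) powr (- 1)) * indicator {z. fst z < snd z} (x, y)) \<partial>LP) \<in> borel_measurable LP"
    by (rule LP.borel_measurable_nn_integral_fst)
  also have "(\<lambda>x. \<integral>\<^sup>+y. F (snd (x, y)) * (ennreal (snd (x, y) powr (- 1)) * indicator {z. fst z < snd z} (x, y)) \<partial>LP) = hardy_above F"
    by (auto simp: hardy_above_def fun_eq_iff indicator_def intro!: nn_integral_cong)
  finally show ?thesis .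
qed

lemma majorant_measurable [measurable]:
  "F \<in> borel_measurable LP \<Longrightarrow> majorant l d F \<in> borel_measurable LP"
  unfolding majorant_def[abs_def] by (intro borel_measurable_add hardy_below_measurable hardy_above_measurable maxfun_measurable)

lemma level_set_LP: "G \<in> borel_measurable LP \<Longrightarrow> {x. 0 < x \<and> c < G x} \<in> sets LP" for G :: "real \<Rightarrow> ennreal"
proof -
  assume [measurable]: "G \<in> borel_measurable LP"
  have "{x \<in> space LP. c < G x} \<in> sets LP" by measurable
  then show ?thesis by simp
qed

text \<open>
  Chebyshev's inequality.
\<close>

lemma weak_bound_of_strong:
  assumes [measurable]: "G \<in> borel_measurable LP" "F \<in> borel_measurable LP" and p: "0 < p" and C: "0 \<le> C"
    and le: "weighted_integral d p G \<le> ennreal C * weighted_integral d p F"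
  shows "weak_bound d p C G F"
  unfolding weak_bound_def
proof (intro allI impI)
  fix g :: real assume g: "0 < g"
  let ?A = "{x. 0 < x \<and> ennreal g < G x}"
  have A [measurable]: "?A \<in> sets LP" by (rule level_set_LP) fact
  have "ennreal (g powr p) * emeasure (power_measure d) ?A = (\<integral>\<^sup>+x. ennreal (g powr p) * (ennreal (x powr d) * indicator ?A x) \<partial>LP)"
    unfolding emeasure_power_measure[OF A] by (rule nn_integral_cmult[symmetric]) measurable
  also have "\<dots> \<le> weighted_integral d p G"
  proof (rule nn_integral_mono)
    fix x
    have "ennreal (g powr p) \<le> ennreal_powr (G x) p" if "x \<in> ?A"
      using ennreal_powr_mono[of "ennreal g" "G x" p] that g p by (simp add: less_imp_le)
    then show "ennreal (g powr p) * (ennreal (x powr d) * indicator ?A x) \<le> ennreal (x powr d) * ennreal_powr (G x) p"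
      by (auto simp: indicator_def mult.commute intro!: mult_right_mono)
  qed
  also note le
  finally have *: "ennreal (g powr p) * emeasure (power_measure d) ?A \<le> ennreal C * weighted_integral d p F" .
  have "emeasure (power_measure d) ?A = ennreal (g powr (- p)) * (ennreal (g powr p) * emeasure (power_measure d) ?A)"
    using g by (simp add: mult.assoc[symmetric] ennreal_mult[symmetric] powr_add[symmetric])
  also have "\<dots> \<le> ennreal (g powr (- p)) * (ennreal C * weighted_integral d p F)"
    by (intro mult_left_mono *) simp
  also have "\<dots> = (ennreal C * ennreal (g powr (- p))) * weighted_integral d p F"
    by (simp only: mult_ac)
  also have "ennreal C * ennreal (g powr (- p)) = ennreal (C * g powr (- p))"
    using C by (intro ennreal_mult[symmetric]) auto
  finally show "emeasure (power_measure d) ?A \<le> ennreal (C * g powr (- p)) * weighted_integral d p F" .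
qed

text \<open>
  If a sum of three terms exceeds $g$, one of them exceeds $g/3$.
\<close>

lemma weak_bound_sum3:
  assumes [measurable]: "G1 \<in> borel_measurable LP" "G2 \<in> borel_measurable LP" "G3 \<in> borel_measurable LP"
    and w: "weak_bound d p C1 G1 F" "weak_bound d p C2 G2 F" "weak_bound d p C3 G3 F"
    and C: "0 \<le> C1" "0 \<le> C2" "0 \<le> C3"
  shows "weak_bound d p (3 powr p * (C1 + C2 + C3)) (\<lambda>x. G1 x + G2 x + G3 x) F"
  unfolding weak_bound_def
proof (intro allI impI)
  fix g :: real assume g: "0 < g"
  let ?N = "power_measure d" and ?I = "weighted_integral d p F"
  let ?A = "\<lambda>G. {x. 0 < x \<and> ennreal (g / 3) < (G x :: ennreal)}"
  have s: "?A G1 \<in> sets ?N" "?A G2 \<in> sets ?N" "?A G3 \<in> sets ?N"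
    unfolding sets_power_measure by (rule level_set_LP, fact)+
  have "{x. 0 < x \<and> ennreal g < G1 x + G2 x + G3 x} \<subseteq> ?A G1 \<union> ?A G2 \<union> ?A G3"
  proof
    fix x assume x: "x \<in> {x. 0 < x \<and> ennreal g < G1 x + G2 x + G3 x}"
    show "x \<in> ?A G1 \<union> ?A G2 \<union> ?A G3"
    proof (rule ccontr)
      assume "x \<notin> ?A G1 \<union> ?A G2 \<union> ?A G3"
      then have "G1 x + G2 x + G3 x \<le> ennreal (g / 3) + ennreal (g / 3) + ennreal (g / 3)"
        using x by (intro add_mono) auto
      also have "\<dots> = ennreal g" using g by (simp add: ennreal_plus[symmetric] del: ennreal_plus)
      finally show False using x by auto
    qed
  qed
  then have "emeasure ?N {x. 0 < x \<and> ennreal g < G1 x + G2 x + G3 x} \<le> emeasure ?N (?A G1 \<union> ?A G2 \<union> ?A G3)"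
    using s by (intro emeasure_mono) auto
  also have "\<dots> \<le> emeasure ?N (?A G1) + emeasure ?N (?A G2) + emeasure ?N (?A G3)"
    using s by (intro order_trans[OF emeasure_subadditive] add_right_mono emeasure_subadditive) auto
  also have "\<dots> \<le> ennreal (C1 * (g / 3) powr (- p)) * ?I + ennreal (C2 * (g / 3) powr (- p)) * ?I + ennreal (C3 * (g / 3) powr (- p)) * ?I"
    using w g unfolding weak_bound_def by (intro add_mono) auto
  also have "\<dots> = ennreal (C1 * (g / 3) powr (- p) + C2 * (g / 3) powr (- p) + C3 * (g / 3) powr (- p)) * ?I"
    using C by (simp add: distrib_right[symmetric] ennreal_plus[symmetric] del: ennreal_plus)
  also have "C1 * (g / 3) powr (- p) + C2 * (g / 3) powr (- p) + C3 * (g / 3) powr (- p) = 3 powr p * (C1 + C2 + C3) * g powr (- p)"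
  proof -
    have "(g / 3) powr (- p) = 3 powr p * g powr (- p)"
      using g by (simp add: powr_divide powr_minus field_simps)
    then show ?thesis by (simp only: distrib_left distrib_right mult_ac)
  qed
  finally show "emeasure ?N {x. 0 < x \<and> ennreal g < G1 x + G2 x + G3 x} \<le> ennreal (3 powr p * (C1 + C2 + C3) * g powr (- p)) * ?I" .
qed

lemma maxfun_weak_bound:
  assumes p: "1 \<le> p"
  shows "\<exists>C>0. \<forall>F\<in>borel_measurable LP. weak_bound d p C (maxfun d F) F"
proof (cases "p = 1")
  case True
  show ?thesis
  proof (intro exI[of _ 2] conjI ballI)
    fix F :: "real \<Rightarrow> ennreal" assume F [measurable]: "F \<in> borel_measurable LP"
    show "weak_bound d p 2 (maxfun d F) F"
      unfolding weak_bound_def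
    proof (intro allI impI)
      fix g :: real assume g: "0 < g"
      let ?m = "emeasure (power_measure d) {x. 0 < x \<and> ennreal g < maxfun d F x}"
      have "?m = ennreal (1 / g) * (ennreal g * ?m)"
        using g by (simp add: mult.assoc[symmetric] ennreal_mult[symmetric])
      also have "\<dots> \<le> ennreal (1 / g) * (2 * (\<integral>\<^sup>+x. F x \<partial>power_measure d))"
        by (intro mult_left_mono maxfun_weak F) simp
      also have "\<dots> = (2 * ennreal (1 / g)) * (\<integral>\<^sup>+x. F x \<partial>power_measure d)" by (simp only: mult_ac)
      also have "2 * ennreal (1 / g) = ennreal (2 * g powr (- p))"
      proof -
        have "ennreal (2 * (1 / g)) = ennreal 2 * ennreal (1 / g)" using g by (intro ennreal_mult) auto
        then show ?thesis using g True by (simp add: powr_minus divide_inverse)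
      qed
      also have "(\<integral>\<^sup>+x. F x \<partial>power_measure d) = weighted_integral d p F"
        using nn_integral_power_measure[OF F] True by simp
      finally show "?m \<le> ennreal (2 * g powr (- p)) * weighted_integral d p F" .
    qed
  qed simp
next
  case False
  then have "1 < p" using p by simp
  from maxfun_strong_bound[OF this, of d] obtain C where C: "0 < C" "\<And>F. F \<in> borel_measurable LP \<Longrightarrow>
     weighted_integral d p (maxfun d F) \<le> ennreal C * weighted_integral d p F"
    by blast
  show ?thesis
    by (intro exI[of _ C] conjI ballI weak_bound_of_strong C maxfun_measurable) (use p C in auto)
qed

lemma hardy_above_weak_bound:
  assumes p: "1 \<le> p" and d: "-1 < d"
  shows "\<exists>C>0. \<forall>F\<in>borel_measurable LP. weak_bound d p C (hardy_above F) F"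
proof -
  obtain C where C: "0 < C" "\<And>F. F \<in> borel_measurable LP \<Longrightarrow>
     weighted_integral d p (hardy_above F) \<le> ennreal C * weighted_integral d p F"
    using hardy_above_strong[OF p d] by blast
  show ?thesis
    by (intro exI[of _ C] conjI ballI weak_bound_of_strong C hardy_above_measurable) (use p C in auto)
qed

text \<open>
  At the endpoint for $p = 1$ the mass in hardy_below_weak_of_mass is the norm of $F$ itself.
\<close>

lemma hardy_below_weak_bound:
  assumes p: "1 \<le> p" and k: "0 < k" and d: "d < k * p - 1 \<or> p = 1 \<and> d = k - 1"
  shows "\<exists>C>0. \<forall>F\<in>borel_measurable LP. weak_bound d p C (hardy_below k F) F"
  using d
proof
  assume d: "d < k * p - 1"
  obtain C where C: "0 < C" "\<And>F. F \<in> borel_measurable LP \<Longrightarrow>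
     weighted_integral d p (hardy_below k F) \<le> ennreal C * weighted_integral d p F"
    using hardy_below_strong[OF p d] by blast
  show ?thesis
    by (intro exI[of _ C] conjI ballI weak_bound_of_strong C hardy_below_measurable) (use p C in auto)
next
  assume pd: "p = 1 \<and> d = k - 1"
  show ?thesis
  proof (intro exI[of _ "1 / k"] conjI ballI)
    show "0 < 1 / k" using k by simp
    fix F :: "real \<Rightarrow> ennreal" assume F [measurable]: "F \<in> borel_measurable LP"
    show "weak_bound d p (1 / k) (hardy_below k F) F"
      unfolding weak_bound_def
    proof (intro allI impI)
      fix g :: real assume g: "0 < g"
      let ?I = "weighted_integral d p F"
      show "emeasure (power_measure d) {x. 0 < x \<and> ennreal g < hardy_below k F x} \<le> ennreal (1 / k * g powr (- p)) * ?I"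
      proof (cases ?I)
        case (real W)
        have "emeasure (power_measure (k * 1 - 1)) {x. 0 < x \<and> ennreal g < hardy_below k F x} \<le> ennreal (g powr (- 1) * W powr 1 / (k * 1))"
        proof (rule hardy_below_weak_of_mass)
          show "(\<integral>\<^sup>+y. F y * ennreal (y powr (k - 1)) \<partial>LP) \<le> ennreal W"
            using real pd by (simp add: mult.commute)
        qed (use k g real F in \<open>auto intro!: level_set_LP hardy_below_measurable\<close>)
        also have "ennreal (g powr (- 1) * W powr 1 / (k * 1)) = ennreal (1 / k * g powr (- p)) * ennreal W"
          using k g real pd by (subst ennreal_mult[symmetric]) auto
        finally show ?thesis using pd real by simp
      next
        case top
        have "ennreal (1 / k * g powr (- p)) \<noteq> 0" using k g by simp
        then show ?thesis unfolding top ennreal_mult_top by (simp only: if_False top_greatest)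
      qed
    qed
  qed
qed

text \<open>
  At the endpoint for general $p$ the mass of an indicator is controlled by mass_le_power_measure;
  for general $F$ and $p > 1$ it may be infinite.
\<close>

lemma hardy_below_restricted_weak_bound:
  assumes p: "1 \<le> p" and k: "0 < k" and d: "d = k * p - 1"
  shows "\<exists>C>0. \<forall>E\<in>sets LP. emeasure (power_measure d) E < top \<longrightarrow> weak_bound d p C (hardy_below k (indicator E)) (indicator E)"
proof -
  define c where "c = 2 powr p / k powr (p - 1)"
  have c: "0 < c" using k by (simp add: c_def)
  show ?thesis
  proof (intro exI[of _ "c / (k * p)"] conjI ballI impI)
    show "0 < c / (k * p)" using c k p by simp
    fix E assume E [measurable]: "E \<in> sets LP" and fin: "emeasure (power_measure d) E < top"
    then obtain M where M: "emeasure (power_measure d) E = ennreal M" "0 \<le> M" by (cases "emeasure (power_measure d) E") auto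
    have I: "weighted_integral d p (indicator E) = ennreal M"
    proof -
      have "ennreal_powr (indicator E x) p = indicator E x" for x
        using ennreal_powr_ennreal[of 1 p] by (auto simp: indicator_def)
      then show ?thesis using M emeasure_power_measure[OF E] by simp
    qed
    show "weak_bound d p (c / (k * p)) (hardy_below k (indicator E)) (indicator E)"
      unfolding weak_bound_def I
    proof (intro allI impI)
      fix g :: real assume g: "0 < g"
      have "emeasure (power_measure (k * p - 1)) {x. 0 < x \<and> ennreal g < hardy_below k (indicator E) x}
         \<le> ennreal (g powr (- p) * ((c * M) powr (1 / p)) powr p / (k * p))"
      proof (rule hardy_below_weak_of_mass)
        show "(\<integral>\<^sup>+y. indicator E y * ennreal (y powr (k - 1)) \<partial>LP) \<le> ennreal ((c * M) powr (1 / p))"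
          unfolding c_def using mass_le_power_measure[OF k p E] M d by simp
      qed (use k p g in \<open>auto intro!: level_set_LP hardy_below_measurable\<close>)
      also have "g powr (- p) * ((c * M) powr (1 / p)) powr p / (k * p) = c / (k * p) * g powr (- p) * M"
        using c M p by (simp add: powr_powr)
      also have "ennreal (c / (k * p) * g powr (- p) * M) = ennreal (c / (k * p) * g powr (- p)) * ennreal M"
        using c k p M by (intro ennreal_mult) auto
      finally show "emeasure (power_measure d) {x. 0 < x \<and> ennreal g < hardy_below k (indicator E) x} \<le> ennreal (c / (k * p) * g powr (- p)) * ennreal M"
        unfolding d .
    qed
  qed
qed

lemma majorant_weak_bound:
  assumes p: "1 \<le> p" and l: "l > -1/2" and d: "(-1 < d \<and> d < (2 * l + 1) * p - 1) \<or> (p = 1 \<and> d = 2 * l)"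
  shows "\<exists>C>0. \<forall>F\<in>borel_measurable LP. weak_bound d p C (majorant l d F) F"
proof -
  have d1: "-1 < d" using d l by auto
  obtain C1 where C1: "0 < C1" "\<And>F. F \<in> borel_measurable LP \<Longrightarrow> weak_bound d p C1 (maxfun d F) F"
    using maxfun_weak_bound[OF p] by blast
  obtain C2 where C2: "0 < C2" "\<And>F. F \<in> borel_measurable LP \<Longrightarrow> weak_bound d p C2 (hardy_below (2 * l + 1) F) F"
    using hardy_below_weak_bound[OF p, of "2 * l + 1" d] l d by auto
  obtain C3 where C3: "0 < C3" "\<And>F. F \<in> borel_measurable LP \<Longrightarrow> weak_bound d p C3 (hardy_above F) F"
    using hardy_above_weak_bound[OF p d1] by blast
  show ?thesis unfolding majorant_def[abs_def]
    by (intro exI[of _ "3 powr p * (C1 + C2 + C3)"] conjI ballI weak_bound_sum3 C1 C2 C3 less_imp_le[OF C1(1)] less_imp_le[OF C2(1)] less_imp_le[OF C3(1)]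
        maxfun_measurable hardy_below_measurable hardy_above_measurable mult_pos_pos add_pos_pos)
       auto
qed

lemma majorant_restricted_weak_bound:
  assumes p: "1 \<le> p" and l: "l > -1/2" and d: "-1 < d" "d \<le> (2 * l + 1) * p - 1"
  shows "\<exists>C>0. \<forall>E\<in>sets LP. emeasure (power_measure d) E < top \<longrightarrow> weak_bound d p C (majorant l d (indicator E)) (indicator E)"
proof -
  have k: "0 < 2 * l + 1" using l by simp
  have mE: "indicator E \<in> borel_measurable LP" if "E \<in> sets LP" for E :: "real set" using that by simp
  obtain C1 where C1: "0 < C1" "\<And>F. F \<in> borel_measurable LP \<Longrightarrow> weak_bound d p C1 (maxfun d F) F"
    using maxfun_weak_bound[OF p] by blast
  obtain C2 where C2: "0 < C2" "\<And>E. E \<in> sets LP \<Longrightarrow> emeasure (power_measure d) E < top \<Longrightarrow> weak_bound d p C2 (hardy_below (2 * l + 1) (indicator E)) (indicator E)"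
  proof (cases "d = (2 * l + 1) * p - 1")
    case True
    then show ?thesis using hardy_below_restricted_weak_bound[OF p k True] that by blast
  next
    case False
    then have "d < (2 * l + 1) * p - 1" using d by simp
    then obtain C where "0 < C" "\<forall>F\<in>borel_measurable LP. weak_bound d p C (hardy_below (2 * l + 1) F) F"
      using hardy_below_weak_bound[OF p k, of d] by blast
    then show ?thesis using that[of C] mE by blast
  qed
  obtain C3 where C3: "0 < C3" "\<And>F. F \<in> borel_measurable LP \<Longrightarrow> weak_bound d p C3 (hardy_above F) F"
    using hardy_above_weak_bound[OF p d(1)] by blast
  show ?thesis unfolding majorant_def[abs_def]
    by (intro exI[of _ "3 powr p * (C1 + C2 + C3)"] conjI ballI impI weak_bound_sum3 C1 C2 C3 less_imp_le[OF C1(1)] less_imp_le[OF C2(1)] less_imp_le[OF C3(1)]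
        maxfun_measurable hardy_below_measurable hardy_above_measurable mult_pos_pos add_pos_pos mE)
       auto
qed

lemma majorant_strong_bound:
  assumes p: "1 < p" and d: "-1 < d" "d < (2 * l + 1) * p - 1"
  shows "\<exists>C>0. \<forall>F\<in>borel_measurable LP. weighted_integral d p (majorant l d F)
     \<le> ennreal C * weighted_integral d p F"
proof -
  have p1: "1 \<le> p" using p by simp
  let ?N = "\<lambda>F. \<integral>\<^sup>+x. ennreal (x powr d) * ennreal_powr (F x) p \<partial>LP"
  obtain C1 where C1: "0 < C1" "\<And>F. F \<in> borel_measurable LP \<Longrightarrow> ?N (maxfun d F) \<le> ennreal C1 * ?N F"
    using maxfun_strong_bound[OF p, of d] by blast
  obtain C2 where C2: "0 < C2" "\<And>F. F \<in> borel_measurable LP \<Longrightarrow> ?N (hardy_below (2 * l + 1) F) \<le> ennreal C2 * ?N F"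
    using hardy_below_strong[OF p1 d(2)] by blast
  obtain C3 where C3: "0 < C3" "\<And>F. F \<in> borel_measurable LP \<Longrightarrow> ?N (hardy_above F) \<le> ennreal C3 * ?N F"
    using hardy_above_strong[OF p1 d(1)] by blast
  show ?thesis
  proof (intro exI[of _ "3 powr p * (C1 + C2 + C3)"] conjI ballI)
    show "0 < 3 powr p * (C1 + C2 + C3)" using C1 C2 C3 by simp
    fix F :: "real \<Rightarrow> ennreal" assume F [measurable]: "F \<in> borel_measurable LP"
    let ?G1 = "maxfun d F" and ?G2 = "hardy_below (2 * l + 1) F" and ?G3 = "hardy_above F"
    have "?N (majorant l d F) \<le> (\<integral>\<^sup>+x. ennreal (3 powr p) * (ennreal (x powr d) * ennreal_powr (?G1 x) p + ennreal (x powr d) * ennreal_powr (?G2 x) p + ennreal (x powr d) * ennreal_powr (?G3 x) p) \<partial>LP)"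
    proof (rule nn_integral_mono)
      fix x
      show "ennreal (x powr d) * ennreal_powr (majorant l d F x) p \<le> ennreal (3 powr p) * (ennreal (x powr d) * ennreal_powr (?G1 x) p + ennreal (x powr d) * ennreal_powr (?G2 x) p + ennreal (x powr d) * ennreal_powr (?G3 x) p)"
        using mult_left_mono[OF ennreal_powr_add3[of p "?G1 x" "?G2 x" "?G3 x"], of "ennreal (x powr d)"] p
        by (simp add: majorant_def distrib_left mult_ac)
    qed
    also have "\<dots> = ennreal (3 powr p) * (?N ?G1 + ?N ?G2 + ?N ?G3)"
      by (simp add: nn_integral_cmult nn_integral_add)
    also have "\<dots> \<le> ennreal (3 powr p) * (ennreal C1 * ?N F + ennreal C2 * ?N F + ennreal C3 * ?N F)"
      by (intro mult_left_mono add_mono C1 C2 C3 F) auto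
    also have "\<dots> = ennreal (3 powr p) * (ennreal C1 + ennreal C2 + ennreal C3) * ?N F"
      by (simp only: distrib_right mult.assoc)
    also have "ennreal (3 powr p) * (ennreal C1 + ennreal C2 + ennreal C3) = ennreal (3 powr p * (C1 + C2 + C3))"
      using C1 C2 C3 by (simp add: ennreal_mult ennreal_plus[symmetric] less_imp_le del: ennreal_plus)
    finally show "?N (majorant l d F) \<le> ennreal (3 powr p * (C1 + C2 + C3)) * ?N F" .
  qed
qed

text \<open>
  The bound is uniform in $t$, which is what turns it into a bound of the maximal function. The
  three regions $y \le x/2$, $x/2 < y < 2x$ and $y \ge 2x$ correspond to the three summands of the
  majorant.
\<close>

lemma poisson_model_le_majorant:
  assumes l: "l > -1/2" and F [measurable]: "F \<in> borel_measurable LP" and t: "0 < t" and x: "0 < x"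
  shows "(\<integral>\<^sup>+y. F y * ennreal (poisson_model l t x y * y powr (2 * l)) \<partial>LP) \<le> ennreal (90 * 4 powr \<bar>d\<bar>) * majorant l d F x"
proof -
  let ?g1 = "\<lambda>y. F y * (ennreal (t / (t\<^sup>2 + (x - y)\<^sup>2) + 1 / x) * indicator {x / 2<..<2 * x} y)"
  let ?g2 = "\<lambda>y. F y * ennreal (x powr (- (2 * l + 1)) * y powr ((2 * l + 1) - 1)) * indicator {..<x} y"
  let ?g3 = "\<lambda>y. F y * ennreal (y powr (- 1)) * indicator {x<..} y"
  have [measurable]: "(\<lambda>y. indicator {..<x} y :: ennreal) \<in> borel_measurable LP" "(\<lambda>y. indicator {x<..} y :: ennreal) \<in> borel_measurable LP"
    "(\<lambda>y. indicator {x / 2<..<2 * x} y :: ennreal) \<in> borel_measurable LP" "(\<lambda>y::real. y) \<in> borel_measurable LP"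
    by (intro borel_LP, measurable)+
  have "(\<integral>\<^sup>+y. F y * ennreal (poisson_model l t x y * y powr (2 * l)) \<partial>LP) \<le> (\<integral>\<^sup>+y. 5 * (?g1 y + ?g2 y + ?g3 y) \<partial>LP)"
  proof (rule nn_integral_mono)
    fix y assume "y \<in> space LP"
    then have y: "0 < y" by simp
    have F5: "F y * ennreal (poisson_model l t x y * y powr (2 * l)) \<le> 5 * (F y * ennreal K)"
      if "poisson_model l t x y * y powr (2 * l) \<le> 5 * K" "0 \<le> K" for K
    proof -
      have "F y * ennreal (poisson_model l t x y * y powr (2 * l)) \<le> F y * ennreal (5 * K)"
        using that by (intro mult_left_mono ennreal_leI) auto
      also have "ennreal (5 * K) = 5 * ennreal K" using that by (simp add: ennreal_mult)
      finally show ?thesis by (simp add: mult_ac)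
    qed
    consider "y \<le> x / 2" | "x / 2 < y" "y < 2 * x" | "2 * x \<le> y" by linarith
    then show "F y * ennreal (poisson_model l t x y * y powr (2 * l)) \<le> 5 * (?g1 y + ?g2 y + ?g3 y)"
    proof cases
      case 1
      have "F y * ennreal (poisson_model l t x y * y powr (2 * l)) \<le> 5 * (F y * ennreal (x powr (- (2 * l + 1)) * y powr (2 * l)))"
        using poisson_model_below[OF l t x y 1] by (intro F5) auto
      also have "\<dots> = 5 * ?g2 y" using 1 x y by (simp add: mult.assoc)
      also have "\<dots> \<le> 5 * (?g1 y + ?g2 y + ?g3 y)" by (intro mult_left_mono) (auto intro: add_increasing2 add_increasing)
      finally show ?thesis .
    next
      case 2
      have "F y * ennreal (poisson_model l t x y * y powr (2 * l)) \<le> 5 * (F y * ennreal (t / (t\<^sup>2 + (x - y)\<^sup>2) + 1 / x))"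
        using poisson_model_near[OF l t x y 2] t x by (intro F5) auto
      also have "\<dots> = 5 * ?g1 y" using 2 by simp
      also have "\<dots> \<le> 5 * (?g1 y + ?g2 y + ?g3 y)" by (intro mult_left_mono) (auto intro: add_increasing2 simp: add.assoc)
      finally show ?thesis .
    next
      case 3
      have "F y * ennreal (poisson_model l t x y * y powr (2 * l)) \<le> 5 * (F y * ennreal (y powr (- 1)))"
        using poisson_model_above(1)[OF l t x y 3] by (intro F5) auto
      also have "\<dots> = 5 * ?g3 y" using 3 x by simp
      also have "\<dots> \<le> 5 * (?g1 y + ?g2 y + ?g3 y)" by (intro mult_left_mono) (auto intro: add_increasing)
      finally show ?thesis .
    qed
  qed
  also have "\<dots> = 5 * ((\<integral>\<^sup>+y. ?g1 y \<partial>LP) + (\<integral>\<^sup>+y. ?g2 y \<partial>LP) + (\<integral>\<^sup>+y. ?g3 y \<partial>LP))"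
    by (subst nn_integral_cmult, measurable) (subst nn_integral_add, measurable, subst nn_integral_add, measurable)
  also have "(\<integral>\<^sup>+y. ?g2 y \<partial>LP) = hardy_below (2 * l + 1) F x" by (simp only: hardy_below_def)
  also have "(\<integral>\<^sup>+y. ?g3 y \<partial>LP) = hardy_above F x" by (simp only: hardy_above_def)
  also have "5 * ((\<integral>\<^sup>+y. ?g1 y \<partial>LP) + hardy_below (2 * l + 1) F x + hardy_above F x)
     \<le> 5 * (ennreal (18 * 4 powr \<bar>d\<bar>) * maxfun d F x + ennreal (18 * 4 powr \<bar>d\<bar>) * hardy_below (2 * l + 1) F x + ennreal (18 * 4 powr \<bar>d\<bar>) * hardy_above F x)"
  proof -
    have "(1::real) \<le> 4 powr \<bar>d\<bar>" by (rule ge_one_powr_ge_zero) auto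
    then have "1 \<le> ennreal (18 * 4 powr \<bar>d\<bar>)" by (subst ennreal_1[symmetric], intro ennreal_leI) simp
    then have b: "a \<le> ennreal (18 * 4 powr \<bar>d\<bar>) * a" for a using mult_right_mono[of 1 _ a] by simp
    show ?thesis by (intro mult_left_mono add_mono b local_poisson_le_maxfun F x t) simp
  qed
  also have "\<dots> = (5 * ennreal (18 * 4 powr \<bar>d\<bar>)) * majorant l d F x"
    unfolding majorant_def by (simp only: distrib_left mult_ac)
  also have "5 * ennreal (18 * 4 powr \<bar>d\<bar>) = ennreal (90 * 4 powr \<bar>d\<bar>)"
    using ennreal_mult[of 5 "18 * 4 powr \<bar>d\<bar>"] by simp
  finally show ?thesis .
qed

text \<open>
  This yields strong type at infinity. The local part is again an average, now of the constant
  function 1; beyond $2x$ the mass is split at $y = t$, where the kernel passes from $t^{-(2l+1)}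
  y^{2l}$ to $t y^{-2}$.
\<close>

lemma poisson_model_mass:
  assumes l: "l > -1/2"
  shows "\<exists>C>0. \<forall>t>0. \<forall>x>0. (\<integral>\<^sup>+y. ennreal (poisson_model l t x y * y powr (2 * l)) \<partial>LP) \<le> ennreal C"
proof -
  define k where "k = 2 * l + 1"
  have k: "0 < k" "2 * l = k - 1" using l by (auto simp: k_def)
  show ?thesis
  proof (intro exI[of _ "5 * (18 + 2 / k + 2)"] conjI allI impI)
    show "0 < 5 * (18 + 2 / k + 2)" using k by (simp add: add_pos_pos)
    fix t x :: real assume t: "0 < t" and x: "0 < x"
    let ?g1 = "\<lambda>y. 1 * (ennreal (t / (t\<^sup>2 + (x - y)\<^sup>2) + 1 / x) * indicator {x / 2<..<2 * x} y)"
    let ?g2 = "\<lambda>y. ennreal (x powr (- k)) * (ennreal (y powr (k - 1)) * indicator {..<x} y)"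
    let ?g3 = "\<lambda>y. ennreal (t powr (- k)) * (ennreal (y powr (k - 1)) * indicator {..<t} y)"
    let ?g4 = "\<lambda>y. ennreal t * (ennreal (y powr (- 1 - 1)) * indicator {t / 2<..} y)"
    have im [measurable]: "(\<lambda>y. indicator {..<c} y :: ennreal) \<in> borel_measurable LP" "(\<lambda>y. indicator {c<..} y :: ennreal) \<in> borel_measurable LP"
      "(\<lambda>y. indicator {c<..<e} y :: ennreal) \<in> borel_measurable LP" for c e :: real
      by (intro borel_LP, measurable)+
    have [measurable]: "(\<lambda>y::real. y) \<in> borel_measurable LP" by (rule measurable_LP_id)
    have "(\<integral>\<^sup>+y. ennreal (poisson_model l t x y * y powr (2 * l)) \<partial>LP) \<le> (\<integral>\<^sup>+y. 5 * (?g1 y + ?g2 y + ?g3 y + ?g4 y) \<partial>LP)"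
    proof (rule nn_integral_mono)
      fix y assume "y \<in> space LP"
      then have y: "0 < y" by simp
      have F5: "ennreal (poisson_model l t x y * y powr (2 * l)) \<le> 5 * ennreal K"
        if "poisson_model l t x y * y powr (2 * l) \<le> 5 * K" "0 \<le> K" for K
      proof -
        have "ennreal (poisson_model l t x y * y powr (2 * l)) \<le> ennreal (5 * K)"
          using that by (intro ennreal_leI) auto
        also have "ennreal (5 * K) = 5 * ennreal K" using that by (simp add: ennreal_mult)
        finally show ?thesis .
      qed
      consider "y \<le> x / 2" | "x / 2 < y" "y < 2 * x" | "2 * x \<le> y" "y < t" | "2 * x \<le> y" "t \<le> y" by linarith
      then show "ennreal (poisson_model l t x y * y powr (2 * l)) \<le> 5 * (?g1 y + ?g2 y + ?g3 y + ?g4 y)"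
      proof cases
        case 1
        have "ennreal (poisson_model l t x y * y powr (2 * l)) \<le> 5 * ennreal (x powr (- k) * y powr (k - 1))"
          using poisson_model_below[OF l t x y 1] by (intro F5) (auto simp: k_def)
        also have "\<dots> = 5 * ?g2 y" using 1 x y by (simp add: ennreal_mult)
        also have "\<dots> \<le> 5 * (?g1 y + ?g2 y + ?g3 y + ?g4 y)" by (intro mult_left_mono) (auto intro: add_increasing2 add_increasing)
        finally show ?thesis .
      next
        case 2
        have "ennreal (poisson_model l t x y * y powr (2 * l)) \<le> 5 * ennreal (t / (t\<^sup>2 + (x - y)\<^sup>2) + 1 / x)"
          using poisson_model_near[OF l t x y 2] t x by (intro F5) auto
        also have "\<dots> = 5 * ?g1 y" using 2 by simp
        also have "\<dots> \<le> 5 * (?g1 y + ?g2 y + ?g3 y + ?g4 y)" by (intro mult_left_mono) (auto intro: add_increasing2 simp: add.assoc)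
        finally show ?thesis .
      next
        case 3
        have "ennreal (poisson_model l t x y * y powr (2 * l)) \<le> 5 * ennreal (t powr (- k) * y powr (k - 1))"
          using poisson_model_above(2)[OF l t x y 3(1)] by (intro F5) (auto simp: k_def)
        also have "\<dots> = 5 * ?g3 y" using 3 by (simp add: ennreal_mult)
        also have "\<dots> \<le> 5 * (?g1 y + ?g2 y + ?g3 y + ?g4 y)" by (intro mult_left_mono) (auto intro: add_increasing2 add_increasing)
        finally show ?thesis .
      next
        case 4
        have "ennreal (poisson_model l t x y * y powr (2 * l)) \<le> 5 * ennreal (t * y powr (- 2))"
          using poisson_model_above(3)[OF l t x y 4(1)] t by (intro F5) auto
        also have "\<dots> = 5 * ?g4 y" using 4 t y by (simp add: ennreal_mult)
        also have "\<dots> \<le> 5 * (?g1 y + ?g2 y + ?g3 y + ?g4 y)" by (intro mult_left_mono) (auto intro: add_increasing)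
        finally show ?thesis .
      qed
    qed
    also have "\<dots> = 5 * ((\<integral>\<^sup>+y. ?g1 y \<partial>LP) + (\<integral>\<^sup>+y. ?g2 y \<partial>LP) + (\<integral>\<^sup>+y. ?g3 y \<partial>LP) + (\<integral>\<^sup>+y. ?g4 y \<partial>LP))"
      by (subst nn_integral_cmult, measurable) (subst nn_integral_add, measurable, subst nn_integral_add, measurable, subst nn_integral_add, measurable)
    also have "\<dots> \<le> 5 * (ennreal 18 + ennreal (1 / k) + ennreal (1 / k) + ennreal 2)"
    proof (intro mult_left_mono add_mono)
      have "(\<integral>\<^sup>+y. ?g1 y \<partial>LP) \<le> ennreal (18 * 4 powr \<bar>0\<bar>) * maxfun 0 (\<lambda>_. 1) x"
        by (rule local_poisson_le_maxfun) (use x t in auto)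
      also have "maxfun 0 (\<lambda>_. 1) x \<le> 1"
        unfolding maxfun_def
      proof (rule SUP_least)
        fix I :: "real set" assume "I \<in> {{a<..<b} |a b. 0 < a \<and> a < x \<and> x < b}"
        then obtain a b where I: "I = {a<..<b}" "0 < a" "a < b" by force
        have sI: "I \<in> sets LP" using I by (auto intro!: borel_set_LP)
        have "(\<integral>\<^sup>+y. 1 * indicator I y \<partial>power_measure 0) = emeasure (power_measure 0) I" using sI by simp
        moreover have "emeasure (power_measure 0) I / emeasure (power_measure 0) I = 1"
          using power_measure_interval(1,4)[OF I(2,3), of 0] I(1) by (intro ennreal_divide_self) auto
        ultimately show "(\<integral>\<^sup>+y. 1 * indicator I y \<partial>power_measure 0) / emeasure (power_measure 0) I \<le> 1" by simp
      qed
      finally show "(\<integral>\<^sup>+y. ?g1 y \<partial>LP) \<le> ennreal 18" by (simp add: mult_left_mono)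
      have low: "(\<integral>\<^sup>+y. ennreal (c powr (- k)) * (ennreal (y powr (k - 1)) * indicator {..<c} y) \<partial>LP) \<le> ennreal (1 / k)" if "0 < c" for c
      proof -
        have "(\<integral>\<^sup>+y. ennreal (c powr (- k)) * (ennreal (y powr (k - 1)) * indicator {..<c} y) \<partial>LP)
          = ennreal (c powr (- k)) * (\<integral>\<^sup>+y. ennreal (y powr (k - 1)) * indicator {..<c} y \<partial>LP)"
          by (rule nn_integral_cmult) measurable
        also have "\<dots> = ennreal (c powr (- k)) * ennreal (c powr k / k)"
          using k that by (subst nn_integral_powr_lessThan) auto
        also have "\<dots> = ennreal (c powr (- k) * (c powr k / k))" using k by (intro ennreal_mult[symmetric]) auto
        also have "c powr (- k) * (c powr k / k) = 1 / k" using that by (simp add: powr_minus)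
        finally show ?thesis by simp
      qed
      show "(\<integral>\<^sup>+y. ?g2 y \<partial>LP) \<le> ennreal (1 / k)" "(\<integral>\<^sup>+y. ?g3 y \<partial>LP) \<le> ennreal (1 / k)"
        by (rule low, fact)+
      have "(\<integral>\<^sup>+y. ?g4 y \<partial>LP) = ennreal t * (\<integral>\<^sup>+y. ennreal (y powr (- 1 - 1)) * indicator {t / 2<..} y \<partial>LP)"
        by (rule nn_integral_cmult) measurable
      also have "\<dots> = ennreal t * ennreal ((t / 2) powr (- 1) / 1)"
        using t by (subst nn_integral_powr_greaterThan) auto
      also have "\<dots> = ennreal 2" using t by (simp add: ennreal_mult[symmetric] powr_minus)
      finally show "(\<integral>\<^sup>+y. ?g4 y \<partial>LP) \<le> ennreal 2" by simp
    qed auto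
    also have "\<dots> = ennreal (5 * (18 + 2 / k + 2))"
    proof -
      have "ennreal (18 + 1 / k + 1 / k + 2) = ennreal (18 + 1 / k + 1 / k) + ennreal 2" using k by (intro ennreal_plus) auto
      moreover have "ennreal (18 + 1 / k + 1 / k) = ennreal (18 + 1 / k) + ennreal (1 / k)" using k by (intro ennreal_plus) auto
      moreover have "ennreal (18 + 1 / k) = ennreal 18 + ennreal (1 / k)" using k by (intro ennreal_plus) auto
      ultimately have e1: "ennreal 18 + ennreal (1 / k) + ennreal (1 / k) + ennreal 2 = ennreal (18 + 1 / k + 1 / k + 2)" by simp
      have e2: "5 * ennreal (18 + 1 / k + 1 / k + 2) = ennreal (5 * (18 + 1 / k + 1 / k + 2))"
        using k by (subst ennreal_mult) auto
      have e3: "18 + 1 / k + 1 / k + 2 = 18 + 2 / k + 2" using k by (simp add: field_simps)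
      show ?thesis unfolding e1 e2 unfolding e3 ..
    qed
    finally show "(\<integral>\<^sup>+y. ennreal (poisson_model l t x y * y powr (2 * l)) \<partial>LP) \<le> ennreal (5 * (18 + 2 / k + 2))" .
  qed
qed

section \<open>Measurability and sublinearity of the Poisson maximal operator\<close>

lemma poisson_kernel_continuous:
  assumes l: "l > -1/2" and t: "0 < t"
  shows "0 < x \<Longrightarrow> continuous_on {0<..} (\<lambda>y. poisson_kernel l t x y)"
    and "0 < y \<Longrightarrow> continuous_on {0<..} (\<lambda>x. poisson_kernel l t x y)"
proof -
  note c = continuous_on_poisson_kernel[OF l]
  have "continuous_on {0<..} (\<lambda>y. case (t, x, y) of (t, x, y) \<Rightarrow> poisson_kernel l t x y)" if "0 < x"
    by (rule continuous_on_compose2[OF c]) (use t that in \<open>auto intro!: continuous_intros\<close>)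
  then show "0 < x \<Longrightarrow> continuous_on {0<..} (\<lambda>y. poisson_kernel l t x y)" by simp
  have "continuous_on {0<..} (\<lambda>x. case (t, x, y) of (t, x, y) \<Rightarrow> poisson_kernel l t x y)" if "0 < y"
    by (rule continuous_on_compose2[OF c]) (use t that in \<open>auto intro!: continuous_intros\<close>)
  then show "0 < y \<Longrightarrow> continuous_on {0<..} (\<lambda>x. poisson_kernel l t x y)" by simp
qed

lemma poisson_kernel_measurable:
  assumes "l > -1/2" "0 < t" "0 < x"
  shows "(\<lambda>y. poisson_kernel l t x y) \<in> borel_measurable LP"
  by (intro continuous_imp_measurable_on_sets_lebesgue poisson_kernel_continuous assms) simp

lemma poisson_model_nonneg: "0 < t \<Longrightarrow> 0 \<le> poisson_model l t x y"
  by (simp add: poisson_model_def)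

lemma poisson_kernel_upper:
  assumes l: "l > -1/2"
  shows "\<exists>C>0. \<forall>t x y. 0 < t \<longrightarrow> 0 < x \<longrightarrow> 0 < y \<longrightarrow> poisson_kernel l t x y \<le> C * poisson_model l t x y"
  by (rule poisson_kernel_bounds[OF l]) auto

lemma poisson_kernel_lower:
  assumes l: "l > -1/2"
  shows "\<exists>c>0. \<forall>t x y. 0 < t \<longrightarrow> 0 < x \<longrightarrow> 0 < y \<longrightarrow> c * poisson_model l t x y \<le> poisson_kernel l t x y"
  by (rule poisson_kernel_bounds[OF l]) auto

lemma poisson_kernel_nonneg:
  assumes "l > -1/2" "0 < t" "0 < x" "0 < y"
  shows "0 \<le> poisson_kernel l t x y"
proof -
  obtain c where c: "0 < c" "c * poisson_model l t x y \<le> poisson_kernel l t x y"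
    using poisson_kernel_lower[OF assms(1)] assms(2-) by blast
  then show ?thesis using poisson_model_nonneg[OF assms(2), of l x y]
    by (intro order_trans[OF _ c(2)]) auto
qed

lemma poisson_model_measurable:
  assumes "0 < t"
  shows "(\<lambda>y. poisson_model l t x y) \<in> borel_measurable LP"
proof -
  have "(\<lambda>y. t * sqsum t x y powr (- l) / (t\<^sup>2 + (x - y)\<^sup>2)) \<in> borel_measurable borel"
    unfolding sqsum_def by measurable
  then show ?thesis unfolding poisson_model_def by (rule borel_LP)
qed

lemma ennreal_norm_integral_le:
  fixes f :: "'a \<Rightarrow> 'b::{banach, second_countable_topology}"
  shows "ennreal (norm (integral\<^sup>L M f)) \<le> (\<integral>\<^sup>+x. ennreal (norm (f x)) \<partial>M)"
proof (cases "integrable M f")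
  case True
  then show ?thesis by (rule integral_norm_bound_ennreal)
qed (simp add: not_integrable_integral_eq)

lemma kernel_times_norm_le:
  assumes l: "l > -1/2"
  shows "\<exists>C>0. \<forall>f t x. f \<in> borel_measurable LP \<longrightarrow> 0 < t \<longrightarrow> 0 < x \<longrightarrow>
     (\<integral>\<^sup>+y. ennreal (norm (complex_of_real (poisson_kernel l t x y) * f y)) \<partial>power_measure (2 * l))
       \<le> ennreal C * (\<integral>\<^sup>+y. enorm f y * ennreal (poisson_model l t x y * y powr (2 * l)) \<partial>LP)"
proof -
  obtain C where C: "0 < C" "\<And>t x y. 0 < t \<Longrightarrow> 0 < x \<Longrightarrow> 0 < y \<Longrightarrow> poisson_kernel l t x y \<le> C * poisson_model l t x y"
    using poisson_kernel_upper[OF l] by auto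
  show ?thesis
  proof (intro exI[of _ C] conjI allI impI C(1))
    fix f :: "real \<Rightarrow> complex" and t x :: real
    assume f [measurable]: "f \<in> borel_measurable LP" and t: "0 < t" and x: "0 < x"
    note [measurable] = poisson_kernel_measurable[OF l t x] poisson_model_measurable[OF t]
    have "(\<integral>\<^sup>+y. ennreal (norm (complex_of_real (poisson_kernel l t x y) * f y)) \<partial>power_measure (2 * l))
      = (\<integral>\<^sup>+y. ennreal (y powr (2 * l)) * ennreal (norm (complex_of_real (poisson_kernel l t x y) * f y)) \<partial>LP)"
      by (rule nn_integral_power_measure) measurable
    also have "\<dots> \<le> (\<integral>\<^sup>+y. ennreal C * (enorm f y * ennreal (poisson_model l t x y * y powr (2 * l))) \<partial>LP)"
    proof (rule nn_integral_mono)
      fix y assume "y \<in> space LP"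
      then have y: "0 < y" by simp
      have m0: "0 \<le> poisson_model l t x y" by (rule poisson_model_nonneg[OF t])
      have "y powr (2 * l) * norm (complex_of_real (poisson_kernel l t x y) * f y)
         = y powr (2 * l) * (poisson_kernel l t x y * norm (f y))"
        using poisson_kernel_nonneg[OF l t x y] by (simp add: norm_mult)
      also have "\<dots> \<le> y powr (2 * l) * (C * poisson_model l t x y * norm (f y))"
        using C t x y by (intro mult_left_mono mult_right_mono) auto
      finally have "ennreal (y powr (2 * l) * norm (complex_of_real (poisson_kernel l t x y) * f y))
         \<le> ennreal (C * (norm (f y) * (poisson_model l t x y * y powr (2 * l))))"
        by (intro ennreal_leI) (simp add: mult_ac)
      then show "ennreal (y powr (2 * l)) * ennreal (norm (complex_of_real (poisson_kernel l t x y) * f y))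
         \<le> ennreal C * (enorm f y * ennreal (poisson_model l t x y * y powr (2 * l)))"
        using C(1) m0 by (simp add: ennreal_mult)
    qed
    also have "\<dots> = ennreal C * (\<integral>\<^sup>+y. enorm f y * ennreal (poisson_model l t x y * y powr (2 * l)) \<partial>LP)"
      by (rule nn_integral_cmult) measurable
    finally show "(\<integral>\<^sup>+y. ennreal (norm (complex_of_real (poisson_kernel l t x y) * f y)) \<partial>power_measure (2 * l))
       \<le> ennreal C * (\<integral>\<^sup>+y. enorm f y * ennreal (poisson_model l t x y * y powr (2 * l)) \<partial>LP)" .
  qed
qed

lemma poisson_maximal_le_majorant:
  assumes l: "l > -1/2"
  shows "\<exists>C>0. \<forall>f x. f \<in> borel_measurable LP \<longrightarrow> 0 < x \<longrightarrow>
     poisson_maximal l f x \<le> ennreal C * majorant l d (enorm f) x"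
proof -
  obtain C where C: "0 < C" "\<And>f t x. f \<in> borel_measurable LP \<Longrightarrow> 0 < t \<Longrightarrow> 0 < x \<Longrightarrow>
     (\<integral>\<^sup>+y. ennreal (norm (complex_of_real (poisson_kernel l t x y) * f y)) \<partial>power_measure (2 * l))
       \<le> ennreal C * (\<integral>\<^sup>+y. enorm f y * ennreal (poisson_model l t x y * y powr (2 * l)) \<partial>LP)"
    using kernel_times_norm_le[OF l] by auto
  show ?thesis
  proof (intro exI[of _ "C * (90 * 4 powr \<bar>d\<bar>)"] conjI allI impI)
    show "0 < C * (90 * 4 powr \<bar>d\<bar>)" using C by simp
    fix f :: "real \<Rightarrow> complex" and x :: real
    assume f [measurable]: "f \<in> borel_measurable LP" and x: "0 < x"
    show "poisson_maximal l f x \<le> ennreal (C * (90 * 4 powr \<bar>d\<bar>)) * majorant l d (enorm f) x"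
      unfolding poisson_maximal_def
    proof (rule SUP_least)
      fix t :: real assume "t \<in> {0<..}"
      then have t: "0 < t" by simp
      have "ennreal (norm (poisson_integral l t f x)) \<le> (\<integral>\<^sup>+y. ennreal (norm (complex_of_real (poisson_kernel l t x y) * f y)) \<partial>power_measure (2 * l))"
        unfolding poisson_integral_def by (rule ennreal_norm_integral_le)
      also have "\<dots> \<le> ennreal C * (\<integral>\<^sup>+y. enorm f y * ennreal (poisson_model l t x y * y powr (2 * l)) \<partial>LP)"
        by (rule C(2)[OF f t x])
      also have "\<dots> \<le> ennreal C * (ennreal (90 * 4 powr \<bar>d\<bar>) * majorant l d (enorm f) x)"
        by (intro mult_left_mono poisson_model_le_majorant l t x) (auto, measurable)
      also have "\<dots> = ennreal (C * (90 * 4 powr \<bar>d\<bar>)) * majorant l d (enorm f) x"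
        using C(1) by (simp add: ennreal_mult mult.assoc)
      finally show "ennreal (norm (poisson_integral l t f x)) \<le> ennreal (C * (90 * 4 powr \<bar>d\<bar>)) * majorant l d (enorm f) x" .
    qed
  qed
qed

text \<open>
  The size of the kernel in $y$ for fixed $t$ and $x$, by the lemma poisson_model_decay.
\<close>

definition decay :: "real \<Rightarrow> real \<Rightarrow> real" where
  "decay l y = (1 + y\<^sup>2) powr (- (l + 1))"

lemma powr_between_inverse:
  fixes s Q c :: real
  assumes "1 \<le> Q" "1 / Q \<le> s" "s \<le> Q"
  shows "s powr c \<le> Q powr \<bar>c\<bar>" "Q powr (- \<bar>c\<bar>) \<le> s powr c"
proof -
  have s: "0 < s" using assms by (auto intro: less_le_trans[of 0 "1 / Q"])
  have "\<bar>ln s\<bar> \<le> ln Q"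
  proof -
    have "ln (1 / Q) \<le> ln s" "ln s \<le> ln Q" using assms s by auto
    then show ?thesis using assms by (simp add: ln_div)
  qed
  then have "\<bar>c * ln s\<bar> \<le> \<bar>c\<bar> * ln Q" by (simp add: abs_mult mult_left_mono)
  then have "c * ln s \<le> \<bar>c\<bar> * ln Q" "- \<bar>c\<bar> * ln Q \<le> c * ln s" by (auto simp: abs_le_iff)
  then show "s powr c \<le> Q powr \<bar>c\<bar>" "Q powr (- \<bar>c\<bar>) \<le> s powr c"
    using assms s by (auto simp: powr_def)
qed

text \<open>
  For $t$ and $x$ in a compact range, both $t^2 + x^2 + y^2$ and $t^2 + (x-y)^2$ are comparable with
  $1 + y^2$.
\<close>

lemma poisson_model_decay:
  assumes R: "1 \<le> (R::real)"
  shows "\<exists>B>0. \<forall>t x y. 1 / R \<le> t \<longrightarrow> t \<le> R \<longrightarrow> 0 < x \<longrightarrow> x \<le> R \<longrightarrow> 0 < y \<longrightarrow>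
    poisson_model l t x y \<le> B * decay l y \<and> decay l y \<le> B * poisson_model l t x y"
proof -
  \<comment> \<open>A common comparison constant for the two quadratic forms and 1 + y^2.\<close>
  define Q where "Q = 5 * R ^ 4"
  have R2: "1 \<le> R\<^sup>2" "R\<^sup>2 \<le> R ^ 4" "1 \<le> R ^ 4"
    using R by (auto intro: one_le_power power_increasing)
  have Q1: "1 \<le> Q" using R2 by (simp add: Q_def)
  define B where "B = R * Q powr \<bar>l\<bar> * Q"
  have B: "0 < B" using R Q1 by (simp add: B_def)
  have main: "poisson_model l t x y \<le> B * decay l y \<and> decay l y \<le> B * poisson_model l t x y"
    if t: "1 / R \<le> t" "t \<le> R" and x: "0 < x" "x \<le> R" and y: "0 < y" for t x y
  proof -
    define u where "u = 1 + y\<^sup>2"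
    define A where "A = sqsum t x y"
    define D where "D = t\<^sup>2 + (x - y)\<^sup>2"
    have t0: "0 < t" using t R by (auto intro: less_le_trans[of 0 "1 / R"])
    have u1: "1 \<le> u" by (simp add: u_def)
    have tR: "1 \<le> R\<^sup>2 * t\<^sup>2"
    proof -
      have "1 \<le> R * t" using t R by (simp add: field_simps)
      then have "1\<^sup>2 \<le> (R * t)\<^sup>2" by (intro power_mono) auto
      then show ?thesis by (simp add: power_mult_distrib)
    qed
    have t2: "t\<^sup>2 \<le> R\<^sup>2" "x\<^sup>2 \<le> R\<^sup>2" using t x t0 by (auto intro: power_mono)
    have D0: "t\<^sup>2 \<le> D" by (simp add: D_def)
    have DA: "D \<le> A" using x y by (simp add: D_def A_def sqsum_def power2_diff)
    have AU: "A \<le> Q * u"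
    proof -
      have "A \<le> 2 * R\<^sup>2 + y\<^sup>2" using t2 by (simp add: A_def sqsum_def)
      also have "\<dots> \<le> 2 * R\<^sup>2 * u"
      proof -
        have "1 * y\<^sup>2 \<le> (2 * R\<^sup>2) * y\<^sup>2" using R2(1) by (intro mult_right_mono) auto
        then show ?thesis by (simp add: u_def distrib_left)
      qed
      also have "\<dots> \<le> Q * u" using R2 u1 by (intro mult_right_mono) (auto simp: Q_def)
      finally show ?thesis .
    qed
    have UD: "u \<le> Q * D"
    proof -
      have "y\<^sup>2 \<le> 2 * x\<^sup>2 + 2 * (x - y)\<^sup>2"
        using zero_le_power2[of "2 * x - y"] by (simp add: power2_eq_square algebra_simps)
      then have "u \<le> 1 + 2 * R\<^sup>2 + 2 * D" using t2 zero_le_power2[of t] unfolding u_def D_def by argo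
      also have "1 \<le> R ^ 4 * D"
      proof -
        have "1 \<le> R\<^sup>2 * t\<^sup>2" by (rule tR)
        also have "\<dots> \<le> R ^ 4 * D" using R2 D0 by (intro mult_mono) auto
        finally show ?thesis .
      qed
      also have "2 * R\<^sup>2 \<le> 2 * (R ^ 4 * D)"
      proof -
        have "R\<^sup>2 * 1 \<le> R\<^sup>2 * (R\<^sup>2 * t\<^sup>2)" using tR by (intro mult_left_mono) auto
        also have "\<dots> = R ^ 4 * t\<^sup>2" by (simp add: power2_eq_square power4_eq_xxxx)
        also have "\<dots> \<le> R ^ 4 * D" using R2 D0 by (intro mult_left_mono) auto
        finally show ?thesis by simp
      qed
      also have "2 * D \<le> 2 * (R ^ 4 * D)"
      proof -
        have "0 \<le> D" using D0 zero_le_power2[of t] by linarith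
        then show ?thesis using R2(3) mult_right_mono[of 1 "R ^ 4" D] by simp
      qed
      finally have "u \<le> R ^ 4 * D + 2 * (R ^ 4 * D) + 2 * (R ^ 4 * D)" by simp
      then show ?thesis by (simp add: Q_def mult_ac)
    qed
    have "0 < t\<^sup>2" using t0 by simp
    then have D: "0 < D" using D0 by linarith
    have A: "0 < A" using D DA by simp
    have u: "0 < u" using u1 by simp
    have Q0: "0 < Q" using Q1 by simp
    have UA: "u \<le> Q * A" using order_trans[OF UD mult_left_mono[OF DA less_imp_le[OF Q0]]] .
    have DU: "D \<le> Q * u" using DA AU by simp
    have su: "1 / Q \<le> A / u" "A / u \<le> Q" "1 / Q \<le> D / u" "D / u \<le> Q"
      using UA AU UD DU u Q0 by (simp_all add: field_simps)
    have Apow: "A powr (- l) = u powr (- l) * (A / u) powr (- l)" using A u by (simp add: powr_divide)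
    have up: "A powr (- l) \<le> u powr (- l) * Q powr \<bar>l\<bar>"
      unfolding Apow using powr_between_inverse(1)[OF Q1 su(1,2), of "- l"] by (intro mult_left_mono) auto
    have lo: "u powr (- l) * Q powr (- \<bar>l\<bar>) \<le> A powr (- l)"
      unfolding Apow using powr_between_inverse(2)[OF Q1 su(1,2), of "- l"] by (intro mult_left_mono) auto
    have du: "decay l y = u powr (- l) / u"
    proof -
      have "u powr (- (l + 1)) = u powr (- l - 1)" by (rule arg_cong) simp
      then show ?thesis using u unfolding decay_def u_def[symmetric] by (simp add: powr_diff)
    qed
    have m: "poisson_model l t x y = t * A powr (- l) / D" by (simp add: poisson_model_def A_def D_def)
    have "poisson_model l t x y \<le> R * (u powr (- l) * Q powr \<bar>l\<bar>) / (u / Q)"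
      unfolding m using t t0 up D u Q1 UD R by (intro frac_le mult_mono) (auto simp: field_simps)
    also have "\<dots> = B * decay l y" unfolding du B_def by simp
    finally have 1: "poisson_model l t x y \<le> B * decay l y" .
    have "decay l y = B * ((1 / R) * (u powr (- l) * Q powr (- \<bar>l\<bar>)) / (Q * u))"
      unfolding du B_def using R Q1 u by (simp add: powr_minus field_simps)
    also have "\<dots> \<le> B * poisson_model l t x y"
    proof (intro mult_left_mono)
      show "1 / R * (u powr - l * Q powr - \<bar>l\<bar>) / (Q * u) \<le> poisson_model l t x y"
        unfolding m using t t0 lo D u Q1 DA AU R by (intro frac_le mult_mono) auto
    qed (use B in simp)
    finally show ?thesis using 1 by blast
  qed
  show ?thesis by (intro exI[of _ B] conjI allI impI B) (use main in auto)
qed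

text \<open>
  The functions whose Poisson integral converges absolutely. By poisson_model_decay convergence at
  one pair $(t, x)$ implies convergence at all of them, locally uniformly.
\<close>

definition decay_integrable :: "real \<Rightarrow> (real \<Rightarrow> complex) \<Rightarrow> bool" where
  "decay_integrable l f \<longleftrightarrow> f \<in> borel_measurable LP \<and>
     (\<integral>\<^sup>+y. enorm f y * ennreal (decay l y * y powr (2 * l)) \<partial>LP) < top"

lemma decay_measurable [measurable]: "decay l \<in> borel_measurable LP"
proof -
  have "(\<lambda>y. (1 + y\<^sup>2) powr (- (l + 1))) \<in> borel_measurable borel" by measurable
  then show ?thesis unfolding decay_def[abs_def] by (rule borel_LP)
qed

lemma decay_nonneg: "0 \<le> decay l y" by (simp add: decay_def)

lemma decay_integral_le_model:
  assumes f [measurable]: "f \<in> borel_measurable LP" and x: "0 < x"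
  shows "\<exists>B>0. (\<integral>\<^sup>+y. enorm f y * ennreal (decay l y * y powr (2 * l)) \<partial>LP) \<le> ennreal B * (\<integral>\<^sup>+y. enorm f y * ennreal (poisson_model l 1 x y * y powr (2 * l)) \<partial>LP)"
proof -
  define R where "R = max 1 x"
  have R: "1 \<le> R" "x \<le> R" by (auto simp: R_def)
  obtain B where B: "0 < B" "\<And>t x y. 1 / R \<le> t \<Longrightarrow> t \<le> R \<Longrightarrow> 0 < x \<Longrightarrow> x \<le> R \<Longrightarrow> 0 < y \<Longrightarrow> decay l y \<le> B * poisson_model l t x y"
    using poisson_model_decay[OF R(1), of l] by auto
  have [measurable]: "(\<lambda>y. poisson_model l 1 x y) \<in> borel_measurable LP" by (rule poisson_model_measurable) simp
  have "(\<integral>\<^sup>+y. enorm f y * ennreal (decay l y * y powr (2 * l)) \<partial>LP) \<le> (\<integral>\<^sup>+y. ennreal B * (enorm f y * ennreal (poisson_model l 1 x y * y powr (2 * l))) \<partial>LP)"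
  proof (rule nn_integral_mono)
    fix y assume "y \<in> space LP"
    then have y: "0 < y" by simp
    have "decay l y * y powr (2 * l) \<le> B * (poisson_model l 1 x y * y powr (2 * l))"
      using B(2)[of 1 x y] R x y mult_right_mono[of "decay l y" "B * poisson_model l 1 x y" "y powr (2 * l)"] by (simp add: mult.assoc)
    then have "ennreal (decay l y * y powr (2 * l)) \<le> ennreal B * ennreal (poisson_model l 1 x y * y powr (2 * l))"
      using B(1) by (subst ennreal_mult[symmetric]) (auto intro!: ennreal_leI simp: poisson_model_nonneg)
    from mult_left_mono[OF this, of "enorm f y"]
    show "enorm f y * ennreal (decay l y * y powr (2 * l)) \<le> ennreal B * (enorm f y * ennreal (poisson_model l 1 x y * y powr (2 * l)))"
      by (simp add: mult_ac)
  qed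
  also have "\<dots> = ennreal B * (\<integral>\<^sup>+y. enorm f y * ennreal (poisson_model l 1 x y * y powr (2 * l)) \<partial>LP)"
    by (rule nn_integral_cmult) measurable
  finally show ?thesis using B(1) by blast
qed

text \<open>
  Finiteness of the majorant at a single point is convergence at that point.
\<close>

lemma decay_integrable_of_majorant:
  assumes l: "l > -1/2" and f [measurable]: "f \<in> borel_measurable LP" and x: "0 < x" and fin: "majorant l d (enorm f) x < top"
  shows "decay_integrable l f"
proof -
  obtain B where B: "0 < B"
    "(\<integral>\<^sup>+y. enorm f y * ennreal (decay l y * y powr (2 * l)) \<partial>LP) \<le> ennreal B * (\<integral>\<^sup>+y. enorm f y * ennreal (poisson_model l 1 x y * y powr (2 * l)) \<partial>LP)"
    using decay_integral_le_model[OF f x, of l] by blast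
  note B(2)
  also have "ennreal B * (\<integral>\<^sup>+y. enorm f y * ennreal (poisson_model l 1 x y * y powr (2 * l)) \<partial>LP) \<le> ennreal B * (ennreal (90 * 4 powr \<bar>d\<bar>) * majorant l d (enorm f) x)"
    by (intro mult_left_mono poisson_model_le_majorant l x) (auto, measurable)
  also have "\<dots> < top" using fin by (simp add: ennreal_mult_less_top)
  finally show ?thesis using f by (simp add: decay_integrable_def)
qed

lemma decay_integrable_of_bounded:
  assumes l: "l > -1/2" and f [measurable]: "f \<in> borel_measurable LP" and bd: "AE y in LP. enorm f y \<le> M" and M: "M < top"
  shows "decay_integrable l f"
proof -
  obtain C where C: "\<And>t x. 0 < t \<Longrightarrow> 0 < x \<Longrightarrow> (\<integral>\<^sup>+y. ennreal (poisson_model l t x y * y powr (2 * l)) \<partial>LP) \<le> ennreal C"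
    using poisson_model_mass[OF l] by blast
  have [measurable]: "(\<lambda>y. poisson_model l 1 1 y) \<in> borel_measurable LP" by (rule poisson_model_measurable) simp
  obtain B where B: "0 < B"
    "(\<integral>\<^sup>+y. enorm f y * ennreal (decay l y * y powr (2 * l)) \<partial>LP) \<le> ennreal B * (\<integral>\<^sup>+y. enorm f y * ennreal (poisson_model l 1 1 y * y powr (2 * l)) \<partial>LP)"
    using decay_integral_le_model[OF f zero_less_one, of l] by blast
  note B(2)
  also have "(\<integral>\<^sup>+y. enorm f y * ennreal (poisson_model l 1 1 y * y powr (2 * l)) \<partial>LP) \<le> (\<integral>\<^sup>+y. M * ennreal (poisson_model l 1 1 y * y powr (2 * l)) \<partial>LP)"
  proof (rule nn_integral_mono_AE)
    show "AE y in LP. enorm f y * ennreal (poisson_model l 1 1 y * y powr (2 * l)) \<le> M * ennreal (poisson_model l 1 1 y * y powr (2 * l))"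
      using bd by eventually_elim (intro mult_right_mono, auto)
  qed
  also have "\<dots> = M * (\<integral>\<^sup>+y. ennreal (poisson_model l 1 1 y * y powr (2 * l)) \<partial>LP)" by (rule nn_integral_cmult) measurable
  also have "\<dots> \<le> M * ennreal C" by (intro mult_left_mono C) auto
  finally have "(\<integral>\<^sup>+y. enorm f y * ennreal (decay l y * y powr (2 * l)) \<partial>LP) \<le> ennreal B * (M * ennreal C)"
    by (simp add: mult_left_mono)
  also have "\<dots> < top" using M by (simp add: ennreal_mult_less_top)
  finally show ?thesis using f by (simp add: decay_integrable_def)
qed

text \<open>
  One integrable majorant for a compact range of $t$ and $x$.
\<close>

lemma poisson_dominated:
  assumes l: "l > -1/2" and f: "decay_integrable l f" and R: "1 \<le> R"
  shows "\<exists>W. integrable (power_measure (2 * l)) W \<and>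
    (\<forall>t x y. 1 / R \<le> t \<longrightarrow> t \<le> R \<longrightarrow> 0 < x \<longrightarrow> x \<le> R \<longrightarrow> 0 < y \<longrightarrow> norm (complex_of_real (poisson_kernel l t x y) * f y) \<le> W y)"
proof -
  have [measurable]: "f \<in> borel_measurable LP" and fin: "(\<integral>\<^sup>+y. enorm f y * ennreal (decay l y * y powr (2 * l)) \<partial>LP) < top"
    using f by (auto simp: decay_integrable_def)
  obtain C where C: "0 < C" "\<And>t x y. 0 < t \<Longrightarrow> 0 < x \<Longrightarrow> 0 < y \<Longrightarrow> poisson_kernel l t x y \<le> C * poisson_model l t x y"
    using poisson_kernel_upper[OF l] by auto
  obtain B where B: "0 < B" "\<And>t x y. 1 / R \<le> t \<Longrightarrow> t \<le> R \<Longrightarrow> 0 < x \<Longrightarrow> x \<le> R \<Longrightarrow> 0 < y \<Longrightarrow> poisson_model l t x y \<le> B * decay l y"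
    using poisson_model_decay[OF R(1), of l] by auto
  show ?thesis
  proof (intro exI[of _ "\<lambda>y. C * B * (norm (f y) * decay l y)"] conjI allI impI)
    have m: "(\<lambda>y. norm (f y) * decay l y) \<in> borel_measurable LP" by measurable
    have "(\<integral>\<^sup>+y. ennreal (norm (norm (f y) * decay l y)) \<partial>power_measure (2 * l)) = (\<integral>\<^sup>+y. ennreal (y powr (2 * l)) * ennreal (norm (norm (f y) * decay l y)) \<partial>LP)"
      by (rule nn_integral_power_measure) measurable
    also have "\<dots> = (\<integral>\<^sup>+y. enorm f y * ennreal (decay l y * y powr (2 * l)) \<partial>LP)"
      by (intro nn_integral_cong) (simp add: abs_mult ennreal_mult decay_nonneg mult_ac)
    finally have "integrable (power_measure (2 * l)) (\<lambda>y. norm (f y) * decay l y)"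
      using fin m by (intro integrableI_bounded) auto
    then show "integrable (power_measure (2 * l)) (\<lambda>y. C * B * (norm (f y) * decay l y))"
      by (rule integrable_mult_right)
    fix t x y :: real assume t: "1 / R \<le> t" "t \<le> R" and x: "0 < x" "x \<le> R" and y: "0 < y"
    have t0: "0 < t" using t R by (auto intro: less_le_trans[of 0 "1 / R"])
    have "poisson_kernel l t x y \<le> C * poisson_model l t x y" by (rule C(2)[OF t0 x(1) y])
    also have "\<dots> \<le> C * (B * decay l y)" using C(1) B(2)[OF t x y] by (intro mult_left_mono) auto
    finally have "poisson_kernel l t x y * norm (f y) \<le> C * (B * decay l y) * norm (f y)" by (intro mult_right_mono) auto
    then show "norm (complex_of_real (poisson_kernel l t x y) * f y) \<le> C * B * (norm (f y) * decay l y)"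
      using poisson_kernel_nonneg[OF l t0 x(1) y] by (simp add: norm_mult mult_ac)
  qed
qed

lemma poisson_integrable:
  assumes l: "l > -1/2" and f: "decay_integrable l f" and t: "0 < t" and x: "0 < x"
  shows "integrable (power_measure (2 * l)) (\<lambda>y. complex_of_real (poisson_kernel l t x y) * f y)"
proof -
  define R where "R = max 1 (max t (max (1 / t) x))"
  have R: "1 \<le> R" "t \<le> R" "1 / t \<le> R" "x \<le> R" by (auto simp: R_def)
  then have R': "1 / R \<le> t" using t by (simp add: field_simps)
  obtain W where W: "integrable (power_measure (2 * l)) W"
    "\<And>t x y. 1 / R \<le> t \<Longrightarrow> t \<le> R \<Longrightarrow> 0 < x \<Longrightarrow> x \<le> R \<Longrightarrow> 0 < y \<Longrightarrow> norm (complex_of_real (poisson_kernel l t x y) * f y) \<le> W y"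
    using poisson_dominated[OF l f R(1)] by auto
  have [measurable]: "f \<in> borel_measurable LP" using f by (simp add: decay_integrable_def)
  note [measurable] = poisson_kernel_measurable[OF l t x]
  show ?thesis
  proof (rule Bochner_Integration.integrable_bound[OF W(1)])
    show "(\<lambda>y. complex_of_real (poisson_kernel l t x y) * f y) \<in> borel_measurable (power_measure (2 * l))"
      by measurable
    show "AE y in power_measure (2 * l). norm (complex_of_real (poisson_kernel l t x y) * f y) \<le> norm (W y)"
      by (rule AE_I2) (use W(2)[OF R' R(2) x R(4)] in \<open>auto intro: order_trans[OF _ abs_ge_self]\<close>)
  qed
qed

lemma poisson_integral_continuous:
  assumes l: "l > -1/2" and f: "decay_integrable l f" and t: "0 < t"
  shows "continuous_on {0<..} (poisson_integral l t f)"
  unfolding continuous_on_sequentially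
proof (intro ballI allI impI)
  fix X :: "nat \<Rightarrow> real" and x assume X: "(\<forall>n. X n \<in> {0<..}) \<and> X \<longlonglongrightarrow> x" and x: "x \<in> {0<..}"
  obtain K where K: "\<And>n. norm (X n) \<le> K" using X by (meson BseqE convergentI convergent_imp_Bseq)
  define R where "R = max 1 (max t (max (1 / t) K))"
  have R: "1 \<le> R" "t \<le> R" "1 / t \<le> R" "K \<le> R" by (auto simp: R_def)
  then have R': "1 / R \<le> t" using t by (simp add: field_simps)
  have XR: "X n \<le> R" for n using K[of n] R(4) by simp
  obtain W where W: "integrable (power_measure (2 * l)) W"
    "\<And>t x y. 1 / R \<le> t \<Longrightarrow> t \<le> R \<Longrightarrow> 0 < x \<Longrightarrow> x \<le> R \<Longrightarrow> 0 < y \<Longrightarrow> norm (complex_of_real (poisson_kernel l t x y) * f y) \<le> W y"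
    using poisson_dominated[OF l f R(1)] by auto
  have fm [measurable]: "f \<in> borel_measurable LP" using f by (simp add: decay_integrable_def)
  have km [measurable]: "(\<lambda>y. poisson_kernel l t x y) \<in> borel_measurable LP" if "0 < x" for x
    by (rule poisson_kernel_measurable[OF l t that])
  have "(\<lambda>n. \<integral>y. complex_of_real (poisson_kernel l t (X n) y) * f y \<partial>power_measure (2 * l)) \<longlonglongrightarrow>
     (\<integral>y. complex_of_real (poisson_kernel l t x y) * f y \<partial>power_measure (2 * l))"
  proof (rule integral_dominated_convergence[OF _ _ W(1)])
    show "(\<lambda>y. complex_of_real (poisson_kernel l t x y) * f y) \<in> borel_measurable (power_measure (2 * l))"
      using km[of x] x by simp
    show "(\<lambda>y. complex_of_real (poisson_kernel l t (X n) y) * f y) \<in> borel_measurable (power_measure (2 * l))" for n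
      using km[of "X n"] X by simp
    show "AE y in power_measure (2 * l). (\<lambda>n. complex_of_real (poisson_kernel l t (X n) y) * f y) \<longlonglongrightarrow> complex_of_real (poisson_kernel l t x y) * f y"
    proof (rule AE_I2)
      fix y assume "y \<in> space (power_measure (2 * l))"
      then have y: "0 < y" by simp
      have "(\<lambda>n. poisson_kernel l t (X n) y) \<longlonglongrightarrow> poisson_kernel l t x y"
        using poisson_kernel_continuous(2)[OF l t y] X x unfolding continuous_on_sequentially o_def by blast
      then show "(\<lambda>n. complex_of_real (poisson_kernel l t (X n) y) * f y) \<longlonglongrightarrow> complex_of_real (poisson_kernel l t x y) * f y"
        by (intro tendsto_intros)
    qed
    show "AE y in power_measure (2 * l). norm (complex_of_real (poisson_kernel l t (X n) y) * f y) \<le> W y" for n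
      by (rule AE_I2) (use W(2)[OF R' R(2) _ XR[of n]] X in auto)
  qed
  then show "((poisson_integral l t f) \<circ> X) \<longlonglongrightarrow> poisson_integral l t f x"
    by (simp add: o_def poisson_integral_def)
qed

text \<open>
  A supremum of any family of continuous functions is lower semicontinuous.
\<close>

lemma poisson_maximal_measurable:
  assumes l: "l > -1/2" and f: "decay_integrable l f"
  shows "poisson_maximal l f \<in> borel_measurable LP"
proof (rule borel_measurableI_greater)
  fix c :: ennreal
  let ?g = "\<lambda>t x. ennreal (norm (poisson_integral l t f x))"
  have op: "open (?g t -` {c<..} \<inter> {0<..})" if t: "0 < t" for t
  proof -
    have "continuous_on {0<..} (?g t)"
      by (intro continuous_on_ennreal continuous_on_norm poisson_integral_continuous l f t)
    then show ?thesis by (subst (asm) continuous_on_open_vimage) auto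
  qed
  have "{x \<in> space LP. c < poisson_maximal l f x} = (\<Union>t\<in>{0<..}. ?g t -` {c<..} \<inter> {0<..})"
    by (auto simp: poisson_maximal_def less_SUP_iff)
  moreover have "open (\<Union>t\<in>{0<..}. ?g t -` {c<..} \<inter> {0<..})" by (intro open_UN) (auto intro: op)
  ultimately show "{x \<in> space LP. c < poisson_maximal l f x} \<in> sets LP"
    by (auto intro!: borel_set_LP)
qed

lemma poisson_maximal_add:
  assumes l: "l > -1/2" and "decay_integrable l f" "decay_integrable l g" and x: "0 < x"
  shows "poisson_maximal l (\<lambda>y. f y + g y) x \<le> poisson_maximal l f x + poisson_maximal l g x"
  unfolding poisson_maximal_def
proof (rule SUP_least)
  fix t :: real assume "t \<in> {0<..}"
  then have t: "0 < t" by simp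
  have "poisson_integral l t (\<lambda>y. f y + g y) x = poisson_integral l t f x + poisson_integral l t g x"
    unfolding poisson_integral_def distrib_left
    by (intro Bochner_Integration.integral_add poisson_integrable assms t)
  then have "ennreal (norm (poisson_integral l t (\<lambda>y. f y + g y) x)) \<le> ennreal (norm (poisson_integral l t f x) + norm (poisson_integral l t g x))"
    by (intro ennreal_leI) (simp add: norm_triangle_ineq)
  also have "\<dots> = ennreal (norm (poisson_integral l t f x)) + ennreal (norm (poisson_integral l t g x))" by simp
  also have "\<dots> \<le> (SUP t\<in>{0<..}. ennreal (norm (poisson_integral l t f x))) + (SUP t\<in>{0<..}. ennreal (norm (poisson_integral l t g x)))"
    using t by (intro add_mono SUP_upper) auto
  finally show "ennreal (norm (poisson_integral l t (\<lambda>y. f y + g y) x)) \<le> \<dots>" .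
qed

lemma poisson_maximal_scale:
  "poisson_maximal l (\<lambda>y. c * f y) x = ennreal (norm c) * poisson_maximal l f x"
proof -
  have "poisson_integral l t (\<lambda>y. c * f y) x = c * poisson_integral l t f x" for t
    unfolding poisson_integral_def mult.left_commute[of _ c] by (rule integral_mult_right_zero)
  then show ?thesis
    unfolding poisson_maximal_def by (simp add: norm_mult ennreal_mult SUP_mult_left_ennreal)
qed

section \<open>Mapping properties inside the range\<close>

lemma Lp_norm_power_measure:
  assumes [measurable]: "F \<in> borel_measurable LP"
  shows "Lp_norm (power_measure d) p F = ennreal_powr (weighted_integral d p F) (1 / p)"
  unfolding Lp_norm_def by (subst nn_integral_power_measure) (auto, measurable)

lemma Lp_power_measure_iff:
  assumes p: "0 < p"
  shows "f \<in> Lp (power_measure d) p \<longleftrightarrow> f \<in> borel_measurable LP \<and> weighted_integral d p (enorm f) < top"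
proof -
  have "Lp_norm (power_measure d) p (enorm f) < top \<longleftrightarrow> weighted_integral d p (enorm f) < top" if "f \<in> borel_measurable LP"
  proof -
    have m: "enorm f \<in> borel_measurable LP" using that by measurable
    show ?thesis unfolding Lp_norm_power_measure[OF m]
      by (cases "weighted_integral d p (enorm f)") auto
  qed
  then show ?thesis by (auto simp: Lp_def)
qed

lemma ennreal_powr_Lp_norm:
  assumes "F \<in> borel_measurable LP" "0 < p"
  shows "ennreal_powr (Lp_norm (power_measure d) p F) p = weighted_integral d p F"
  unfolding Lp_norm_power_measure[OF assms(1)] by (rule ennreal_powr_inverse[OF assms(2)])

text \<open>
  Were $G$ infinite everywhere, all its level sets would be the half-line, which is impossible for
  levels tending to infinity. Applied to the majorant this shows that the Poisson integral of every
  function in the space converges.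
\<close>

lemma weak_bound_finite_somewhere:
  assumes w: "weak_bound d p C G F" and p: "0 < p" and C: "0 \<le> C" and fin: "weighted_integral d p F < top"
  shows "\<exists>x>0. G x < top"
proof (rule ccontr)
  assume "\<not> ?thesis"
  then have top: "G x = top" if "0 < x" for x using that top.not_eq_extremum by blast
  obtain M where M: "weighted_integral d p F = ennreal M" "0 \<le> M" using fin by (cases "weighted_integral d p F") auto
  obtain n where n: "emeasure (power_measure d) {1<..<2} = ennreal n" "0 < n"
    using power_measure_interval(1,4)[of 1 2 d] by (cases "emeasure (power_measure d) {1<..<2}") auto
  \<comment> \<open>The level g is chosen such that the weak bound is less than half of n.\<close>
  define q where "q = n / (2 * (C * M + 1))"
  have CM: "0 \<le> C * M" using C M by simp
  have q: "0 < q" using n CM by (simp add: q_def)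
  define g where "g = q powr (- 1 / p)"
  have g: "0 < g" "g powr (- p) = q" using q p by (auto simp: g_def powr_powr)
  have "ennreal n \<le> emeasure (power_measure d) {x. 0 < x \<and> ennreal g < G x}"
  proof -
    have S: "{x. 0 < x \<and> ennreal g < G x} = {0<..}" using top by auto
    show ?thesis unfolding S n(1)[symmetric]
    proof (rule emeasure_mono)
      show "{0<..} \<in> sets (power_measure d)" unfolding sets_power_measure by (rule borel_set_LP) auto
    qed auto
  qed
  also have "\<dots> \<le> ennreal (C * g powr (- p)) * weighted_integral d p F"
    using w g(1) unfolding weak_bound_def by blast
  also have "\<dots> = ennreal (C * q) * ennreal M" unfolding g(2) M(1) ..
  also have "\<dots> = ennreal (C * q * M)" using C q M by (intro ennreal_mult[symmetric]) auto
  finally have "n \<le> C * q * M" using C q M by (subst (asm) ennreal_le_iff) auto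
  also have "C * q * M = n * ((C * M) / (2 * (C * M + 1)))" by (simp add: q_def)
  also have "\<dots> < n * 1"
  proof (intro mult_strict_left_mono)
    show "C * M / (2 * (C * M + 1)) < 1" using CM by (simp add: divide_less_eq)
  qed (use n in simp)
  finally show False by simp
qed

lemma weak_bound_of_pointwise:
  assumes w: "weak_bound d p C G F" and K: "0 < K" and le: "\<And>x. 0 < x \<Longrightarrow> T x \<le> ennreal K * G x"
    and G: "G \<in> borel_measurable LP"
  shows "weak_bound d p (C * K powr p) T F"
  unfolding weak_bound_def
proof (intro allI impI)
  fix g :: real assume g: "0 < g"
  have "{x. 0 < x \<and> ennreal g < T x} \<subseteq> {x. 0 < x \<and> ennreal (g / K) < G x}"
  proof
    fix x assume "x \<in> {x. 0 < x \<and> ennreal g < T x}"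
    then have x: "0 < x" "ennreal g < ennreal K * G x" using le by (auto intro: less_le_trans)
    have "ennreal (g / K) < G x"
    proof (rule ccontr)
      assume "\<not> ennreal (g / K) < G x"
      then have "ennreal K * G x \<le> ennreal K * ennreal (g / K)" by (intro mult_left_mono) auto
      also have "\<dots> = ennreal g" using K g by (simp add: ennreal_mult[symmetric])
      finally show False using x(2) by simp
    qed
    with x show "x \<in> {x. 0 < x \<and> ennreal (g / K) < G x}" by simp
  qed
  then have "emeasure (power_measure d) {x. 0 < x \<and> ennreal g < T x} \<le> emeasure (power_measure d) {x. 0 < x \<and> ennreal (g / K) < G x}"
    using level_set_LP[OF G, of "ennreal (g / K)"] by (intro emeasure_mono) auto
  also have "\<dots> \<le> ennreal (C * (g / K) powr (- p)) * weighted_integral d p F"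
    using w g K unfolding weak_bound_def by auto
  also have "(g / K) powr (- p) = K powr p * g powr (- p)"
    using g K by (simp add: powr_divide powr_minus field_simps)
  finally show "emeasure (power_measure d) {x. 0 < x \<and> ennreal g < T x} \<le> ennreal (C * K powr p * g powr (- p)) * weighted_integral d p F"
    by (simp add: mult.assoc)
qed

lemma weak_type_bound_iff:
  assumes f: "f \<in> borel_measurable LP" and p: "0 < p"
  shows "weak_type_bound (power_measure d) p C g f \<longleftrightarrow> g \<in> borel_measurable LP \<and> weak_bound d p C g (enorm f)"
proof -
  have m: "enorm f \<in> borel_measurable LP" using f by measurable
  have "{x \<in> space (power_measure d). ennreal \<gamma> < g x} = {x. 0 < x \<and> ennreal \<gamma> < g x}" for \<gamma> by auto
  then show ?thesis
    unfolding weak_type_bound_def weak_bound_def ennreal_powr_Lp_norm[OF m p] by simp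
qed

text \<open>
  When all Poisson integrals converge, the maximal operator is its own sublinear extension.
\<close>

lemma poisson_sublinear_extension:
  assumes l: "l > -1/2" and dec: "\<And>f. f \<in> Lp M p \<Longrightarrow> decay_integrable l f" and sp: "space M = {0<..}"
  shows "sublinear_extension (poisson_maximal l) N M p (poisson_maximal l)"
  unfolding sublinear_extension_def
proof (intro conjI ballI allI AE_I2)
  fix f g x assume "f \<in> Lp M p" "g \<in> Lp M p" "x \<in> space M"
  then show "poisson_maximal l (\<lambda>y. f y + g y) x \<le> poisson_maximal l f x + poisson_maximal l g x"
    using sp by (intro poisson_maximal_add l dec) auto
qed (auto simp: poisson_maximal_scale)

lemma poisson_weak_type:
  assumes l: "l > -1/2" and p: "1 \<le> p" and d: "(-1 < d \<and> d < (2 * l + 1) * p - 1) \<or> (p = 1 \<and> d = 2 * l)"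
  shows "weak_type (poisson_maximal l) N (power_measure d) p"
proof -
  have p0: "0 < p" using p by simp
  obtain C where C: "0 < C" "\<And>F. F \<in> borel_measurable LP \<Longrightarrow> weak_bound d p C (majorant l d F) F"
    using majorant_weak_bound[OF p l d] by blast
  obtain K where K: "0 < K" "\<And>f x. f \<in> borel_measurable LP \<Longrightarrow> 0 < x \<Longrightarrow> poisson_maximal l f x \<le> ennreal K * majorant l d (enorm f) x"
    using poisson_maximal_le_majorant[OF l, of d] by auto
  have dec: "decay_integrable l f" if "f \<in> Lp (power_measure d) p" for f
  proof -
    have f: "f \<in> borel_measurable LP" "weighted_integral d p (enorm f) < top"
      using that unfolding Lp_power_measure_iff[OF p0] by blast+
    have m: "enorm f \<in> borel_measurable LP" using f by measurable
    obtain x where "0 < x" "majorant l d (enorm f) x < top"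
      using weak_bound_finite_somewhere[OF C(2)[OF m] p0 less_imp_le[OF C(1)] f(2)] by blast
    then show ?thesis by (intro decay_integrable_of_majorant[OF l f(1)])
  qed
  have "weak_type_bound (power_measure d) p (C * K powr p) (poisson_maximal l f) f" if "f \<in> Lp (power_measure d) p" for f
  proof -
    have f: "f \<in> borel_measurable LP" using that unfolding Lp_power_measure_iff[OF p0] by blast+
    have m: "enorm f \<in> borel_measurable LP" using f by measurable
    show ?thesis unfolding weak_type_bound_iff[OF f p0]
      by (intro conjI poisson_maximal_measurable l dec that weak_bound_of_pointwise[OF C(2)[OF m] K(1) K(2)[OF f]] majorant_measurable m)
  qed
  then show ?thesis unfolding weak_type_def
    by (intro exI[of _ "poisson_maximal l"] conjI poisson_sublinear_extension l dec exI[of _ "C * K powr p"] ballI) auto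
qed

lemma poisson_strong_type:
  assumes l: "l > -1/2" and p: "1 < p" and d: "-1 < d" "d < (2 * l + 1) * p - 1"
  shows "strong_type (poisson_maximal l) N (power_measure d) p"
proof -
  have p0: "0 < p" "1 \<le> p" using p by auto
  obtain C where C: "0 < C" "\<And>F. F \<in> borel_measurable LP \<Longrightarrow> weighted_integral d p (majorant l d F) \<le> ennreal C * weighted_integral d p F"
    using majorant_strong_bound[OF p d] by blast
  obtain K where K: "0 < K" "\<And>f x. f \<in> borel_measurable LP \<Longrightarrow> 0 < x \<Longrightarrow> poisson_maximal l f x \<le> ennreal K * majorant l d (enorm f) x"
    using poisson_maximal_le_majorant[OF l, of d] by auto
  have dec: "decay_integrable l f" if "f \<in> Lp (power_measure d) p" for f
  proof -
    have f: "f \<in> borel_measurable LP" "weighted_integral d p (enorm f) < top"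
      using that unfolding Lp_power_measure_iff[OF p0(1)] by blast+
    have m [measurable]: "enorm f \<in> borel_measurable LP" using f by measurable
    have "weak_bound d p C (majorant l d (enorm f)) (enorm f)"
      by (intro weak_bound_of_strong majorant_measurable m p0 C less_imp_le[OF C(1)])
    from weak_bound_finite_somewhere[OF this p0(1) less_imp_le[OF C(1)] f(2)]
    obtain x where "0 < x" "majorant l d (enorm f) x < top" by blast
    then show ?thesis by (intro decay_integrable_of_majorant[OF l f(1)])
  qed
  define D where "D = (K powr p * C) powr (1 / p)"
  have "poisson_maximal l f \<in> borel_measurable (power_measure d) \<and>
     Lp_norm (power_measure d) p (poisson_maximal l f) \<le> ennreal D * Lp_norm (power_measure d) p (enorm f)"
    if "f \<in> Lp (power_measure d) p" for f
  proof
    have f: "f \<in> borel_measurable LP" using that unfolding Lp_power_measure_iff[OF p0(1)] by blast+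
    have m [measurable]: "enorm f \<in> borel_measurable LP" using f by measurable
    have T [measurable]: "poisson_maximal l f \<in> borel_measurable LP" by (intro poisson_maximal_measurable l dec that)
    then show "poisson_maximal l f \<in> borel_measurable (power_measure d)" by simp
    have [measurable]: "majorant l d (enorm f) \<in> borel_measurable LP" by (intro majorant_measurable m)
    have "weighted_integral d p (poisson_maximal l f) \<le> (\<integral>\<^sup>+x. ennreal (K powr p) * (ennreal (x powr d) * ennreal_powr (majorant l d (enorm f) x) p) \<partial>LP)"
    proof (rule nn_integral_mono)
      fix x assume "x \<in> space LP"
      then have "ennreal_powr (poisson_maximal l f x) p \<le> ennreal_powr (ennreal K * majorant l d (enorm f) x) p"
        using K(2)[OF f, of x] p0 by (intro ennreal_powr_mono) auto
      also have "\<dots> = ennreal (K powr p) * ennreal_powr (majorant l d (enorm f) x) p"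
        using K(1) by (simp add: ennreal_powr_mult)
      finally show "ennreal (x powr d) * ennreal_powr (poisson_maximal l f x) p \<le> ennreal (K powr p) * (ennreal (x powr d) * ennreal_powr (majorant l d (enorm f) x) p)"
        by (subst mult.left_commute) (rule mult_left_mono, auto)
    qed
    also have "\<dots> = ennreal (K powr p) * weighted_integral d p (majorant l d (enorm f))"
      by (rule nn_integral_cmult) measurable
    also have "\<dots> \<le> ennreal (K powr p) * (ennreal C * weighted_integral d p (enorm f))"
      by (intro mult_left_mono C m) simp
    also have "\<dots> = ennreal (K powr p * C) * weighted_integral d p (enorm f)"
      using C(1) by (simp add: ennreal_mult mult.assoc)
    finally have "ennreal_powr (weighted_integral d p (poisson_maximal l f)) (1 / p) \<le> ennreal_powr (ennreal (K powr p * C) * weighted_integral d p (enorm f)) (1 / p)"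
      using p0 by (intro ennreal_powr_mono) auto
    also have "\<dots> = ennreal D * ennreal_powr (weighted_integral d p (enorm f)) (1 / p)"
      using C(1) by (simp add: ennreal_powr_mult D_def)
    finally show "Lp_norm (power_measure d) p (poisson_maximal l f) \<le> ennreal D * Lp_norm (power_measure d) p (enorm f)"
      unfolding Lp_norm_power_measure[OF T] Lp_norm_power_measure[OF m] .
  qed
  then show ?thesis unfolding strong_type_def
    by (intro exI[of _ "poisson_maximal l"] conjI poisson_sublinear_extension l dec exI[of _ D] ballI) auto
qed

lemma poisson_restricted_weak_type:
  assumes l: "l > -1/2" and p: "1 \<le> p" and d: "-1 < d" "d \<le> (2 * l + 1) * p - 1"
  shows "restricted_weak_type (poisson_maximal l) (power_measure d) p"
proof -
  have p0: "0 < p" using p by simp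
  obtain C where C: "0 < C" "\<And>E. E \<in> sets LP \<Longrightarrow> emeasure (power_measure d) E < top \<Longrightarrow> weak_bound d p C (majorant l d (indicator E)) (indicator E)"
    using majorant_restricted_weak_bound[OF p l d] by blast
  obtain K where K: "0 < K" "\<And>f x. f \<in> borel_measurable LP \<Longrightarrow> 0 < x \<Longrightarrow> poisson_maximal l f x \<le> ennreal K * majorant l d (enorm f) x"
    using poisson_maximal_le_majorant[OF l, of d] by auto
  show ?thesis unfolding restricted_weak_type_def
  proof (intro exI[of _ "C * K powr p"] ballI impI)
    fix E assume "E \<in> sets (power_measure d)" and fin: "emeasure (power_measure d) E < top"
    then have E [measurable]: "E \<in> sets LP" by simp
    have f: "(indicator E :: real \<Rightarrow> complex) \<in> borel_measurable LP" by measurable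
    have e: "enorm (indicator E) = (indicator E :: real \<Rightarrow> ennreal)" by (auto simp: indicator_def fun_eq_iff)
    have m: "(indicator E :: real \<Rightarrow> ennreal) \<in> borel_measurable LP" by measurable
    have dec: "decay_integrable l (indicator E)"
      by (rule decay_integrable_of_bounded[OF l f, of 1]) (auto simp: e indicator_def)
    show "weak_type_bound (power_measure d) p (C * K powr p) (poisson_maximal l (indicator E)) (indicator E)"
      unfolding weak_type_bound_iff[OF f p0] e
      by (intro conjI poisson_maximal_measurable l dec weak_bound_of_pointwise[OF C(2)[OF E fin] K(1) K(2)[OF f, unfolded e]] majorant_measurable m)
  qed
qed

lemma poisson_strong_type_infty:
  assumes l: "l > -1/2"
  shows "strong_type_infty (poisson_maximal l) (power_measure d)"
proof -
  obtain C where C: "0 < C" "\<And>t x. 0 < t \<Longrightarrow> 0 < x \<Longrightarrow> (\<integral>\<^sup>+y. ennreal (poisson_model l t x y * y powr (2 * l)) \<partial>LP) \<le> ennreal C"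
    using poisson_model_mass[OF l] by blast
  obtain K where K: "0 < K" "\<And>f t x. f \<in> borel_measurable LP \<Longrightarrow> 0 < t \<Longrightarrow> 0 < x \<Longrightarrow>
     (\<integral>\<^sup>+y. ennreal (norm (complex_of_real (poisson_kernel l t x y) * f y)) \<partial>power_measure (2 * l))
       \<le> ennreal K * (\<integral>\<^sup>+y. enorm f y * ennreal (poisson_model l t x y * y powr (2 * l)) \<partial>LP)"
    using kernel_times_norm_le[OF l] by auto
  show ?thesis unfolding strong_type_infty_def
  proof (intro exI[of _ "K * C"] ballI conjI)
    fix f assume "f \<in> Linfty (power_measure d)"
    then have f [measurable]: "f \<in> borel_measurable LP" and fin: "esssup (power_measure d) (enorm f) < top"
      by (auto simp: Linfty_def)
    define M where "M = esssup (power_measure d) (enorm f)"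
    have m: "enorm f \<in> borel_measurable (power_measure d)" using f by simp
    have "AE y in power_measure d. enorm f y \<le> M" unfolding M_def by (rule esssup_AE)
    then have AE: "AE y in LP. enorm f y \<le> M" by (simp only: AE_power_measure)
    have dec: "decay_integrable l f"
      by (rule decay_integrable_of_bounded[OF l f AE]) (use fin in \<open>simp add: M_def\<close>)
    show T: "poisson_maximal l f \<in> borel_measurable (power_measure d)"
      using poisson_maximal_measurable[OF l dec] by simp
    have "poisson_maximal l f x \<le> ennreal (K * C) * M" if x: "0 < x" for x
      unfolding poisson_maximal_def
    proof (rule SUP_least)
      fix t :: real assume "t \<in> {0<..}"
      then have t: "0 < t" by simp
      note [measurable] = poisson_model_measurable[OF t]
      have "ennreal (norm (poisson_integral l t f x)) \<le> (\<integral>\<^sup>+y. ennreal (norm (complex_of_real (poisson_kernel l t x y) * f y)) \<partial>power_measure (2 * l))"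
        unfolding poisson_integral_def by (rule ennreal_norm_integral_le)
      also have "\<dots> \<le> ennreal K * (\<integral>\<^sup>+y. enorm f y * ennreal (poisson_model l t x y * y powr (2 * l)) \<partial>LP)"
        by (rule K(2)[OF f t x])
      also have "(\<integral>\<^sup>+y. enorm f y * ennreal (poisson_model l t x y * y powr (2 * l)) \<partial>LP) \<le> (\<integral>\<^sup>+y. M * ennreal (poisson_model l t x y * y powr (2 * l)) \<partial>LP)"
      proof (rule nn_integral_mono_AE)
        show "AE y in LP. enorm f y * ennreal (poisson_model l t x y * y powr (2 * l)) \<le> M * ennreal (poisson_model l t x y * y powr (2 * l))"
          using AE by eventually_elim (intro mult_right_mono, auto)
      qed
      also have "\<dots> = M * (\<integral>\<^sup>+y. ennreal (poisson_model l t x y * y powr (2 * l)) \<partial>LP)" by (rule nn_integral_cmult) measurable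
      also have "\<dots> \<le> M * ennreal C" by (intro mult_left_mono C t x) auto
      finally have "ennreal (norm (poisson_integral l t f x)) \<le> ennreal K * (M * ennreal C)" by (simp add: mult_left_mono)
      then show "ennreal (norm (poisson_integral l t f x)) \<le> ennreal (K * C) * M"
        using K(1) C(1) by (simp add: ennreal_mult mult_ac)
    qed
    then have "AE x in power_measure d. poisson_maximal l f x \<le> ennreal (K * C) * M"
      by (intro AE_I2) auto
    then show "esssup (power_measure d) (poisson_maximal l f) \<le> ennreal (K * C) * esssup (power_measure d) (enorm f)"
      unfolding M_def[symmetric] by (rule esssup_I[OF T])
  qed
qed

section \<open>Lower bounds of the Poisson maximal function\<close>

lemma bounded_support_Lp:
  assumes f: "f \<in> borel_measurable LP" and p: "0 < p" and a: "0 < a" "a < b"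
    and bd: "\<And>y. norm (f y) \<le> B * indicator {a..b} y" and B: "0 \<le> B"
  shows "f \<in> Lp (power_measure d) p"
proof -
  have [measurable]: "(\<lambda>y. indicator {a/2<..<2*b} y :: ennreal) \<in> borel_measurable LP" by (intro borel_LP) measurable
  have sI: "{a/2<..<2*b} \<in> sets LP" using a by (intro borel_set_LP) auto
  have "weighted_integral d p (enorm f) \<le> (\<integral>\<^sup>+x. ennreal (B powr p) * (ennreal (x powr d) * indicator {a/2<..<2*b} x) \<partial>LP)"
  proof (rule nn_integral_mono)
    fix x
    have "norm (f x) \<le> B * indicator {a/2<..<2*b} x"
      by (intro order_trans[OF bd] mult_left_mono B) (use a in \<open>auto simp: indicator_def\<close>)
    then have "ennreal_powr (enorm f x) p \<le> ennreal (B powr p) * indicator {a/2<..<2*b} x"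
      using p B by (auto simp: indicator_def split: if_splits intro!: ennreal_leI powr_mono2)
    from mult_left_mono[OF this, of "ennreal (x powr d)"]
    show "ennreal (x powr d) * ennreal_powr (enorm f x) p \<le> ennreal (B powr p) * (ennreal (x powr d) * indicator {a/2<..<2*b} x)"
      by (simp add: mult_ac)
  qed
  also have "\<dots> = ennreal (B powr p) * emeasure (power_measure d) {a/2<..<2*b}"
    unfolding emeasure_power_measure[OF sI] by (rule nn_integral_cmult) measurable
  also have "\<dots> < top" using power_measure_interval(4)[of "a/2" "2*b" d] a by (simp add: ennreal_mult_less_top)
  finally show ?thesis using f unfolding Lp_power_measure_iff[OF p] by simp
qed

text \<open>
  A lower bound from a single time $t$. Stating it with a number $v$ below the integral, in place of
  the integral itself, keeps the conclusion free of a finiteness question.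
\<close>

lemma poisson_maximal_lower:
  assumes l: "l > -1/2"
  shows "\<exists>c>0. \<forall>h t x v. h \<in> borel_measurable LP \<longrightarrow> (\<forall>y. 0 \<le> h y) \<longrightarrow> decay_integrable l (\<lambda>y. complex_of_real (h y)) \<longrightarrow>
     0 < t \<longrightarrow> 0 < x \<longrightarrow> 0 \<le> v \<longrightarrow> ennreal v \<le> (\<integral>\<^sup>+y. ennreal (h y * (poisson_model l t x y * y powr (2 * l))) \<partial>LP)
     \<longrightarrow> ennreal (c * v) \<le> poisson_maximal l (\<lambda>y. complex_of_real (h y)) x"
proof -
  obtain c where c: "0 < c" "\<And>t x y. 0 < t \<Longrightarrow> 0 < x \<Longrightarrow> 0 < y \<Longrightarrow> c * poisson_model l t x y \<le> poisson_kernel l t x y"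
    using poisson_kernel_lower[OF l] by auto
  show ?thesis
  proof (intro exI[of _ c] conjI allI impI c(1))
    fix h :: "real \<Rightarrow> real" and t x v :: real
    assume h [measurable]: "h \<in> borel_measurable LP" and h0: "\<forall>y. 0 \<le> h y" and dec: "decay_integrable l (\<lambda>y. complex_of_real (h y))"
      and t: "0 < t" and x: "0 < x" and v: "0 \<le> v" "ennreal v \<le> (\<integral>\<^sup>+y. ennreal (h y * (poisson_model l t x y * y powr (2 * l))) \<partial>LP)"
    let ?N = "power_measure (2 * l)"
    note [measurable] = poisson_model_measurable[OF t] poisson_kernel_measurable[OF l t x]
    have i: "integrable ?N (\<lambda>y. complex_of_real (poisson_kernel l t x y * h y))"
      using poisson_integrable[OF l dec t x] by simp
    then have ir: "integrable ?N (\<lambda>y. poisson_kernel l t x y * h y)"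
      by (simp only: complex_of_real_integrable_eq)
    have k0: "0 \<le> poisson_kernel l t x y * h y" if "0 < y" for y
      using poisson_kernel_nonneg[OF l t x that] h0 by simp
    have "poisson_integral l t (\<lambda>y. complex_of_real (h y)) x = (\<integral>y. complex_of_real (poisson_kernel l t x y * h y) \<partial>?N)"
      by (simp add: poisson_integral_def)
    also have "\<dots> = complex_of_real (\<integral>y. poisson_kernel l t x y * h y \<partial>?N)"
      by (rule integral_complex_of_real)
    finally have P: "norm (poisson_integral l t (\<lambda>y. complex_of_real (h y)) x) = \<bar>\<integral>y. poisson_kernel l t x y * h y \<partial>?N\<bar>" by simp
    have "ennreal (c * v) \<le> ennreal c * (\<integral>\<^sup>+y. ennreal (h y * (poisson_model l t x y * y powr (2 * l))) \<partial>LP)"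
      using v c(1) by (simp add: ennreal_mult mult_left_mono)
    also have "\<dots> = (\<integral>\<^sup>+y. ennreal c * ennreal (h y * (poisson_model l t x y * y powr (2 * l))) \<partial>LP)"
      by (rule nn_integral_cmult[symmetric]) measurable
    also have "\<dots> \<le> (\<integral>\<^sup>+y. ennreal (y powr (2 * l)) * ennreal (poisson_kernel l t x y * h y) \<partial>LP)"
    proof (rule nn_integral_mono)
      fix y assume "y \<in> space LP"
      then have y: "0 < y" by simp
      have "c * poisson_model l t x y * (h y * y powr (2 * l)) \<le> poisson_kernel l t x y * (h y * y powr (2 * l))"
        using c(2)[OF t x y] h0 by (intro mult_right_mono) auto
      then have "c * (h y * (poisson_model l t x y * y powr (2 * l))) \<le> y powr (2 * l) * (poisson_kernel l t x y * h y)"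
        by (simp add: mult_ac)
      then show "ennreal c * ennreal (h y * (poisson_model l t x y * y powr (2 * l))) \<le> ennreal (y powr (2 * l)) * ennreal (poisson_kernel l t x y * h y)"
        using c(1) h0 k0[OF y] poisson_model_nonneg[OF t, of l x y] by (simp add: ennreal_mult[symmetric] ennreal_leI)
    qed
    also have "\<dots> = (\<integral>\<^sup>+y. ennreal (poisson_kernel l t x y * h y) \<partial>?N)"
      by (rule nn_integral_power_measure[symmetric]) measurable
    also have "\<dots> = ennreal (\<integral>y. poisson_kernel l t x y * h y \<partial>?N)"
      by (intro nn_integral_eq_integral ir AE_I2) (use k0 in auto)
    also have "\<dots> \<le> ennreal (norm (poisson_integral l t (\<lambda>y. complex_of_real (h y)) x))"
      unfolding P by (intro ennreal_leI) simp
    also have "\<dots> \<le> poisson_maximal l (\<lambda>y. complex_of_real (h y)) x"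
      unfolding poisson_maximal_def using t by (intro SUP_upper) auto
    finally show "ennreal (c * v) \<le> poisson_maximal l (\<lambda>y. complex_of_real (h y)) x" .
  qed
qed

text \<open>
  The power $A^{-l}$ may increase or decrease in $A$; the form $Q^{-|l|}$ treats both signs of $l$
  at once when $A$ is known up to the factor $Q$.
\<close>

lemma poisson_model_ge:
  assumes "0 < t" "1 \<le> Q" "0 < k" "k / Q \<le> sqsum t x y" "sqsum t x y \<le> k * Q" "t\<^sup>2 + (x - y)\<^sup>2 \<le> D"
  shows "t * k powr (- l) * Q powr (- \<bar>l\<bar>) / D \<le> poisson_model l t x y"
proof -
  define s where "s = sqsum t x y / k"
  have s: "1 / Q \<le> s" "s \<le> Q" using assms by (auto simp: s_def field_simps)
  have S: "sqsum t x y = k * s" using assms by (simp add: s_def)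
  have s0: "0 < s" using s(1) assms(2) by (auto intro: less_le_trans[of 0 "1 / Q"])
  have "Q powr (- \<bar>- l\<bar>) \<le> s powr (- l)" by (rule powr_between_inverse(2)[OF assms(2) s])
  then have "k powr (- l) * Q powr (- \<bar>l\<bar>) \<le> k powr (- l) * s powr (- l)" by (intro mult_left_mono) auto
  also have "\<dots> = sqsum t x y powr (- l)" unfolding S using assms s0 by (simp add: powr_mult)
  finally have le: "t * (k powr (- l) * Q powr (- \<bar>l\<bar>)) \<le> t * sqsum t x y powr (- l)" using assms by (intro mult_left_mono) auto
  have "0 < t\<^sup>2 + (x - y)\<^sup>2" using assms by (simp add: add_pos_nonneg)
  then show ?thesis unfolding poisson_model_def mult.assoc using le assms by (intro frac_le) auto
qed

lemma powr_ge_near_one: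
  assumes "1/2 \<le> y" "y \<le> 2"
  shows "2 powr (- \<bar>c\<bar>) \<le> (y::real) powr c"
  using powr_between_inverse(2)[of 2 y c] assms by simp

lemma nn_integral_LP_Icc:
  assumes "0 < a" "a \<le> b"
  shows "(\<integral>\<^sup>+y. indicator {a..b} y \<partial>LP) = ennreal (b - a)"
proof -
  have "(\<integral>\<^sup>+y. indicator {a..b} y \<partial>LP) = (\<integral>\<^sup>+y. indicator {a..b} y \<partial>lborel)"
    unfolding nn_integral_LP using assms by (intro nn_integral_cong) (auto simp: indicator_def)
  then show ?thesis using assms by simp
qed

lemma nn_integral_LP_reciprocal:
  assumes "0 < a" "a \<le> b" "s < a"
  shows "(\<integral>\<^sup>+y. ennreal (1 / (y - s)) * indicator {a..b} y \<partial>LP) = ennreal (ln (b - s) - ln (a - s))"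
proof -
  have "(\<integral>\<^sup>+y. ennreal (1 / (y - s)) * indicator {a..b} y \<partial>LP) = (\<integral>\<^sup>+y. ennreal (1 / (y - s)) * indicator {a..b} y \<partial>lborel)"
    unfolding nn_integral_LP using assms by (intro nn_integral_cong) (auto simp: indicator_def)
  also have "\<dots> = ennreal (ln (b - s) - ln (a - s))"
    using assms by (intro nn_integral_FTC_Icc) (auto intro!: derivative_eq_intros simp: divide_inverse)
  finally show ?thesis .
qed

lemma indicator_test_function:
  fixes a b :: real
  assumes l: "l > -1/2" and ab: "0 < a" "a < b"
  shows "(\<lambda>y. indicator {a..b} y :: real) \<in> borel_measurable LP"
    and "decay_integrable l (\<lambda>y. complex_of_real (indicator {a..b} y))"
    and "0 < p \<Longrightarrow> (\<lambda>y. complex_of_real (indicator {a..b} y)) \<in> Lp (power_measure d) p"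
proof -
  show m: "(\<lambda>y. indicator {a..b} y :: real) \<in> borel_measurable LP" by (intro borel_LP) measurable
  then have m': "(\<lambda>y. complex_of_real (indicator {a..b} y)) \<in> borel_measurable LP" by measurable
  show "decay_integrable l (\<lambda>y. complex_of_real (indicator {a..b} y))"
    by (rule decay_integrable_of_bounded[OF l m', of 1]) (auto simp: indicator_def)
  show "0 < p \<Longrightarrow> (\<lambda>y. complex_of_real (indicator {a..b} y)) \<in> Lp (power_measure d) p"
    by (rule bounded_support_Lp[OF m' _ ab, of _ 1]) (auto simp: indicator_def)
qed

text \<open>
  The time $t = 1$ serves for $x < 1$ and $t = x$ for $x \ge 2$. Both values are sharp up to
  constants, being those of the Hardy operators.
\<close>

lemma poisson_maximal_unit_interval:
  assumes l: "l > -1/2"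
  shows "\<exists>c>0. (\<forall>x. 0 < x \<longrightarrow> x < 1 \<longrightarrow> ennreal c \<le> poisson_maximal l (indicator {1..2}) x) \<and>
     (\<forall>x\<ge>2. ennreal (c * x powr (- (2 * l + 1))) \<le> poisson_maximal l (indicator {1..2}) x)"
proof -
  obtain c where c: "0 < c" and low: "\<And>h t x v. h \<in> borel_measurable LP \<Longrightarrow> (\<And>y. 0 \<le> h y) \<Longrightarrow> decay_integrable l (\<lambda>y. complex_of_real (h y)) \<Longrightarrow>
     0 < t \<Longrightarrow> 0 < x \<Longrightarrow> 0 \<le> v \<Longrightarrow> ennreal v \<le> (\<integral>\<^sup>+y. ennreal (h y * (poisson_model l t x y * y powr (2 * l))) \<partial>LP)
     \<Longrightarrow> ennreal (c * v) \<le> poisson_maximal l (\<lambda>y. complex_of_real (h y)) x"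
    using poisson_maximal_lower[OF l] by auto
  \<comment> \<open>The denominator 5 bounds t^2 + (x - y)^2 for x < 1, where t = 1; the factor 6 bounds the variation of t^2 + x^2 + y^2 in both cases.\<close>
  define m where "m = 6 powr (- \<bar>l\<bar>) / 5 * 2 powr (- \<bar>2 * l\<bar>)"
  have m: "0 < m" by (simp add: m_def)
  have ind: "(indicator {1..2} :: real \<Rightarrow> complex) = (\<lambda>y. complex_of_real (indicator {1..2} y))"
    by (auto simp: indicator_def fun_eq_iff)
  note test = indicator_test_function[OF l, of 1 2, simplified]
  have key: "ennreal (c * w) \<le> poisson_maximal l (indicator {1..2}) x"
    if t: "0 < t" and x: "0 < x" and w: "0 \<le> w" "\<And>y. 1 \<le> y \<Longrightarrow> y \<le> 2 \<Longrightarrow> w \<le> poisson_model l t x y * y powr (2 * l)" for t x w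
    unfolding ind
  proof (rule low[OF test(1) _ test(2) t x w(1)])
    have "ennreal w = ennreal w * (\<integral>\<^sup>+y. indicator {1..2::real} y \<partial>LP)" by (subst nn_integral_LP_Icc) auto
    also have "\<dots> = (\<integral>\<^sup>+y. ennreal w * indicator {1..2} y \<partial>LP)"
      by (rule nn_integral_cmult[symmetric]) (rule borel_LP, measurable)
    also have "\<dots> \<le> (\<integral>\<^sup>+y. ennreal (indicator {1..2} y * (poisson_model l t x y * y powr (2 * l))) \<partial>LP)"
      using w by (intro nn_integral_mono) (auto simp: indicator_def intro!: ennreal_leI)
    finally show "ennreal w \<le> (\<integral>\<^sup>+y. ennreal (indicator {1..2} y * (poisson_model l t x y * y powr (2 * l))) \<partial>LP)" .
  qed simp
  have sq: "1 \<le> y\<^sup>2" "y\<^sup>2 \<le> 4" if "1 \<le> y" "y \<le> 2" for y :: real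
    using power_mono[of 1 y 2] power_mono[of y 2 2] that by auto
  have near: "ennreal (c * m) \<le> poisson_maximal l (indicator {1..2}) x" if x: "0 < x" "x < 1" for x
  proof (rule key[of 1])
    fix y :: real assume y: "1 \<le> y" "y \<le> 2"
    have x2: "0 \<le> x\<^sup>2" "x\<^sup>2 \<le> 1" using x by (auto simp: power_le_one)
    have "(x - y)\<^sup>2 = (y - x)\<^sup>2" by (rule power2_commute)
    also have "\<dots> \<le> 2\<^sup>2" using x y by (intro power_mono) auto
    finally have "1 * 1 powr (- l) * 6 powr (- \<bar>l\<bar>) / 5 \<le> poisson_model l 1 x y"
      using sq[OF y] x2 by (intro poisson_model_ge) (auto simp: sqsum_def)
    then have "6 powr (- \<bar>l\<bar>) / 5 * 2 powr (- \<bar>2 * l\<bar>) \<le> poisson_model l 1 x y * y powr (2 * l)"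
      using powr_ge_near_one[of y "2 * l"] y by (intro mult_mono poisson_model_nonneg) auto
    then show "m \<le> poisson_model l 1 x y * y powr (2 * l)" by (simp add: m_def)
  qed (use x m in auto)
  have far: "ennreal (c * (m * x powr (- (2 * l + 1)))) \<le> poisson_maximal l (indicator {1..2}) x" if x: "2 \<le> x" for x
  proof (rule key[of x])
    fix y :: real assume y: "1 \<le> y" "y \<le> 2"
    have x4: "4 \<le> x\<^sup>2" using power_mono[of 2 x 2] x by simp
    have "(x - y)\<^sup>2 \<le> x\<^sup>2" using x y by (intro power_mono) auto
    then have "x * (x\<^sup>2) powr (- l) * 6 powr (- \<bar>l\<bar>) / (2 * x\<^sup>2) \<le> poisson_model l x x y"
      using sq[OF y] x4 x by (intro poisson_model_ge) (auto simp: sqsum_def)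
    then have "x * (x\<^sup>2) powr (- l) * 6 powr (- \<bar>l\<bar>) / (2 * x\<^sup>2) * 2 powr (- \<bar>2 * l\<bar>) \<le> poisson_model l x x y * y powr (2 * l)"
      using powr_ge_near_one[of y "2 * l"] y x by (intro mult_mono poisson_model_nonneg) auto
    moreover have "x * (x\<^sup>2) powr (- l) / (2 * x\<^sup>2) = 1/2 * x powr (- (2 * l + 1))"
    proof -
      have 1: "(x\<^sup>2) powr (- l) = x powr (- 2 * l)" using x by (simp add: powr_powr flip: powr_numeral)
      have 2: "x / x\<^sup>2 = x powr (- 1)" using x by (simp add: power2_eq_square powr_minus divide_inverse)
      have e: "- 1 + - 2 * l = - (2 * l + 1)" by simp
      have 3: "x powr (- 1) * x powr (- 2 * l) = x powr (- (2 * l + 1))" unfolding powr_add[symmetric] e ..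
      have "x * (x\<^sup>2) powr (- l) / (2 * x\<^sup>2) = 1/2 * ((x / x\<^sup>2) * (x\<^sup>2) powr (- l))" by simp
      then show ?thesis unfolding 1 2 3 .
    qed
    moreover have "x * (x\<^sup>2) powr (- l) * 6 powr (- \<bar>l\<bar>) / (2 * x\<^sup>2) * 2 powr (- \<bar>2 * l\<bar>)
      = x * (x\<^sup>2) powr (- l) / (2 * x\<^sup>2) * 6 powr (- \<bar>l\<bar>) * 2 powr (- \<bar>2 * l\<bar>)" by simp
    ultimately have "1/2 * x powr (- (2 * l + 1)) * 6 powr (- \<bar>l\<bar>) * 2 powr (- \<bar>2 * l\<bar>) \<le> poisson_model l x x y * y powr (2 * l)"
      by (simp only:)
    moreover have "m * x powr (- (2 * l + 1)) \<le> 1/2 * x powr (- (2 * l + 1)) * 6 powr (- \<bar>l\<bar>) * 2 powr (- \<bar>2 * l\<bar>)"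
    proof -
      have "0 \<le> x powr (- (2 * l + 1)) * (6 powr (- \<bar>l\<bar>) * 2 powr (- \<bar>2 * l\<bar>))" by simp
      then show ?thesis by (simp add: m_def mult_ac)
    qed
    ultimately show "m * x powr (- (2 * l + 1)) \<le> poisson_model l x x y * y powr (2 * l)" by linarith
  qed (use x m in auto)
  show ?thesis
    by (intro exI[of _ "c * m"] conjI allI impI) (use c m near far in \<open>auto simp: mult.assoc\<close>)
qed

section \<open>Necessity of the range\<close>

text \<open>
  Comparison with the divergent integral of $1/y$.
\<close>

lemma emeasure_open_unit_top:
  assumes d: "d \<le> -1"
  shows "emeasure (power_measure d) {0<..<1} = top"
proof (rule ccontr)
  assume "\<not> ?thesis"
  then obtain M where M: "emeasure (power_measure d) {0<..<1} = ennreal M" "0 \<le> M"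
    by (cases "emeasure (power_measure d) {0<..<1}") auto
  \<comment> \<open>Then the integral of 1/y from e to 1/2 is M + 1.\<close>
  define e where "e = exp (- (M + 1)) / 2"
  have e: "0 < e" "e < 1/2"
  proof -
    have "exp (- (M + 1)) < 1" using M by simp
    then show "0 < e" "e < 1/2" by (auto simp: e_def)
  qed
  have s: "{0<..<1::real} \<in> sets LP" by (intro borel_set_LP) auto
  have "ennreal (ln (1/2 - 0) - ln (e - 0)) = (\<integral>\<^sup>+y. ennreal (1 / (y - 0)) * indicator {e..1/2} y \<partial>LP)"
    using e by (intro nn_integral_LP_reciprocal[symmetric]) auto
  also have "\<dots> \<le> (\<integral>\<^sup>+y. ennreal (y powr d) * indicator {0<..<1} y \<partial>LP)"
  proof (rule nn_integral_mono)
    fix y :: real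
    have "1 / y \<le> y powr d" if "0 < y" "y < 1"
    proof -
      have "y powr (- 1) \<le> y powr d" using that d by (intro powr_mono') auto
      then show ?thesis using that by (simp add: powr_minus divide_inverse)
    qed
    then show "ennreal (1 / (y - 0)) * indicator {e..1/2} y \<le> ennreal (y powr d) * indicator {0<..<1} y"
      using e by (auto simp: indicator_def intro!: ennreal_leI)
  qed
  also have "\<dots> = ennreal M" using M emeasure_power_measure[OF s] by simp
  finally have "ennreal (ln (1/2) - ln e) \<le> ennreal M" by simp
  moreover have "ln (1/2) - ln e = M + 1"
  proof -
    have "ln e = ln (exp (- (M + 1))) + ln (1/2)"
      unfolding e_def using ln_mult[of "exp (- (M + 1))" "1/2"] by (simp only: mult_1_right times_divide_eq_right) simp
    then show ?thesis by simp
  qed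
  ultimately show False using M by simp
qed

text \<open>
  The operator in the definition of weak type is an arbitrary extension, known only to agree with
  the maximal operator almost everywhere; this transfers the inequality.
\<close>

lemma weak_bound_level:
  assumes w: "weak_bound d p C g F" and g: "g \<in> borel_measurable LP" and ae: "AE x in LP. g x = T x" and \<gamma>: "0 < \<gamma>"
    and A: "A \<in> sets LP" "\<And>x. x \<in> A \<Longrightarrow> ennreal \<gamma> < T x"
  shows "emeasure (power_measure d) A \<le> ennreal (C * \<gamma> powr (- p)) * weighted_integral d p F"
proof -
  have "emeasure (power_measure d) A \<le> emeasure (power_measure d) {x. 0 < x \<and> ennreal \<gamma> < g x}"
  proof (rule emeasure_mono_AE)
    have ae': "AE x in power_measure d. g x = T x" using ae by (simp only: AE_power_measure)
    have sub: "A \<subseteq> {0<..}" using sets.sets_into_space[OF A(1)] by simp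
    show "AE x in power_measure d. x \<in> A \<longrightarrow> x \<in> {x. 0 < x \<and> ennreal \<gamma> < g x}"
      using ae' by eventually_elim (use A(2) sub in auto)
  qed (use level_set_LP[OF g] in simp)
  also have "\<dots> \<le> ennreal (C * \<gamma> powr (- p)) * weighted_integral d p F"
    using w \<gamma> unfolding weak_bound_def by blast
  finally show ?thesis .
qed

lemma indicator_enorm: "ennreal (norm (indicator E x :: complex)) = indicator E x"
  by (auto simp: indicator_def)

lemma weighted_integral_Icc_finite:
  assumes "0 < p" "0 < a" "a < b"
  shows "weighted_integral d p (indicator {a..b}) < top"
proof -
  have m: "(\<lambda>y. indicator {a..b} y :: complex) \<in> borel_measurable LP" by (intro borel_LP) measurable
  have "(indicator {a..b} :: real \<Rightarrow> complex) \<in> Lp (power_measure d) p"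
    by (rule bounded_support_Lp[OF m assms(1-3), of 1]) (auto simp: indicator_def)
  then show ?thesis unfolding Lp_power_measure_iff[OF assms(1)] indicator_enorm by blast
qed

text \<open>
  On $(0,1)$ the maximal function of the indicator of $[1,2]$ exceeds a constant, so that interval
  has finite measure, that is, $d > -1$. At a height of order $R^{-(2l+1)}$ the level set contains
  $(R/2, R)$, of measure about $R^{d+1}$; weak type bounds this by a multiple of $R^{(2l+1)p}$ for
  all large $R$.
\<close>

lemma weak_bound_necessary:
  assumes l: "l > -1/2" and p: "0 < p" and w: "weak_bound d p C g (indicator {1..2})" and g: "g \<in> borel_measurable LP"
    and ae: "AE x in LP. g x = poisson_maximal l (indicator {1..2}) x"
  shows "-1 < d \<and> d \<le> (2 * l + 1) * p - 1"
proof -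
  obtain c where c: "0 < c" "\<And>x. 0 < x \<Longrightarrow> x < 1 \<Longrightarrow> ennreal c \<le> poisson_maximal l (indicator {1..2}) x"
    "\<And>x. 2 \<le> x \<Longrightarrow> ennreal (c * x powr (- (2 * l + 1))) \<le> poisson_maximal l (indicator {1..2}) x"
    using poisson_maximal_unit_interval[OF l] by blast
  obtain W where W: "weighted_integral d p (indicator {1..2}) = ennreal W" "0 \<le> W"
    using weighted_integral_Icc_finite[OF p, of 1 2 d] by (cases "weighted_integral d p (indicator {1..2})") auto
  have s: "{0<..<1::real} \<in> sets LP" by (intro borel_set_LP) auto
  have "emeasure (power_measure d) {0<..<1} \<le> ennreal (C * (c/2) powr (- p)) * weighted_integral d p (indicator {1..2})"
  proof (rule weak_bound_level[OF w g ae _ s])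
    fix x :: real assume "x \<in> {0<..<1}"
    then have "ennreal c \<le> poisson_maximal l (indicator {1..2}) x" by (intro c) auto
    moreover have "ennreal (c/2) < ennreal c" using c(1) by (simp add: ennreal_less_iff)
    ultimately show "ennreal (c/2) < poisson_maximal l (indicator {1..2}) x" by (rule less_le_trans[rotated])
  qed (use c in simp)
  also have "\<dots> < top" unfolding W by (simp add: ennreal_mult_less_top)
  finally have d1: "-1 < d" using emeasure_open_unit_top[of d] by (cases "d \<le> -1") auto
  define k where "k = 2 * l + 1"
  have k: "0 < k" using l by (simp add: k_def)
  define B where "B = 2 powr (\<bar>d\<bar> + 1) * (\<bar>C\<bar> * (c/2) powr (- p) * W)"
  have B0: "0 \<le> B" using W by (simp add: B_def)
  have bound: "R powr (d + 1 - k * p) \<le> B" if R: "4 \<le> R" for R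
  proof -
    define \<gamma> where "\<gamma> = c/2 * R powr (- k)"
    have \<gamma>: "0 < \<gamma>" using c R by (simp add: \<gamma>_def)
    have sR: "{R/2<..<R} \<in> sets LP" using R by (intro borel_set_LP) auto
    have "ennreal (min ((R/2) powr d) (R powr d) * (R - R/2)) \<le> emeasure (power_measure d) {R/2<..<R}"
      using R by (intro power_measure_interval) auto
    also have "\<dots> \<le> ennreal (C * \<gamma> powr (- p)) * weighted_integral d p (indicator {1..2})"
    proof (rule weak_bound_level[OF w g ae \<gamma> sR])
      fix x assume x: "x \<in> {R/2<..<R}"
      then have "ennreal (c * x powr (- k)) \<le> poisson_maximal l (indicator {1..2}) x"
        unfolding k_def using R by (intro c) auto
      moreover have "\<gamma> < c * x powr (- k)"
      proof -
        have "R powr (- k) \<le> x powr (- k)" using x R k by (intro powr_mono2') auto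
        then have "c * R powr (- k) \<le> c * x powr (- k)" using c by (intro mult_left_mono) auto
        moreover have "\<gamma> < c * R powr (- k)" using c R by (simp add: \<gamma>_def)
        ultimately show ?thesis by simp
      qed
      then have "ennreal \<gamma> < ennreal (c * x powr (- k))" using \<gamma> by (subst ennreal_less_iff) auto
      ultimately show "ennreal \<gamma> < poisson_maximal l (indicator {1..2}) x" by (rule less_le_trans[rotated])
    qed
    also have "\<dots> \<le> ennreal (\<bar>C\<bar> * \<gamma> powr (- p)) * ennreal W"
      unfolding W(1) by (intro mult_right_mono ennreal_leI) auto
    also have "\<dots> = ennreal (\<bar>C\<bar> * \<gamma> powr (- p) * W)" using W by (intro ennreal_mult[symmetric]) auto
    finally have "min ((R/2) powr d) (R powr d) * (R - R/2) \<le> \<bar>C\<bar> * \<gamma> powr (- p) * W"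
      using W by (subst (asm) ennreal_le_iff) auto
    moreover have "2 powr (- \<bar>d\<bar>) * R powr d \<le> min ((R/2) powr d) (R powr d)"
    proof -
      have "(R/2) powr d = R powr d / 2 powr d" by (rule powr_divide)
      then have "(R/2) powr d = 2 powr (- d) * R powr d" by (simp only: powr_minus divide_inverse mult.commute)
      moreover have "2 powr (- \<bar>d\<bar>) * R powr d \<le> 2 powr (- d) * R powr d" by (intro mult_right_mono powr_mono) auto
      moreover have "2 powr (- \<bar>d\<bar>) * R powr d \<le> 1 * R powr d"
        using powr_mono[of "- \<bar>d\<bar>" 0 "2::real"] by (intro mult_right_mono) auto
      ultimately show ?thesis by simp
    qed
    then have "2 powr (- \<bar>d\<bar>) * R powr d * (R - R/2) \<le> min ((R/2) powr d) (R powr d) * (R - R/2)"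
      using R by (intro mult_right_mono) auto
    ultimately have le: "2 powr (- \<bar>d\<bar>) * R powr d * (R/2) \<le> \<bar>C\<bar> * \<gamma> powr (- p) * W" by simp
    have g1: "\<gamma> powr (- p) = (c/2) powr (- p) * R powr (k * p)"
      unfolding \<gamma>_def powr_mult powr_powr by simp
    have "R powr (d + 1) = 2 powr (\<bar>d\<bar> + 1) * (2 powr (- \<bar>d\<bar>) * R powr d * (R/2))"
    proof -
      have "2 powr (\<bar>d\<bar> + 1) * 2 powr (- \<bar>d\<bar>) = 2 powr (1::real)" unfolding powr_add[symmetric] by simp
      then have "2 powr (\<bar>d\<bar> + 1) * 2 powr (- \<bar>d\<bar>) = (2::real)" by simp
      moreover have "R powr (d + 1) = R powr d * R" using R by (simp add: powr_add)
      moreover have "2 powr (\<bar>d\<bar> + 1) * (2 powr (- \<bar>d\<bar>) * R powr d * (R/2)) = (2 powr (\<bar>d\<bar> + 1) * 2 powr (- \<bar>d\<bar>)) * (R powr d * R / 2)" by simp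
      ultimately show ?thesis by simp
    qed
    also have "\<dots> \<le> 2 powr (\<bar>d\<bar> + 1) * (\<bar>C\<bar> * \<gamma> powr (- p) * W)" by (intro mult_left_mono le) simp
    also have "\<dots> = B * R powr (k * p)" unfolding g1 B_def by (simp only: mult_ac)
    finally have fin: "R powr (d + 1) \<le> B * R powr (k * p)" .
    have "R powr (d + 1 - k * p) = R powr (d + 1) / R powr (k * p)" by (rule powr_diff)
    also have "\<dots> \<le> B * R powr (k * p) / R powr (k * p)" by (intro divide_right_mono fin) simp
    also have "\<dots> = B" using R by simp
    finally show ?thesis .
  qed
  have "d + 1 - k * p \<le> 0"
  proof (rule ccontr)
    define e where "e = d + 1 - k * p"
    assume "\<not> d + 1 - k * p \<le> 0"
    then have e: "0 < e" by (simp add: e_def)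
    define R where "R = max 4 ((B + 1) powr (1 / e))"
    have R: "4 \<le> R" "(B + 1) powr (1 / e) \<le> R" by (auto simp: R_def)
    have "B + 1 = ((B + 1) powr (1 / e)) powr e" using B0 e by (simp add: powr_powr)
    also have "\<dots> \<le> R powr e" using R e by (intro powr_mono2) auto
    also have "\<dots> \<le> B" using bound[OF R(1)] by (simp add: e_def)
    finally show False by simp
  qed
  then show ?thesis using d1 by (simp add: k_def)
qed

text \<open>
  The test function is $y^{-(2l+1)}$ on $[e^{-L}, 1]$. The $p$-th power of its norm and its integral
  against $y^{2l} dy$ are both $L$, so its maximal function is at least of order $L$ on $(1,2)$, and
  weak type would give $1 \le C L^{-p} L$, which fails for large $L$.
\<close>

lemma weak_endpoint_fails:
  assumes l: "l > -1/2" and p: "1 < p" and d: "d = (2 * l + 1) * p - 1"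
    and ext: "sublinear_extension (poisson_maximal l) (power_measure (2 * l)) (power_measure d) p S"
    and w: "\<And>f. f \<in> Lp (power_measure d) p \<Longrightarrow> S f \<in> borel_measurable LP \<and> weak_bound d p C (S f) (enorm f)"
  shows False
proof -
  define k where "k = 2 * l + 1"
  have k: "0 < k" "2 * l = k - 1" using l by (auto simp: k_def)
  obtain c where c: "0 < c" and low: "\<And>h t x v. h \<in> borel_measurable LP \<Longrightarrow> (\<And>y. 0 \<le> h y) \<Longrightarrow> decay_integrable l (\<lambda>y. complex_of_real (h y)) \<Longrightarrow>
     0 < t \<Longrightarrow> 0 < x \<Longrightarrow> 0 \<le> v \<Longrightarrow> ennreal v \<le> (\<integral>\<^sup>+y. ennreal (h y * (poisson_model l t x y * y powr (2 * l))) \<partial>LP)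
     \<Longrightarrow> ennreal (c * v) \<le> poisson_maximal l (\<lambda>y. complex_of_real (h y)) x"
    using poisson_maximal_lower[OF l] by auto
  define m where "m = 6 powr (- \<bar>l\<bar>) / 5"
  have m: "0 < m" by (simp add: m_def)
  obtain n where n: "emeasure (power_measure d) {1<..<2} = ennreal n" "0 < n"
    using power_measure_interval(1,4)[of 1 2 d] by (cases "emeasure (power_measure d) {1<..<2}") auto
  have s12: "{1<..<2::real} \<in> sets LP" by (intro borel_set_LP) auto
  have main: "n \<le> \<bar>C\<bar> * (c * m / 2) powr (- p) * L powr (1 - p)" if L: "0 < L" for L
  proof -
    define a where "a = exp (- L)"
    have a: "0 < a" "a < 1" using L by (auto simp: a_def)
    define h where "h y = y powr (- k) * indicator {a..1} y" for y :: real
    have h0: "0 \<le> h y" for y by (simp add: h_def)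
    have hm [measurable]: "h \<in> borel_measurable LP" unfolding h_def[abs_def] by (rule borel_LP) measurable
    have fm: "(\<lambda>y. complex_of_real (h y)) \<in> borel_measurable LP" by measurable
    have hb: "norm (complex_of_real (h y)) \<le> a powr (- k) * indicator {a..1} y" for y
      using a k by (auto simp: h_def indicator_def intro!: powr_mono2')
    have Lp: "(\<lambda>y. complex_of_real (h y)) \<in> Lp (power_measure e) q" if "0 < q" for e q
      by (rule bounded_support_Lp[OF fm that a hb]) simp
    have dec: "decay_integrable l (\<lambda>y. complex_of_real (h y))"
    proof (rule decay_integrable_of_bounded[OF l fm])
      have "ennreal (norm (complex_of_real (h y))) \<le> ennreal (a powr (- k))" for y
        using hb[of y] powr_ge_zero[of a "- k"] by (intro ennreal_leI) (cases "y \<in> {a..1}"; simp)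
      then show "AE y in LP. ennreal (norm (complex_of_real (h y))) \<le> ennreal (a powr (- k))" by simp
    qed simp
    have lnL: "ln (1 - 0) - ln (a - 0) = L" by (simp add: a_def)
    have I: "weighted_integral d p (\<lambda>y. ennreal (norm (complex_of_real (h y)))) = ennreal L"
    proof -
      have "weighted_integral d p (\<lambda>y. ennreal (norm (complex_of_real (h y)))) = (\<integral>\<^sup>+y. ennreal (1 / (y - 0)) * indicator {a..1} y \<partial>LP)"
      proof (rule nn_integral_cong)
        fix y assume "y \<in> space LP"
        then have y: "0 < y" by simp
        have "y powr d * (y powr (- k)) powr p = 1 / y"
        proof -
          have "y powr d * (y powr (- k)) powr p = y powr (d + - k * p)" by (simp add: powr_powr powr_add[symmetric])
          also have "d + - k * p = - 1" unfolding d k_def by (simp add: ring_distribs)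
          finally show ?thesis using y by (simp add: powr_minus divide_inverse)
        qed
        then show "ennreal (y powr d) * ennreal_powr (ennreal (norm (complex_of_real (h y)))) p = ennreal (1 / (y - 0)) * indicator {a..1} y"
          by (auto simp: h_def indicator_def ennreal_mult[symmetric])
      qed
      also have "\<dots> = ennreal (ln (1 - 0) - ln (a - 0))" using a by (intro nn_integral_LP_reciprocal) auto
      finally show ?thesis unfolding lnL .
    qed
    have T: "ennreal (c * (m * L)) \<le> poisson_maximal l (\<lambda>y. complex_of_real (h y)) x" if x: "1 < x" "x < 2" for x
    proof (rule low[OF hm h0 dec zero_less_one])
      have "ennreal (m * L) = ennreal m * (\<integral>\<^sup>+y. ennreal (1 / (y - 0)) * indicator {a..1} y \<partial>LP)"
        using m L a unfolding nn_integral_LP_reciprocal[OF a(1) less_imp_le[OF a(2)] a(1)] lnL by (simp add: ennreal_mult)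
      also have "\<dots> = (\<integral>\<^sup>+y. ennreal m * (ennreal (1 / (y - 0)) * indicator {a..1} y) \<partial>LP)"
        by (rule nn_integral_cmult[symmetric]) (rule borel_LP, measurable)
      also have "\<dots> \<le> (\<integral>\<^sup>+y. ennreal (h y * (poisson_model l 1 x y * y powr (2 * l))) \<partial>LP)"
      proof (rule nn_integral_mono)
        fix y :: real
        show "ennreal m * (ennreal (1 / (y - 0)) * indicator {a..1} y) \<le> ennreal (h y * (poisson_model l 1 x y * y powr (2 * l)))"
        proof (cases "y \<in> {a..1}")
          case True
          then have y: "0 < y" "y \<le> 1" using a by auto
          have sq: "0 \<le> y\<^sup>2" "y\<^sup>2 \<le> 1" "1 \<le> x\<^sup>2" "x\<^sup>2 \<le> 4"
            using y x power_mono[of 1 x 2] power_mono[of x 2 2] by (auto simp: power_le_one)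
          have "(x - y)\<^sup>2 \<le> 2\<^sup>2" using x y by (intro power_mono) auto
          then have "1 * 1 powr (- l) * 6 powr (- \<bar>l\<bar>) / 5 \<le> poisson_model l 1 x y"
            using sq by (intro poisson_model_ge) (auto simp: sqsum_def)
          then have "m \<le> poisson_model l 1 x y" by (simp add: m_def)
          then have "m * (y powr (- k) * y powr (2 * l)) \<le> poisson_model l 1 x y * (y powr (- k) * y powr (2 * l))"
            by (intro mult_right_mono) auto
          moreover have "y powr (- k) * y powr (2 * l) = 1 / y"
          proof -
            have "- k + 2 * l = - 1" using k by simp
            then show ?thesis unfolding powr_add[symmetric] using y by (simp add: powr_minus divide_inverse)
          qed
          ultimately have "m * (1 / y) \<le> h y * (poisson_model l 1 x y * y powr (2 * l))"
            using True by (simp add: h_def mult_ac)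
          then show ?thesis using True m y by (simp add: ennreal_mult[symmetric] ennreal_leI)
        qed simp
      qed
      finally show "ennreal (m * L) \<le> (\<integral>\<^sup>+y. ennreal (h y * (poisson_model l 1 x y * y powr (2 * l))) \<partial>LP)" .
    qed (use x m L in auto)
    define \<gamma> where "\<gamma> = c * m / 2 * L"
    have \<gamma>: "0 < \<gamma>" using c m L by (simp add: \<gamma>_def)
    have "AE x in power_measure d. S (\<lambda>y. complex_of_real (h y)) x = poisson_maximal l (\<lambda>y. complex_of_real (h y)) x"
      using ext Lp p unfolding sublinear_extension_def by simp
    then have ae: "AE x in LP. S (\<lambda>y. complex_of_real (h y)) x = poisson_maximal l (\<lambda>y. complex_of_real (h y)) x"
      by (simp only: AE_power_measure)
    have p0: "0 < p" using p by simp
    note wS = w[OF Lp[OF p0]]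
    have "ennreal n \<le> ennreal (C * \<gamma> powr (- p)) * weighted_integral d p (\<lambda>y. ennreal (norm (complex_of_real (h y))))"
      unfolding n(1)[symmetric]
    proof (rule weak_bound_level[OF conjunct2[OF wS] conjunct1[OF wS] ae \<gamma> s12])
      fix x :: real assume "x \<in> {1<..<2}"
      then have "ennreal (c * (m * L)) \<le> poisson_maximal l (\<lambda>y. complex_of_real (h y)) x" by (intro T) auto
      moreover have "ennreal \<gamma> < ennreal (c * (m * L))" using \<gamma> c m L by (subst ennreal_less_iff) (auto simp: \<gamma>_def)
      ultimately show "ennreal \<gamma> < poisson_maximal l (\<lambda>y. complex_of_real (h y)) x" by (rule less_le_trans[rotated])
    qed
    also have "\<dots> \<le> ennreal (\<bar>C\<bar> * \<gamma> powr (- p)) * ennreal L"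
      unfolding I by (intro mult_right_mono ennreal_leI) auto
    also have "\<dots> = ennreal (\<bar>C\<bar> * \<gamma> powr (- p) * L)" using L by (intro ennreal_mult[symmetric]) auto
    finally have "n \<le> \<bar>C\<bar> * \<gamma> powr (- p) * L" using L by (subst (asm) ennreal_le_iff) auto
    also have "\<gamma> powr (- p) = (c * m / 2) powr (- p) * L powr (- p)"
      unfolding \<gamma>_def using c m L by (intro powr_mult)
    also have "\<bar>C\<bar> * ((c * m / 2) powr (- p) * L powr (- p)) * L = \<bar>C\<bar> * (c * m / 2) powr (- p) * (L powr (- p) * L)" by simp
    also have "L powr (- p) * L = L powr (1 - p)"
      using L powr_add[of L "- p" 1] by simp
    finally show ?thesis .
  qed
  define D where "D = \<bar>C\<bar> * (c * m / 2) powr (- p)"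
  have D: "0 \<le> D" by (simp add: D_def)
  \<comment> \<open>This L makes the right-hand side at most n/2.\<close>
  define L where "L = (2 * (D + 1) / n) powr (1 / (p - 1))"
  have L: "0 < L" using D n by (simp add: L_def)
  have "L powr (1 - p) = (2 * (D + 1) / n) powr (- 1)"
  proof -
    have "1 / (p - 1) * (1 - p) = - 1" using p by (simp add: field_simps)
    then show ?thesis unfolding L_def powr_powr by (simp only:)
  qed
  also have "\<dots> = n / (2 * (D + 1))" using D n by (simp add: powr_minus)
  finally have e: "L powr (1 - p) = n / (2 * (D + 1))" .
  have "n \<le> D * L powr (1 - p)" using main[OF L] by (simp add: D_def)
  also have "\<dots> = n * (D / (2 * (D + 1)))" unfolding e by simp
  also have "\<dots> < n * 1" using D n by (intro mult_strict_left_mono) (auto simp: divide_less_eq)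
  finally show False by simp
qed

text \<open>
  At $x$ in $(1+e, 2)$ and time $t = x - 1$ the indicator of $[1, 1+e]$ has a Poisson integral of
  order $e/(x-1)$. Integrating gives $e \log (1/e)$, while the norm is of order $e$.
\<close>

lemma strong_L1_fails:
  assumes l: "l > -1/2"
    and ext: "sublinear_extension (poisson_maximal l) (power_measure (2 * l)) (power_measure d) 1 S"
    and st: "\<And>f. f \<in> Lp (power_measure d) 1 \<Longrightarrow> S f \<in> borel_measurable LP \<and> weighted_integral d 1 (S f) \<le> ennreal C * weighted_integral d 1 (enorm f)"
  shows False
proof -
  obtain c where c: "0 < c" and low: "\<And>h t x v. h \<in> borel_measurable LP \<Longrightarrow> (\<And>y. 0 \<le> h y) \<Longrightarrow> decay_integrable l (\<lambda>y. complex_of_real (h y)) \<Longrightarrow>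
     0 < t \<Longrightarrow> 0 < x \<Longrightarrow> 0 \<le> v \<Longrightarrow> ennreal v \<le> (\<integral>\<^sup>+y. ennreal (h y * (poisson_model l t x y * y powr (2 * l))) \<partial>LP)
     \<Longrightarrow> ennreal (c * v) \<le> poisson_maximal l (\<lambda>y. complex_of_real (h y)) x"
    using poisson_maximal_lower[OF l] by auto
  define m where "m = 9 powr (- \<bar>l\<bar>) / 2 * 2 powr (- \<bar>2 * l\<bar>)"
  have m: "0 < m" by (simp add: m_def)
  define D where "D = 2 powr (- \<bar>d\<bar>) * (c * m)"
  have D: "0 < D" using c m by (simp add: D_def)
  have main: "D * ln (1 / e) \<le> \<bar>C\<bar> * 2 powr \<bar>d\<bar>" if e: "0 < e" "e < 1" for e
  proof -
    let ?E = "{1..1 + e}"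
    let ?f = "\<lambda>y. complex_of_real (indicator ?E y)"
    note test = indicator_test_function[OF l, of 1 "1 + e", simplified, OF e(1)]
    have fL: "?f \<in> Lp (power_measure d') p" if "0 < p" for d' p using test(3)[OF that] .
    have T: "ennreal (c * (m * e / (x - 1))) \<le> poisson_maximal l ?f x" if x: "1 + e < x" "x < 2" for x
    proof (rule low[OF test(1) _ test(2)])
      show "0 < x - 1" using x e by simp
      have "ennreal (m * e / (x - 1)) = ennreal (m / (x - 1)) * ennreal e"
        using m e x by (subst ennreal_mult[symmetric]) auto
      also have "ennreal e = (\<integral>\<^sup>+y. indicator ?E y \<partial>LP)" using e by (subst nn_integral_LP_Icc) auto
      also have "ennreal (m / (x - 1)) * \<dots> = (\<integral>\<^sup>+y. ennreal (m / (x - 1)) * indicator ?E y \<partial>LP)"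
        by (rule nn_integral_cmult[symmetric]) (rule borel_LP, measurable)
      also have "\<dots> \<le> (\<integral>\<^sup>+y. ennreal (indicator ?E y * (poisson_model l (x - 1) x y * y powr (2 * l))) \<partial>LP)"
      proof (rule nn_integral_mono)
        fix y :: real
        show "ennreal (m / (x - 1)) * indicator ?E y \<le> ennreal (indicator ?E y * (poisson_model l (x - 1) x y * y powr (2 * l)))"
        proof (cases "y \<in> ?E")
          case True
          then have y: "1 \<le> y" "y < x" using x by auto
          have sq: "0 \<le> (x - 1)\<^sup>2" "(x - 1)\<^sup>2 \<le> 1" "1 \<le> x\<^sup>2" "x\<^sup>2 \<le> 4" "1 \<le> y\<^sup>2" "y\<^sup>2 \<le> 4"
            using y x e power_mono[of 1 x 2] power_mono[of x 2 2] power_mono[of 1 y 2] power_mono[of y 2 2] by (auto simp: power_le_one)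
          have "(x - y)\<^sup>2 \<le> (x - 1)\<^sup>2" using x y by (intro power_mono) auto
          then have D: "(x - 1)\<^sup>2 + (x - y)\<^sup>2 \<le> 2 * (x - 1)\<^sup>2" by linarith
          have "1 / 9 \<le> sqsum (x - 1) x y" "sqsum (x - 1) x y \<le> 9" unfolding sqsum_def using sq by linarith+
          then have "(x - 1) * 1 powr (- l) * 9 powr (- \<bar>l\<bar>) / (2 * (x - 1)\<^sup>2) \<le> poisson_model l (x - 1) x y"
            using D x e by (intro poisson_model_ge) auto
          then have "(x - 1) * 1 powr (- l) * 9 powr (- \<bar>l\<bar>) / (2 * (x - 1)\<^sup>2) * 2 powr (- \<bar>2 * l\<bar>) \<le> poisson_model l (x - 1) x y * y powr (2 * l)"
            using powr_ge_near_one[of y "2 * l"] y x e by (intro mult_mono poisson_model_nonneg) auto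
          moreover have "(x - 1) * 1 powr (- l) * 9 powr (- \<bar>l\<bar>) / (2 * (x - 1)\<^sup>2) * 2 powr (- \<bar>2 * l\<bar>) = m / (x - 1)"
            using x e by (simp add: m_def power2_eq_square)
          ultimately show ?thesis using True by (simp add: ennreal_leI)
        qed simp
      qed
      finally show "ennreal (m * e / (x - 1)) \<le> (\<integral>\<^sup>+y. ennreal (indicator ?E y * (poisson_model l (x - 1) x y * y powr (2 * l))) \<partial>LP)" .
    qed (use x e m in auto)
    have ae: "AE x in LP. S ?f x = poisson_maximal l ?f x"
    proof -
      have "AE x in power_measure d. S ?f x = poisson_maximal l ?f x"
        using ext fL unfolding sublinear_extension_def by simp
      then show ?thesis by (simp only: AE_power_measure)
    qed
    have pd: "2 powr (- \<bar>d\<bar>) \<le> x powr d" "x powr d \<le> 2 powr \<bar>d\<bar>" if "1 \<le> x" "x \<le> 2" for x :: real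
      using powr_between_inverse[of 2 x d] that by auto
    have "ennreal (D * e * ln (1 / e)) = ennreal (D * e) * ennreal (ln (2 - 1) - ln (1 + e - 1))"
      using e D by (subst ennreal_mult[symmetric]) (auto simp: ln_div)
    also have "\<dots> = ennreal (D * e) * (\<integral>\<^sup>+x. ennreal (1 / (x - 1)) * indicator {1 + e..2} x \<partial>LP)"
      using e by (subst nn_integral_LP_reciprocal) auto
    also have "\<dots> = (\<integral>\<^sup>+x. ennreal (D * e) * (ennreal (1 / (x - 1)) * indicator {1 + e..2} x) \<partial>LP)"
      by (rule nn_integral_cmult[symmetric]) (rule borel_LP, measurable)
    also have "\<dots> \<le> weighted_integral d 1 (S ?f)"
    proof (rule nn_integral_mono_AE)
      have "AE x in lebesgue. x \<noteq> 1 + e \<and> x \<noteq> (2::real)"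
        by (intro AE_conjI) (auto intro!: AE_completion AE_lborel_singleton)
      then have "AE x in LP. x \<noteq> 1 + e \<and> x \<noteq> (2::real)"
        by (subst AE_restrict_space_iff) (auto elim: eventually_mono)
      then show "AE x in LP. ennreal (D * e) * (ennreal (1 / (x - 1)) * indicator {1 + e..2} x) \<le> ennreal (x powr d) * ennreal_powr (S ?f x) 1"
        using ae
      proof eventually_elim
        case (elim x)
        show ?case
        proof (cases "x \<in> {1 + e..2}")
          case True
          then have x: "1 + e < x" "x < 2" using elim by auto
          have "D * e * (1 / (x - 1)) = 2 powr (- \<bar>d\<bar>) * (c * (m * e / (x - 1)))" by (simp add: D_def)
          then have "ennreal (D * e * (1 / (x - 1))) = ennreal (2 powr (- \<bar>d\<bar>)) * ennreal (c * (m * e / (x - 1)))"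
            using c m e x by (simp only:) (intro ennreal_mult; simp)
          also have "\<dots> \<le> ennreal (x powr d) * S ?f x"
            using pd(1)[of x] T[OF x] x e elim by (intro mult_mono ennreal_leI) auto
          finally show ?thesis using True D e x by (simp add: ennreal_mult[symmetric])
        qed simp
      qed
    qed
    also have "\<dots> \<le> ennreal C * weighted_integral d 1 (enorm ?f)" using st[OF fL] by simp
    also have "weighted_integral d 1 (enorm ?f) \<le> ennreal (2 powr \<bar>d\<bar> * e)"
    proof -
      have "weighted_integral d 1 (enorm ?f) \<le> (\<integral>\<^sup>+x. ennreal (2 powr \<bar>d\<bar>) * indicator ?E x \<partial>LP)"
        using pd(2) e by (intro nn_integral_mono) (auto simp: indicator_def intro!: ennreal_leI)
      also have "\<dots> = ennreal (2 powr \<bar>d\<bar>) * (\<integral>\<^sup>+x. indicator ?E x \<partial>LP)"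
        by (rule nn_integral_cmult) (rule borel_LP, measurable)
      also have "(\<integral>\<^sup>+x. indicator ?E x \<partial>LP) = ennreal e" using e by (subst nn_integral_LP_Icc) auto
      also have "ennreal (2 powr \<bar>d\<bar>) * ennreal e = ennreal (2 powr \<bar>d\<bar> * e)" using e by (intro ennreal_mult[symmetric]) auto
      finally show ?thesis .
    qed
    also have "ennreal C * ennreal (2 powr \<bar>d\<bar> * e) \<le> ennreal \<bar>C\<bar> * ennreal (2 powr \<bar>d\<bar> * e)"
      by (intro mult_right_mono ennreal_leI) auto
    also have "\<dots> = ennreal (\<bar>C\<bar> * (2 powr \<bar>d\<bar> * e))" using e by (intro ennreal_mult[symmetric]) auto
    finally have "ennreal (D * e * ln (1 / e)) \<le> ennreal (\<bar>C\<bar> * (2 powr \<bar>d\<bar> * e))"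
      by (simp add: mult_left_mono)
    then have "D * e * ln (1 / e) \<le> \<bar>C\<bar> * (2 powr \<bar>d\<bar> * e)"
      using e by (subst (asm) ennreal_le_iff) auto
    then have "e * (D * ln (1 / e)) \<le> e * (\<bar>C\<bar> * 2 powr \<bar>d\<bar>)" by (simp only: mult_ac)
    then show ?thesis using e by (simp only: mult_le_cancel_left_pos)
  qed
  define L where "L = \<bar>C\<bar> * 2 powr \<bar>d\<bar> / D + 1"
  have L: "0 < L" using D by (simp add: L_def add_nonneg_pos)
  have "1 / exp (- L) = exp L" by (simp add: exp_minus field_simps)
  moreover have "D * ln (1 / exp (- L)) \<le> \<bar>C\<bar> * 2 powr \<bar>d\<bar>" using L by (intro main) auto
  ultimately have "D * L \<le> \<bar>C\<bar> * 2 powr \<bar>d\<bar>" by (simp only: ln_exp)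
  then show False using D by (simp add: L_def distrib_left)
qed

text \<open>
  Chebyshev's inequality for the given extension. The second part removes the roots from the norms.
\<close>

lemma strong_type_imp_weak_type:
  assumes p: "1 \<le> p" and st: "strong_type T N (power_measure d) p"
  shows "weak_type T N (power_measure d) p"
    and "\<exists>S C. sublinear_extension T N (power_measure d) p S \<and>
      (\<forall>f\<in>Lp (power_measure d) p. S f \<in> borel_measurable LP \<and> weighted_integral d p (S f) \<le> ennreal C * weighted_integral d p (enorm f))"
proof -
  have p0: "0 < p" using p by simp
  obtain S C where S: "sublinear_extension T N (power_measure d) p S"
    and C: "\<And>f. f \<in> Lp (power_measure d) p \<Longrightarrow> S f \<in> borel_measurable (power_measure d) \<and>
          Lp_norm (power_measure d) p (S f) \<le> ennreal C * Lp_norm (power_measure d) p (enorm f)"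
    using st unfolding strong_type_def by blast
  define K where "K = \<bar>C\<bar> powr p"
  have b: "S f \<in> borel_measurable LP \<and> weighted_integral d p (S f) \<le> ennreal K * weighted_integral d p (enorm f)"
    if f: "f \<in> Lp (power_measure d) p" for f
  proof -
    have m: "S f \<in> borel_measurable LP" using C[OF f] by simp
    have fm: "f \<in> borel_measurable LP" using f unfolding Lp_power_measure_iff[OF p0] by blast
    have fe: "enorm f \<in> borel_measurable LP" using fm by measurable
    have "weighted_integral d p (S f) = ennreal_powr (Lp_norm (power_measure d) p (S f)) p"
      by (rule ennreal_powr_Lp_norm[OF m p0, symmetric])
    also have "\<dots> \<le> ennreal_powr (ennreal C * Lp_norm (power_measure d) p (enorm f)) p"
      using C[OF f] p0 by (intro ennreal_powr_mono) auto
    also have "\<dots> = ennreal_powr (ennreal C) p * ennreal_powr (Lp_norm (power_measure d) p (enorm f)) p"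
      by (rule ennreal_powr_mult)
    also have "\<dots> = ennreal_powr (ennreal C) p * weighted_integral d p (enorm f)"
      unfolding ennreal_powr_Lp_norm[OF fe p0] ..
    also have "\<dots> \<le> ennreal_powr (ennreal \<bar>C\<bar>) p * weighted_integral d p (enorm f)"
      using p0 by (intro mult_right_mono ennreal_powr_mono ennreal_leI) auto
    also have "ennreal_powr (ennreal \<bar>C\<bar>) p = ennreal K" by (simp add: K_def)
    finally show ?thesis using m by blast
  qed
  then show "\<exists>S C. sublinear_extension T N (power_measure d) p S \<and>
      (\<forall>f\<in>Lp (power_measure d) p. S f \<in> borel_measurable LP \<and> weighted_integral d p (S f) \<le> ennreal C * weighted_integral d p (enorm f))"
    using S by blast
  have "weak_type_bound (power_measure d) p K (S f) f" if f: "f \<in> Lp (power_measure d) p" for f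
  proof -
    have fm: "f \<in> borel_measurable LP" using f unfolding Lp_power_measure_iff[OF p0] by blast
    have fe: "enorm f \<in> borel_measurable LP" using fm by measurable
    show ?thesis unfolding weak_type_bound_iff[OF fm p0]
      using b[OF f] by (intro conjI weak_bound_of_strong fe p0) (auto simp: K_def)
  qed
  then show "weak_type T N (power_measure d) p" unfolding weak_type_def using S by blast
qed

text \<open>
  At the endpoint only $p = 1$ survives weak_endpoint_fails, and then the endpoint is $2l$.
\<close>

lemma weak_type_imp_range:
  assumes l: "l > -1/2" and p: "1 \<le> p"
    and w: "weak_type (poisson_maximal l) (power_measure (2 * l)) (power_measure d) p"
  shows "(-1 < d \<and> d < (2 * l + 1) * p - 1) \<or> (p = 1 \<and> d = 2 * l)"
proof -
  have p0: "0 < p" using p by simp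
  obtain S C where S: "sublinear_extension (poisson_maximal l) (power_measure (2 * l)) (power_measure d) p S"
    and C: "\<And>f. f \<in> Lp (power_measure d) p \<Longrightarrow> weak_type_bound (power_measure d) p C (S f) f"
    using w unfolding weak_type_def by blast
  have wb: "S f \<in> borel_measurable LP \<and> weak_bound d p C (S f) (enorm f)" if f: "f \<in> Lp (power_measure d) p" for f
  proof -
    have fm: "f \<in> borel_measurable LP" using f unfolding Lp_power_measure_iff[OF p0] by blast
    show ?thesis using C[OF f] unfolding weak_type_bound_iff[OF fm p0] .
  qed
  let ?f = "indicator {1..2} :: real \<Rightarrow> complex"
  have fL: "?f \<in> Lp (power_measure d') q" if "0 < q" for d' q
  proof -
    have m: "?f \<in> borel_measurable LP" by (intro borel_LP) measurable
    show ?thesis by (rule bounded_support_Lp[OF m that, of 1 2 1]) (auto simp: indicator_def)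
  qed
  have "AE x in power_measure d. S ?f x = poisson_maximal l ?f x"
    using S fL[of 2] fL[OF p0] unfolding sublinear_extension_def by simp
  then have ae: "AE x in LP. S ?f x = poisson_maximal l ?f x" by (simp only: AE_power_measure)
  have "weak_bound d p C (S ?f) (indicator {1..2})" using wb[OF fL[OF p0]] unfolding indicator_enorm by blast
  then have r: "-1 < d \<and> d \<le> (2 * l + 1) * p - 1"
    using wb[OF fL[OF p0]] by (intro weak_bound_necessary[OF l p0 _ _ ae]) auto
  show ?thesis
  proof (cases "d = (2 * l + 1) * p - 1")
    case True
    have "\<not> 1 < p" using weak_endpoint_fails[OF l _ True S wb] by blast
    then have "p = 1" using p by simp
    then show ?thesis using True by simp
  qed (use r in auto)
qed

lemma restricted_weak_type_imp_range:
  assumes l: "l > -1/2" and p: "1 \<le> p" and w: "restricted_weak_type (poisson_maximal l) (power_measure d) p"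
  shows "-1 < d \<and> d \<le> (2 * l + 1) * p - 1"
proof -
  have p0: "0 < p" using p by simp
  obtain C where C: "\<And>E. E \<in> sets (power_measure d) \<Longrightarrow> emeasure (power_measure d) E < top \<Longrightarrow>
     weak_type_bound (power_measure d) p C (poisson_maximal l (indicator E)) (indicator E)"
    using w unfolding restricted_weak_type_def by blast
  have s: "{1..2::real} \<in> sets (power_measure d)" unfolding sets_power_measure by (rule borel_set_LP) auto
  have s2: "{1/2<..<3::real} \<in> sets (power_measure d)" unfolding sets_power_measure by (rule borel_set_LP) auto
  have "emeasure (power_measure d) {1..2} \<le> emeasure (power_measure d) {1/2<..<3}"
    by (rule emeasure_mono[OF _ s2]) auto
  also have "\<dots> < top" by (rule power_measure_interval) auto
  finally have fin: "emeasure (power_measure d) {1..2} < top" .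
  have m: "(indicator {1..2} :: real \<Rightarrow> complex) \<in> borel_measurable LP" by (intro borel_LP) measurable
  have "poisson_maximal l (indicator {1..2}) \<in> borel_measurable LP \<and> weak_bound d p C (poisson_maximal l (indicator {1..2})) (indicator {1..2})"
    using C[OF s fin] unfolding weak_type_bound_iff[OF m p0] indicator_enorm .
  then show ?thesis by (intro weak_bound_necessary[OF l p0]) auto
qed

theorem theorem2:
  fixes l p \<delta> :: real
  assumes "l > -1/2" and "1 \<le> p"
  shows
    "(strong_type (poisson_maximal l) (power_measure (2 * l)) (power_measure \<delta>) p
        \<longleftrightarrow> p > 1 \<and> -1 < \<delta> \<and> \<delta> < (2 * l + 1) * p - 1) \<and>
     (weak_type (poisson_maximal l) (power_measure (2 * l)) (power_measure \<delta>) p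
        \<longleftrightarrow> (-1 < \<delta> \<and> \<delta> < (2 * l + 1) * p - 1) \<or> \<delta> = 2 * l) \<and>
     (restricted_weak_type (poisson_maximal l) (power_measure \<delta>) p
        \<longleftrightarrow> -1 < \<delta> \<and> \<delta> \<le> (2 * l + 1) * p - 1) \<and>
     strong_type_infty (poisson_maximal l) (power_measure \<delta>)"
proof (intro conjI)
  have mid: "(-1 < \<delta> \<and> \<delta> < (2 * l + 1) * p - 1) \<or> (p = 1 \<and> \<delta> = 2 * l)"
    if d: "(-1 < \<delta> \<and> \<delta> < (2 * l + 1) * p - 1) \<or> \<delta> = 2 * l"
  proof (cases "p = 1")
    case False
    then have "1 < p" using assms by simp
    then have "(2 * l + 1) * 1 < (2 * l + 1) * p" using assms by (intro mult_strict_left_mono) auto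
    then have "2 * l < (2 * l + 1) * p - 1" by (simp only: mult_1_right less_diff_eq)
    then show ?thesis using d assms by auto
  qed (use d in auto)
  show "weak_type (poisson_maximal l) (power_measure (2 * l)) (power_measure \<delta>) p
        \<longleftrightarrow> (-1 < \<delta> \<and> \<delta> < (2 * l + 1) * p - 1) \<or> \<delta> = 2 * l"
    using weak_type_imp_range[OF assms, of \<delta>] poisson_weak_type[OF assms mid] by blast
  show "restricted_weak_type (poisson_maximal l) (power_measure \<delta>) p
        \<longleftrightarrow> -1 < \<delta> \<and> \<delta> \<le> (2 * l + 1) * p - 1"
    using restricted_weak_type_imp_range[OF assms, of \<delta>] poisson_restricted_weak_type[OF assms, of \<delta>] by blast
  show "strong_type_infty (poisson_maximal l) (power_measure \<delta>)"
    by (rule poisson_strong_type_infty[OF assms(1)])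
  show "strong_type (poisson_maximal l) (power_measure (2 * l)) (power_measure \<delta>) p
        \<longleftrightarrow> p > 1 \<and> -1 < \<delta> \<and> \<delta> < (2 * l + 1) * p - 1"
  proof
    assume st: "strong_type (poisson_maximal l) (power_measure (2 * l)) (power_measure \<delta>) p"
    have "p \<noteq> 1"
    proof
      assume p1: "p = 1"
      obtain S C where "sublinear_extension (poisson_maximal l) (power_measure (2 * l)) (power_measure \<delta>) 1 S"
        and "\<And>f. f \<in> Lp (power_measure \<delta>) 1 \<Longrightarrow> S f \<in> borel_measurable LP \<and> weighted_integral \<delta> 1 (S f) \<le> ennreal C * weighted_integral \<delta> 1 (enorm f)"
        using strong_type_imp_weak_type(2)[OF assms(2) st] unfolding p1 by blast
      then show False by (rule strong_L1_fails[OF assms(1)])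
    qed
    then have "1 < p" using assms by simp
    moreover have "(-1 < \<delta> \<and> \<delta> < (2 * l + 1) * p - 1) \<or> (p = 1 \<and> \<delta> = 2 * l)"
      by (rule weak_type_imp_range[OF assms strong_type_imp_weak_type(1)[OF assms(2) st]])
    ultimately show "p > 1 \<and> -1 < \<delta> \<and> \<delta> < (2 * l + 1) * p - 1" by auto
  next
    assume "p > 1 \<and> -1 < \<delta> \<and> \<delta> < (2 * l + 1) * p - 1"
    then show "strong_type (poisson_maximal l) (power_measure (2 * l)) (power_measure \<delta>) p"
      by (intro poisson_strong_type assms) auto
  qed
qed

end
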